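(* Let $n\ge1$, let $s>0$ be a real number, and let $B,Q$ be real $n\times n$ matrices with $Q$ symmetric positive semidefinite. Let $\mathcal P=\frac12\operatorname{Tr}^s(-Q\nabla_x^2)+\langle Bx,\nabla_x\rangle$ be the associated fractional Ornstein-Uhlenbeck operator on $L^2(\mathbb R^n)$, equipped with the domain $D(\mathcal P)=\{u\in L^2(\mathbb R^n):\mathcal Pu\in L^2(\mathbb R^n)\}$, and let $(e^{-t\mathcal P})_{t\ge0}$ be the strongly continuous semigroup it generates on $L^2(\mathbb R^n)$. Let $S=\bigcap_{j=0}^{n-1}\operatorname{Ker}\big(\sqrt Q(B^T)^j\big)$ and let $0\le r\le n-1$ be the smallest integer such that $S=\bigcap_{j=0}^{r}\operatorname{Ker}\big(\sqrt Q(B^T)^j\big)$. Then there exist constants $c>1$ and $T>0$ such that for all $m\ge1$, $\xi_1,\ldots,\xi_m\in S^\perp$, $0<t<T$ and $u\in L^2(\mathbb R^n)$, $$\big\Vert\langle\xi_1,\nabla_x\rangle\cdots\langle\xi_m,\nabla_x\rangle e^{-t\mathcal P}u\big\Vert_{L^2}\le\frac{c^m e^{\frac12\operatorname{Tr}(B)t}}{t^{k_{\xi_1}+\cdots+k_{\xi_m}+\frac m{2s}}}\bigg(\prod_{j=1}^m|\xi_j|\bigg)(m!)^{\frac1{2s}}\Vert u\Vert_{L^2},$$ where $0\le k_{\xi_j}\le r$ denotes the index of the vector $\xi_j\in S^\perp$.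
   Context: The operator $\operatorname{Tr}^s(-Q\nabla_x^2)$ is the Fourier multiplier with symbol $\xi\mapsto\langle Q\xi,\xi\rangle^s$, and $\langle Bx,\nabla_x\rangle=\sum_{i=1}^n\sum_{j=1}^nB_{i,j}x_j\partial_{x_i}$ with $B=(B_{i,j})$. The expression $\mathcal Pu$ for $u\in L^2(\mathbb R^n)$ is understood in the sense of distributions. It is known that $-\mathcal P$ with domain $D(\mathcal P)$ is the generator of a strongly continuous semigroup on $L^2(\mathbb R^n)$, denoted $(e^{-t\mathcal P})_{t\ge0}$. $\langle\cdot,\cdot\rangle$ and $|\cdot|$ are the canonical Euclidean scalar product and norm on $\mathbb R^n$, $\perp$ denotes the orthogonal complement for it, $\sqrt Q$ is the positive semidefinite square root of $Q$, and $\langle\xi_j,\nabla_x\rangle$ is the directional derivative $\sum_i(\xi_j)_i\partial_{x_i}$. For $k\in\{0,\ldots,r\}$ set $V_k=\bigcap_{j=0}^k\operatorname{Ker}\big(\sqrt Q(B^T)^j\big)$, so that $V_0^\perp\subset\cdots\subset V_r^\perp=S^\perp$. The index of a vector $\xi_0\in S^\perp$ is $k_{\xi_0}=\min\{0\le k\le r:\xi_0\in V_k^\perp\}$. *)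

theory Defs
  imports "HOL-Analysis.Analysis"
begin

text \<open>
  Elements of \<open>L\<^sup>2\<close> are represented by square integrable functions, to be read up to equality
  almost everywhere; functions are complex valued.
\<close>

definition L2 :: "(real^'n \<Rightarrow> complex) set" where
  "L2 = {f \<in> borel_measurable lborel. integrable lborel (\<lambda>x. (cmod (f x))\<^sup>2)}"

definition L2norm :: "(real^'n \<Rightarrow> complex) \<Rightarrow> real" where
  "L2norm f = sqrt (LINT x|lborel. (cmod (f x))\<^sup>2)"

definition dir_deriv :: "real^'n \<Rightarrow> (real^'n \<Rightarrow> complex) \<Rightarrow> real^'n \<Rightarrow> complex" where
  "dir_deriv v f = (\<lambda>x. frechet_derivative f (at x) v)"

text \<open>
  The empty list of directions in the following definition yields differentiability and rapid
  decay of the function itself.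
\<close>

definition schwartz :: "(real^'n \<Rightarrow> complex) set" where
  "schwartz = {f. \<forall>vs. (\<forall>x. foldr dir_deriv vs f differentiable (at x)) \<and>
                       (\<forall>k. bounded (range (\<lambda>x. norm x ^ k *\<^sub>R foldr dir_deriv vs f x)))}"

text \<open>
  Tempered distributions are functionals of which only the values on Schwartz functions are
  relevant. The pairing with functions is bilinear (no complex conjugation).
\<close>

type_synonym 'n distr = "(real^'n \<Rightarrow> complex) \<Rightarrow> complex"

definition distr_of :: "(real^'n \<Rightarrow> complex) \<Rightarrow> 'n distr" where
  "distr_of f = (\<lambda>\<phi>. LINT x|lborel. f x * \<phi> x)"

definition represents :: "(real^'n \<Rightarrow> complex) \<Rightarrow> 'n distr \<Rightarrow> bool" where
  "represents f T \<longleftrightarrow> (\<forall>\<phi>\<in>schwartz. T \<phi> = distr_of f \<phi>)"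

definition distr_deriv :: "real^'n \<Rightarrow> 'n distr \<Rightarrow> 'n distr" where
  "distr_deriv v T = (\<lambda>\<phi>. - T (dir_deriv v \<phi>))"

definition coord_mult :: "'n::finite \<Rightarrow> 'n distr \<Rightarrow> 'n distr" where
  "coord_mult j T = (\<lambda>\<phi>. T (\<lambda>x. complex_of_real (x $ j) * \<phi> x))"

definition fourier :: "(real^'n \<Rightarrow> complex) \<Rightarrow> real^'n \<Rightarrow> complex" where
  "fourier \<phi> = (\<lambda>\<xi>. LINT x|lborel. cis (- (x \<bullet> \<xi>)) * \<phi> x)"

definition inv_fourier :: "(real^'n \<Rightarrow> complex) \<Rightarrow> real^'n \<Rightarrow> complex" where
  "inv_fourier \<phi> = (\<lambda>x. complex_of_real (1 / (2 * pi) ^ CARD('n)) *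
                          (LINT \<xi>|lborel. cis (x \<bullet> \<xi>) * \<phi> \<xi>))"

text \<open>
  The Fourier transform on \<open>L\<^sup>2\<close> (unique up to null sets), obtained as the function representing
  the distributional Fourier transform of \<open>u\<close>.
\<close>

definition fourier_L2 :: "(real^'n \<Rightarrow> complex) \<Rightarrow> real^'n \<Rightarrow> complex" where
  "fourier_L2 u = (SOME v. v \<in> L2 \<and> represents v (\<lambda>\<phi>. distr_of u (fourier \<phi>)))"

text \<open>
  For symbols of at most polynomial growth and \<open>u\<close> in \<open>L\<^sup>2\<close>: the tempered distribution which is
  the inverse Fourier transform of the function \<open>\<sigma>\<close> times the Fourier transform of \<open>u\<close>. It need
  not be a function.
\<close>

definition fourier_multiplier :: "(real^'n \<Rightarrow> real) \<Rightarrow> (real^'n \<Rightarrow> complex) \<Rightarrow> 'n distr" where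
  "fourier_multiplier \<sigma> u =
     (\<lambda>\<phi>. distr_of (\<lambda>\<xi>. complex_of_real (\<sigma> \<xi>) * fourier_L2 u \<xi>) (inv_fourier \<phi>))"

definition drift :: "real^'n^'n \<Rightarrow> 'n distr \<Rightarrow> 'n distr" where
  "drift B T =
     (\<lambda>\<phi>. \<Sum>i\<in>UNIV. \<Sum>j\<in>UNIV.
        complex_of_real (B $ i $ j) * coord_mult j (distr_deriv (axis i 1) T) \<phi>)"

definition OU :: "real \<Rightarrow> real^'n^'n \<Rightarrow> real^'n^'n \<Rightarrow> (real^'n \<Rightarrow> complex) \<Rightarrow> 'n distr" where
  "OU s B Q u =
     (\<lambda>\<phi>. (1/2) * fourier_multiplier (\<lambda>\<xi>. ((Q *v \<xi>) \<bullet> \<xi>) powr s) u \<phi>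
           + drift B (distr_of u) \<phi>)"

definition OU_domain :: "real \<Rightarrow> real^'n^'n \<Rightarrow> real^'n^'n \<Rightarrow> (real^'n \<Rightarrow> complex) set" where
  "OU_domain s B Q = {u \<in> L2. \<exists>g\<in>L2. represents g (OU s B Q u)}"

text \<open>
  Linearity up to null sets together with boundedness makes each \<open>U t\<close> compatible with equality
  almost everywhere, so that it induces a bounded operator on the quotient space.
\<close>

definition C0_semigroup :: "(real \<Rightarrow> (real^'n \<Rightarrow> complex) \<Rightarrow> real^'n \<Rightarrow> complex) \<Rightarrow> bool" where
  "C0_semigroup U \<longleftrightarrow>
     (\<forall>t\<ge>0. \<forall>u\<in>L2. U t u \<in> L2) \<and>
     (\<forall>t\<ge>0. \<forall>u\<in>L2. \<forall>v\<in>L2. \<forall>a b.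
        AE x in lborel. U t (\<lambda>x. a * u x + b * v x) x = a * U t u x + b * U t v x) \<and>
     (\<forall>t\<ge>0. \<exists>C. \<forall>u\<in>L2. L2norm (U t u) \<le> C * L2norm u) \<and>
     (\<forall>u\<in>L2. AE x in lborel. U 0 u x = u x) \<and>
     (\<forall>t\<ge>0. \<forall>t'\<ge>0. \<forall>u\<in>L2. AE x in lborel. U (t + t') u x = U t (U t' u) x) \<and>
     (\<forall>u\<in>L2. ((\<lambda>t. L2norm (\<lambda>x. U t u x - u x)) \<longlongrightarrow> 0) (at_right 0))"

text \<open>\<open>u\<close> lies in the domain of the infinitesimal generator of \<open>U\<close>, which maps it to \<open>g\<close>.\<close>

definition generator ::
    "(real \<Rightarrow> (real^'n \<Rightarrow> complex) \<Rightarrow> real^'n \<Rightarrow> complex) \<Rightarrow>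
     (real^'n \<Rightarrow> complex) \<Rightarrow> (real^'n \<Rightarrow> complex) \<Rightarrow> bool" where
  "generator U u g \<longleftrightarrow> u \<in> L2 \<and> g \<in> L2 \<and>
     ((\<lambda>t. L2norm (\<lambda>x. (U t u x - u x) / complex_of_real t - g x)) \<longlongrightarrow> 0) (at_right 0)"

text \<open>\<open>U\<close> is the strongly continuous semigroup generated by minus the operator \<open>OU s B Q\<close>.\<close>

definition OU_semigroup ::
    "real \<Rightarrow> real^'n^'n \<Rightarrow> real^'n^'n \<Rightarrow>
     (real \<Rightarrow> (real^'n \<Rightarrow> complex) \<Rightarrow> real^'n \<Rightarrow> complex) \<Rightarrow> bool" where
  "OU_semigroup s B Q U \<longleftrightarrow> C0_semigroup U \<and>
     {u. \<exists>g. generator U u g} = OU_domain s B Q \<and>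
     (\<forall>u\<in>OU_domain s B Q. \<forall>g\<in>L2. represents g (OU s B Q u) \<longrightarrow> generator U u (\<lambda>x. - g x))"

definition pos_semidef :: "real^'n^'n \<Rightarrow> bool" where
  "pos_semidef M \<longleftrightarrow> transpose M = M \<and> (\<forall>x. 0 \<le> (M *v x) \<bullet> x)"

definition psd_sqrt :: "real^'n^'n \<Rightarrow> real^'n^'n" where
  "psd_sqrt Q = (THE R. pos_semidef R \<and> R ** R = Q)"

text \<open>The operator \<open>^\<close> on this matrix type is the componentwise power, hence the iteration.\<close>

definition mat_pow :: "real^'n^'n \<Rightarrow> nat \<Rightarrow> real^'n^'n" where
  "mat_pow A j = (((**) A) ^^ j) (mat 1)"

definition V_space :: "real^'n^'n \<Rightarrow> real^'n^'n \<Rightarrow> nat \<Rightarrow> (real^'n) set" where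
  "V_space B Q k = (\<Inter>j\<in>{0..k}. {x. (psd_sqrt Q ** mat_pow (transpose B) j) *v x = 0})"

definition singular_space :: "real^'n^'n \<Rightarrow> real^'n^'n \<Rightarrow> (real^'n) set" where
  "singular_space B Q =
     (\<Inter>j\<in>{0..CARD('n) - 1}. {x. (psd_sqrt Q ** mat_pow (transpose B) j) *v x = 0})"

definition smallest_r :: "real^'n^'n \<Rightarrow> real^'n^'n \<Rightarrow> nat" where
  "smallest_r B Q = (LEAST r. r \<le> CARD('n) - 1 \<and> singular_space B Q = V_space B Q r)"

definition vec_index :: "real^'n^'n \<Rightarrow> real^'n^'n \<Rightarrow> real^'n \<Rightarrow> nat" where
  "vec_index B Q \<xi> = (LEAST k. k \<le> smallest_r B Q \<and> \<xi> \<in> (V_space B Q k)\<^sup>\<bottom>)"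

end

theory Submission
  imports Defs "HOL-Probability.Probability"
begin

text \<open>
  On the Fourier side the equation is a damped transport equation. For \<open>v\<close> of class \<open>C\<^sup>1\<close> with compact
  support it is solved by
  \<open>(T\<^sub>t v)(\<xi>) = e\<^bsup>t tr B\<^esup> exp (- \<integral>\<^sub>0\<^sup>t |\<surd>Q e\<^bsup>\<tau>B\<^sup>T\<^esup> \<xi>|\<^bsup>2s\<^esup> d\<tau> / 2) v (e\<^bsup>tB\<^sup>T\<^esup> \<xi>)\<close>.
  The solution stays in the domain of the generator, so uniqueness for the abstract Cauchy problem identifies
  the semigroup with \<open>T\<close> conjugated by the Fourier transform, first on a dense set of initial data.
  Derivatives along \<open>\<xi>\<^sub>1, \<dots>, \<xi>\<^sub>m\<close> then become multiplication by \<open>\<xi>\<^sub>j \<bullet> \<xi>\<close>, and everything rests on the pointwise bound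
  \<open>|\<xi>\<^sub>0 \<bullet> \<xi>| \<le> C |\<xi>\<^sub>0| H\<^bsup>1/(2s)\<^esup> / t\<^bsup>k + 1/(2s)\<^esup>\<close>, where \<open>H\<close> is the integral in the
  exponent and \<open>k\<close> the index of \<open>\<xi>\<^sub>0\<close>: up to a small remainder \<open>\<surd>Q e\<^bsup>t\<sigma>B\<^sup>T\<^esup> \<xi>\<close> is a polynomial of degree \<open>r\<close> in
  \<open>\<sigma>\<close> with coefficients \<open>t\<^sup>j \<surd>Q (B\<^sup>T)\<^sup>j \<xi> / j!\<close>, which is as large as its coefficients on an interval of fixed length,
  and the coefficients with \<open>j \<le> k\<close> control the distance of \<open>\<xi>\<close> to \<open>V\<^sub>k\<close>, hence \<open>\<xi>\<^sub>0 \<bullet> \<xi>\<close>.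
\<close>

section \<open>Square roots of positive semidefinite matrices\<close>

text \<open>\<open>U\<close> is an arbitrary family subject to \<open>OU_semigroup\<close>: apart
  from the semigroup laws, the boundedness of each single \<open>U t\<close> and strong continuity
  at 0, only a distributional description of its generator is available. Identifying
  \<open>U\<close> therefore meets three obstacles. The choice operator in \<open>fourier_L2\<close>
  has to be pinned down almost everywhere, for which Schwartz functions must separate L^2. The
  explicit solution, in general not smooth, must be shown to solve the equation weakly. And
  \<open>U\<close> must be uniformly bounded for small times, which boundedness at each time does
  not give directly. The final time threshold has two sources: this interval of uniform boundedness,
  and the smallness that keeps the Taylor remainder below half of the polynomial. As for the shape
  of the estimate, T_t carries e^(t tr B), and the change of variables in the L^2 norm contributes
  e^(-t tr B / 2); the m factors H^(1/(2s)) are absorbed by e^(-H/2) at the price of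
  (m!)^(1/(2s)).\<close>

lemma semidefinite_null_vector:
  fixes C :: "'a::real_inner \<Rightarrow> 'a"
  assumes "linear C" and sym: "\<And>x y. C x \<bullet> y = x \<bullet> C y" and "subspace S"
    and nonneg: "\<And>z. z \<in> S \<Longrightarrow> 0 \<le> C z \<bullet> z"
    and "x \<in> S" "C x \<bullet> x = 0" "z \<in> S"
  shows "C x \<bullet> z = 0"
proof (rule ccontr)
  assume nz: "C x \<bullet> z \<noteq> 0"
  interpret linear C by fact
  define a where "a = C x \<bullet> z"
  define b where "b = C z \<bullet> z"
  \<comment> \<open>The minimiser - a / b of the quadratic 2 t a + t^2 b with b + 1 in place of b,
    since b may vanish; the value stays negative.\<close>
  define t where "t = - a / (b + 1)"
  have b: "b \<ge> 0" unfolding b_def using nonneg \<open>z \<in> S\<close> by simp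
  have "x + t *\<^sub>R z \<in> S"
    using assms by (simp add: subspace_add subspace_scale)
  from nonneg[OF this] have "0 \<le> C (x + t *\<^sub>R z) \<bullet> (x + t *\<^sub>R z)" .
  also have "\<dots> = 2 * t * a + t\<^sup>2 * b"
    using assms(6) sym[of z x] by (simp add: add scale inner_add inner_commute a_def b_def power2_eq_square algebra_simps)
  also have "\<dots> = - (a\<^sup>2 * (b + 2)) / (b + 1)\<^sup>2"
  proof -
    define d where "d = b + 1"
    have "d \<noteq> 0" and bd: "b = d - 1" using b by (auto simp: d_def)
    then show ?thesis unfolding t_def bd by (simp add: field_simps power2_eq_square)
  qed
  also have "\<dots> < 0"
    using b nz by (simp add: a_def divide_neg_pos zero_less_power2 mult_pos_pos)
  finally show False by simp
qed

text \<open>A maximiser of the Rayleigh quotient on the unit sphere of \<open>S\<close> exists by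
  compactness. It is an eigenvector because \<open>C = \<mu> - A\<close> is semidefinite on
  \<open>S\<close> with \<open>C x \<bullet> x = 0\<close>, so
  \<open>semidefinite_null_vector\<close> with \<open>z = C x\<close> gives
  \<open>C x = 0\<close>.\<close>

lemma rayleigh_maximum:
  fixes A :: "'a::euclidean_space \<Rightarrow> 'a"
  assumes "linear A" and sym: "\<And>x y. A x \<bullet> y = x \<bullet> A y" and S: "subspace S" "A ` S \<subseteq> S" "S \<noteq> {0}"
  obtains x \<mu> where "x \<in> S" "norm x = 1" "A x = \<mu> *\<^sub>R x" "\<And>z. z \<in> S \<Longrightarrow> A z \<bullet> z \<le> \<mu> * (z \<bullet> z)"
proof -
  interpret linear A by fact
  let ?K = "S \<inter> sphere 0 1"
  obtain y where y: "y \<in> S" "y \<noteq> 0" using S subspace_0 by blast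
  have "(1 / norm y) *\<^sub>R y \<in> ?K" using y S(1) by (simp add: subspace_scale)
  then have "?K \<noteq> {}" by blast
  moreover have "compact ?K"
    by (simp add: closed_Int_compact closed_subspace S(1))
  moreover have "continuous_on ?K (\<lambda>z. A z \<bullet> z)"
    by (intro continuous_intros linear_continuous_on linear_conv_bounded_linear[THEN iffD1] \<open>linear A\<close>)
  ultimately obtain x where x: "x \<in> ?K" and max: "\<And>z. z \<in> ?K \<Longrightarrow> A z \<bullet> z \<le> A x \<bullet> x"
    using continuous_attains_sup[of ?K "\<lambda>z. A z \<bullet> z"] by blast
  define \<mu> where "\<mu> = A x \<bullet> x"
  have le: "A z \<bullet> z \<le> \<mu> * (z \<bullet> z)" if "z \<in> S" for z
  proof (cases "z = 0")
    case False
    have "(1 / norm z) *\<^sub>R z \<in> ?K" using that False S(1) by (simp add: subspace_scale)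
    from max[OF this] show ?thesis
      using False by (simp add: scale \<mu>_def field_simps power2_norm_eq_inner[symmetric] power2_eq_square)
  qed (simp add: linear_0)
  define C where "C = (\<lambda>z. \<mu> *\<^sub>R z - A z)"
  have "linear C" unfolding C_def
    by (intro linearI) (simp_all add: add scale algebra_simps)
  have "C x \<bullet> C x = 0"
  proof (rule semidefinite_null_vector[of C S x "C x"])
    show "C u \<bullet> v = u \<bullet> C v" for u v using sym[of u v] by (simp add: C_def inner_diff)
    show "0 \<le> C z \<bullet> z" if "z \<in> S" for z using le[OF that] by (simp add: C_def inner_diff)
    show "C x \<bullet> x = 0" using x by (simp add: C_def inner_diff \<mu>_def norm_eq_1)
    show "C x \<in> S" using x S by (auto simp: C_def intro!: subspace_diff subspace_scale)
  qed (use x S \<open>linear C\<close> in auto)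
  then have "A x = \<mu> *\<^sub>R x" by (simp add: C_def)
  with that x le show ?thesis by auto
qed

text \<open>An eigenvector \<open>e\<close> is split off, and the root on its complement in
  \<open>S\<close> is extended by \<open>sqrt \<mu>\<close> on \<open>e\<close>. The last conjunct
  carries the induction: the root belonging to the smaller space kills \<open>e\<close>, so no cross
  terms arise in \<open>T (T x)\<close>.\<close>

lemma semidefinite_sqrt_on_subspace:
  fixes A :: "'a::euclidean_space \<Rightarrow> 'a"
  assumes "linear A" and sym: "\<And>x y. A x \<bullet> y = x \<bullet> A y" and psd: "\<And>x. 0 \<le> A x \<bullet> x"
    and "subspace S" "A ` S \<subseteq> S"
  shows "\<exists>R. linear R \<and> (\<forall>x y. R x \<bullet> y = x \<bullet> R y) \<and> (\<forall>x. 0 \<le> R x \<bullet> x) \<and>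
             (\<forall>x\<in>S. R (R x) = A x) \<and> (\<forall>x. (\<forall>y\<in>S. x \<bullet> y = 0) \<longrightarrow> R x = 0)"
  using assms(4,5)
proof (induction "dim S" arbitrary: S)
  case 0
  then have "S \<subseteq> {0}" by (metis dim_eq_0)
  then show ?case using linear_0[OF \<open>linear A\<close>] linear_zero by (intro exI[of _ "\<lambda>_. 0"]) auto
next
  case (Suc d)
  interpret linear A by fact
  from Suc.hyps(2) have "S \<noteq> {0}" by (metis dim_eq_0 nat.distinct(1) subset_refl)
  then obtain e \<mu> where e: "e \<in> S" "norm e = 1" "A e = \<mu> *\<^sub>R e"
    using rayleigh_maximum[OF \<open>linear A\<close> sym Suc.prems] by metis
  have ee: "e \<bullet> e = 1" using e by (simp add: norm_eq_1)
  have \<mu>: "0 \<le> \<mu>" using psd[of e] e ee by simp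
  define S' where "S' = {x \<in> S. e \<bullet> x = 0}"
  have S': "subspace S'" unfolding S'_def using Suc.prems(1)
    by (auto simp: subspace_def inner_add_right)
  have inv: "A ` S' \<subseteq> S'"
  proof
    fix y assume "y \<in> A ` S'"
    then obtain x where x: "x \<in> S" "e \<bullet> x = 0" "y = A x" by (auto simp: S'_def)
    then have "e \<bullet> y = 0" using sym[of e x] e by simp
    then show "y \<in> S'" using x Suc.prems(2) by (auto simp: S'_def)
  qed
  have "dim S' < dim S"
  proof (rule dim_psubset)
    have "span S' = S'" "span S = S" using S' Suc.prems(1) by (simp_all add: span_eq_iff)
    moreover have "e \<notin> S'" "S' \<subseteq> S" using ee by (auto simp: S'_def)
    then have "S' \<subset> S" using e(1) by blast
    ultimately show "span S' \<subset> span S" by metis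
  qed
  moreover have "S \<subseteq> span (insert e S')"
  proof
    fix x assume "x \<in> S"
    then have "x - (e \<bullet> x) *\<^sub>R e \<in> S'"
      using e ee Suc.prems(1) by (auto simp: S'_def subspace_diff subspace_scale inner_diff_right)
    then have "(x - (e \<bullet> x) *\<^sub>R e) + (e \<bullet> x) *\<^sub>R e \<in> span (insert e S')"
      by (intro span_add span_scale) (auto intro: span_base)
    then show "x \<in> span (insert e S')" by simp
  qed
  then have "dim S \<le> dim (insert e S')" by (metis dim_span dim_subset)
  then have "dim S \<le> Suc (dim S')" by (simp add: dim_insert split: if_splits)
  ultimately have "d = dim S'" using Suc.hyps(2) by linarith
  from Suc.hyps(1)[OF this S' inv] obtain R where R: "linear R" "\<And>x y. R x \<bullet> y = x \<bullet> R y"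
    "\<And>x. 0 \<le> R x \<bullet> x" "\<And>x. x \<in> S' \<Longrightarrow> R (R x) = A x" "\<And>x. (\<And>y. y \<in> S' \<Longrightarrow> x \<bullet> y = 0) \<Longrightarrow> R x = 0"
    by blast
  interpret R: linear R by fact
  have Re: "R e = 0" by (rule R(5)) (simp add: S'_def)
  have Re': "R x \<bullet> e = 0" for x by (simp add: R(2) Re)
  define T where "T = (\<lambda>x. R x + (sqrt \<mu> * (e \<bullet> x)) *\<^sub>R e)"
  have "linear T" unfolding T_def
    by (intro linearI) (simp_all add: R.add R.scale inner_add_right algebra_simps)
  moreover have "T x \<bullet> y = x \<bullet> T y" for x y
    by (simp add: T_def inner_add R(2) inner_commute[of e])
  moreover have "0 \<le> T x \<bullet> x" for x
    using R(3)[of x] \<mu> by (simp add: T_def inner_add mult.assoc)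
  moreover have "T (T x) = A x" if "x \<in> S" for x
  proof -
    define x' where "x' = x - (e \<bullet> x) *\<^sub>R e"
    have x': "x' \<in> S'"
      using that e ee Suc.prems(1) by (auto simp: x'_def S'_def subspace_diff subspace_scale inner_diff_right)
    have x: "x = x' + (e \<bullet> x) *\<^sub>R e" by (simp add: x'_def)
    have "T (T x) = R (R x) + (\<mu> * (e \<bullet> x)) *\<^sub>R e"
      using Re Re' ee \<mu> by (simp add: T_def R.add R.scale inner_add_right inner_commute[of e "R _"])
    also have "R (R x) = R (R x')"
      by (subst x) (simp add: R.add R.scale Re)
    also have "\<dots> = A x'" by (rule R(4)[OF x'])
    also have "A x' + (\<mu> * (e \<bullet> x)) *\<^sub>R e = A x"
      using e by (subst (2) x) (simp add: add scale)
    finally show ?thesis .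
  qed
  moreover have "T x = 0" if "\<forall>y\<in>S. x \<bullet> y = 0" for x
    using that e by (auto simp: T_def inner_commute S'_def intro!: R(5))
  ultimately show ?case by blast
qed

text \<open>Pair \<open>R (R e) - R' (R' e) = 0\<close> with the top eigenvector \<open>e\<close> of
  \<open>R - R'\<close>: the eigenvalue times \<open>R e \<bullet> e + R' e \<bullet> e\<close>
  vanishes, which forces the eigenvalue to be at most 0. Exchanging the roles makes the quadratic
  form of the difference zero. Uniqueness gives meaning to the definite description in
  \<open>psd_sqrt\<close>.\<close>

lemma semidefinite_sqrt_unique:
  fixes R R' :: "'a::euclidean_space \<Rightarrow> 'a"
  assumes "linear R" and symR: "\<And>x y. R x \<bullet> y = x \<bullet> R y" and psdR: "\<And>x. 0 \<le> R x \<bullet> x"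
    and "linear R'" and symR': "\<And>x y. R' x \<bullet> y = x \<bullet> R' y" and psdR': "\<And>x. 0 \<le> R' x \<bullet> x"
    and eq: "\<And>x. R (R x) = R' (R' x)"
  shows "R = R'"
proof (cases "(UNIV :: 'a set) = {0}")
  case True
  then have "x = 0" for x :: 'a by (metis UNIV_I singletonD)
  then show ?thesis by (metis ext)
next
  case False
  have main: "R x \<bullet> x \<le> R' x \<bullet> x"
    if "linear R" "\<And>x y. R x \<bullet> y = x \<bullet> R y" "\<And>x. 0 \<le> R x \<bullet> x"
      "linear R'" "\<And>x y. R' x \<bullet> y = x \<bullet> R' y" "\<And>x. 0 \<le> R' x \<bullet> x"
      "\<And>x. R (R x) = R' (R' x)"
    for R R' :: "'a \<Rightarrow> 'a" and x
  proof -
    define D where "D = (\<lambda>x. R x - R' x)"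
    interpret R: linear R by fact
    interpret R': linear R' by fact
    have "linear D" unfolding D_def by (intro linear_compose_sub that)
    moreover have "D x \<bullet> y = x \<bullet> D y" for x y by (simp add: D_def inner_diff that(2)[of x y] that(5)[of x y])
    ultimately obtain e \<mu> where e: "norm e = 1" "D e = \<mu> *\<^sub>R e" "\<And>z. D z \<bullet> z \<le> \<mu> * (z \<bullet> z)"
      using rayleigh_maximum[OF _ _ subspace_UNIV subset_UNIV False, of D] by (metis UNIV_I)
    have "0 = (R (R e) - R' (R' e)) \<bullet> e" using that(7) by simp
    also have "\<dots> = R e \<bullet> D e + D e \<bullet> R' e"
      using that(2)[of "R e" e] that(5)[of "R' e" e]
      by (simp add: D_def inner_diff inner_commute[of "R' e" "R e"])
    also have "\<dots> = \<mu> * (R e \<bullet> e + R' e \<bullet> e)"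
      by (simp add: e inner_commute algebra_simps)
    finally have "\<mu> = 0 \<or> (R e \<bullet> e = 0 \<and> R' e \<bullet> e = 0)"
      using that(3)[of e] that(6)[of e] by (auto simp: add_nonneg_eq_0_iff)
    moreover have "\<mu> = R e \<bullet> e - R' e \<bullet> e"
      using e(1,2) by (simp add: D_def norm_eq_1 flip: inner_diff_left)
    ultimately have "\<mu> \<le> 0" by auto
    then have "D x \<bullet> x \<le> 0"
      using e(3)[of x] mult_nonpos_nonneg[of \<mu> "x \<bullet> x"] by simp
    then show ?thesis by (simp add: D_def inner_diff)
  qed
  define D where "D = (\<lambda>x. R x - R' x)"
  have "linear D" unfolding D_def by (intro linear_compose_sub assms)
  have "D x \<bullet> x = 0" for x
    using main[of R R' x] main[of R' R x] assms by (simp add: D_def inner_diff)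
  moreover have "D x \<bullet> y = x \<bullet> D y" for x y by (simp add: D_def inner_diff symR[of x y] symR'[of x y])
  ultimately have "D x \<bullet> D x = 0" for x
    using semidefinite_null_vector[OF \<open>linear D\<close>, of UNIV x "D x"] by simp
  then show ?thesis by (auto simp: D_def fun_eq_iff)
qed

lemma pos_semidef_sym: "pos_semidef M \<Longrightarrow> (M *v x) \<bullet> y = x \<bullet> (M *v y)"
  using dot_lmul_matrix[of x M y] by (simp add: pos_semidef_def flip: transpose_matrix_vector)

lemma psd_sqrt:
  fixes Q :: "real^'n^'n"
  assumes "pos_semidef Q"
  shows "pos_semidef (psd_sqrt Q)" "psd_sqrt Q ** psd_sqrt Q = Q"
proof -
  obtain R where R: "linear R" "\<And>x y. R x \<bullet> y = x \<bullet> R y" "\<And>x. 0 \<le> R x \<bullet> x" "\<And>x. R (R x) = Q *v x"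
    using semidefinite_sqrt_on_subspace[of "(*v) Q" UNIV] pos_semidef_sym[OF assms] assms
    by (auto simp: pos_semidef_def)
  have "pos_semidef (matrix R) \<and> matrix R ** matrix R = Q"
  proof
    have "transpose (matrix R) = matrix R"
      using R(2)[of "axis i 1" "axis j 1" for i j]
      by (simp add: transpose_def matrix_def vec_eq_iff inner_axis inner_axis')
    then show "pos_semidef (matrix R)"
      using R by (simp add: pos_semidef_def matrix_works)
    show "matrix R ** matrix R = Q"
      using R(1,4) by (simp add: matrix_eq matrix_works flip: matrix_vector_mul_assoc)
  qed
  moreover have "M = matrix R" if "pos_semidef M \<and> M ** M = Q" for M
  proof -
    have "(*v) M = R"
    proof (rule semidefinite_sqrt_unique)
      show "(M *v x) \<bullet> y = x \<bullet> (M *v y)" for x y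
        using that pos_semidef_sym by blast
      show "M *v (M *v x) = R (R x)" for x
        using that R(4) by (simp add: matrix_vector_mul_assoc)
    qed (use that R pos_semidef_sym in \<open>auto simp: pos_semidef_def\<close>)
    then show ?thesis by (metis matrix_of_matrix_vector_mul)
  qed
  ultimately have "pos_semidef (psd_sqrt Q) \<and> psd_sqrt Q ** psd_sqrt Q = Q"
    unfolding psd_sqrt_def by (rule theI)
  then show "pos_semidef (psd_sqrt Q)" "psd_sqrt Q ** psd_sqrt Q = Q" by auto
qed

section \<open>Common kernels and polynomials on an interval\<close>

text \<open>Dimension count in place of Cayley--Hamilton: the spaces \<open>W k\<close> decrease, a
  single equality \<open>W (Suc k) = W k\<close> propagates to all later indices, and more than
  \<open>DIM('a)\<close> strict inclusions in a row are impossible.\<close>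

lemma common_kernel_stable:
  fixes L :: "'a::euclidean_space \<Rightarrow> 'b::real_vector" and N :: "'a \<Rightarrow> 'a"
  assumes L: "linear L" and N: "linear N" and x: "\<And>j. j < DIM('a) \<Longrightarrow> L ((N ^^ j) x) = 0"
  shows "L ((N ^^ j) x) = 0"
proof -
  define W where "W = (\<lambda>k. {x. \<forall>j<k. L ((N ^^ j) x) = 0})"
  have lin: "linear (\<lambda>x. L ((N ^^ j) x))" for j
  proof -
    have "linear (N ^^ j)"
      by (induction j) (auto intro: linear_compose[OF _ N, unfolded o_def] simp: o_def linear_ident id_def)
    from linear_compose[OF this L] show ?thesis by (simp add: o_def)
  qed
  have sub: "subspace (W k)" for k
    using linear_0[OF lin] linear_add[OF lin] linear_cmul[OF lin] by (auto simp: W_def subspace_def)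
  have mono: "W (Suc k) \<subseteq> W k" for k by (auto simp: W_def)
  have W_Suc: "W (Suc k) = {x. L x = 0 \<and> N x \<in> W k}" for k
    by (auto simp: W_def less_Suc_eq_0_disj funpow_swap1)
  have stable: "W (k + i) = W k" if "W (Suc k) = W k" for k i
  proof (induction i)
    case (Suc i)
    have "W (Suc (k + i)) = W (Suc k)" using Suc by (simp add: W_Suc)
    then show ?case using that by simp
  qed simp
  have "W (Suc DIM('a)) = W DIM('a)"
  proof (rule ccontr)
    assume ne: "W (Suc DIM('a)) \<noteq> W DIM('a)"
    have "dim (W j) + j \<le> DIM('a)" if "j \<le> Suc DIM('a)" for j
      using that
    proof (induction j)
      case (Suc j)
      have "W (Suc j) \<noteq> W j"
      proof
        assume "W (Suc j) = W j"
        from stable[OF this, of "DIM('a) - j"] stable[OF this, of "Suc DIM('a) - j"] Suc.prems ne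
        show False by simp
      qed
      then have "dim (W (Suc j)) < dim (W j)"
        using mono sub by (intro dim_psubset) (metis psubsetI span_eq_iff)
      then show ?case using Suc by linarith
    qed (simp add: dim_subset_UNIV)
    from this[of "Suc DIM('a)"] show False by simp
  qed
  from stable[OF this, of "Suc j"] have "W (DIM('a) + Suc j) = W DIM('a)" .
  moreover have "x \<in> W DIM('a)" using x by (simp add: W_def)
  ultimately have "x \<in> W (DIM('a) + Suc j)" by blast
  then show ?thesis by (simp add: W_def)
qed

text \<open>\<open>y\<close> is the orthogonal projection of \<open>x\<close> to the common kernel.
  On the orthogonal complement the sum of the norms vanishes only at 0, so its minimum on the unit
  sphere is positive; the constant is the inverse of this minimum, or 1 if that is larger.\<close>

lemma kernel_complement_bound:
  fixes L :: "nat \<Rightarrow> 'a::euclidean_space \<Rightarrow> 'b::real_normed_vector"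
  assumes L: "\<And>j. bounded_linear (L j)"
  obtains C where "C \<ge> 1"
    "\<And>x. \<exists>y. (\<forall>j\<le>k. L j y = 0) \<and> norm (x - y) \<le> C * (\<Sum>j\<le>k. norm (L j x)) \<and>
            (\<forall>v. (\<forall>j\<le>k. L j v = 0) \<longrightarrow> v \<bullet> (x - y) = 0)"
proof -
  define V where "V = {x. \<forall>j\<le>k. L j x = 0}"
  define S where "S = {x. \<forall>v\<in>V. v \<bullet> x = 0}"
  have lin: "linear (L j)" for j using L by (rule bounded_linear.linear)
  have V: "subspace V"
    using lin by (auto simp: V_def subspace_def linear_0 linear_add linear_cmul)
  have S: "subspace S"
    by (auto simp: S_def subspace_def inner_add_right)
  have VS: "x = 0" if "x \<in> V" "x \<in> S" for x
    using that by (auto simp: S_def)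
  have "\<exists>C\<ge>1. \<forall>x\<in>S. norm x \<le> C * (\<Sum>j\<le>k. norm (L j x))"
  proof (cases "S = {0}")
    case True
    then show ?thesis by (intro exI[of _ 1]) (auto intro!: sum_nonneg)
  next
    case False
    let ?K = "S \<inter> sphere 0 1" and ?f = "\<lambda>x. \<Sum>j\<le>k. norm (L j x)"
    obtain y where y: "y \<in> S" "y \<noteq> 0" using False S subspace_0 by blast
    have "(1 / norm y) *\<^sub>R y \<in> ?K" using y S by (simp add: subspace_scale)
    then have "?K \<noteq> {}" by blast
    moreover have "compact ?K" by (simp add: closed_Int_compact closed_subspace S)
    moreover have "continuous_on ?K ?f"
      by (intro continuous_intros linear_continuous_on L)
    ultimately obtain x0 where x0: "x0 \<in> ?K" and min: "\<And>z. z \<in> ?K \<Longrightarrow> ?f x0 \<le> ?f z"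
      using continuous_attains_inf[of ?K ?f] by blast
    have pos: "?f x0 > 0"
    proof (rule ccontr)
      assume "\<not> ?f x0 > 0"
      then have "?f x0 = 0" using sum_nonneg[of "{..k}" "\<lambda>j. norm (L j x0)"] by auto
      then have "x0 \<in> V" by (auto simp: V_def sum_nonneg_eq_0_iff)
      with VS x0 show False by force
    qed
    have "norm x \<le> max 1 (1 / ?f x0) * ?f x" if "x \<in> S" for x
    proof (cases "x = 0")
      case False
      have "(1 / norm x) *\<^sub>R x \<in> ?K" using that False S by (simp add: subspace_scale)
      from min[OF this] have "?f x0 \<le> ?f x / norm x"
        by (simp add: linear_cmul[OF lin] sum_divide_distrib)
      then have "norm x \<le> (1 / ?f x0) * ?f x"
        using pos False by (simp add: field_simps)
      also have "\<dots> \<le> max 1 (1 / ?f x0) * ?f x"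
        by (intro mult_right_mono) (auto intro: sum_nonneg)
      finally show ?thesis .
    qed (auto intro!: mult_nonneg_nonneg sum_nonneg)
    then show ?thesis by (intro exI[of _ "max 1 (1 / ?f x0)"]) auto
  qed
  then obtain C where C: "C \<ge> 1" "\<And>x. x \<in> S \<Longrightarrow> norm x \<le> C * (\<Sum>j\<le>k. norm (L j x))" by blast
  have "\<exists>y. (\<forall>j\<le>k. L j y = 0) \<and> norm (x - y) \<le> C * (\<Sum>j\<le>k. norm (L j x)) \<and>
            (\<forall>v. (\<forall>j\<le>k. L j v = 0) \<longrightarrow> v \<bullet> (x - y) = 0)" for x
  proof -
    obtain y z where yz: "y \<in> span V" "\<And>w. w \<in> span V \<Longrightarrow> orthogonal z w" "x = y + z"
      using orthogonal_subspace_decomp_exists[of V x] by metis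
    have y: "y \<in> V" using yz V by (metis span_eq_iff)
    have z: "z \<in> S" using yz(2) by (auto simp: S_def orthogonal_def inner_commute span_base)
    have "norm z \<le> C * (\<Sum>j\<le>k. norm (L j x))"
      using C(2)[OF z] y lin by (simp add: yz linear_add V_def)
    with y z show ?thesis
      by (intro exI[of _ y]) (auto simp: yz V_def S_def)
  qed
  with C(1) that show ?thesis by blast
qed

text \<open>Passing from \<open>p\<close> to \<open>p(\<sigma>) - 2\<^sup>r p(\<sigma>/2)\<close> eliminates the leading coefficient.\<close>

lemma polynomial_coefficient_bound:
  "\<exists>C\<ge>1. \<forall>(a :: nat \<Rightarrow> 'a::real_normed_vector) K.
     (\<forall>\<sigma>\<in>{0..1::real}. norm (\<Sum>j\<le>r. \<sigma> ^ j *\<^sub>R a j) \<le> K) \<longrightarrow> (\<forall>j\<le>r. norm (a j) \<le> C * K)"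
proof (induction r)
  case 0
  show ?case by (intro exI[of _ 1]) auto
next
  case (Suc r)
  then obtain C where C: "C \<ge> 1" and IH: "\<And>(a :: nat \<Rightarrow> 'a) K j.
    (\<And>\<sigma>. \<sigma> \<in> {0..1} \<Longrightarrow> norm (\<Sum>j\<le>r. \<sigma> ^ j *\<^sub>R a j) \<le> K) \<Longrightarrow> j \<le> r \<Longrightarrow> norm (a j) \<le> C * K"
    by blast
  define D where "D = C * (1 + 2 ^ Suc r)"
  have D: "D \<ge> 1" using C by (simp add: D_def) (smt (verit) mult_le_cancel_right1 zero_less_power)
  have "norm (a j) \<le> (1 + real (Suc r) * D) * K"
    if a: "\<And>\<sigma>. \<sigma> \<in> {0..1} \<Longrightarrow> norm (\<Sum>j\<le>Suc r. \<sigma> ^ j *\<^sub>R a j) \<le> K" and j: "j \<le> Suc r"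
    for a :: "nat \<Rightarrow> 'a" and K j
  proof -
    have "0 \<le> K" using a[of 0] norm_ge_zero order_trans by (metis atLeastAtMost_iff le_numeral_extra(3) zero_le_one)
    define b where "b = (\<lambda>j. (1 - 2 ^ Suc r / 2 ^ j) *\<^sub>R a j)"
    have low: "norm (a i) \<le> D * K" if i: "i \<le> r" for i
    proof -
      have "norm (\<Sum>j\<le>r. \<sigma> ^ j *\<^sub>R b j) \<le> (1 + 2 ^ Suc r) * K" if \<sigma>: "\<sigma> \<in> {0..1}" for \<sigma> :: real
      proof -
        have "(\<Sum>j\<le>r. \<sigma> ^ j *\<^sub>R b j) = (\<Sum>j\<le>Suc r. \<sigma> ^ j *\<^sub>R b j)"
          by (simp add: b_def)
        also have "\<dots> = (\<Sum>j\<le>Suc r. \<sigma> ^ j *\<^sub>R a j) - 2 ^ Suc r *\<^sub>R (\<Sum>j\<le>Suc r. (\<sigma> / 2) ^ j *\<^sub>R a j)"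
          unfolding scaleR_sum_right sum_subtractf[symmetric] b_def
          by (intro sum.cong) (simp_all add: algebra_simps power_divide)
        also have "norm \<dots> \<le> K + 2 ^ Suc r * K"
          using a[OF \<sigma>] a[of "\<sigma> / 2"] \<sigma>
          by (intro order_trans[OF norm_triangle_ineq4] add_mono)
            (auto simp: power_Suc[symmetric] simp del: power_Suc intro!: mult_left_mono)
        finally show ?thesis by (simp add: algebra_simps)
      qed
      from IH[OF this i] have "norm (b i) \<le> D * K" by (simp add: D_def mult.assoc)
      \<comment> \<open>For i \<le> r the factor 1 - 2^(r+1) / 2^i is at most -1, so the modified
        coefficients are no smaller than the original ones.\<close>
      moreover have "norm (a i) \<le> norm (b i)"
      proof -
        have "(2::real) * 2 ^ i \<le> 2 ^ Suc r" using i by simp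
        then have "(2::real) \<le> 2 ^ Suc r / 2 ^ i" by (simp add: field_simps)
        then have "1 \<le> \<bar>1 - 2 ^ Suc r / 2 ^ i :: real\<bar>" by linarith
        then show ?thesis unfolding b_def norm_scaleR by (metis mult_le_cancel_right1 norm_ge_zero linorder_not_less)
      qed
      ultimately show ?thesis by linarith
    qed
    have top: "norm (a (Suc r)) \<le> (1 + real (Suc r) * D) * K"
    proof -
      have "a (Suc r) = (\<Sum>j\<le>Suc r. 1 ^ j *\<^sub>R a j) - (\<Sum>j\<le>r. a j)" by simp
      also have "norm \<dots> \<le> K + (\<Sum>j\<le>r. D * K)"
        using a[of 1] low by (intro order_trans[OF norm_triangle_ineq4] add_mono sum_norm_le) auto
      finally show ?thesis by (simp add: algebra_simps)
    qed
    have "D * K \<le> (1 + real (Suc r) * D) * K"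
      using D \<open>0 \<le> K\<close> by (intro mult_right_mono) (auto simp: algebra_simps)
    then show ?thesis using order_trans[OF low] top j by (cases "j = Suc r") (auto simp del: of_nat_Suc)
  qed
  moreover have "1 + real (Suc r) * D \<ge> 1" using D by simp
  ultimately show ?case by blast
qed

lemma power_diff_abs_le:
  fixes x y :: real
  assumes "x \<in> {0..1}" "y \<in> {0..1}"
  shows "\<bar>x ^ j - y ^ j\<bar> \<le> real j * \<bar>x - y\<bar>"
  using norm_power_diff[of x y j] assms by simp

text \<open>The constants are fixed before the coefficients; only the position \<open>x\<close> of
  the interval depends on \<open>a\<close>. The coefficient bound yields one point of [0, 1] at
  which the polynomial is large, and a Lipschitz estimate extends this to an interval.\<close>

lemma polynomial_large_on_interval:
  "\<exists>c>0. \<exists>l>0. \<forall>a :: nat \<Rightarrow> 'a::real_normed_vector. \<exists>x\<ge>0. x + l \<le> 1 \<and>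
     (\<forall>\<sigma>\<in>{x..x + l}. c * (\<Sum>j\<le>r. norm (a j)) \<le> norm (\<Sum>j\<le>r. \<sigma> ^ j *\<^sub>R a j))"
proof -
  obtain C where C: "C \<ge> 1" and coeff: "\<And>(a :: nat \<Rightarrow> 'a) K j.
    (\<And>\<sigma>. \<sigma> \<in> {0..1} \<Longrightarrow> norm (\<Sum>j\<le>r. \<sigma> ^ j *\<^sub>R a j) \<le> K) \<Longrightarrow> j \<le> r \<Longrightarrow> norm (a j) \<le> C * K"
    using polynomial_coefficient_bound[of r, where 'a='a] by blast
  define D where "D = real (Suc r) * C"
  have D: "D \<ge> 1" unfolding D_def using C by (metis mult_mono' mult_1 of_nat_0_le_iff of_nat_Suc le_add_same_cancel1 zero_le_one)
  \<comment> \<open>On [0, 1] the polynomial has Lipschitz constant at most (r + 1) S, where S is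
    the sum of the norms of the coefficients. Over the length \<open>l\<close> it changes by at most
    S / (4 D), which is half of the value S / (2 D) exceeded at the good point.\<close>
  define l where "l = 1 / (4 * D * (r + 1))"
  have "1 \<le> D * (1 + r)" using mult_mono[of 1 D 1 "1 + real r"] D by simp
  then have l: "0 < l" "l \<le> 1/2" unfolding l_def by (simp_all add: field_simps)
  have "\<exists>x\<ge>0. x + l \<le> 1 \<and> (\<forall>\<sigma>\<in>{x..x + l}. 1 / (4 * D) * (\<Sum>j\<le>r. norm (a j)) \<le> norm (\<Sum>j\<le>r. \<sigma> ^ j *\<^sub>R a j))"
    for a :: "nat \<Rightarrow> 'a"
  proof (cases "(\<Sum>j\<le>r. norm (a j)) = 0")
    case True
    then show ?thesis using l by (intro exI[of _ 0]) auto
  next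
    case False
    define S where "S = (\<Sum>j\<le>r. norm (a j))"
    define p where "p = (\<lambda>\<sigma>::real. \<Sum>j\<le>r. \<sigma> ^ j *\<^sub>R a j)"
    have S: "S > 0" using False sum_nonneg[of "{..r}" "\<lambda>j. norm (a j)"] by (simp add: S_def)
    have "\<exists>\<sigma>\<in>{0..1}. S / (2 * D) < norm (p \<sigma>)"
    proof (rule ccontr)
      assume "\<not> ?thesis"
      then have "norm (a j) \<le> C * (S / (2 * D))" if "j \<le> r" for j
        using that by (intro coeff) (auto simp: p_def not_less)
      then have "S \<le> (\<Sum>j\<le>r. C * (S / (2 * D)))" unfolding S_def by (intro sum_mono) auto
      also have "\<dots> = D * (S / (2 * D))" by (simp only: D_def sum_constant card_atMost mult.assoc)
      also have "\<dots> = S / 2" using D by simp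
      finally show False using S by simp
    qed
    then obtain s where s: "s \<in> {0..1}" "S / (2 * D) < norm (p s)" by blast
    \<comment> \<open>The interval starts or ends at \<open>s\<close>, on the side where [0, 1] has
      room for the length l \<le> 1/2.\<close>
    define x where "x = (if s \<le> 1/2 then s else s - l)"
    have "1 / (4 * D) * S \<le> norm (p \<sigma>)" if "\<sigma> \<in> {x..x + l}" for \<sigma>
    proof -
      have d: "\<bar>\<sigma> - s\<bar> \<le> l" and \<sigma>: "\<sigma> \<in> {0..1}" using that s l by (auto simp: x_def split: if_splits)
      have "norm (p \<sigma> - p s) = norm (\<Sum>j\<le>r. (\<sigma> ^ j - s ^ j) *\<^sub>R a j)"
        by (simp add: p_def sum_subtractf scaleR_diff_left)
      also have "\<dots> \<le> (\<Sum>j\<le>r. (r + 1) * l * norm (a j))"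
      proof (intro sum_norm_le)
        fix j assume "j \<in> {..r}"
        then have "\<bar>\<sigma> ^ j - s ^ j\<bar> \<le> (r + 1) * l"
          using power_diff_abs_le[OF \<sigma> s(1), of j] mult_mono[of "real j" "r + 1" "\<bar>\<sigma> - s\<bar>" l] d
          by auto
        then show "norm ((\<sigma> ^ j - s ^ j) *\<^sub>R a j) \<le> (r + 1) * l * norm (a j)"
          by (simp add: mult_right_mono)
      qed
      also have "\<dots> = S / (4 * D)" 
      proof -
        have "q * (1 / (4 * D * q)) * S = S / (4 * D)" if "q > 0" for q using that D by (simp add: field_simps)
        from this[of "real (r + 1)"] show ?thesis unfolding sum_distrib_left[symmetric] S_def[symmetric] l_def by simp
      qed
      finally have "norm (p \<sigma> - p s) \<le> S / (4 * D)" .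
      moreover have "S / (2 * D) = S / (4 * D) + S / (4 * D)" using D by (simp add: field_simps)
      moreover have "norm (p s) \<le> norm (p \<sigma>) + norm (p \<sigma> - p s)"
        by (metis norm_minus_commute norm_triangle_sub)
      ultimately show ?thesis using s(2) by simp
    qed
    moreover have "x \<ge> 0" "x + l \<le> 1" using s l by (auto simp: x_def)
    ultimately show ?thesis unfolding S_def p_def by blast
  qed
  moreover have "1 / (4 * D) > 0" using D by simp
  ultimately show ?thesis using l(1) by blast
qed

section \<open>The matrix exponential\<close>

lemma mat_pow_0 [simp]: "mat_pow M 0 = mat 1"
  by (simp add: mat_pow_def)

lemma mat_pow_Suc: "mat_pow M (Suc k) = M ** mat_pow M k"
  by (simp add: mat_pow_def)

lemma mat_pow_Suc_right: "mat_pow M (Suc k) = mat_pow M k ** M"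
proof (induction k)
  case (Suc k)
  have "mat_pow M (Suc (Suc k)) = M ** (mat_pow M k ** M)" using Suc by (simp add: mat_pow_Suc[of M "Suc k"])
  also have "\<dots> = mat_pow M (Suc k) ** M" by (simp add: mat_pow_Suc[of M k] matrix_mul_assoc)
  finally show ?case .
qed (simp add: mat_pow_Suc)

lemma mat_pow_vector: "mat_pow M k *v x = ((*v) M ^^ k) x"
  by (induction k) (simp_all add: mat_pow_Suc flip: matrix_vector_mul_assoc)

lemma mat_pow_entry_bound:
  fixes M :: "real^'n^'n"
  obtains K where "K \<ge> 1" "\<And>k i j. \<bar>mat_pow M k $ i $ j\<bar> \<le> K ^ k"
proof
  let ?K = "1 + (\<Sum>i\<in>UNIV. \<Sum>j\<in>UNIV. \<bar>M $ i $ j\<bar>)"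
  show "?K \<ge> 1" by (simp add: sum_nonneg)
  have row: "(\<Sum>l\<in>UNIV. \<bar>M $ i $ l\<bar>) \<le> ?K" for i
    using member_le_sum[of i UNIV "\<lambda>i. \<Sum>l\<in>UNIV. \<bar>M $ i $ l\<bar>"] by (simp add: sum_nonneg)
  show "\<bar>mat_pow M k $ i $ j\<bar> \<le> ?K ^ k" for k i j
  proof (induction k arbitrary: i j)
    case (Suc k)
    have "\<bar>mat_pow M (Suc k) $ i $ j\<bar> \<le> (\<Sum>l\<in>UNIV. \<bar>M $ i $ l\<bar> * \<bar>mat_pow M k $ l $ j\<bar>)"
      by (simp add: mat_pow_Suc matrix_matrix_mult_def sum_abs[THEN order_trans] abs_mult flip: abs_mult)
    also have "\<dots> \<le> (\<Sum>l\<in>UNIV. \<bar>M $ i $ l\<bar> * ?K ^ k)"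
      by (intro sum_mono mult_left_mono Suc) auto
    also have "\<dots> \<le> ?K * ?K ^ k"
      unfolding sum_distrib_right[symmetric]
      by (intro mult_right_mono row zero_le_power) (simp add: sum_nonneg)
    finally show ?case by simp
  qed (simp add: mat_def)
qed

text \<open>The matrix exponential e^(sM), taken entry by entry so that real power series can be
  differentiated termwise.\<close>

definition mexp :: "real^'n^'n \<Rightarrow> real \<Rightarrow> real^'n^'n" where
  "mexp M s = (\<chi> i j. \<Sum>k. mat_pow M k $ i $ j / fact k * s ^ k)"

lemma summable_mexp: "summable (\<lambda>k. mat_pow M k $ i $ j / fact k * s ^ k)"
proof -
  obtain K where K: "K \<ge> 1" "\<And>k i j. \<bar>mat_pow M k $ i $ j\<bar> \<le> K ^ k"
    using mat_pow_entry_bound[of M] by metis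
  show ?thesis
  proof (rule summable_comparison_test')
    show "summable (\<lambda>k. inverse (fact k) * (K * \<bar>s\<bar>) ^ k)" by (rule summable_exp)
    show "norm (mat_pow M k $ i $ j / fact k * s ^ k) \<le> inverse (fact k) * (K * \<bar>s\<bar>) ^ k" if "k \<ge> 0" for k
      using mult_right_mono[OF K(2)[of k i j], of "\<bar>s\<bar> ^ k"]
      by (simp add: abs_mult power_abs power_mult_distrib divide_simps)
  qed
qed

lemma mexp_sums: "(\<lambda>k. mat_pow M k $ i $ j / fact k * s ^ k) sums (mexp M s $ i $ j)"
  using summable_sums[OF summable_mexp[of M i j s]] by (simp add: mexp_def)

lemma mexp_0 [simp]: "mexp M 0 = mat 1"
proof -
  have "mexp M 0 $ i $ j = mat 1 $ i $ j" for i j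
    using sums_unique2[OF mexp_sums[of M i j 0] powser_sums_zero] by simp
  then show ?thesis by (simp add: vec_eq_iff)
qed

text \<open>The two forms come from splitting a factor \<open>M\<close> off
  \<open>mat_pow M (Suc k)\<close> on the left or on the right. Uniqueness of derivatives then shows
  that \<open>M\<close> commutes with its exponential.\<close>

lemma mexp_entry_deriv:
  "((\<lambda>s. mexp M s $ i $ j) has_real_derivative (M ** mexp M s) $ i $ j) (at s)" (is ?A)
  "((\<lambda>s. mexp M s $ i $ j) has_real_derivative (mexp M s ** M) $ i $ j) (at s)" (is ?B)
proof -
  let ?c = "\<lambda>k. mat_pow M k $ i $ j / fact k"
  have "((\<lambda>x. \<Sum>k. ?c k * x ^ k) has_field_derivative (\<Sum>k. diffs ?c k * s ^ k)) (at s)"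
    by (intro termdiffs_strong_converges_everywhere summable_mexp)
  moreover have "diffs ?c = (\<lambda>k. mat_pow M (Suc k) $ i $ j / fact k)"
    by (rule ext) (simp add: diffs_def del: of_nat_Suc)
  ultimately have D: "((\<lambda>s. mexp M s $ i $ j) has_real_derivative
      (\<Sum>k. mat_pow M (Suc k) $ i $ j / fact k * s ^ k)) (at s)"
    by (simp add: mexp_def)
  have "(\<lambda>k. \<Sum>l\<in>UNIV. M $ i $ l * (mat_pow M k $ l $ j / fact k * s ^ k)) sums
      (\<Sum>l\<in>UNIV. M $ i $ l * mexp M s $ l $ j)"
    by (intro sums_sum sums_mult mexp_sums)
  moreover have "(\<Sum>l\<in>UNIV. M $ i $ l * (mat_pow M k $ l $ j / fact k * s ^ k)) = mat_pow M (Suc k) $ i $ j / fact k * s ^ k" for k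
    by (simp add: mat_pow_Suc matrix_matrix_mult_def sum_distrib_right sum_divide_distrib mult.assoc)
  ultimately have "(\<lambda>k. mat_pow M (Suc k) $ i $ j / fact k * s ^ k) sums (\<Sum>l\<in>UNIV. M $ i $ l * mexp M s $ l $ j)"
    by simp
  from sums_unique[OF this] show ?A
    using D by (simp add: matrix_matrix_mult_def)
  have "(\<lambda>k. \<Sum>l\<in>UNIV. (mat_pow M k $ i $ l / fact k * s ^ k) * M $ l $ j) sums
      (\<Sum>l\<in>UNIV. mexp M s $ i $ l * M $ l $ j)"
    by (intro sums_sum sums_mult2 mexp_sums)
  moreover have "(\<Sum>l\<in>UNIV. (mat_pow M k $ i $ l / fact k * s ^ k) * M $ l $ j) = mat_pow M (Suc k) $ i $ j / fact k * s ^ k" for k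
    unfolding mat_pow_Suc_right matrix_matrix_mult_def
    by (simp add: sum_distrib_left sum_divide_distrib mult_ac)
  ultimately have "(\<lambda>k. mat_pow M (Suc k) $ i $ j / fact k * s ^ k) sums (\<Sum>l\<in>UNIV. mexp M s $ i $ l * M $ l $ j)"
    by simp
  from sums_unique[OF this] show ?B
    using D by (simp add: matrix_matrix_mult_def)
qed

lemma mexp_commute: "M ** mexp M s = mexp M s ** M"
proof -
  have "(M ** mexp M s) $ i $ j = (mexp M s ** M) $ i $ j" for i j
    by (rule DERIV_unique[OF mexp_entry_deriv])
  then show ?thesis unfolding vec_eq_iff by blast
qed

lemma has_vector_derivative_vec:
  fixes f :: "real \<Rightarrow> real^'n"
  assumes "\<And>i. ((\<lambda>s. f s $ i) has_real_derivative f' $ i) (at s within S)"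
  shows "(f has_vector_derivative f') (at s within S)"
  unfolding has_vector_derivative_def
proof (subst has_derivative_componentwise_within, rule ballI)
  fix b :: "real^'n" assume "b \<in> Basis"
  then obtain i where "b = axis i 1" by (auto simp: Basis_vec_def)
  then show "((\<lambda>x. f x \<bullet> b) has_derivative (\<lambda>x. x *\<^sub>R f' \<bullet> b)) (at s within S)"
    using assms[of i] by (simp add: inner_axis has_field_derivative_def mult.commute[of "f' $ i"] mult_commute_abs)
qed

lemma mexp_flow_deriv:
  "((\<lambda>s. mexp M s *v x) has_vector_derivative M *v (mexp M s *v x)) (at s within S)"
proof (rule has_vector_derivative_vec)
  fix i
  have "((\<lambda>s. \<Sum>j\<in>UNIV. mexp M s $ i $ j * x $ j) has_real_derivative (\<Sum>j\<in>UNIV. (M ** mexp M s) $ i $ j * x $ j)) (at s within S)"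
    by (intro DERIV_sum DERIV_cmult_right DERIV_subset[OF mexp_entry_deriv(1)]) auto
  then show "((\<lambda>s. (mexp M s *v x) $ i) has_real_derivative (M *v (mexp M s *v x)) $ i) (at s within S)"
    by (simp add: matrix_vector_mul_assoc) (simp add: matrix_vector_mult_def)
qed

text \<open>The vector e^((s+t-r)M) e^(rM) x is constant in \<open>r\<close>: the derivative of the
  first factor, in the form with \<open>M\<close> on the right, cancels against the flow derivative
  of the second. Compare \<open>r = t\<close> with \<open>r = 0\<close>.\<close>

lemma mexp_add: "mexp M (s + t) *v x = mexp M s *v (mexp M t *v x)"
proof -
  have "(mexp M (s + t - r) *v (mexp M r *v x)) $ i = (mexp M (s + t) *v x) $ i" for r i
  proof -
    let ?f = "\<lambda>r. \<Sum>j\<in>UNIV. mexp M (s + t - r) $ i $ j * (mexp M r *v x) $ j"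
    have "(?f has_real_derivative 0) (at r)" for r
    proof -
      have 1: "((\<lambda>r. mexp M (s + t - r) $ i $ j) has_real_derivative - (mexp M (s + t - r) ** M) $ i $ j) (at r)" for j
      proof -
        have "((\<lambda>r. s + t - r) has_real_derivative - 1) (at r)"
          by (auto intro!: derivative_eq_intros)
        from DERIV_chain2[OF mexp_entry_deriv(2) this] show ?thesis by simp
      qed
      have 2: "((\<lambda>r. (mexp M r *v x) $ j) has_real_derivative (M *v (mexp M r *v x)) $ j) (at r)" for j
        unfolding has_real_derivative_iff_has_vector_derivative
        by (rule bounded_linear.has_vector_derivative[OF bounded_linear_vec_nth mexp_flow_deriv])
      have "(?f has_real_derivative (\<Sum>j\<in>UNIV. - (mexp M (s + t - r) ** M) $ i $ j * (mexp M r *v x) $ j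
          + (M *v (mexp M r *v x)) $ j * mexp M (s + t - r) $ i $ j)) (at r)"
        by (intro DERIV_sum DERIV_mult 1 2)
      also have "(\<Sum>j\<in>UNIV. - (mexp M (s + t - r) ** M) $ i $ j * (mexp M r *v x) $ j
          + (M *v (mexp M r *v x)) $ j * mexp M (s + t - r) $ i $ j) =
         (mexp M (s + t - r) *v (M *v (mexp M r *v x))) $ i - ((mexp M (s + t - r) ** M) *v (mexp M r *v x)) $ i"
        by (simp add: matrix_vector_mult_def[of "mexp M (s + t - r)"] matrix_vector_mult_def[of "mexp M (s + t - r) ** M"]
            sum_subtractf[symmetric] mult.commute)
      finally show ?thesis by (simp add: matrix_vector_mul_assoc matrix_mul_assoc)
    qed
    then have "?f r = ?f 0" using DERIV_isconst_all by blast
    then show ?thesis by (simp add: matrix_vector_mult_def[of "mexp M (s + t - r)"] matrix_vector_mult_def[of "mexp M (s + t)"])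
  qed
  from this[of t] show ?thesis by (simp add: vec_eq_iff)
qed

lemma mexp_minus_cancel [simp]:
  "mexp M (- s) *v (mexp M s *v x) = x" "mexp M s *v (mexp M (- s) *v x) = x"
  using mexp_add[of M "- s" s x] mexp_add[of M s "- s" x] by auto

lemma continuous_on_mexp_flow:
  assumes "continuous_on S f" "continuous_on S g"
  shows "continuous_on S (\<lambda>z. mexp M (f z) *v g z)"
proof -
  have "continuous_on UNIV (\<lambda>s. mexp M s $ i $ j)" for i j
    using mexp_entry_deriv(1) by (intro continuous_at_imp_continuous_on) (blast intro: DERIV_isCont)
  from continuous_on_compose2[OF this assms(1)]
  have "continuous_on S (\<lambda>z. mexp M (f z) $ i $ j)" for i j by simp
  then show ?thesis unfolding matrix_vector_mult_def
  proof (intro continuous_on_vec_lambda continuous_on_sum continuous_on_mult)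
    show "continuous_on S (\<lambda>z. g z $ j)" for j by (intro continuous_on_component assms)
  qed
qed

lemma mexp_flow_sums: "(\<lambda>k. (s ^ k / fact k) *\<^sub>R (mat_pow M k *v x)) sums (mexp M s *v x)"
  unfolding sums_def
proof (rule vec_tendstoI)
  fix i
  have "(\<lambda>k. \<Sum>j\<in>UNIV. (mat_pow M k $ i $ j / fact k * s ^ k) * x $ j) sums (\<Sum>j\<in>UNIV. mexp M s $ i $ j * x $ j)"
    by (intro sums_sum sums_mult2 mexp_sums)
  then show "(\<lambda>n. (\<Sum>k<n. (s ^ k / fact k) *\<^sub>R (mat_pow M k *v x)) $ i) \<longlonglongrightarrow> (mexp M s *v x) $ i"
    by (simp add: sums_def matrix_vector_mult_def sum_component sum_distrib_left mult_ac)
qed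

lemma mexp_flow_bound:
  fixes M :: "real^'n^'n"
  obtains C where "C \<ge> 1" "\<And>s x. \<bar>s\<bar> \<le> a \<Longrightarrow> norm (mexp M s *v x) \<le> C * norm x"
proof -
  have "compact ((\<lambda>z. mexp M (fst z) *v snd z) ` ({-a..a} \<times> sphere 0 1))"
    by (intro compact_continuous_image compact_Times continuous_on_mexp_flow continuous_intros) auto
  then obtain C where C: "\<And>z. z \<in> {-a..a} \<times> sphere 0 1 \<Longrightarrow> norm (mexp M (fst z) *v snd z) \<le> C"
    using compact_imp_bounded bounded_iff by (metis (no_types, lifting) imageI)
  show ?thesis
  proof
    show "max C 1 \<ge> 1" by simp
    show "norm (mexp M s *v x) \<le> max C 1 * norm x" if "\<bar>s\<bar> \<le> a" for s x
    proof (cases "x = 0")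
      case False
      have "norm (mexp M s *v (x /\<^sub>R norm x)) \<le> C"
        using C[of "(s, x /\<^sub>R norm x)"] that False by (auto simp: abs_le_iff)
      then have "norm (mexp M s *v x) \<le> C * norm x"
        using False by (simp add: matrix_vector_mult_scaleR field_simps)
      also have "\<dots> \<le> max C 1 * norm x" by (intro mult_right_mono) auto
      finally show ?thesis .
    qed simp
  qed
qed

section \<open>The dissipation along the flow\<close>

definition symb :: "real \<Rightarrow> real^'n^'n \<Rightarrow> real^'n \<Rightarrow> real" where
  "symb s Q \<xi> = ((Q *v \<xi>) \<bullet> \<xi>) powr s"

definition dissip :: "real \<Rightarrow> real^'n^'n \<Rightarrow> real^'n^'n \<Rightarrow> real \<Rightarrow> real^'n \<Rightarrow> real" where
  "dissip s Q M t \<xi> = integral {0..t} (\<lambda>\<tau>. symb s Q (mexp M \<tau> *v \<xi>))"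

lemma symb_psd_sqrt:
  assumes "pos_semidef Q"
  shows "symb s Q \<xi> = norm (psd_sqrt Q *v \<xi>) powr (2 * s)"
proof -
  have "(Q *v \<xi>) \<bullet> \<xi> = norm (psd_sqrt Q *v \<xi>) ^ 2"
    using psd_sqrt[OF assms] pos_semidef_sym[of "psd_sqrt Q" "psd_sqrt Q *v \<xi>" \<xi>]
    by (simp add: power2_norm_eq_inner matrix_vector_mul_assoc)
  then show ?thesis
    by (cases "psd_sqrt Q *v \<xi> = 0") (simp_all add: symb_def powr_powr flip: powr_numeral)
qed

lemma symb_nonneg: "symb s Q \<xi> \<ge> 0"
  by (simp add: symb_def)

lemma continuous_on_symb:
  fixes Q :: "real^'n^'n"
  assumes "pos_semidef Q" "s > 0" "continuous_on S f"
  shows "continuous_on S (\<lambda>x. symb s Q (f x))"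
proof -
  have "continuous_on S (\<lambda>x. Q *v f x)"
    by (rule bounded_linear.continuous_on[OF matrix_vector_mul_bounded_linear assms(3)])
  then show ?thesis
    unfolding symb_def using assms
    by (intro continuous_on_powr' continuous_intros) (auto simp: pos_semidef_def)
qed

lemma integral_ge_on_subinterval:
  fixes g :: "real \<Rightarrow> real"
  assumes "continuous_on {0..t} g" "\<And>x. 0 \<le> g x" "0 \<le> a" "0 \<le> b" "a + b \<le> t" "\<And>x. x \<in> {a..a + b} \<Longrightarrow> m \<le> g x"
  shows "b * m \<le> integral {0..t} g"
proof -
  have sub: "{a..a + b} \<subseteq> {0..t}" using assms by auto
  have "b * m = integral {a..a + b} (\<lambda>_. m)" using assms(4) by simp
  also have "\<dots> \<le> integral {a..a + b} g"
    using assms sub by (intro integral_le integrable_continuous_interval continuous_intros) (auto intro: continuous_on_subset)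
  also have "\<dots> \<le> integral {0..t} g"
    using assms sub by (intro integral_subset_le integrable_continuous_interval) (auto intro: continuous_on_subset)
  finally show ?thesis .
qed

section \<open>The spaces V_k and the stabilisation of the kernels\<close>

lemma V_space_iff:
  "x \<in> V_space B Q k \<longleftrightarrow> (\<forall>j\<le>k. psd_sqrt Q *v (mat_pow (transpose B) j *v x) = 0)"
  by (auto simp: V_space_def matrix_vector_mul_assoc)

lemma smallest_r:
  fixes B Q :: "real^'n^'n"
  shows "smallest_r B Q \<le> CARD('n) - 1" "singular_space B Q = V_space B Q (smallest_r B Q)"
proof -
  have "CARD('n) - 1 \<le> CARD('n) - 1 \<and> singular_space B Q = V_space B Q (CARD('n) - 1)"
    by (simp add: singular_space_def V_space_def)
  from LeastI[of "\<lambda>r. r \<le> CARD('n) - 1 \<and> singular_space B Q = V_space B Q r", OF this]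
  show "smallest_r B Q \<le> CARD('n) - 1" "singular_space B Q = V_space B Q (smallest_r B Q)"
    unfolding smallest_r_def by auto
qed

lemma vec_index:
  assumes "\<xi> \<in> (singular_space B Q)\<^sup>\<bottom>"
  shows "vec_index B Q \<xi> \<le> smallest_r B Q" "\<xi> \<in> (V_space B Q (vec_index B Q \<xi>))\<^sup>\<bottom>"
proof -
  have "smallest_r B Q \<le> smallest_r B Q \<and> \<xi> \<in> (V_space B Q (smallest_r B Q))\<^sup>\<bottom>"
    using assms by (simp add: smallest_r(2))
  from LeastI[of "\<lambda>k. k \<le> smallest_r B Q \<and> \<xi> \<in> (V_space B Q k)\<^sup>\<bottom>", OF this]
  show "vec_index B Q \<xi> \<le> smallest_r B Q" "\<xi> \<in> (V_space B Q (vec_index B Q \<xi>))\<^sup>\<bottom>"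
    unfolding vec_index_def by auto
qed

text \<open>The singular space involves the powers up to n - 1, and
  \<open>common_kernel_stable\<close> propagates vanishing from these to every power. By the choice
  of \<open>smallest_r\<close>, vanishing for the first r + 1 powers already means membership in the
  singular space.\<close>

lemma V_space_smallest_r_stable:
  fixes B Q :: "real^'n^'n"
  assumes "\<And>j. j \<le> smallest_r B Q \<Longrightarrow> psd_sqrt Q *v (mat_pow (transpose B) j *v x) = 0"
  shows "psd_sqrt Q *v (mat_pow (transpose B) j *v x) = 0"
proof -
  have "x \<in> singular_space B Q" using assms smallest_r(2)[of B Q] V_space_iff by blast
  then have *: "psd_sqrt Q *v ((((*v) (transpose B)) ^^ i) x) = 0" if "i < DIM(real^'n)" for i
    using that by (auto simp: singular_space_def mat_pow_vector[symmetric] simp flip: matrix_vector_mul_assoc)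
  show ?thesis
    unfolding mat_pow_vector
    by (rule common_kernel_stable[of "(*v) (psd_sqrt Q)" "(*v) (transpose B)"]) (use * in auto)
qed

text \<open>Up to the factor 1/j!, the j-th Taylor coefficient at \<tau> = 0 of R e^(\<tau>M) x;
  stacked over j these maps form the matrix of Kalman's rank condition.\<close>

definition kalman :: "real^'n^'n \<Rightarrow> real^'n^'n \<Rightarrow> nat \<Rightarrow> real^'n \<Rightarrow> real^'n" where
  "kalman R M j x = R *v (mat_pow M j *v x)"

lemma bounded_linear_kalman: "bounded_linear (kalman R M j)"
  unfolding kalman_def
  by (intro bounded_linear_compose[OF matrix_vector_mul_bounded_linear] matrix_vector_mul_bounded_linear)

text \<open>Subtracting from \<open>\<xi>\<close> a vector of the common kernel of the leading coefficients changes no coefficient.\<close>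

lemma flow_taylor_remainder:
  fixes R M :: "real^'n^'n"
  defines "L \<equiv> kalman R M"
  assumes stable: "\<And>x j. (\<And>j. j \<le> r \<Longrightarrow> L j x = 0) \<Longrightarrow> L j x = 0"
  obtains D where "D > 0" "\<And>\<tau> \<xi>. \<tau> \<in> {0..1} \<Longrightarrow>
     norm (R *v (mexp M \<tau> *v \<xi>) - (\<Sum>j\<le>r. (\<tau> ^ j / fact j) *\<^sub>R L j \<xi>)) \<le> D * \<tau> ^ Suc r * (\<Sum>j\<le>r. norm (L j \<xi>))"
proof -
  have bl: "bounded_linear (L j)" for j unfolding L_def by (rule bounded_linear_kalman)
  obtain C where C: "C \<ge> 1" "\<And>x. \<exists>y. (\<forall>j\<le>r. L j y = 0) \<and> norm (x - y) \<le> C * (\<Sum>j\<le>r. norm (L j x)) \<and>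
            (\<forall>v. (\<forall>j\<le>r. L j v = 0) \<longrightarrow> v \<bullet> (x - y) = 0)"
    using kernel_complement_bound[of L r, OF bl] by metis
  obtain \<kappa> where \<kappa>: "\<kappa> > 0" "\<And>x. norm (M *v x) \<le> \<kappa> * norm x"
    using linear_bounded_pos[OF matrix_vector_mul_linear] by blast
  obtain \<rho> where \<rho>: "\<rho> > 0" "\<And>x. norm (R *v x) \<le> \<rho> * norm x"
    using linear_bounded_pos[OF matrix_vector_mul_linear] by blast
  have pow: "norm (mat_pow M k *v x) \<le> \<kappa> ^ k * norm x" for k x
  proof (induction k)
    case (Suc k)
    have "norm (mat_pow M (Suc k) *v x) \<le> \<kappa> * norm (mat_pow M k *v x)"
      using \<kappa>(2) by (simp add: mat_pow_Suc flip: matrix_vector_mul_assoc)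
    also have "\<dots> \<le> \<kappa> * (\<kappa> ^ k * norm x)" using Suc \<kappa>(1) by simp
    finally show ?case by simp
  qed simp
  define D where "D = \<rho> * \<kappa> ^ Suc r * exp \<kappa> * C"
  have "norm (R *v (mexp M \<tau> *v \<xi>) - (\<Sum>j\<le>r. (\<tau> ^ j / fact j) *\<^sub>R L j \<xi>)) \<le> D * \<tau> ^ Suc r * (\<Sum>j\<le>r. norm (L j \<xi>))"
    if \<tau>: "\<tau> \<in> {0..1}" for \<tau> \<xi>
  proof -
    \<comment> \<open>A tail bound by the norm of \<open>\<xi>\<close> would be useless, since
      \<open>\<xi>\<close> may be large along the common kernel without affecting any coefficient.
      The vector \<open>z\<close> has the same coefficients, and its norm is controlled by the first
      r + 1 of them.\<close>
    obtain y where y: "\<And>j. j \<le> r \<Longrightarrow> L j y = 0" "norm (\<xi> - y) \<le> C * (\<Sum>j\<le>r. norm (L j \<xi>))"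
      using C(2) by blast
    define z where "z = \<xi> - y"
    have Lz: "L j \<xi> = L j z" for j
      using stable[OF y(1), of j] bounded_linear.linear[OF bl] by (simp add: z_def linear_diff)
    have "(\<lambda>k. (\<tau> ^ k / fact k) *\<^sub>R L k \<xi>) sums (R *v (mexp M \<tau> *v \<xi>))"
      using bounded_linear.sums[OF matrix_vector_mul_bounded_linear[of R] mexp_flow_sums[of \<tau> M \<xi>]]
      by (simp add: L_def kalman_def matrix_vector_mult_scaleR)
    from sums_split_initial_segment[OF this, of "Suc r"]
    have rem: "(\<lambda>k. (\<tau> ^ (k + Suc r) / fact (k + Suc r)) *\<^sub>R L (k + Suc r) \<xi>) sums
       (R *v (mexp M \<tau> *v \<xi>) - (\<Sum>j\<le>r. (\<tau> ^ j / fact j) *\<^sub>R L j \<xi>))"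
      by (simp only: lessThan_Suc_atMost)
    let ?g = "\<lambda>k. (\<tau> ^ Suc r * \<rho> * norm z * \<kappa> ^ Suc r) * (inverse (fact k) * \<kappa> ^ k)"
    have g: "?g sums ((\<tau> ^ Suc r * \<rho> * norm z * \<kappa> ^ Suc r) * exp \<kappa>)"
      using exp_converges[of \<kappa>] by (intro sums_mult) (simp add: field_simps)
    have "norm ((\<tau> ^ (k + Suc r) / fact (k + Suc r)) *\<^sub>R L (k + Suc r) \<xi>) \<le> ?g k" for k
    proof -
      have "norm (L (k + Suc r) \<xi>) \<le> \<rho> * (\<kappa> ^ (k + Suc r) * norm z)"
      proof -
        have "norm (L (k + Suc r) \<xi>) = norm (R *v (mat_pow M (k + Suc r) *v z))"
          by (subst Lz) (simp only: L_def kalman_def)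
        also have "\<dots> \<le> \<rho> * norm (mat_pow M (k + Suc r) *v z)" by (rule \<rho>(2))
        also have "\<dots> \<le> \<rho> * (\<kappa> ^ (k + Suc r) * norm z)"
          using \<rho>(1) by (intro mult_left_mono pow) auto
        finally show ?thesis .
      qed
      moreover have "\<tau> ^ (k + Suc r) / fact (k + Suc r) \<le> \<tau> ^ Suc r / fact k"
        using \<tau> by (intro frac_le power_decreasing fact_mono) auto
      ultimately have "norm ((\<tau> ^ (k + Suc r) / fact (k + Suc r)) *\<^sub>R L (k + Suc r) \<xi>) \<le>
        (\<tau> ^ Suc r / fact k) * (\<rho> * (\<kappa> ^ (k + Suc r) * norm z))"
        using \<tau> by (simp only: norm_scaleR) (intro mult_mono, auto)
      also have "\<dots> = ?g k" by (simp add: power_add divide_inverse mult_ac)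
      finally show ?thesis .
    qed
    then have "norm (R *v (mexp M \<tau> *v \<xi>) - (\<Sum>j\<le>r. (\<tau> ^ j / fact j) *\<^sub>R L j \<xi>)) \<le> suminf ?g"
      unfolding sums_unique[OF rem] by (intro norm_suminf_le sums_summable[OF g])
    also have "\<dots> = (\<tau> ^ Suc r * \<rho> * \<kappa> ^ Suc r * exp \<kappa>) * norm z"
      using sums_unique[OF g] by (simp add: mult_ac)
    also have "\<dots> \<le> (\<tau> ^ Suc r * \<rho> * \<kappa> ^ Suc r * exp \<kappa>) * (C * (\<Sum>j\<le>r. norm (L j \<xi>)))"
      using \<tau> \<rho>(1) \<kappa>(1) y(2) unfolding z_def by (intro mult_left_mono) auto
    finally show ?thesis by (simp add: D_def mult_ac)
  qed
  moreover have "D > 0" using \<rho> \<kappa> C(1) by (simp add: D_def)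
  ultimately show ?thesis using that by blast
qed

text \<open>Substitute \<tau> = t \<sigma>. The Taylor polynomial acquires the coefficients t^j L_j
  \<xi> / j!, and since t^r \<le> t^j for t \<le> 1 and j \<le> r, the remainder is at most D t
  times the weighted sum \<open>N\<close>, hence absorbed for small \<open>t\<close>. The symbol is
  then bounded below on an interval of length l t, which suffices because it is non-negative
  elsewhere.\<close>

lemma dissip_lower_bound:
  fixes Q M :: "real^'n^'n"
  defines "L \<equiv> kalman (psd_sqrt Q) M"
  assumes Q: "pos_semidef Q" and s: "s > 0"
    and stable: "\<And>x j. (\<And>j. j \<le> r \<Longrightarrow> L j x = 0) \<Longrightarrow> L j x = 0"
  obtains c T where "c > 0" "T > 0" "T \<le> 1" "\<And>t \<xi>. 0 < t \<Longrightarrow> t < T \<Longrightarrow>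
     c * (\<Sum>j\<le>r. t ^ j * norm (L j \<xi>)) \<le> (dissip s Q M t \<xi> / t) powr (1 / (2 * s))"
proof -
  let ?R = "psd_sqrt Q"
  obtain D where D: "D > 0" "\<And>\<tau> \<xi>. \<tau> \<in> {0..1} \<Longrightarrow>
     norm (?R *v (mexp M \<tau> *v \<xi>) - (\<Sum>j\<le>r. (\<tau> ^ j / fact j) *\<^sub>R L j \<xi>)) \<le> D * \<tau> ^ Suc r * (\<Sum>j\<le>r. norm (L j \<xi>))"
    using flow_taylor_remainder[of r ?R M, folded L_def, OF stable] by blast
  obtain c l where cl: "c > 0" "l > 0" and poly: "\<And>a :: nat \<Rightarrow> real^'n. \<exists>x\<ge>0. x + l \<le> 1 \<and>
     (\<forall>\<sigma>\<in>{x..x + l}. c * (\<Sum>j\<le>r. norm (a j)) \<le> norm (\<Sum>j\<le>r. \<sigma> ^ j *\<^sub>R a j))"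
    using polynomial_large_on_interval[of r, where 'a = "real^'n"] by blast
  \<comment> \<open>r! bounds the factorials in the Taylor coefficients; the factor 2 reserves half
    of the polynomial for the remainder.\<close>
  define c1 where "c1 = c / (2 * fact r)"
  define T where "T = min 1 (c1 / D)"
  have c1: "c1 > 0" using cl by (simp add: c1_def)
  have "c1 * l powr (1 / (2 * s)) * (\<Sum>j\<le>r. t ^ j * norm (L j \<xi>)) \<le> (dissip s Q M t \<xi> / t) powr (1 / (2 * s))"
    if t: "0 < t" "t < T" for t \<xi>
  proof -
    define N where "N = (\<Sum>j\<le>r. t ^ j * norm (L j \<xi>))"
    have N: "N \<ge> 0" using t by (simp add: N_def sum_nonneg)
    have t1: "t \<le> 1" "D * t \<le> c1" using t D(1) by (auto simp: T_def field_simps)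
    define a where "a = (\<lambda>j. (t ^ j / fact j) *\<^sub>R L j \<xi>)"
    obtain x where x: "x \<ge> 0" "x + l \<le> 1"
      "\<And>\<sigma>. \<sigma> \<in> {x..x + l} \<Longrightarrow> c * (\<Sum>j\<le>r. norm (a j)) \<le> norm (\<Sum>j\<le>r. \<sigma> ^ j *\<^sub>R a j)"
      using poly[of a] by blast
    have "N / fact r \<le> (\<Sum>j\<le>r. norm (a j))"
      unfolding N_def sum_divide_distrib
    proof (intro sum_mono)
      fix j assume "j \<in> {..r}"
      then have "t ^ j * norm (L j \<xi>) / fact r \<le> t ^ j * norm (L j \<xi>) / fact j"
        using t by (intro divide_left_mono fact_mono) auto
      then show "t ^ j * norm (L j \<xi>) / fact r \<le> norm (a j)" using t by (simp add: a_def)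
    qed
    then have N_le: "2 * c1 * N \<le> c * (\<Sum>j\<le>r. norm (a j))"
      using cl(1) mult_left_mono[of "N / fact r" _ c] by (simp add: c1_def)
    have lower: "c1 * N \<le> norm (?R *v (mexp M (t * \<sigma>) *v \<xi>))" if \<sigma>: "\<sigma> \<in> {x..x + l}" for \<sigma>
    proof -
      have \<sigma>1: "0 \<le> \<sigma>" "\<sigma> \<le> 1" using \<sigma> x by auto
      have ts: "0 \<le> t * \<sigma>" "t * \<sigma> \<le> t" using \<sigma>1 t by (auto simp: mult_left_le)
      have eq: "(\<Sum>j\<le>r. ((t * \<sigma>) ^ j / fact j) *\<^sub>R L j \<xi>) = (\<Sum>j\<le>r. \<sigma> ^ j *\<^sub>R a j)"
        by (simp add: a_def power_mult_distrib mult_ac)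
      have "t * \<sigma> \<in> {0..1}" using ts t1(1) by auto
      note rem = D(2)[OF this, of \<xi>, unfolded eq]
      have "D * (t * \<sigma>) ^ Suc r * (\<Sum>j\<le>r. norm (L j \<xi>)) \<le> D * t ^ Suc r * (\<Sum>j\<le>r. norm (L j \<xi>))"
        using ts D(1) by (intro mult_right_mono mult_left_mono power_mono sum_nonneg) auto
      also have "\<dots> = D * t * (\<Sum>j\<le>r. t ^ r * norm (L j \<xi>))" by (simp add: sum_distrib_left mult_ac)
      also have "\<dots> \<le> D * t * N" unfolding N_def
        using D(1) t t1(1) by (intro mult_left_mono sum_mono mult_right_mono power_decreasing) auto
      also have "\<dots> \<le> c1 * N" using t1(2) N by (rule mult_right_mono)
      finally have "norm (?R *v (mexp M (t * \<sigma>) *v \<xi>) - (\<Sum>j\<le>r. \<sigma> ^ j *\<^sub>R a j)) \<le> c1 * N"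
        using rem by linarith
      moreover have "norm (\<Sum>j\<le>r. \<sigma> ^ j *\<^sub>R a j) \<le> norm (?R *v (mexp M (t * \<sigma>) *v \<xi>)) +
         norm (?R *v (mexp M (t * \<sigma>) *v \<xi>) - (\<Sum>j\<le>r. \<sigma> ^ j *\<^sub>R a j))"
        by (subst norm_minus_commute) (rule norm_triangle_sub)
      ultimately show ?thesis using x(3)[OF \<sigma>] N_le by linarith
    qed
    have "(l * t) * (c1 * N) powr (2 * s) \<le> dissip s Q M t \<xi>"
      unfolding dissip_def
    proof (rule integral_ge_on_subinterval[where a = "x * t"])
      show "continuous_on {0..t} (\<lambda>\<tau>. symb s Q (mexp M \<tau> *v \<xi>))"
        by (intro continuous_on_symb Q s continuous_on_mexp_flow continuous_intros)
      show "(c1 * N) powr (2 * s) \<le> symb s Q (mexp M \<tau> *v \<xi>)" if "\<tau> \<in> {x * t..x * t + l * t}" for \<tau>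
      proof -
        have "\<tau> / t \<in> {x..x + l}" using that t by (auto simp: field_simps)
        from lower[OF this] show ?thesis
          unfolding symb_psd_sqrt[OF Q] using t N c1 s by (intro powr_mono2) auto
      qed
      show "x * t + l * t \<le> t" using mult_right_mono[OF x(2), of t] t by (simp add: distrib_right)
    qed (use x cl t symb_nonneg in auto)
    then have "l * (c1 * N) powr (2 * s) \<le> dissip s Q M t \<xi> / t"
      using t by (simp add: field_simps)
    then have "(l * (c1 * N) powr (2 * s)) powr (1 / (2 * s)) \<le> (dissip s Q M t \<xi> / t) powr (1 / (2 * s))"
      using s cl by (intro powr_mono2) auto
    moreover have "(l * (c1 * N) powr (2 * s)) powr (1 / (2 * s)) = l powr (1 / (2 * s)) * (c1 * N)"
      using s cl c1 N by (simp add: powr_mult powr_powr)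
    ultimately show ?thesis by (simp add: N_def mult_ac)
  qed
  moreover have "T > 0" "T \<le> 1" using c1 D by (auto simp: T_def)
  moreover have "c1 * l powr (1 / (2 * s)) > 0" using c1 cl by simp
  ultimately show ?thesis using that by blast
qed

text \<open>Only the component of \<xi> orthogonal to V_k pairs with a vector of index k, and it is
  bounded by the coefficients with j \<le> k. Weighting these with t^j costs t^(-k); the remaining
  power t^(-1/(2s)) comes from the time average H / t.\<close>

lemma inner_dissip_bound:
  fixes B Q :: "real^'n^'n"
  assumes Q: "pos_semidef Q" and s: "s > 0"
  obtains C T where "C \<ge> 1" "T > 0" "T \<le> 1"
    "\<And>t \<xi> \<xi>0. 0 < t \<Longrightarrow> t < T \<Longrightarrow> \<xi>0 \<in> (singular_space B Q)\<^sup>\<bottom> \<Longrightarrow>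
       \<bar>\<xi>0 \<bullet> \<xi>\<bar> \<le> C * norm \<xi>0 * dissip s Q (transpose B) t \<xi> powr (1 / (2 * s))
          / t powr (real (vec_index B Q \<xi>0) + 1 / (2 * s))"
proof -
  define L where "L = kalman (psd_sqrt Q) (transpose B)"
  define r where "r = smallest_r B Q"
  obtain c T where cT: "c > 0" "T > 0" "T \<le> 1" "\<And>t \<xi>. 0 < t \<Longrightarrow> t < T \<Longrightarrow>
     c * (\<Sum>j\<le>r. t ^ j * norm (L j \<xi>)) \<le> (dissip s Q (transpose B) t \<xi> / t) powr (1 / (2 * s))"
  proof (rule dissip_lower_bound[OF Q s, of r "transpose B", folded L_def])
    show "L j x = 0" if "\<And>j. j \<le> r \<Longrightarrow> L j x = 0" for x j
      using that V_space_smallest_r_stable[of B Q x j] by (simp add: L_def kalman_def r_def)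
  qed blast
  have bl: "bounded_linear (L j)" for j unfolding L_def by (rule bounded_linear_kalman)
  \<comment> \<open>The index varies with the vector, so a constant is taken for every
    \<open>k\<close>; summing over k \<le> r makes it uniform.\<close>
  have "\<exists>C\<ge>1. \<forall>x. \<exists>y. (\<forall>j\<le>k. L j y = 0) \<and> norm (x - y) \<le> C * (\<Sum>j\<le>k. norm (L j x))" for k
  proof (rule kernel_complement_bound[of L k, OF bl])
    fix C assume "1 \<le> C" and *: "\<And>x. \<exists>y. (\<forall>j\<le>k. L j y = 0) \<and> norm (x - y) \<le> C * (\<Sum>j\<le>k. norm (L j x)) \<and>
      (\<forall>v. (\<forall>j\<le>k. L j v = 0) \<longrightarrow> v \<bullet> (x - y) = 0)"
    have "\<exists>y. (\<forall>j\<le>k. L j y = 0) \<and> norm (x - y) \<le> C * (\<Sum>j\<le>k. norm (L j x))" for x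
      using *[of x] by blast
    with \<open>1 \<le> C\<close> show ?thesis by blast
  qed
  then have "\<exists>Ck. \<forall>k. Ck k \<ge> 1 \<and> (\<forall>x. \<exists>y. (\<forall>j\<le>k. L j y = 0) \<and> norm (x - y) \<le> Ck k * (\<Sum>j\<le>k. norm (L j x)))"
    by (intro choice allI) blast
  then obtain Ck where Ck: "\<And>k. Ck k \<ge> 1"
    "\<And>k x. \<exists>y. (\<forall>j\<le>k. L j y = 0) \<and> norm (x - y) \<le> Ck k * (\<Sum>j\<le>k. norm (L j x))"
    by blast
  define C where "C = (\<Sum>k\<le>r. Ck k)"
  have C_le: "Ck k \<le> C" if "k \<le> r" for k
    unfolding C_def using that Ck(1) by (intro member_le_sum) (auto intro: order_trans[of 0 1])
  have C: "C \<ge> 1" using C_le[of 0] Ck(1)[of 0] by simp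
  have "\<bar>\<xi>0 \<bullet> \<xi>\<bar> \<le> max 1 (C / c) * norm \<xi>0 * dissip s Q (transpose B) t \<xi> powr (1 / (2 * s))
          / t powr (real (vec_index B Q \<xi>0) + 1 / (2 * s))"
    if t: "0 < t" "t < T" and \<xi>0: "\<xi>0 \<in> (singular_space B Q)\<^sup>\<bottom>" for t \<xi> \<xi>0
  proof -
    define k where "k = vec_index B Q \<xi>0"
    define H where "H = dissip s Q (transpose B) t \<xi>"
    have H: "H \<ge> 0" unfolding H_def dissip_def
      by (intro integral_nonneg integrable_continuous_interval continuous_on_symb Q s continuous_on_mexp_flow continuous_intros symb_nonneg)
    have k: "k \<le> r" "\<xi>0 \<in> (V_space B Q k)\<^sup>\<bottom>" using vec_index[OF \<xi>0] by (auto simp: k_def r_def)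
    obtain y where y: "\<And>j. j \<le> k \<Longrightarrow> L j y = 0" "norm (\<xi> - y) \<le> Ck k * (\<Sum>j\<le>k. norm (L j \<xi>))"
      using Ck(2) by blast
    have "y \<in> V_space B Q k" using y(1) by (simp add: V_space_iff L_def kalman_def)
    then have "\<xi>0 \<bullet> y = 0" using k(2) by (auto simp: orthogonal_comp_def orthogonal_def inner_commute)
    then have "\<bar>\<xi>0 \<bullet> \<xi>\<bar> = \<bar>\<xi>0 \<bullet> (\<xi> - y)\<bar>" by (simp add: inner_diff_right)
    also have "\<dots> \<le> norm \<xi>0 * norm (\<xi> - y)" by (rule Cauchy_Schwarz_ineq2)
    also have "\<dots> \<le> norm \<xi>0 * (C * (\<Sum>j\<le>k. norm (L j \<xi>)))"
      using y(2) C_le[OF k(1)] by (intro mult_left_mono order_trans[OF y(2)] mult_right_mono sum_nonneg) auto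
    also have "(\<Sum>j\<le>k. norm (L j \<xi>)) \<le> (\<Sum>j\<le>r. t ^ j * norm (L j \<xi>)) / t ^ k"
    proof -
      have "(\<Sum>j\<le>k. norm (L j \<xi>)) * t ^ k \<le> (\<Sum>j\<le>k. t ^ j * norm (L j \<xi>))"
        unfolding sum_distrib_right using t cT(3)
        by (intro sum_mono) (auto simp: mult.commute[of "norm _"] intro!: mult_right_mono power_decreasing)
      also have "\<dots> \<le> (\<Sum>j\<le>r. t ^ j * norm (L j \<xi>))"
        using k(1) t by (intro sum_mono2) auto
      finally show ?thesis using t by (simp add: field_simps)
    qed
    also have "(\<Sum>j\<le>r. t ^ j * norm (L j \<xi>)) \<le> (H / t) powr (1 / (2 * s)) / c"
      using cT(4)[OF t, of \<xi>] cT(1) by (simp add: H_def field_simps)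
    also have "norm \<xi>0 * (C * ((H / t) powr (1 / (2 * s)) / c / t ^ k)) =
       (C / c) * (norm \<xi>0 * H powr (1 / (2 * s)) / t powr (real k + 1 / (2 * s)))"
      using t H by (simp add: powr_divide powr_add powr_realpow field_simps)
    also have "\<dots> \<le> max 1 (C / c) * (norm \<xi>0 * H powr (1 / (2 * s)) / t powr (real k + 1 / (2 * s)))"
      by (intro mult_right_mono) auto
    finally show ?thesis
      using C t by (simp add: k_def H_def mult.assoc mult_left_mono divide_right_mono)
  qed
  with cT that[of "max 1 (C / c)" T] show ?thesis by auto
qed

section \<open>Square integrable functions\<close>

lemma L2_measurable: "f \<in> L2 \<Longrightarrow> f \<in> borel_measurable borel"
  by (simp add: L2_def)

lemma L2_integrable_square: "f \<in> L2 \<Longrightarrow> integrable lborel (\<lambda>x. (cmod (f x))\<^sup>2)"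
  by (simp add: L2_def)

lemma L2norm_nonneg [simp]: "0 \<le> L2norm f"
  by (simp add: L2norm_def)

lemma L2norm_square: "(L2norm f)\<^sup>2 = (LINT x|lborel. (cmod (f x))\<^sup>2)"
  by (simp add: L2norm_def)

lemma L2norm_nn_integral:
  assumes "f \<in> L2"
  shows "(\<integral>\<^sup>+x. ennreal ((cmod (f x))\<^sup>2) \<partial>lborel) = ennreal ((L2norm f)\<^sup>2)"
  unfolding L2norm_square by (rule nn_integral_eq_integral[OF L2_integrable_square[OF assms]]) simp

lemma L2I_nn_integral:
  assumes "f \<in> borel_measurable borel" "(\<integral>\<^sup>+x. ennreal ((cmod (f x))\<^sup>2) \<partial>lborel) \<le> ennreal (C\<^sup>2)" "C \<ge> 0"
  shows "f \<in> L2" "L2norm f \<le> C"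
proof -
  have "(\<integral>\<^sup>+x. ennreal (norm ((cmod (f x))\<^sup>2)) \<partial>lborel) < \<infinity>"
    using assms(2) by (simp add: le_less_trans[OF _ ennreal_less_top])
  then have "integrable lborel (\<lambda>x. (cmod (f x))\<^sup>2)"
    using assms(1) by (intro integrableI_bounded) auto
  then show f: "f \<in> L2" using assms(1) by (simp add: L2_def)
  from L2norm_nn_integral[OF this] assms(2) have "(L2norm f)\<^sup>2 \<le> C\<^sup>2" by simp
  then show "L2norm f \<le> C" using assms(3) by (simp add: power2_le_iff_abs_le)
qed

lemma L2_mult_integrable:
  assumes "f \<in> L2" "g \<in> L2"
  shows "integrable lborel (\<lambda>x. f x * g x)"
proof (rule Bochner_Integration.integrable_bound)
  show "integrable lborel (\<lambda>x. (cmod (f x))\<^sup>2 + (cmod (g x))\<^sup>2)"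
    using assms by (intro Bochner_Integration.integrable_add L2_integrable_square)
  show "(\<lambda>x. f x * g x) \<in> borel_measurable lborel"
    using assms[THEN L2_measurable] by simp
  have "cmod (f x) * cmod (g x) \<le> (cmod (f x))\<^sup>2 + (cmod (g x))\<^sup>2" for x
    using sum_squares_bound[of "cmod (f x)" "cmod (g x)"] mult_nonneg_nonneg[OF norm_ge_zero norm_ge_zero, of "f x" "g x"]
    unfolding mult.assoc by linarith
  then show "AE x in lborel. norm (f x * g x) \<le> norm ((cmod (f x))\<^sup>2 + (cmod (g x))\<^sup>2)"
    by (simp add: norm_mult)
qed

lemma L2_scale: "f \<in> L2 \<Longrightarrow> (\<lambda>x. c * f x) \<in> L2"
  by (auto simp: L2_def norm_mult power_mult_distrib)

lemma L2_cnj: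
  assumes "f \<in> L2"
  shows "(\<lambda>x. cnj (f x)) \<in> L2"
proof -
  have "cnj \<in> borel_measurable borel" by (intro borel_measurable_continuous_onI continuous_intros)
  from measurable_compose[OF L2_measurable[OF assms] this] show ?thesis
    using assms by (simp add: L2_def)
qed

lemma L2_add:
  assumes "f \<in> L2" "g \<in> L2"
  shows "(\<lambda>x. f x + g x) \<in> L2"
proof -
  have "integrable lborel (\<lambda>x. (cmod (f x + g x))\<^sup>2)"
  proof (rule Bochner_Integration.integrable_bound)
    show "integrable lborel (\<lambda>x. 2 * (cmod (f x))\<^sup>2 + 2 * (cmod (g x))\<^sup>2)"
      using assms by (intro Bochner_Integration.integrable_add integrable_mult_right L2_integrable_square)
    have "(cmod (f x + g x))\<^sup>2 \<le> 2 * (cmod (f x))\<^sup>2 + 2 * (cmod (g x))\<^sup>2" for x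
    proof -
      have "(cmod (f x + g x))\<^sup>2 \<le> (cmod (f x) + cmod (g x))\<^sup>2"
        by (intro power_mono norm_triangle_ineq) simp
      also have "\<dots> \<le> 2 * (cmod (f x))\<^sup>2 + 2 * (cmod (g x))\<^sup>2"
        using sum_squares_bound[of "cmod (f x)" "cmod (g x)"] by (simp add: power2_sum)
      finally show ?thesis .
    qed
    then show "AE x in lborel. norm ((cmod (f x + g x))\<^sup>2) \<le> norm (2 * (cmod (f x))\<^sup>2 + 2 * (cmod (g x))\<^sup>2)"
      by simp
  qed (use assms[THEN L2_measurable] in simp)
  then show ?thesis using assms[THEN L2_measurable] by (simp add: L2_def)
qed

lemma L2_diff:
  assumes "f \<in> L2" "g \<in> L2"
  shows "(\<lambda>x. f x - g x) \<in> L2"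
  using L2_add[OF assms(1) L2_scale[OF assms(2), of "-1"]] by simp

lemma L2norm_cong_AE:
  assumes "f \<in> borel_measurable borel" "g \<in> borel_measurable borel" "AE x in lborel. f x = g x"
  shows "L2norm f = L2norm g"
  unfolding L2norm_def using assms by (intro arg_cong[where f = sqrt] integral_cong_AE) auto

lemma L2norm_scale: "L2norm (\<lambda>x. c * f x) = cmod c * L2norm f"
  by (simp add: L2norm_def norm_mult power_mult_distrib real_sqrt_mult)

lemma L2norm_minus_commute: "L2norm (\<lambda>x. f x - g x) = L2norm (\<lambda>x. g x - f x)"
  by (simp add: L2norm_def norm_minus_commute)

lemma L2norm_eq_0_AE:
  assumes "f \<in> L2" "L2norm f = 0"
  shows "AE x in lborel. f x = 0"
  using assms integral_nonneg_eq_0_iff_AE[OF L2_integrable_square[OF assms(1)]]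
  by (simp add: L2norm_def)

lemma L2_Cauchy_Schwarz_norm:
  assumes f: "f \<in> L2" and g: "g \<in> L2"
  shows "(LINT x|lborel. cmod (f x) * cmod (g x)) \<le> L2norm f * L2norm g"
proof (cases "L2norm f = 0 \<or> L2norm g = 0")
  case True
  then have "AE x in lborel. cmod (f x) * cmod (g x) = 0"
    using L2norm_eq_0_AE[OF f] L2norm_eq_0_AE[OF g] by auto
  then have "(LINT x|lborel. cmod (f x) * cmod (g x)) = 0"
    using L2_measurable[OF f] L2_measurable[OF g] by (subst integral_cong_AE[where g = "\<lambda>_. 0"]) auto
  then show ?thesis by simp
next
  case False
  define a where "a = L2norm g"
  define b where "b = L2norm f"
  have ab: "a > 0" "b > 0" using False by (simp_all add: a_def b_def less_le)
  have int: "integrable lborel (\<lambda>x. cmod (f x) * cmod (g x))"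
    using integrable_norm[OF L2_mult_integrable[OF f g]] by (simp add: norm_mult)
  note F = L2_integrable_square[OF f] and G = L2_integrable_square[OF g]
  have "0 \<le> (LINT x|lborel. (a * cmod (f x) - b * cmod (g x))\<^sup>2)" by simp
  also have "\<dots> = (LINT x|lborel. a\<^sup>2 * (cmod (f x))\<^sup>2 + b\<^sup>2 * (cmod (g x))\<^sup>2 - (2 * a * b) * (cmod (f x) * cmod (g x)))"
    by (intro Bochner_Integration.integral_cong) (auto simp: power2_eq_square algebra_simps)
  also have "\<dots> = a\<^sup>2 * b\<^sup>2 + b\<^sup>2 * a\<^sup>2 - (2 * a * b) * (LINT x|lborel. cmod (f x) * cmod (g x))"
    using int F G by (simp add: a_def b_def L2norm_square)
  finally have "(2 * a * b) * (LINT x|lborel. cmod (f x) * cmod (g x)) \<le> (2 * a * b) * (b * a)"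
    by (simp add: power2_eq_square algebra_simps)
  then show ?thesis using ab by (simp add: a_def b_def)
qed

lemma L2_Cauchy_Schwarz:
  assumes f: "f \<in> L2" and g: "g \<in> L2"
  shows "cmod (LINT x|lborel. f x * g x) \<le> L2norm f * L2norm g"
  using integral_norm_bound[of lborel "\<lambda>x. f x * g x"] L2_Cauchy_Schwarz_norm[OF f g]
  by (simp add: norm_mult)

lemma L2norm_triangle:
  assumes f: "f \<in> L2" and g: "g \<in> L2"
  shows "L2norm (\<lambda>x. f x + g x) \<le> L2norm f + L2norm g"
proof -
  have int: "integrable lborel (\<lambda>x. cmod (f x) * cmod (g x))"
    using integrable_norm[OF L2_mult_integrable[OF f g]] by (simp add: norm_mult)
  note F = L2_integrable_square[OF f] and G = L2_integrable_square[OF g]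
  have "(L2norm (\<lambda>x. f x + g x))\<^sup>2 \<le> (LINT x|lborel. (cmod (f x))\<^sup>2 + (cmod (g x))\<^sup>2 + 2 * (cmod (f x) * cmod (g x)))"
    unfolding L2norm_square
  proof (intro integral_mono)
    show "integrable lborel (\<lambda>x. (cmod (f x + g x))\<^sup>2)" using L2_add[OF f g] by (rule L2_integrable_square)
    show "integrable lborel (\<lambda>x. (cmod (f x))\<^sup>2 + (cmod (g x))\<^sup>2 + 2 * (cmod (f x) * cmod (g x)))"
      using int F G by simp
    show "(cmod (f x + g x))\<^sup>2 \<le> (cmod (f x))\<^sup>2 + (cmod (g x))\<^sup>2 + 2 * (cmod (f x) * cmod (g x))" for x
      using power_mono[OF norm_triangle_ineq[of "f x" "g x"], of 2] by (simp add: power2_sum)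
  qed
  also have "\<dots> \<le> (L2norm f + L2norm g)\<^sup>2"
    using L2_Cauchy_Schwarz_norm[OF f g] int F G by (simp add: power2_sum L2norm_square)
  finally show ?thesis by (rule power2_le_imp_le) simp
qed

lemma L2norm_triangle_diff:
  assumes "f \<in> L2" "g \<in> L2" "h \<in> L2"
  shows "L2norm (\<lambda>x. f x - h x) \<le> L2norm (\<lambda>x. f x - g x) + L2norm (\<lambda>x. g x - h x)"
  using L2norm_triangle[OF L2_diff[OF assms(1,2)] L2_diff[OF assms(2,3)]] by simp

lemma L2norm_diff_le:
  assumes "f \<in> L2" "g \<in> L2"
  shows "L2norm f \<le> L2norm g + L2norm (\<lambda>x. f x - g x)"
  using L2norm_triangle[OF assms(2) L2_diff[OF assms]] by simp

text \<open>Riesz--Fischer. Along a subsequence the increments have norm below 2^(-k), so even after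
  weighting their squares by 2^k the integrals are summable. Finiteness of the weighted series at a
  point makes the increments decay there like 2^(-k/2), which gives convergence almost everywhere;
  Fatou turns this into convergence in norm.\<close>

lemma L2_complete:
  fixes f :: "nat \<Rightarrow> real^'n \<Rightarrow> complex"
  assumes f: "\<And>n. f n \<in> L2"
    and Cauchy: "\<And>e. e > 0 \<Longrightarrow> \<exists>N. \<forall>m\<ge>N. \<forall>n\<ge>N. L2norm (\<lambda>x. f m x - f n x) < e"
  obtains g where "g \<in> L2" "(\<lambda>n. L2norm (\<lambda>x. f n x - g x)) \<longlonglongrightarrow> 0"
proof -
  have [measurable]: "f n \<in> borel_measurable borel" for n using f by (rule L2_measurable)
  have "\<exists>N. \<forall>m\<ge>N. \<forall>n\<ge>N. L2norm (\<lambda>x. f m x - f n x) < (1/2) ^ k" for k by (intro Cauchy) simp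
  then obtain N where N: "\<And>k m n. m \<ge> N k \<Longrightarrow> n \<ge> N k \<Longrightarrow> L2norm (\<lambda>x. f m x - f n x) < (1/2) ^ k" by metis
  \<comment> \<open>A monotone choice of indices that dominates both \<open>N k\<close> and
    \<open>k\<close>.\<close>
  define r where "r = (\<lambda>k. k + (\<Sum>i\<le>k. N i))"
  have rN: "N k \<le> r k" "r k \<le> r (Suc k)" "k \<le> r k" for k
    using member_le_sum[of k "{..k}" N] by (simp_all add: r_def)
  define h where "h = (\<lambda>k x. cmod (f (r (Suc k)) x - f (r k) x))"
  have [measurable]: "h k \<in> borel_measurable borel" for k unfolding h_def by simp
  have "(\<integral>\<^sup>+x. (\<Sum>k. ennreal (2 ^ k * (h k x)\<^sup>2)) \<partial>lborel) = (\<Sum>k. \<integral>\<^sup>+x. ennreal (2 ^ k * (h k x)\<^sup>2) \<partial>lborel)"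
    by (intro nn_integral_suminf) simp
  also have "\<dots> \<le> (\<Sum>k. ennreal ((1/2) ^ k))"
  proof (intro suminf_le summableI)
    fix k
    have "(\<integral>\<^sup>+x. ennreal (2 ^ k * (h k x)\<^sup>2) \<partial>lborel) = ennreal (2 ^ k) * (\<integral>\<^sup>+x. ennreal ((h k x)\<^sup>2) \<partial>lborel)"
      by (simp add: ennreal_mult nn_integral_cmult)
    also have "\<dots> = ennreal (2 ^ k * (L2norm (\<lambda>x. f (r (Suc k)) x - f (r k) x))\<^sup>2)"
      using L2norm_nn_integral[OF L2_diff[OF f[of "r (Suc k)"] f[of "r k"]]] by (simp add: h_def ennreal_mult)
    also have "\<dots> \<le> ennreal (2 ^ k * ((1/2) ^ k)\<^sup>2)"
      using N[of k "r (Suc k)" "r k"] rN[of k]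
      by (intro ennreal_leI mult_left_mono power_mono) auto
    also have "2 ^ k * ((1/2) ^ k)\<^sup>2 = ((1/2::real) ^ k)"
      by (simp add: power2_eq_square power_one_over)
    finally show "(\<integral>\<^sup>+x. ennreal (2 ^ k * (h k x)\<^sup>2) \<partial>lborel) \<le> ennreal ((1/2) ^ k)" .
  qed
  also have "\<dots> = ennreal (\<Sum>k. (1/2) ^ k)" by (intro suminf_ennreal2 summable_geometric) auto
  also have "\<dots> < \<infinity>" by simp
  finally have "AE x in lborel. (\<Sum>k. ennreal (2 ^ k * (h k x)\<^sup>2)) \<noteq> \<infinity>"
    by (intro nn_integral_PInf_AE) auto
  then have conv: "AE x in lborel. convergent (\<lambda>k. f (r k) x)"
  proof eventually_elim
    case (elim x)
    then have sm: "summable (\<lambda>k. 2 ^ k * (h k x)\<^sup>2)"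
      by (intro summable_suminf_not_top) auto
    define C where "C = (\<Sum>k. 2 ^ k * (h k x)\<^sup>2)"
    have h_le: "h k x \<le> sqrt C * sqrt (1/2) ^ k" for k
    proof -
      have "2 ^ k * (h k x)\<^sup>2 \<le> C"
        unfolding C_def using sum_le_suminf[OF sm, of "{k}"] by simp
      then have "(h k x)\<^sup>2 \<le> C * (1/2) ^ k" by (simp add: field_simps power_one_over)
      then have "sqrt ((h k x)\<^sup>2) \<le> sqrt (C * (1/2) ^ k)" by (rule real_sqrt_le_mono)
      then show ?thesis by (simp add: h_def real_sqrt_mult real_sqrt_power)
    qed
    have geo: "summable (\<lambda>k. sqrt C * sqrt (1/2) ^ k)"
    proof (intro summable_mult summable_geometric)
      have "sqrt (1/2) < sqrt (1::real)" by (intro real_sqrt_less_mono) simp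
      then show "norm (sqrt (1/2) :: real) < 1" by simp
    qed
    have "summable (\<lambda>k. norm (f (r (Suc k)) x - f (r k) x))"
    proof (rule summable_comparison_test'[OF geo, of 0])
      show "norm (norm (f (r (Suc k)) x - f (r k) x)) \<le> sqrt C * sqrt (1/2) ^ k" for k
        using h_le[of k] by (simp add: h_def)
    qed
    then have "summable (\<lambda>k. f (r (Suc k)) x - f (r k) x)" by (rule summable_norm_cancel)
    then have "convergent (\<lambda>n. (\<Sum>k<n. f (r (Suc k)) x - f (r k) x))" by (simp add: summable_iff_convergent)
    then have "convergent (\<lambda>n. f (r n) x - f (r 0) x)"
      using sum_lessThan_telescope[of "\<lambda>k. f (r k) x"] by simp
    then show "convergent (\<lambda>k. f (r k) x)" by (simp add: convergent_diff_const_right_iff)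
  qed
  define g where "g = (\<lambda>x. lim (\<lambda>k. f (r k) x))"
  have [measurable]: "g \<in> borel_measurable borel" unfolding g_def by (rule borel_measurable_lim_metric) simp
  \<comment> \<open>Fatou along the subsequence: a bound on the distances from \<open>f n\<close> to
    all late members passes to the limit \<open>g\<close>.\<close>
  have close: "(\<lambda>x. f n x - g x) \<in> L2 \<and> L2norm (\<lambda>x. f n x - g x) \<le> e"
    if n: "\<And>m. m \<ge> K \<Longrightarrow> L2norm (\<lambda>x. f n x - f m x) < e" and "e > 0" for n e K
  proof -
    have unb: "eventually (\<lambda>k. L2norm (\<lambda>x. f n x - f (r k) x) \<le> e) sequentially"
      using eventually_ge_at_top[of K]
    proof eventually_elim
      case (elim k)
      from n[of "r k"] rN(3)[of k] elim show ?case by simp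
    qed
    have "(\<integral>\<^sup>+x. ennreal ((cmod (f n x - g x))\<^sup>2) \<partial>lborel) \<le> (\<integral>\<^sup>+x. liminf (\<lambda>k. ennreal ((cmod (f n x - f (r k) x))\<^sup>2)) \<partial>lborel)"
    proof (rule nn_integral_mono_AE)
      show "AE x in lborel. ennreal ((cmod (f n x - g x))\<^sup>2) \<le> liminf (\<lambda>k. ennreal ((cmod (f n x - f (r k) x))\<^sup>2))"
        using conv
      proof eventually_elim
        case (elim x)
        then have "(\<lambda>k. f (r k) x) \<longlonglongrightarrow> g x" by (simp add: g_def convergent_LIMSEQ_iff)
        then have "(\<lambda>k. ennreal ((cmod (f n x - f (r k) x))\<^sup>2)) \<longlonglongrightarrow> ennreal ((cmod (f n x - g x))\<^sup>2)"
          by (intro tendsto_ennrealI tendsto_intros)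
        from lim_imp_Liminf[OF sequentially_bot this] show ?case by (simp only: order_refl)
      qed
    qed
    also have "\<dots> \<le> liminf (\<lambda>k. \<integral>\<^sup>+x. ennreal ((cmod (f n x - f (r k) x))\<^sup>2) \<partial>lborel)"
      by (rule nn_integral_liminf) simp
    also have "\<dots> = liminf (\<lambda>k. ennreal ((L2norm (\<lambda>x. f n x - f (r k) x))\<^sup>2))"
      by (simp add: L2norm_nn_integral L2_diff f)
    also have "\<dots> \<le> liminf (\<lambda>k::nat. ennreal (e\<^sup>2))"
      using unb by (intro Liminf_mono) (auto elim!: eventually_mono intro!: ennreal_leI power_mono)
    also have "\<dots> = ennreal (e\<^sup>2)" by (simp add: Liminf_const)
    finally show ?thesis using \<open>e > 0\<close> by (auto intro!: L2I_nn_integral)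
  qed
  have "g \<in> L2"
  proof -
    obtain K where "\<And>m n. m \<ge> K \<Longrightarrow> n \<ge> K \<Longrightarrow> L2norm (\<lambda>x. f m x - f n x) < 1" using Cauchy[of 1] by auto
    then have "(\<lambda>x. f K x - g x) \<in> L2" using close[of K K 1] by auto
    from L2_diff[OF f[of K] this] show ?thesis by simp
  qed
  moreover have "(\<lambda>n. L2norm (\<lambda>x. f n x - g x)) \<longlonglongrightarrow> 0"
  proof (rule LIMSEQ_I)
    fix e :: real assume "e > 0"
    then obtain K where K: "\<And>m n. m \<ge> K \<Longrightarrow> n \<ge> K \<Longrightarrow> L2norm (\<lambda>x. f m x - f n x) < e / 2"
      using Cauchy[of "e / 2"] by auto
    have "L2norm (\<lambda>x. f n x - g x) < e" if "n \<ge> K" for n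
      using close[of K n "e / 2"] K that \<open>e > 0\<close> by fastforce
    then show "\<exists>no. \<forall>n\<ge>no. norm (L2norm (\<lambda>x. f n x - g x) - 0) < e"
      by (intro exI[of _ K]) simp
  qed
  ultimately show ?thesis by (rule that)
qed

section \<open>Continuous functions with compact support\<close>

definition Cc :: "(real^'n \<Rightarrow> complex) set" where
  "Cc = {f. continuous_on UNIV f \<and> (\<exists>R. \<forall>x. norm x > R \<longrightarrow> f x = 0)}"

text \<open>Continuity of the derivative is asked direction by direction, which in finite dimension
  is the usual C^1 condition and needs no operator norm.\<close>

definition C1c :: "(real^'n \<Rightarrow> complex) set" where
  "C1c = {f. (\<exists>f'. (\<forall>x. (f has_derivative f' x) (at x)) \<and> (\<forall>y. continuous_on UNIV (\<lambda>x. f' x y))) \<and>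
             (\<exists>R. \<forall>x. norm x > R \<longrightarrow> f x = 0)}"

lemma C1c_imp_Cc:
  assumes "f \<in> C1c"
  shows "f \<in> Cc"
proof -
  obtain f' where "\<And>x. (f has_derivative f' x) (at x)" using assms by (auto simp: C1c_def)
  then have "continuous_on UNIV f" by (intro continuous_at_imp_continuous_on ballI has_derivative_continuous)
  then show ?thesis using assms by (simp add: C1c_def Cc_def)
qed

lemma Cc_support:
  assumes "f \<in> Cc"
  obtains R where "R > 0" "\<And>x. norm x > R \<Longrightarrow> f x = 0"
proof -
  obtain R where "\<forall>x. norm x > R \<longrightarrow> f x = 0" using assms by (auto simp: Cc_def)
  then show ?thesis by (intro that[of "max R 1"]) auto
qed

lemma Cc_continuous: "f \<in> Cc \<Longrightarrow> continuous_on UNIV f"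
  by (simp add: Cc_def)

lemma Cc_measurable: "f \<in> Cc \<Longrightarrow> f \<in> borel_measurable borel"
  by (intro borel_measurable_continuous_onI Cc_continuous)

lemma Cc_bounded:
  assumes "f \<in> Cc"
  obtains C where "C > 0" "\<And>x. cmod (f x) \<le> C"
proof -
  obtain R where R: "R > 0" "\<And>x. norm x > R \<Longrightarrow> f x = 0" using Cc_support[OF assms] by blast
  have "bounded (f ` cball 0 R)"
    by (intro compact_imp_bounded compact_continuous_image continuous_on_subset[OF Cc_continuous[OF assms]]) auto
  then obtain C where C: "\<And>x. x \<in> cball 0 R \<Longrightarrow> cmod (f x) \<le> C" unfolding bounded_iff by blast
  show ?thesis
  proof
    show "max C 1 > 0" by simp
    show "cmod (f x) \<le> max C 1" for x
      using C[of x] R(2)[of x] by (cases "norm x > R") auto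
  qed
qed

lemma continuous_compact_support_integrable:
  fixes f :: "'a::euclidean_space \<Rightarrow> 'b::euclidean_space"
  assumes "continuous_on UNIV f" "\<And>x. norm x > R \<Longrightarrow> f x = 0"
  shows "integrable lborel f"
proof -
  have "integrable lborel (\<lambda>x. indicator (cball 0 R) x *\<^sub>R f x)"
    by (intro borel_integrable_compact continuous_on_subset[OF assms(1)]) auto
  moreover have "(\<lambda>x. indicator (cball 0 R) x *\<^sub>R f x) = f"
    using assms(2) by (auto simp: indicator_def fun_eq_iff)
  ultimately show ?thesis by simp
qed

lemma Cc_integrable:
  assumes "f \<in> Cc"
  shows "integrable lborel f"
  by (rule Cc_support[OF assms], rule continuous_compact_support_integrable[OF Cc_continuous[OF assms]])

lemma Cc_L2:
  assumes "f \<in> Cc"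
  shows "f \<in> L2"
proof -
  obtain R where R: "R > 0" "\<And>x. norm x > R \<Longrightarrow> f x = 0" using Cc_support[OF assms] by blast
  have "integrable lborel (\<lambda>x. (cmod (f x))\<^sup>2)"
    by (rule continuous_compact_support_integrable[of _ R])
      (auto intro!: continuous_intros Cc_continuous assms simp: R(2))
  then show ?thesis using Cc_measurable[OF assms] by (simp add: L2_def)
qed

lemma L2norm_bounded_support:
  fixes f :: "real^'n \<Rightarrow> complex"
  assumes "f \<in> borel_measurable borel" "\<And>x. cmod (f x) \<le> e" "\<And>x. norm x > R \<Longrightarrow> f x = 0" "e \<ge> 0"
  shows "L2norm f \<le> e * sqrt (measure lborel (cball (0::real^'n) R))"
proof -
  let ?g = "\<lambda>x::real^'n. indicator (cball 0 R) x *\<^sub>R e\<^sup>2"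
  have g: "integrable lborel ?g" by (intro borel_integrable_compact continuous_intros) auto
  have le: "(cmod (f x))\<^sup>2 \<le> ?g x" for x
    using assms(2)[of x] assms(3)[of x] by (auto simp: indicator_def intro: power_mono)
  have "integrable lborel (\<lambda>x. (cmod (f x))\<^sup>2)"
    by (rule Bochner_Integration.integrable_bound[OF g]) (use assms(1) le order_trans[OF le abs_ge_self] in auto)
  then have "(LINT x|lborel. (cmod (f x))\<^sup>2) \<le> (LINT x|lborel. ?g x)"
    using g le by (intro integral_mono)
  also have "\<dots> = e\<^sup>2 * measure lborel (cball (0::real^'n) R)"
    by (simp add: mult.commute)
  finally show ?thesis
    unfolding L2norm_def using assms(4) by (metis real_sqrt_le_mono real_sqrt_mult real_sqrt_abs abs_of_nonneg)
qed

text \<open>A measurable function is an almost everywhere limit of continuous ones. Clipping their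
  values to the disc of radius K (\<open>cl\<close>) and cutting off outside radius K + 1
  (\<open>ch\<close>) leaves the limit unchanged, because \<open>w\<close> obeys both bounds, and
  supplies a dominating function.\<close>

lemma Cc_dense_bounded:
  fixes w :: "real^'n \<Rightarrow> complex"
  assumes w: "w \<in> borel_measurable borel" and K: "K > 0" "\<And>x. cmod (w x) \<le> K" "\<And>x. norm x > K \<Longrightarrow> w x = 0"
    and "e > 0"
  obtains v where "v \<in> Cc" "L2norm (\<lambda>x. w x - v x) < e"
proof -
  have "w \<in> borel_measurable lebesgue" using w by (intro measurable_completion) simp
  then have "w measurable_on UNIV" by (rule lebesgue_measurable_imp_measurable_on) simp
  then obtain N g where N: "negligible N" and g: "\<And>n. continuous_on UNIV (g n)"
    "\<And>x. x \<notin> N \<Longrightarrow> (\<lambda>n. g n x) \<longlonglongrightarrow> w x" by (auto simp: measurable_on_def)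
  define cl where "cl = (\<lambda>z::complex. (K / max K (cmod z)) *\<^sub>R z)"
  define ch where "ch = (\<lambda>x::real^'n. max 0 (min 1 (K + 1 - norm x)))"
  define v where "v = (\<lambda>n x. ch x *\<^sub>R cl (g n x))"
  have cl: "continuous_on UNIV cl" unfolding cl_def using K(1) by (intro continuous_intros) (auto simp: max_def)
  have cl_le: "cmod (cl z) \<le> K" for z
    using K(1) by (auto simp: cl_def max_def field_simps)
  have cl_id: "cl z = z" if "cmod z \<le> K" for z using that K(1) by (simp add: cl_def)
  have ch: "0 \<le> ch x" "ch x \<le> 1" "norm x > K + 1 \<Longrightarrow> ch x = 0" "norm x \<le> K \<Longrightarrow> ch x = 1" for x
    by (auto simp: ch_def)
  have v: "v n \<in> Cc" for n
  proof -
    have "continuous_on UNIV ch" unfolding ch_def by (intro continuous_intros)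
    then have "continuous_on UNIV (v n)"
      unfolding v_def by (intro continuous_intros continuous_on_compose2[OF cl g(1)]) auto
    then show ?thesis using ch(3) by (auto simp: Cc_def v_def intro!: exI[of _ "K + 1"])
  qed
  have AEN: "AE x in lborel. x \<notin> N"
  proof -
    have "AE x in lebesgue. x \<notin> N" using N by (intro AE_not_in) (simp add: negligible_iff_null_sets)
    then show ?thesis by (simp only: AE_completion_iff)
  qed
  have lim: "AE x in lborel. (\<lambda>n. (cmod (w x - v n x))\<^sup>2) \<longlonglongrightarrow> 0"
    using AEN
  proof eventually_elim
    case (elim x)
    have "isCont cl (w x)" using cl by (simp add: continuous_on_eq_continuous_at)
    then have "(\<lambda>n. cl (g n x)) \<longlonglongrightarrow> cl (w x)" using g(2)[OF elim] by (rule isCont_tendsto_compose)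
    then have "(\<lambda>n. v n x) \<longlonglongrightarrow> ch x *\<^sub>R w x"
      unfolding v_def using cl_id[OF K(2)[of x]] by (intro tendsto_intros) simp
    moreover have "ch x *\<^sub>R w x = w x" using ch(4)[of x] K(3)[of x] by (cases "norm x \<le> K") auto
    ultimately have "(\<lambda>n. v n x) \<longlonglongrightarrow> w x" by simp
    then have "(\<lambda>n. (cmod (w x - v n x))\<^sup>2) \<longlonglongrightarrow> (cmod (w x - w x))\<^sup>2"
      by (intro tendsto_intros)
    then show ?case by simp
  qed
  have "(\<lambda>n. LINT x|lborel. (cmod (w x - v n x))\<^sup>2) \<longlonglongrightarrow> (LINT x|(lborel :: (real^'n) measure). 0)"
  proof (rule integral_dominated_convergence[where w = "\<lambda>x. indicator (cball 0 (K + 1)) x *\<^sub>R (2 * K)\<^sup>2"])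
    show "integrable lborel (\<lambda>x::real^'n. indicator (cball 0 (K + 1)) x *\<^sub>R (2 * K)\<^sup>2)"
      by (intro borel_integrable_compact continuous_intros) auto
    show "AE x in lborel. norm ((cmod (w x - v n x))\<^sup>2) \<le> indicator (cball 0 (K + 1)) x *\<^sub>R (2 * K)\<^sup>2" for n
    proof (intro AE_I2)
      fix x :: "real^'n"
      show "norm ((cmod (w x - v n x))\<^sup>2) \<le> indicator (cball 0 (K + 1)) x *\<^sub>R (2 * K)\<^sup>2"
      proof (cases "norm x \<le> K + 1")
        case True
        have "cmod (v n x) \<le> 1 * K" unfolding v_def using ch(1,2)[of x] cl_le[of "g n x"]
          by (simp only: norm_scaleR) (intro mult_mono, auto)
        then have "cmod (w x - v n x) \<le> 2 * K" using K(2)[of x] norm_triangle_ineq4[of "w x" "v n x"] by simp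
        then have "(cmod (w x - v n x))\<^sup>2 \<le> (2 * K)\<^sup>2" by (intro power_mono) auto
        then show ?thesis using True by simp
      next
        case False
        then show ?thesis using K(3)[of x] ch(3)[of x] by (simp add: v_def)
      qed
    qed
  qed (use w Cc_measurable[OF v] lim in auto)
  then have "(\<lambda>n. L2norm (\<lambda>x. w x - v n x)) \<longlonglongrightarrow> sqrt 0"
    unfolding L2norm_def by (intro tendsto_real_sqrt) simp
  from order_tendstoD(2)[OF this, of e] \<open>e > 0\<close> obtain n where "L2norm (\<lambda>x. w x - v n x) < e"
    by (auto simp: eventually_sequentially)
  with v that show ?thesis by blast
qed

lemma Cc_dense:
  fixes u :: "real^'n \<Rightarrow> complex"
  assumes u: "u \<in> L2" and "e > 0"
  obtains v where "v \<in> Cc" "L2norm (\<lambda>x. u x - v x) < e"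
proof -
  have [measurable]: "u \<in> borel_measurable borel" by (rule L2_measurable[OF u])
  define A where "A = (\<lambda>n::nat. {x. cmod (u x) \<le> Suc n \<and> norm x \<le> Suc n})"
  define w where "w = (\<lambda>n x. indicator (A n) x * u x)"
  have [measurable]: "A n \<in> sets borel" for n unfolding A_def by simp
  have [measurable]: "w n \<in> borel_measurable borel" for n unfolding w_def by simp
  have w_le: "cmod (w n x) \<le> cmod (u x)" for n x by (simp add: w_def indicator_def)
  have wL2: "w n \<in> L2" for n
    using Bochner_Integration.integrable_bound[OF L2_integrable_square[OF u], of "\<lambda>x. (cmod (w n x))\<^sup>2"] w_le
    by (simp add: L2_def power_mono)
  have "(\<lambda>n. LINT x|lborel. (cmod (u x - w n x))\<^sup>2) \<longlonglongrightarrow> (LINT x|(lborel :: (real^'n) measure). 0)"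
  proof (rule integral_dominated_convergence[where w = "\<lambda>x. (cmod (u x))\<^sup>2"])
    show "AE x in lborel. (\<lambda>n. (cmod (u x - w n x))\<^sup>2) \<longlonglongrightarrow> 0"
    proof (intro AE_I2 tendsto_eventually)
      fix x :: "real^'n"
      obtain K :: nat where K: "max (cmod (u x)) (norm x) \<le> K" using real_arch_simple by blast
      have "x \<in> A n" if "n \<ge> K" for n using K that by (auto simp: A_def)
      then show "eventually (\<lambda>n. (cmod (u x - w n x))\<^sup>2 = 0) sequentially"
        by (intro eventually_mono[OF eventually_ge_at_top[of K]]) (simp add: w_def)
    qed
    show "AE x in lborel. norm ((cmod (u x - w n x))\<^sup>2) \<le> (cmod (u x))\<^sup>2" for n
      by (intro AE_I2) (auto simp: w_def indicator_def)
  qed (use L2_integrable_square[OF u] in auto)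
  then have "(\<lambda>n. L2norm (\<lambda>x. u x - w n x)) \<longlonglongrightarrow> sqrt 0"
    unfolding L2norm_def by (intro tendsto_real_sqrt) simp
  from order_tendstoD(2)[OF this, of "e/2"] \<open>e > 0\<close> obtain n where n: "L2norm (\<lambda>x. u x - w n x) < e/2"
    by (auto simp: eventually_sequentially)
  obtain v where v: "v \<in> Cc" "L2norm (\<lambda>x. w n x - v x) < e/2"
    by (rule Cc_dense_bounded[of "w n" "real (Suc n)" "e/2"]) (use \<open>e > 0\<close> in \<open>auto simp: w_def A_def indicator_def\<close>)
  have "L2norm (\<lambda>x. u x - v x) < e"
    using L2norm_triangle_diff[OF u wL2[of n] Cc_L2[OF v(1)]] n v(2) by simp
  with v(1) that show ?thesis by blast
qed

section \<open>C^1 approximation by polynomials times a cutoff\<close>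

lemma real_polynomial_function_derivative:
  fixes p :: "'a::real_normed_vector \<Rightarrow> real"
  assumes "real_polynomial_function p"
  shows "\<exists>p'. (\<forall>x. (p has_derivative p' x) (at x)) \<and> (\<forall>y. real_polynomial_function (\<lambda>x. p' x y))"
  using assms
proof induction
  case (linear f)
  then show ?case
    by (intro exI[of _ "\<lambda>_. f"]) (auto intro: bounded_linear_imp_has_derivative real_polynomial_function.intros)
next
  case (const c)
  then show ?case
    by (intro exI[of _ "\<lambda>_ _. 0"]) (auto intro: real_polynomial_function.intros)
next
  case (add f g)
  then obtain f' g' where "\<And>x. (f has_derivative f' x) (at x)" "\<And>y. real_polynomial_function (\<lambda>x. f' x y)"
    "\<And>x. (g has_derivative g' x) (at x)" "\<And>y. real_polynomial_function (\<lambda>x. g' x y)" by blast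
  then show ?case
    by (intro exI[of _ "\<lambda>x y. f' x y + g' x y"]) (auto intro!: derivative_intros real_polynomial_function.intros(3,4))
next
  case (mult f g)
  then obtain f' g' where "\<And>x. (f has_derivative f' x) (at x)" "\<And>y. real_polynomial_function (\<lambda>x. f' x y)"
    "\<And>x. (g has_derivative g' x) (at x)" "\<And>y. real_polynomial_function (\<lambda>x. g' x y)" by blast
  with mult.hyps show ?case
    by (intro exI[of _ "\<lambda>x y. f x * g' x y + f' x y * g x"]) (auto intro!: derivative_intros real_polynomial_function.intros(3,4))
qed

lemma polynomial_function_complex_derivative:
  fixes p :: "'a::real_normed_vector \<Rightarrow> complex"
  assumes "polynomial_function p"
  shows "\<exists>p'. (\<forall>x. (p has_derivative p' x) (at x)) \<and> (\<forall>y. continuous_on UNIV (\<lambda>x. p' x y))"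
proof -
  have Re: "real_polynomial_function (\<lambda>x. Re (p x))" and Im: "real_polynomial_function (\<lambda>x. Im (p x))"
    using assms unfolding polynomial_function_def o_def by (auto intro: bounded_linear_Re bounded_linear_Im)
  obtain a b where a: "\<And>x. ((\<lambda>x. Re (p x)) has_derivative a x) (at x)" "\<And>y. real_polynomial_function (\<lambda>x. a x y)"
    and b: "\<And>x. ((\<lambda>x. Im (p x)) has_derivative b x) (at x)" "\<And>y. real_polynomial_function (\<lambda>x. b x y)"
    using real_polynomial_function_derivative[OF Re] real_polynomial_function_derivative[OF Im] by blast
  have "(p has_derivative (\<lambda>y. complex_of_real (a x y) + \<i> * complex_of_real (b x y))) (at x)" for x
  proof -
    have "((\<lambda>x. complex_of_real (Re (p x)) + \<i> * complex_of_real (Im (p x))) has_derivative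
        (\<lambda>y. complex_of_real (a x y) + \<i> * complex_of_real (b x y))) (at x)"
      by (intro derivative_intros a b)
    then show ?thesis by (simp flip: complex_eq)
  qed
  moreover have "continuous_on UNIV (\<lambda>x. complex_of_real (a x y) + \<i> * complex_of_real (b x y))" for y
    using a(2)[of y] b(2)[of y] by (intro continuous_intros continuous_on_polymonial_function) (auto simp: real_polynomial_function_eq)
  ultimately show ?thesis
    by (intro exI[of _ "\<lambda>x y. complex_of_real (a x y) + \<i> * complex_of_real (b x y)"]) blast
qed

text \<open>Squaring the positive part makes it C^1 across 0; this is the profile of the cutoff that
  produces elements of \<open>C1c\<close>.\<close>

lemma DERIV_max_square: "((\<lambda>y::real. (max 0 y)\<^sup>2) has_real_derivative 2 * max 0 x) (at x)"
proof -
  consider "x > 0" | "x < 0" | "x = 0" by linarith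
  then show ?thesis
  proof cases
    case 1
    then have "((\<lambda>y. y\<^sup>2) has_real_derivative 2 * max 0 x) (at x)" by (auto intro!: derivative_eq_intros)
    then show ?thesis by (rule has_field_derivative_transform_within_open[of _ _ _ "{0<..}"]) (use 1 in auto)
  next
    case 2
    then have "((\<lambda>y. 0) has_real_derivative 2 * max 0 x) (at x)" by (auto intro!: derivative_eq_intros)
    then show ?thesis by (rule has_field_derivative_transform_within_open[of _ _ _ "{..<0}"]) (use 2 in auto)
  next
    case 3
    have "((\<lambda>h::real. (max 0 h)\<^sup>2 / h) \<longlongrightarrow> 0) (at 0)"
    proof (rule Lim_null_comparison)
      show "\<forall>\<^sub>F h in at 0. norm ((max 0 h)\<^sup>2 / h) \<le> \<bar>h\<bar>" for h :: real
        by (intro always_eventually) (auto simp: max_def power2_eq_square)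
      show "((\<lambda>h::real. \<bar>h\<bar>) \<longlongrightarrow> 0) (at 0)" by (rule tendsto_rabs_zero) (rule tendsto_ident_at)
    qed
    then show ?thesis using 3 by (simp add: DERIV_def)
  qed
qed

text \<open>Stone--Weierstrass applied to the quotient by a \<open>C\<^sup>1\<close> cutoff; multiplying by the cutoff restores compact support.\<close>

lemma Cc_uniform_approx:
  fixes f :: "real^'n \<Rightarrow> complex"
  assumes "f \<in> Cc"
  obtains R where "R > 0" "\<And>x. norm x > R \<Longrightarrow> f x = 0"
    "\<And>e. e > 0 \<Longrightarrow> \<exists>v\<in>C1c. (\<forall>x. cmod (f x - v x) \<le> e) \<and> (\<forall>x. norm x > R \<longrightarrow> v x = 0)"
proof -
  obtain R where R: "R > 0" "\<And>x. norm x > R \<Longrightarrow> f x = 0" using Cc_support[OF assms] by blast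
  define ch where "ch = (\<lambda>x::real^'n. (max 0 ((R + 1)\<^sup>2 - x \<bullet> x))\<^sup>2)"
  \<comment> \<open>The minimum of \<open>ch\<close> on the ball of radius R. Where \<open>f\<close>
    may be nonzero the denominator \<open>max c (ch x)\<close> is therefore \<open>ch x\<close>, and
    everywhere it stays away from 0, so the quotient \<open>q\<close> is continuous.\<close>
  define c where "c = ((R + 1)\<^sup>2 - R\<^sup>2)\<^sup>2"
  have "(R + 1)\<^sup>2 - R\<^sup>2 = 2 * R + 1" by (simp add: power2_sum)
  then have c: "c > 0" using R(1) by (simp add: c_def)
  define q where "q = (\<lambda>x. f x / complex_of_real (max c (ch x)))"
  have ch_cont: "continuous_on UNIV ch" unfolding ch_def by (intro continuous_intros)
  have q: "continuous_on UNIV q"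
    unfolding q_def using c by (intro continuous_intros Cc_continuous[OF assms] ch_cont) (auto simp: max_def)
  have sq: "x \<bullet> x \<le> R\<^sup>2 \<longleftrightarrow> norm x \<le> R" "x \<bullet> x \<le> (R + 1)\<^sup>2 \<longleftrightarrow> norm x \<le> R + 1" for x :: "real^'n"
    using R(1) by (simp_all add: power2_norm_eq_inner[symmetric] power2_le_iff_abs_le)
  have ch0: "ch x = 0" if "norm x > R + 1" for x using that sq(2)[of x] by (simp add: ch_def)
  have ch_le: "0 \<le> ch x" "ch x \<le> (R + 1) ^ 4" for x
  proof -
    have "(max 0 ((R + 1)\<^sup>2 - x \<bullet> x))\<^sup>2 \<le> ((R + 1)\<^sup>2)\<^sup>2" by (intro power_mono) auto
    then show "ch x \<le> (R + 1) ^ 4" by (simp add: ch_def)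
  qed (simp add: ch_def)
  have fq: "f x = ch x * q x" for x
  proof (cases "norm x \<le> R")
    case True
    then have "c \<le> ch x" unfolding c_def ch_def using sq(1)[of x] R(1)
      by (intro power_mono) (auto simp: power2_sum max_def)
    then show ?thesis using c by (simp add: q_def max_def)
  qed (simp add: q_def R(2))
  have ch_deriv: "(ch has_derivative (\<lambda>y. (2 * max 0 ((R + 1)\<^sup>2 - x \<bullet> x)) * (- 2 * (x \<bullet> y)))) (at x)" for x
  proof -
    have 1: "((\<lambda>x::real^'n. (R + 1)\<^sup>2 - x \<bullet> x) has_derivative (\<lambda>y. - 2 * (x \<bullet> y))) (at x)"
      by (auto intro!: derivative_eq_intros simp: inner_commute)
    from has_derivative_compose[OF 1 DERIV_max_square[unfolded has_field_derivative_def]]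
    show ?thesis unfolding ch_def by simp
  qed
  show ?thesis
  proof
    show "R + 1 > 0" using R by simp
    show "f x = 0" if "norm x > R + 1" for x using R(2)[of x] that by simp
    fix e :: real assume "e > 0"
    define d where "d = e / (R + 1) ^ 4"
    have d: "d > 0" using \<open>e > 0\<close> R(1) by (simp add: d_def)
    obtain p where p: "polynomial_function p" "\<And>x. x \<in> cball 0 (R + 1) \<Longrightarrow> norm (q x - p x) < d"
      using Stone_Weierstrass_polynomial_function[OF compact_cball continuous_on_subset[OF q subset_UNIV] d, of 0 "R + 1"]
      by blast
    obtain p' where p': "\<And>x. (p has_derivative p' x) (at x)" "\<And>y. continuous_on UNIV (\<lambda>x. p' x y)"
      using polynomial_function_complex_derivative[OF p(1)] by blast
    define v where "v = (\<lambda>x. complex_of_real (ch x) * p x)"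
    have v0: "v x = 0" if "norm x > R + 1" for x using ch0[OF that] by (simp add: v_def)
    have "(v has_derivative (\<lambda>y. complex_of_real (ch x) * p' x y +
         complex_of_real ((2 * max 0 ((R + 1)\<^sup>2 - x \<bullet> x)) * (- 2 * (x \<bullet> y))) * p x)) (at x)" for x
      unfolding v_def by (intro derivative_intros ch_deriv p')
    moreover have "continuous_on UNIV (\<lambda>x. complex_of_real (ch x) * p' x y +
         complex_of_real ((2 * max 0 ((R + 1)\<^sup>2 - x \<bullet> x)) * (- 2 * (x \<bullet> y))) * p x)" for y
      by (intro continuous_intros ch_cont p' continuous_on_polymonial_function p)
    ultimately have "\<exists>f'. (\<forall>x. (v has_derivative f' x) (at x)) \<and> (\<forall>y. continuous_on UNIV (\<lambda>x. f' x y))"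
      by (intro exI[of _ "\<lambda>x y. complex_of_real (ch x) * p' x y +
         complex_of_real ((2 * max 0 ((R + 1)\<^sup>2 - x \<bullet> x)) * (- 2 * (x \<bullet> y))) * p x"] conjI allI)
    then have "v \<in> C1c" unfolding C1c_def using v0 by blast
    moreover have "cmod (f x - v x) \<le> e" for x
    proof (cases "norm x \<le> R + 1")
      case True
      have "cmod (f x - v x) = ch x * cmod (q x - p x)"
        using ch_le(1)[of x] by (simp add: fq v_def norm_mult flip: right_diff_distrib)
      also have "\<dots> \<le> (R + 1) ^ 4 * d"
        using p(2)[of x] True ch_le[of x] by (intro mult_mono) auto
      also have "\<dots> = e" using R(1) by (simp add: d_def)
      finally show ?thesis .
    next
      case False
      then show ?thesis using R(2)[of x] v0[of x] \<open>e > 0\<close> by simp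
    qed
    ultimately show "\<exists>v\<in>C1c. (\<forall>x. cmod (f x - v x) \<le> e) \<and> (\<forall>x. norm x > R + 1 \<longrightarrow> v x = 0)"
      using v0 by blast
  qed
qed

lemma C1c_dense:
  fixes u :: "real^'n \<Rightarrow> complex"
  assumes u: "u \<in> L2" and e: "e > 0"
  obtains v where "v \<in> C1c" "L2norm (\<lambda>x. u x - v x) < e"
proof -
  obtain f where f: "f \<in> Cc" "L2norm (\<lambda>x. u x - f x) < e/2"
    using Cc_dense[OF u, of "e/2"] e by auto
  obtain R where R: "R > 0" "\<And>x. norm x > R \<Longrightarrow> f x = 0"
    "\<And>e. e > 0 \<Longrightarrow> \<exists>v\<in>C1c. (\<forall>x. cmod (f x - v x) \<le> e) \<and> (\<forall>x. norm x > R \<longrightarrow> v x = 0)"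
    using Cc_uniform_approx[OF f(1)] by blast
  define a where "a = sqrt (measure lborel (cball (0::real^'n) R)) + 1"
  have a: "a > 0" unfolding a_def by (simp add: add_nonneg_pos)
  obtain v where v: "v \<in> C1c" "\<And>x. cmod (f x - v x) \<le> e / 2 / a" "\<And>x. norm x > R \<Longrightarrow> v x = 0"
    using R(3)[of "e / 2 / a"] e a by auto
  have "L2norm (\<lambda>x. f x - v x) \<le> e / 2 / a * sqrt (measure lborel (cball (0::real^'n) R))"
    using v R(2) e a Cc_measurable[OF f(1)] Cc_measurable[OF C1c_imp_Cc[OF v(1)]]
    by (intro L2norm_bounded_support) auto
  also have "\<dots> \<le> e / 2 / a * a" using e a by (intro mult_left_mono) (auto simp: a_def)
  also have "\<dots> = e / 2" using a by simp
  finally have "L2norm (\<lambda>x. u x - v x) < e"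
    using L2norm_triangle_diff[OF u Cc_L2[OF f(1)] Cc_L2[OF C1c_imp_Cc[OF v(1)]]] f(2) by simp
  with v(1) that show ?thesis by blast
qed

section \<open>Gaussians and the Fourier transform\<close>

lemma integral_basis_product:
  fixes f :: "'a::euclidean_space \<Rightarrow> real \<Rightarrow> 'b::{real_normed_field, banach, second_countable_topology}"
  assumes int: "\<And>b. b \<in> Basis \<Longrightarrow> integrable lborel (f b)"
  shows "integrable lborel (\<lambda>x::'a. \<Prod>b\<in>Basis. f b (x \<bullet> b))"
    and "(LINT x|lborel. (\<Prod>b\<in>Basis. f b (x \<bullet> b))) = (\<Prod>b\<in>(Basis :: 'a set). (LINT x|lborel. f b x))"
proof -
  interpret product_sigma_finite "\<lambda>b::'a. lborel :: real measure" by standard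
  have T: "(\<lambda>g. \<Sum>b\<in>Basis. g b *\<^sub>R b) \<in> measurable (\<Pi>\<^sub>M b\<in>(Basis :: 'a set). lborel) (borel :: 'a measure)" by measurable
  have [measurable]: "f b \<in> borel_measurable borel" if "b \<in> Basis" for b
    using int[OF that] by (auto dest: borel_measurable_integrable)
  have m: "(\<lambda>x::'a. \<Prod>b\<in>Basis. f b (x \<bullet> b)) \<in> borel_measurable borel"
    by measurable
  have eq: "(\<Prod>b\<in>Basis. f b ((\<Sum>b\<in>Basis. g b *\<^sub>R b) \<bullet> b)) = (\<Prod>b\<in>Basis. f b (g b))" for g
    by (intro prod.cong) simp_all
  show "integrable lborel (\<lambda>x::'a. \<Prod>b\<in>Basis. f b (x \<bullet> b))"
    unfolding lborel_eq[where 'a='a] integrable_distr_eq[OF T m] eq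
    by (intro product_integrable_prod int) auto
  show "(LINT x|lborel. (\<Prod>b\<in>Basis. f b (x \<bullet> b))) = (\<Prod>b\<in>(Basis :: 'a set). (LINT x|lborel. f b x))"
    unfolding lborel_eq[where 'a='a] integral_distr[OF T m] eq
    by (intro product_integral_prod int) auto
qed

lemma borel_measurable_cis [measurable (raw)]:
  assumes "f \<in> borel_measurable M"
  shows "(\<lambda>x. cis (f x)) \<in> borel_measurable M"
proof -
  have "cis \<in> borel_measurable borel" by (intro borel_measurable_continuous_onI continuous_intros)
  from measurable_compose[OF assms this] show ?thesis .
qed

lemma integral_lborel_affine:
  fixes f :: "'a::euclidean_space \<Rightarrow> complex"
  assumes [measurable]: "f \<in> borel_measurable borel" and "c \<noteq> 0"
  shows "(LINT x|lborel. f x) = complex_of_real (\<bar>c\<bar> ^ DIM('a)) * (LINT x|lborel. f (t + c *\<^sub>R x))"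
  by (subst lborel_affine[OF assms(2), of t]) (simp add: integral_density integral_distr scaleR_conv_of_real)

text \<open>The characteristic function of the standard normal distribution, with its density
  written out.\<close>

lemma gaussian_real:
  "integrable lborel (\<lambda>x::real. exp (- x\<^sup>2 / 2))"
  "(LINT x|lborel. cis (t * x) * complex_of_real (exp (- x\<^sup>2 / 2))) = complex_of_real (sqrt (2 * pi) * exp (- t\<^sup>2 / 2))"
proof -
  have "integrable lborel (\<lambda>x. sqrt (2 * pi) * std_normal_density x)" by simp
  then show "integrable lborel (\<lambda>x::real. exp (- x\<^sup>2 / 2))"
    by (simp add: std_normal_density_def)
  have "char std_normal_distribution t = (LINT x|lborel. std_normal_density x *\<^sub>R iexp (t * x))"
    unfolding char_def by (subst integral_density) auto
  also have "\<dots> = (LINT x|lborel. complex_of_real (1 / sqrt (2 * pi)) * (cis (t * x) * complex_of_real (exp (- x\<^sup>2 / 2))))"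
    by (intro Bochner_Integration.integral_cong) (auto simp: std_normal_density_def scaleR_conv_of_real cis_conv_exp)
  also have "\<dots> = complex_of_real (1 / sqrt (2 * pi)) * (LINT x|lborel. cis (t * x) * complex_of_real (exp (- x\<^sup>2 / 2)))"
    by simp
  finally have "complex_of_real (exp (- t\<^sup>2 / 2)) = complex_of_real (1 / sqrt (2 * pi)) * (LINT x|lborel. cis (t * x) * complex_of_real (exp (- x\<^sup>2 / 2)))"
    by (simp add: char_std_normal_distribution)
  then show "(LINT x|lborel. cis (t * x) * complex_of_real (exp (- x\<^sup>2 / 2))) = complex_of_real (sqrt (2 * pi) * exp (- t\<^sup>2 / 2))"
    by (simp add: field_simps)
qed

definition gauss :: "'a::euclidean_space \<Rightarrow> real" where
  "gauss x = exp (- (norm x)\<^sup>2 / 2)"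

lemma gauss_nonneg [simp]: "0 \<le> gauss x" and gauss_le_1: "gauss x \<le> 1" and gauss_0 [simp]: "gauss 0 = 1"
  by (simp_all add: gauss_def)

lemma continuous_on_gauss [continuous_intros]: "continuous_on S f \<Longrightarrow> continuous_on S (\<lambda>x. gauss (f x))"
  unfolding gauss_def by (intro continuous_intros) auto

lemma gauss_measurable [measurable]: "gauss \<in> borel_measurable borel"
  by (intro borel_measurable_continuous_onI continuous_intros)

lemma gauss_prod: "gauss x = (\<Prod>b\<in>Basis. exp (- (x \<bullet> b)\<^sup>2 / 2))"
proof -
  have "- (norm x)\<^sup>2 / 2 = (\<Sum>b\<in>Basis. - (x \<bullet> b)\<^sup>2 / 2)"
    unfolding power2_norm_eq_inner euclidean_inner[of x x]
    by (simp add: power2_eq_square sum_negf sum_divide_distrib)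
  then show ?thesis by (simp only: gauss_def exp_sum[OF finite_Basis])
qed

lemma cis_sum: "finite A \<Longrightarrow> cis (sum f A) = (\<Prod>a\<in>A. cis (f a))"
  by (induction A rule: finite_induct) (simp_all add: cis_mult[symmetric])

lemma gauss_fourier:
  fixes z :: "'a::euclidean_space"
  shows "integrable lborel (gauss :: 'a \<Rightarrow> real)"
    "(LINT x|lborel. cis (x \<bullet> z) * complex_of_real (gauss x)) = complex_of_real (sqrt (2 * pi) ^ DIM('a) * gauss z)"
proof -
  show int: "integrable lborel (gauss :: 'a \<Rightarrow> real)"
    using integral_basis_product(1)[of "\<lambda>_::'a. \<lambda>x. exp (- x\<^sup>2 / 2)", OF gaussian_real(1)]
    by (simp add: gauss_prod[abs_def])
  have "(LINT x|lborel. cis (x \<bullet> z) * complex_of_real (gauss x)) =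
     (LINT x|(lborel :: 'a measure). (\<Prod>b\<in>Basis. cis ((z \<bullet> b) * (x \<bullet> b)) * complex_of_real (exp (- (x \<bullet> b)\<^sup>2 / 2))))"
    by (simp add: gauss_prod euclidean_inner[of _ z] cis_sum prod.distrib mult.commute)
  also have "\<dots> = (\<Prod>b\<in>(Basis::'a set). (LINT x|lborel. cis ((z \<bullet> b) * x) * complex_of_real (exp (- x\<^sup>2 / 2))))"
  proof (rule integral_basis_product(2))
    fix b :: 'a
    show "integrable lborel (\<lambda>x. cis ((z \<bullet> b) * x) * complex_of_real (exp (- x\<^sup>2 / 2)))"
      by (rule Bochner_Integration.integrable_bound[OF gaussian_real(1)]) (auto simp: norm_mult)
  qed
  also have "\<dots> = complex_of_real (sqrt (2 * pi) ^ DIM('a) * gauss z)"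
    by (simp only: gaussian_real(2)) (simp add: gauss_prod prod.distrib)
  finally show "(LINT x|lborel. cis (x \<bullet> z) * complex_of_real (gauss x)) = complex_of_real (sqrt (2 * pi) ^ DIM('a) * gauss z)" .
qed

lemma gauss_integral: "(LINT x|lborel. gauss (x :: 'a::euclidean_space)) = sqrt (2 * pi) ^ DIM('a)"
  using gauss_fourier(2)[of "0::'a"] by (simp flip: of_real_power)

lemma gauss_fourier_scaled:
  fixes z :: "'a::euclidean_space"
  assumes "h > 0"
  shows "integrable lborel (\<lambda>x::'a. gauss (h *\<^sub>R x))"
    "(LINT x|lborel. cis (x \<bullet> z) * complex_of_real (gauss (h *\<^sub>R x))) =
       complex_of_real ((sqrt (2 * pi) / h) ^ DIM('a) * gauss (z /\<^sub>R h))"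
proof -
  have "integrable (density (distr lborel borel (\<lambda>x::'a. 0 + h *\<^sub>R x)) (\<lambda>_. \<bar>h\<bar>^DIM('a))) (gauss :: 'a \<Rightarrow> real)"
    using gauss_fourier(1)[where 'a = 'a] lborel_affine[of h "0::'a"] assms by simp
  then show "integrable lborel (\<lambda>x::'a. gauss (h *\<^sub>R x))"
    using assms by (simp add: integrable_density integrable_distr_eq)
  let ?F = "\<lambda>x. cis (x \<bullet> (z /\<^sub>R h)) * complex_of_real (gauss x)"
  have "(LINT x|lborel. ?F x) = complex_of_real (h ^ DIM('a)) * (LINT x|lborel. cis (x \<bullet> z) * complex_of_real (gauss (h *\<^sub>R x)))"
  proof -
    have cancel: "inverse h * (h * t) = t" for t using assms by simp
    show ?thesis
      by (subst integral_lborel_affine[of ?F h 0]) (use assms in \<open>auto simp: cancel\<close>)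
  qed
  then show "(LINT x|lborel. cis (x \<bullet> z) * complex_of_real (gauss (h *\<^sub>R x))) =
       complex_of_real ((sqrt (2 * pi) / h) ^ DIM('a) * gauss (z /\<^sub>R h))"
    unfolding gauss_fourier(2) using assms by (simp add: power_divide field_simps)
qed

section \<open>Fourier integrals and Gaussian regularisation\<close>

lemma pair_product_integrable:
  fixes f :: "'a::euclidean_space \<Rightarrow> complex" and g :: "'b::euclidean_space \<Rightarrow> complex"
  assumes f: "integrable lborel f" and g: "integrable lborel g"
  shows "integrable (lborel \<Otimes>\<^sub>M lborel) (\<lambda>(x, y). f x * g y)"
proof -
  have [measurable]: "f \<in> borel_measurable borel" "g \<in> borel_measurable borel"
    using f g by (auto dest: borel_measurable_integrable)
  show ?thesis
    by (rule lborel_pair.Fubini_integrable) (use f g in \<open>auto simp: norm_mult\<close>)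
qed

text \<open>The value -1 of \<open>\<sigma>\<close> gives \<open>fourier\<close>, the value 1 gives
  \<open>inv_fourier\<close> without its constant; one set of facts then serves both
  directions.\<close>

definition ftr :: "real \<Rightarrow> (real^'n \<Rightarrow> complex) \<Rightarrow> real^'n \<Rightarrow> complex" where
  "ftr \<sigma> f x = (LINT y|lborel. cis (\<sigma> * (x \<bullet> y)) * f y)"

lemma fourier_ftr: "fourier f = ftr (-1) f"
  by (simp add: fourier_def ftr_def fun_eq_iff inner_commute)

lemma inv_fourier_ftr: "inv_fourier f x = complex_of_real (1 / (2 * pi) ^ CARD('n)) * ftr 1 f (x :: real^'n)"
  by (simp add: inv_fourier_def ftr_def)

lemma cis_mult_integrable:
  assumes "integrable lborel f"
  shows "integrable lborel (\<lambda>y. cis (\<sigma> * (x \<bullet> y)) * f y)"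
  using assms by (intro Bochner_Integration.integrable_bound[OF assms])
    (auto simp: norm_mult dest: borel_measurable_integrable)

lemma ftr_measurable [measurable]:
  assumes [measurable]: "f \<in> borel_measurable borel"
  shows "ftr \<sigma> f \<in> borel_measurable borel"
  unfolding ftr_def[abs_def] by measurable

lemma ftr_bound:
  assumes "integrable lborel f"
  shows "cmod (ftr \<sigma> f x) \<le> (LINT y|lborel. cmod (f y))"
  unfolding ftr_def using integral_norm_bound[of lborel "\<lambda>y. cis (\<sigma> * (x \<bullet> y)) * f y"] by (simp add: norm_mult)

lemma ftr_swap:
  assumes f: "integrable lborel f" and g: "integrable lborel g"
  shows "(LINT x|lborel. ftr \<sigma> f x * g x) = (LINT y|lborel. f y * ftr \<sigma> g y)"
proof -
  have [measurable]: "f \<in> borel_measurable borel" "g \<in> borel_measurable borel"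
    using f g by (auto dest: borel_measurable_integrable)
  have int: "integrable (lborel \<Otimes>\<^sub>M lborel) (\<lambda>(y, x). cis (\<sigma> * (x \<bullet> y)) * f y * g x)"
    by (rule Bochner_Integration.integrable_bound[OF pair_product_integrable[OF f g]]) (auto simp: norm_mult)
  have "(LINT x|lborel. ftr \<sigma> f x * g x) = (LINT x|lborel. (LINT y|lborel. cis (\<sigma> * (x \<bullet> y)) * f y * g x))"
    unfolding ftr_def by simp
  also have "\<dots> = (LINT y|lborel. (LINT x|lborel. cis (\<sigma> * (x \<bullet> y)) * f y * g x))"
    by (rule lborel_pair.Fubini_integral[OF int])
  also have "\<dots> = (LINT y|lborel. (LINT x|lborel. f y * (cis (\<sigma> * (y \<bullet> x)) * g x)))"
    by (simp add: mult_ac inner_commute)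
  also have "\<dots> = (LINT y|lborel. f y * ftr \<sigma> g y)"
    unfolding ftr_def by simp
  finally show ?thesis .
qed

text \<open>The substitution y = \<xi> - h \<zeta> turns the inner integral into an average of
  translates of \<open>g\<close>, which tends to a multiple of \<open>g\<close> as h = 1/(i+1) goes
  to 0. The majorant \<open>D\<close> is left open because two situations are covered: integrable
  \<open>f\<close> with bounded \<open>g\<close>, and square integrable \<open>f\<close> with
  compactly supported \<open>g\<close>.\<close>

lemma gauss_approximate_identity:
  fixes f g :: "real^'n \<Rightarrow> complex"
  assumes [measurable]: "f \<in> borel_measurable borel" and g: "continuous_on UNIV g"
    and D: "integrable (lborel \<Otimes>\<^sub>M lborel) D"
    and le: "\<And>h \<xi> \<zeta>. 0 < h \<Longrightarrow> h \<le> 1 \<Longrightarrow> cmod (f \<xi> * g (\<xi> - h *\<^sub>R \<zeta>)) * gauss \<zeta> \<le> D (\<xi>, \<zeta>)"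
  shows "(\<lambda>i. LINT \<xi>|lborel. f \<xi> * (LINT y|lborel. g y * complex_of_real ((sqrt (2 * pi) / (1 / Suc i)) ^ CARD('n) * gauss ((\<xi> - y) /\<^sub>R (1 / Suc i)))))
     \<longlonglongrightarrow> complex_of_real ((2 * pi) ^ CARD('n)) * (LINT \<xi>|lborel. f \<xi> * g \<xi>)"
proof -
  have [measurable]: "g \<in> borel_measurable borel" using g by (rule borel_measurable_continuous_onI)
  \<comment> \<open>One factor \<open>c\<close> is the prefactor that survives the substitution, the
    other is the mass of the Gaussian; together they give (2 pi)^n.\<close>
  define c where "c = complex_of_real (sqrt (2 * pi) ^ CARD('n))"
  have cc: "c * c = complex_of_real ((2 * pi) ^ CARD('n))"
    unfolding c_def of_real_mult[symmetric] power_mult_distrib[symmetric] by simp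
  let ?s = "\<lambda>h (\<xi>, \<zeta>). f \<xi> * g (\<xi> - h *\<^sub>R \<zeta>) * complex_of_real (gauss \<zeta>)"
  have int_s: "integrable (lborel \<Otimes>\<^sub>M lborel) (?s h)" if "0 < h" "h \<le> 1" for h
  proof (rule Bochner_Integration.integrable_bound[OF D])
    show "AE z in lborel \<Otimes>\<^sub>M lborel. norm (?s h z) \<le> norm (D z)"
    proof (intro AE_I2)
      fix z :: "(real^'n) \<times> (real^'n)"
      have "norm (?s h z) \<le> D z" using le[OF that, of "fst z" "snd z"] by (simp add: norm_mult split_beta)
      also have "\<dots> \<le> norm (D z)" by simp
      finally show "norm (?s h z) \<le> norm (D z)" .
    qed
  qed measurable
  have lim0: "(\<lambda>i. ?s (1 / Suc i) z) \<longlonglongrightarrow> ?s 0 z" for z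
  proof -
    obtain \<xi> \<zeta> where z: "z = (\<xi>, \<zeta>)" by (cases z)
    have "isCont g (\<xi> - 0 *\<^sub>R \<zeta>)" using g by (simp add: continuous_on_eq_continuous_at)
    moreover have "(\<lambda>i. \<xi> - (1 / real (Suc i)) *\<^sub>R \<zeta>) \<longlonglongrightarrow> \<xi> - 0 *\<^sub>R \<zeta>"
      using LIMSEQ_inverse_real_of_nat by (intro tendsto_intros) (simp add: inverse_eq_divide)
    ultimately have "(\<lambda>i. g (\<xi> - (1 / real (Suc i)) *\<^sub>R \<zeta>)) \<longlonglongrightarrow> g (\<xi> - 0 *\<^sub>R \<zeta>)"
      by (rule isCont_tendsto_compose)
    then show ?thesis unfolding z by (auto intro!: tendsto_intros)
  qed
  have DCT: "integrable (lborel \<Otimes>\<^sub>M lborel) (?s 0)"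
    "(\<lambda>i. integral\<^sup>L (lborel \<Otimes>\<^sub>M lborel) (?s (1 / Suc i))) \<longlonglongrightarrow> integral\<^sup>L (lborel \<Otimes>\<^sub>M lborel) (?s 0)"
  proof -
    have bound: "AE z in lborel \<Otimes>\<^sub>M lborel. norm (?s (1 / Suc i) z) \<le> D z" for i
      using le[of "1 / Suc i"] by (intro AE_I2) (auto simp: norm_mult)
    show "integrable (lborel \<Otimes>\<^sub>M lborel) (?s 0)"
      by (rule integrable_dominated_convergence[where s = "\<lambda>i. ?s (1 / Suc i)" and w = D])
        (use D lim0 bound in auto)
    show "(\<lambda>i. integral\<^sup>L (lborel \<Otimes>\<^sub>M lborel) (?s (1 / Suc i))) \<longlonglongrightarrow> integral\<^sup>L (lborel \<Otimes>\<^sub>M lborel) (?s 0)"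
      by (rule integral_dominated_convergence[where w = D]) (use D lim0 bound in auto)
  qed
  have 0: "integral\<^sup>L (lborel \<Otimes>\<^sub>M lborel) (?s 0) = c * (LINT \<xi>|lborel. f \<xi> * g \<xi>)"
  proof -
    have "integral\<^sup>L (lborel \<Otimes>\<^sub>M lborel) (?s 0) = (LINT \<xi>|lborel. (LINT \<zeta>|lborel. f \<xi> * g \<xi> * complex_of_real (gauss (\<zeta> :: real^'n))))"
      using lborel_pair.integral_fst'[OF DCT(1)] by simp
    also have "\<dots> = (LINT \<xi>|lborel. f \<xi> * g \<xi> * c)"
      using gauss_integral[where 'a = "real^'n"] by (simp add: c_def)
    finally show ?thesis by (simp add: mult.commute)
  qed
  have i: "(LINT \<xi>|lborel. f \<xi> * (LINT y|lborel. g y * complex_of_real ((sqrt (2 * pi) / h) ^ CARD('n) * gauss ((\<xi> - y) /\<^sub>R h))))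
     = c * integral\<^sup>L (lborel \<Otimes>\<^sub>M lborel) (?s h)" if h: "0 < h" "h \<le> 1" for h
  proof -
    have "(LINT y|lborel. g y * complex_of_real ((sqrt (2 * pi) / h) ^ CARD('n) * gauss ((\<xi> - y) /\<^sub>R h)))
       = c * (LINT \<zeta>|lborel. g (\<xi> - h *\<^sub>R \<zeta>) * complex_of_real (gauss \<zeta>))" for \<xi>
    proof -
      have "(LINT y|lborel. g y * complex_of_real ((sqrt (2 * pi) / h) ^ CARD('n) * gauss ((\<xi> - y) /\<^sub>R h)))
        = complex_of_real (h ^ CARD('n)) * (LINT \<zeta>|lborel. g (\<xi> + (- h) *\<^sub>R \<zeta>) * complex_of_real ((sqrt (2 * pi) / h) ^ CARD('n) * gauss ((\<xi> - (\<xi> + (- h) *\<^sub>R \<zeta>)) /\<^sub>R h)))"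
        using h by (subst integral_lborel_affine[where c = "- h" and t = \<xi>]) auto
      also have "\<dots> = complex_of_real (h ^ CARD('n)) * (LINT \<zeta>|lborel. (c / complex_of_real (h ^ CARD('n))) * (g (\<xi> - h *\<^sub>R \<zeta>) * complex_of_real (gauss \<zeta>)))"
        using h by (simp add: c_def power_divide mult_ac)
      also have "\<dots> = c * (LINT \<zeta>|lborel. g (\<xi> - h *\<^sub>R \<zeta>) * complex_of_real (gauss \<zeta>))"
        using h by simp
      finally show ?thesis .
    qed
    then have "(LINT \<xi>|lborel. f \<xi> * (LINT y|lborel. g y * complex_of_real ((sqrt (2 * pi) / h) ^ CARD('n) * gauss ((\<xi> - y) /\<^sub>R h))))
      = (LINT \<xi>|lborel. c * (LINT \<zeta>|lborel. ?s h (\<xi>, \<zeta>)))"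
      by (simp add: mult_ac)
    also have "\<dots> = c * integral\<^sup>L (lborel \<Otimes>\<^sub>M lborel) (?s h)"
      using lborel_pair.integral_fst'[OF int_s[OF h]] by simp
    finally show ?thesis .
  qed
  have ii: "(LINT \<xi>|lborel. f \<xi> * (LINT y|lborel. g y * complex_of_real ((sqrt (2 * pi) / (1 / Suc k)) ^ CARD('n) * gauss ((\<xi> - y) /\<^sub>R (1 / Suc k)))))
     = c * integral\<^sup>L (lborel \<Otimes>\<^sub>M lborel) (?s (1 / Suc k))" for k
    by (rule i) auto
  show ?thesis
    unfolding ii cc[symmetric] mult.assoc[of c c] 0[symmetric] using DCT(2) by (intro tendsto_mult tendsto_const)
qed

section \<open>Parseval and Plancherel identities\<close>

text \<open>A class containing both \<open>Cc\<close> and the Schwartz functions, so that Parseval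
  can pair one with the other.\<close>

definition bci :: "(real^'n \<Rightarrow> complex) set" where
  "bci = {f. continuous_on UNIV f \<and> bounded (range f) \<and> integrable lborel f}"

lemma isCont_gauss: "isCont gauss (x :: 'a::euclidean_space)"
proof -
  have "continuous_on UNIV (gauss :: 'a \<Rightarrow> real)" by (intro continuous_intros)
  then show ?thesis by (simp add: continuous_on_eq_continuous_at)
qed

lemma bciD:
  assumes "f \<in> bci"
  shows "continuous_on UNIV f" "integrable lborel f" "f \<in> borel_measurable borel"
  using assms by (auto simp: bci_def intro: borel_measurable_continuous_onI)

lemma bci_bound:
  assumes "f \<in> bci"
  obtains C where "C > 0" "\<And>x. cmod (f x) \<le> C"
  using assms unfolding bci_def bounded_pos by auto

lemma bci_L2:
  assumes "f \<in> bci"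
  shows "f \<in> L2"
proof -
  obtain C where C: "C > 0" "\<And>x. cmod (f x) \<le> C" using bci_bound[OF assms] by blast
  have "integrable lborel (\<lambda>x. (cmod (f x))\<^sup>2)"
  proof (rule Bochner_Integration.integrable_bound)
    show "integrable lborel (\<lambda>x. C * cmod (f x))" using bciD(2)[OF assms] by simp
    show "AE x in lborel. norm ((cmod (f x))\<^sup>2) \<le> norm (C * cmod (f x))"
      using C by (intro AE_I2) (simp add: power2_eq_square abs_mult mult_right_mono)
  qed (use bciD(3)[OF assms] in auto)
  then show ?thesis using bciD(3)[OF assms] by (simp add: L2_def)
qed

lemma Cc_bci:
  assumes "f \<in> Cc"
  shows "f \<in> bci"
proof -
  obtain C where "\<And>x. cmod (f x) \<le> C" using Cc_bounded[OF assms] by blast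
  then show ?thesis
    using Cc_continuous[OF assms] Cc_integrable[OF assms] by (auto simp: bci_def bounded_iff)
qed

lemma bci_cnj: "f \<in> bci \<Longrightarrow> (\<lambda>x. cnj (f x)) \<in> bci"
  unfolding bci_def bounded_iff by (auto intro: continuous_intros)

lemma ftr_cnj: "ftr \<sigma> (\<lambda>x. cnj (f x)) x = cnj (ftr (- \<sigma>) f x)"
  unfolding ftr_def Bochner_Integration.integral_cnj[symmetric] by (simp only: complex_cnj_mult cis_cnj mult_minus_left minus_minus)

text \<open>The Gaussian makes the product of the transforms integrable before anything is known
  about their square integrability. Two applications of \<open>ftr_swap\<close> move the transforms
  onto the Gaussian and produce a kernel in \<xi> - y that concentrates on the diagonal.\<close>

lemma parseval_gauss:
  fixes f g :: "real^'n \<Rightarrow> complex"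
  assumes f: "f \<in> bci" and g: "g \<in> bci"
  shows "(\<lambda>i. LINT x|lborel. ftr 1 f x * (ftr (-1) g x * complex_of_real (gauss ((1 / Suc i) *\<^sub>R x))))
     \<longlonglongrightarrow> complex_of_real ((2 * pi) ^ CARD('n)) * (LINT x|lborel. f x * g x)"
proof -
  note [measurable] = bciD(3)[OF f] bciD(3)[OF g]
  obtain C where C: "C > 0" "\<And>x. cmod (g x) \<le> C" using bci_bound[OF g] by blast
  have "(LINT x|lborel. ftr 1 f x * (ftr (-1) g x * complex_of_real (gauss (h *\<^sub>R x)))) =
     (LINT \<xi>|lborel. f \<xi> * (LINT y|lborel. g y * complex_of_real ((sqrt (2 * pi) / h) ^ CARD('n) * gauss ((\<xi> - y) /\<^sub>R h))))"
    if h: "h > 0" for h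
  proof -
    have gi: "integrable lborel (\<lambda>x::real^'n. complex_of_real (gauss (h *\<^sub>R x)))"
      using gauss_fourier_scaled(1)[OF h, where 'a = "real^'n"] by simp
    have "integrable lborel (\<lambda>x. ftr (-1) g x * complex_of_real (gauss (h *\<^sub>R x)))"
    proof (rule Bochner_Integration.integrable_bound)
      show "integrable lborel (\<lambda>x. complex_of_real (LINT y|lborel. cmod (g y)) * complex_of_real (gauss (h *\<^sub>R (x :: real^'n))))"
        using gi by (rule integrable_mult_right)
      show "AE x in lborel. norm (ftr (-1) g x * complex_of_real (gauss (h *\<^sub>R x))) \<le>
          norm (complex_of_real (LINT y|lborel. cmod (g y)) * complex_of_real (gauss (h *\<^sub>R x)))"
        using ftr_bound[OF bciD(2)[OF g]] by (intro AE_I2) (auto simp: norm_mult intro!: mult_right_mono)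
    qed measurable
    then have outer: "(LINT x|lborel. ftr 1 f x * (ftr (-1) g x * complex_of_real (gauss (h *\<^sub>R x)))) =
      (LINT \<xi>|lborel. f \<xi> * ftr 1 (\<lambda>x. ftr (-1) g x * complex_of_real (gauss (h *\<^sub>R x))) \<xi>)"
      by (rule ftr_swap[OF bciD(2)[OF f]])
    have inner: "ftr 1 (\<lambda>x. ftr (-1) g x * complex_of_real (gauss (h *\<^sub>R x))) \<xi> =
      (LINT y|lborel. g y * complex_of_real ((sqrt (2 * pi) / h) ^ CARD('n) * gauss ((\<xi> - y) /\<^sub>R h)))" for \<xi>
    proof -
      have gi': "integrable lborel (\<lambda>x. cis (x \<bullet> \<xi>) * complex_of_real (gauss (h *\<^sub>R x)))"
        using cis_mult_integrable[OF gi, of 1 \<xi>] by (simp add: inner_commute)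
      have kernel: "ftr (-1) (\<lambda>x. cis (x \<bullet> \<xi>) * complex_of_real (gauss (h *\<^sub>R x))) y =
          complex_of_real ((sqrt (2 * pi) / h) ^ CARD('n) * gauss ((\<xi> - y) /\<^sub>R h))" for y
      proof -
        have "ftr (-1) (\<lambda>x. cis (x \<bullet> \<xi>) * complex_of_real (gauss (h *\<^sub>R x))) y =
           (LINT x|lborel. cis (x \<bullet> (\<xi> - y)) * complex_of_real (gauss (h *\<^sub>R x)))"
          unfolding ftr_def by (simp add: mult.assoc[symmetric] cis_mult inner_diff_right inner_commute)
        then show ?thesis using gauss_fourier_scaled(2)[OF h, of "\<xi> - y"] by simp
      qed
      have "ftr 1 (\<lambda>x. ftr (-1) g x * complex_of_real (gauss (h *\<^sub>R x))) \<xi> =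
        (LINT x|lborel. ftr (-1) g x * (cis (x \<bullet> \<xi>) * complex_of_real (gauss (h *\<^sub>R x))))"
        by (simp add: ftr_def[of 1] inner_commute mult_ac)
      also have "\<dots> = (LINT y|lborel. g y * ftr (-1) (\<lambda>x. cis (x \<bullet> \<xi>) * complex_of_real (gauss (h *\<^sub>R x))) y)"
        by (rule ftr_swap[OF bciD(2)[OF g] gi'])
      finally show ?thesis by (simp only: kernel)
    qed
    show ?thesis unfolding outer by (simp only: inner)
  qed
  from this[of "1 / Suc i" for i]
  have eq: "(LINT x|lborel. ftr 1 f x * (ftr (-1) g x * complex_of_real (gauss ((1 / Suc i) *\<^sub>R x)))) =
     (LINT \<xi>|lborel. f \<xi> * (LINT y|lborel. g y * complex_of_real ((sqrt (2 * pi) / (1 / Suc i)) ^ CARD('n) * gauss ((\<xi> - y) /\<^sub>R (1 / Suc i)))))" for i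
    by simp
  show ?thesis unfolding eq
  proof (rule gauss_approximate_identity)
    have "integrable (lborel \<Otimes>\<^sub>M lborel) (\<lambda>(x, y). f x * (complex_of_real C * complex_of_real (gauss (y :: real^'n))))"
      using gauss_fourier(1)[where 'a = "real^'n"] by (intro pair_product_integrable bciD(2)[OF f]) simp
    from integrable_norm[OF this]
    show "integrable (lborel \<Otimes>\<^sub>M lborel) (\<lambda>z. cmod (f (fst z)) * (C * gauss (snd z :: real^'n)))"
      using C(1) by (simp add: norm_mult split_beta)
    show "cmod (f \<xi> * g (\<xi> - h *\<^sub>R \<zeta>)) * gauss \<zeta> \<le> cmod (f (fst (\<xi>, \<zeta>))) * (C * gauss (snd (\<xi>, \<zeta>)))" for h \<xi> \<zeta>
      using C(2)[of "\<xi> - h *\<^sub>R \<zeta>"] by (simp add: norm_mult mult.assoc mult_left_mono mult_right_mono)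
  qed (use bciD[OF f] bciD[OF g] in auto)
qed

text \<open>With the conjugate of \<open>f\<close> as second function, the regularised integrals
  have non-negative integrands and a finite limit; Fatou removes the Gaussian.\<close>

lemma ftr_1_L2:
  fixes f :: "real^'n \<Rightarrow> complex"
  assumes f: "f \<in> bci"
  shows "ftr 1 f \<in> L2"
proof -
  note [measurable] = bciD(3)[OF f]
  let ?h = "\<lambda>i. 1 / real (Suc i)"
  let ?I = "\<lambda>i. LINT x|lborel. (cmod (ftr 1 f x))\<^sup>2 * gauss (?h i *\<^sub>R x)"
  define N where "N = (2 * pi) ^ CARD('n) * (LINT x|lborel. (cmod (f x))\<^sup>2)"
  have N: "N \<ge> 0" by (simp add: N_def)
  have sq: "z * cnj z = complex_of_real ((cmod z)\<^sup>2)" for z by (rule complex_norm_square[symmetric])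
  have "(\<lambda>i. complex_of_real (?I i)) \<longlonglongrightarrow> complex_of_real N"
  proof -
    have "ftr 1 f x * (ftr (-1) (\<lambda>x. cnj (f x)) x * complex_of_real (gauss (?h i *\<^sub>R x))) =
        complex_of_real ((cmod (ftr 1 f x))\<^sup>2 * gauss (?h i *\<^sub>R x))" for i x
      by (simp only: ftr_cnj minus_minus mult.assoc[symmetric] sq of_real_mult)
    with parseval_gauss[OF f bci_cnj[OF f]] show ?thesis
      by (simp only: sq integral_complex_of_real of_real_mult[symmetric] N_def)
  qed
  then have lim: "?I \<longlonglongrightarrow> N" by (simp only: tendsto_of_real_iff)
  have int: "integrable lborel (\<lambda>x. (cmod (ftr 1 f x))\<^sup>2 * gauss (h *\<^sub>R x))" if "h > 0" for h
  proof (rule Bochner_Integration.integrable_bound)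
    show "integrable lborel (\<lambda>x::real^'n. (LINT y|lborel. cmod (f y))\<^sup>2 * gauss (h *\<^sub>R x))"
      by (intro integrable_mult_right gauss_fourier_scaled(1) that)
    show "AE x in lborel. norm ((cmod (ftr 1 f x))\<^sup>2 * gauss (h *\<^sub>R x)) \<le> norm ((LINT y|lborel. cmod (f y))\<^sup>2 * gauss (h *\<^sub>R x))"
      using ftr_bound[OF bciD(2)[OF f]] by (intro AE_I2) (auto simp: abs_mult intro!: mult_right_mono power_mono)
  qed measurable
  have "(\<integral>\<^sup>+x. ennreal ((cmod (ftr 1 f x))\<^sup>2) \<partial>lborel) = (\<integral>\<^sup>+x. liminf (\<lambda>i. ennreal ((cmod (ftr 1 f x))\<^sup>2 * gauss (?h i *\<^sub>R x))) \<partial>lborel)"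
  proof (intro nn_integral_cong)
    fix x :: "real^'n"
    have "isCont gauss (0 *\<^sub>R x)"
      by (rule isCont_gauss)
    moreover have "(\<lambda>i. ?h i *\<^sub>R x) \<longlonglongrightarrow> 0 *\<^sub>R x"
      using LIMSEQ_inverse_real_of_nat by (intro tendsto_intros) (simp add: inverse_eq_divide)
    ultimately have "(\<lambda>i. gauss (?h i *\<^sub>R x)) \<longlonglongrightarrow> gauss (0 *\<^sub>R x)" by (rule isCont_tendsto_compose)
    then have "(\<lambda>i. ennreal ((cmod (ftr 1 f x))\<^sup>2 * gauss (?h i *\<^sub>R x))) \<longlonglongrightarrow> ennreal ((cmod (ftr 1 f x))\<^sup>2 * gauss (0 *\<^sub>R x))"
      by (intro tendsto_ennrealI tendsto_intros)
    from lim_imp_Liminf[OF sequentially_bot this]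
    show "ennreal ((cmod (ftr 1 f x))\<^sup>2) = liminf (\<lambda>i. ennreal ((cmod (ftr 1 f x))\<^sup>2 * gauss (?h i *\<^sub>R x)))" by simp
  qed
  also have "\<dots> \<le> liminf (\<lambda>i. \<integral>\<^sup>+x. ennreal ((cmod (ftr 1 f x))\<^sup>2 * gauss (?h i *\<^sub>R x)) \<partial>lborel)"
    by (rule nn_integral_liminf) simp
  also have "\<dots> = liminf (\<lambda>i. ennreal (?I i))"
  proof -
    have "(\<integral>\<^sup>+x. ennreal ((cmod (ftr 1 f x))\<^sup>2 * gauss (?h i *\<^sub>R x)) \<partial>lborel) = ennreal (?I i)" for i
      by (rule nn_integral_eq_integral[OF int]) auto
    then show ?thesis by simp
  qed
  also have "\<dots> = ennreal N"
    using lim by (intro lim_imp_Liminf tendsto_ennrealI) auto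
  also have "\<dots> = ennreal ((sqrt N)\<^sup>2)" using N by simp
  finally show ?thesis by (intro L2I_nn_integral[where C = "sqrt N"]) (use N in auto)
qed

lemma ftr_minus_1_L2:
  assumes "f \<in> bci"
  shows "ftr (-1) f \<in> L2"
  using L2_cnj[OF ftr_1_L2[OF bci_cnj[OF assms]]] by (simp add: ftr_cnj)

lemma parseval:
  fixes f g :: "real^'n \<Rightarrow> complex"
  assumes f: "f \<in> bci" and g: "g \<in> bci"
  shows "(LINT x|lborel. ftr 1 f x * ftr (-1) g x) = complex_of_real ((2 * pi) ^ CARD('n)) * (LINT x|lborel. f x * g x)"
proof (rule LIMSEQ_unique[OF _ parseval_gauss[OF f g]])
  note [measurable] = bciD(3)[OF f] bciD(3)[OF g]
  have int: "integrable lborel (\<lambda>x. ftr 1 f x * ftr (-1) g x)"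
    by (rule L2_mult_integrable[OF ftr_1_L2[OF f] ftr_minus_1_L2[OF g]])
  show "(\<lambda>i. LINT x|lborel. ftr 1 f x * (ftr (-1) g x * complex_of_real (gauss ((1 / Suc i) *\<^sub>R x))))
    \<longlonglongrightarrow> (LINT x|lborel. ftr 1 f x * ftr (-1) g x)"
  proof (rule integral_dominated_convergence[where w = "\<lambda>x. norm (ftr 1 f x * ftr (-1) g x)"])
    show "integrable lborel (\<lambda>x. norm (ftr 1 f x * ftr (-1) g x))" using int by (rule integrable_norm)
    show "AE x in lborel. (\<lambda>i. ftr 1 f x * (ftr (-1) g x * complex_of_real (gauss ((1 / Suc i) *\<^sub>R x)))) \<longlonglongrightarrow> ftr 1 f x * ftr (-1) g x"
    proof (intro AE_I2)
      fix x :: "real^'n"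
      have "isCont gauss (0 *\<^sub>R x)"
        by (rule isCont_gauss)
      moreover have "(\<lambda>i. (1 / real (Suc i)) *\<^sub>R x) \<longlonglongrightarrow> 0 *\<^sub>R x"
        using LIMSEQ_inverse_real_of_nat by (intro tendsto_intros) (simp add: inverse_eq_divide)
      ultimately have "(\<lambda>i. gauss ((1 / real (Suc i)) *\<^sub>R x)) \<longlonglongrightarrow> gauss (0 *\<^sub>R x)" by (rule isCont_tendsto_compose)
      then have "(\<lambda>i. ftr 1 f x * (ftr (-1) g x * complex_of_real (gauss ((1 / Suc i) *\<^sub>R x)))) \<longlonglongrightarrow>
          ftr 1 f x * (ftr (-1) g x * complex_of_real (gauss (0 *\<^sub>R x)))"
        by (intro tendsto_intros)
      then show "(\<lambda>i. ftr 1 f x * (ftr (-1) g x * complex_of_real (gauss ((1 / Suc i) *\<^sub>R x)))) \<longlonglongrightarrow> ftr 1 f x * ftr (-1) g x"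
        by simp
    qed
    show "AE x in lborel. norm (ftr 1 f x * (ftr (-1) g x * complex_of_real (gauss ((1 / Suc i) *\<^sub>R x)))) \<le> norm (ftr 1 f x * ftr (-1) g x)" for i
      using gauss_le_1 by (intro AE_I2) (auto simp: norm_mult intro!: mult_left_mono mult_left_le)
  qed measurable
qed

lemma plancherel_ftr:
  fixes f :: "real^'n \<Rightarrow> complex"
  assumes f: "f \<in> bci"
  shows "(L2norm (ftr 1 f))\<^sup>2 = (2 * pi) ^ CARD('n) * (L2norm f)\<^sup>2"
    "(L2norm (ftr (-1) f))\<^sup>2 = (2 * pi) ^ CARD('n) * (L2norm f)\<^sup>2"
proof -
  have sq: "z * cnj z = complex_of_real ((cmod z)\<^sup>2)" for z by (rule complex_norm_square[symmetric])
  have 1: "(L2norm (ftr 1 f))\<^sup>2 = (2 * pi) ^ CARD('n) * (L2norm f)\<^sup>2" if f: "f \<in> bci" for f :: "real^'n \<Rightarrow> complex"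
  proof -
    have "complex_of_real ((L2norm (ftr 1 f))\<^sup>2) = complex_of_real ((2 * pi) ^ CARD('n) * (L2norm f)\<^sup>2)"
      using parseval[OF f bci_cnj[OF f]]
      by (simp only: ftr_cnj minus_minus sq integral_complex_of_real of_real_mult[symmetric] L2norm_square)
    then show ?thesis by (simp only: of_real_eq_iff)
  qed
  show "(L2norm (ftr 1 f))\<^sup>2 = (2 * pi) ^ CARD('n) * (L2norm f)\<^sup>2" by (rule 1[OF f])
  have "L2norm (ftr (-1) f) = L2norm (ftr 1 (\<lambda>x. cnj (f x)))"
    by (simp add: L2norm_def ftr_cnj)
  then show "(L2norm (ftr (-1) f))\<^sup>2 = (2 * pi) ^ CARD('n) * (L2norm f)\<^sup>2"
    using 1[OF bci_cnj[OF f]] by (simp add: L2norm_def)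
qed

lemma bci_inv_fourier_L2:
  assumes "f \<in> bci"
  shows "inv_fourier f \<in> L2"
  unfolding inv_fourier_ftr[abs_def] by (rule L2_scale[OF ftr_1_L2[OF assms]])

lemma plancherel_inv_fourier:
  fixes f :: "real^'n \<Rightarrow> complex"
  assumes f: "f \<in> bci"
  shows "L2norm (inv_fourier f) = L2norm f / sqrt ((2 * pi) ^ CARD('n))"
proof -
  define a where "a = (2 * pi) ^ CARD('n)"
  have a: "a > 0" by (simp add: a_def)
  have "sqrt ((L2norm (ftr 1 f))\<^sup>2) = sqrt a * sqrt ((L2norm f)\<^sup>2)"
    unfolding plancherel_ftr(1)[OF f] a_def by (rule real_sqrt_mult)
  then have "L2norm (ftr 1 f) = sqrt a * L2norm f" by simp
  moreover have "L2norm (inv_fourier f) = L2norm (ftr 1 f) / a"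
    unfolding inv_fourier_ftr[abs_def] L2norm_scale a_def[symmetric] using a by (simp add: norm_divide)
  moreover have "sqrt a * L2norm f / a = L2norm f / sqrt a"
    using a real_sqrt_mult_self[of a] by (simp add: field_simps)
  ultimately show ?thesis by (simp add: a_def)
qed

lemma L2norm_diff_square:
  assumes f: "f \<in> L2" and g: "g \<in> L2"
  shows "(L2norm (\<lambda>x. f x - g x))\<^sup>2 = (L2norm f)\<^sup>2 + (L2norm g)\<^sup>2 - 2 * Re (LINT x|lborel. f x * cnj (g x))"
proof -
  have int: "integrable lborel (\<lambda>x. f x * cnj (g x))" by (rule L2_mult_integrable[OF f L2_cnj[OF g]])
  have "(cmod (f x - g x))\<^sup>2 = (cmod (f x))\<^sup>2 + (cmod (g x))\<^sup>2 - 2 * Re (f x * cnj (g x))" for x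
    by (simp add: cmod_power2 power2_diff)
  then have "(LINT x|lborel. (cmod (f x - g x))\<^sup>2) =
      (LINT x|lborel. (cmod (f x))\<^sup>2 + (cmod (g x))\<^sup>2 - 2 * Re (f x * cnj (g x)))"
    by (simp only:)
  also have "\<dots> = (LINT x|lborel. (cmod (f x))\<^sup>2) + (LINT x|lborel. (cmod (g x))\<^sup>2) - 2 * (LINT x|lborel. Re (f x * cnj (g x)))"
    using int L2_integrable_square[OF f] L2_integrable_square[OF g]
    by (simp del: times_complex.sel)
  finally show ?thesis using int by (simp only: L2norm_square integral_Re)
qed

text \<open>The transform of \<open>w\<close> is not known to be integrable, so Fourier inversion
  for \<open>w\<close> is not at hand. Instead the squared distance from \<open>w\<close> to
  \<open>inv_fourier v\<close> is expanded; by Plancherel and \<open>ftr_swap\<close> it equals c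
  \<le> 1 times the squared distance from the transform of \<open>w\<close> to \<open>v\<close>, and
  the latter can be made small.\<close>

lemma inv_fourier_C1c_dense:
  fixes u :: "real^'n \<Rightarrow> complex"
  assumes u: "u \<in> L2" and e: "e > 0"
  obtains v where "v \<in> C1c" "L2norm (\<lambda>x. u x - inv_fourier v x) < e"
proof -
  obtain w where w: "w \<in> C1c" "L2norm (\<lambda>x. u x - w x) < e / 2" using C1c_dense[OF u, of "e / 2"] e by auto
  have wb: "w \<in> bci" using w(1) by (intro Cc_bci C1c_imp_Cc)
  obtain v where v: "v \<in> C1c" "L2norm (\<lambda>x. ftr (-1) w x - v x) < e / 2"
    using C1c_dense[OF ftr_minus_1_L2[OF wb], of "e / 2"] e by auto
  have vb: "v \<in> bci" using v(1) by (intro Cc_bci C1c_imp_Cc)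
  define c where "c = 1 / (2 * pi) ^ CARD('n)"
  have "1 \<le> (2 * pi) ^ CARD('n)" using pi_gt3 by (intro one_le_power) simp
  then have c: "0 < c" "c \<le> 1" unfolding c_def by (auto simp: divide_le_eq simp del: power_mult_distrib)
  have "(LINT x|lborel. w x * cnj (inv_fourier v x)) = complex_of_real c * (LINT x|lborel. w x * ftr (-1) (\<lambda>x. cnj (v x)) x)"
    by (simp add: inv_fourier_ftr c_def ftr_cnj mult_ac)
  also have "(LINT x|lborel. w x * ftr (-1) (\<lambda>x. cnj (v x)) x) = (LINT x|lborel. ftr (-1) w x * cnj (v x))"
    using ftr_swap[OF bciD(2)[OF wb] bciD(2)[OF bci_cnj[OF vb]]] by simp
  finally have cross: "(LINT x|lborel. w x * cnj (inv_fourier v x)) = complex_of_real c * (LINT x|lborel. ftr (-1) w x * cnj (v x))" .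
  have "(L2norm (inv_fourier v))\<^sup>2 = c * (L2norm v)\<^sup>2"
    unfolding plancherel_inv_fourier[OF vb] by (simp add: c_def power_divide)
  moreover have "(L2norm w)\<^sup>2 = c * (L2norm (ftr (-1) w))\<^sup>2"
    unfolding plancherel_ftr(2)[OF wb] by (simp add: c_def)
  ultimately have "(L2norm (\<lambda>x. w x - inv_fourier v x))\<^sup>2 = c * (L2norm (\<lambda>x. ftr (-1) w x - v x))\<^sup>2"
    unfolding L2norm_diff_square[OF bci_L2[OF wb] bci_inv_fourier_L2[OF vb]]
      L2norm_diff_square[OF ftr_minus_1_L2[OF wb] bci_L2[OF vb]] cross
    by (simp add: algebra_simps)
  also have "\<dots> \<le> (L2norm (\<lambda>x. ftr (-1) w x - v x))\<^sup>2" using c by (intro mult_left_le_one_le) auto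
  finally have "L2norm (\<lambda>x. w x - inv_fourier v x) \<le> L2norm (\<lambda>x. ftr (-1) w x - v x)"
    by (rule power2_le_imp_le) simp
  then have "L2norm (\<lambda>x. u x - inv_fourier v x) < e"
    using L2norm_triangle_diff[OF u bci_L2[OF wb] bci_inv_fourier_L2[OF vb]] w(2) v(2) by linarith
  with v(1) that show ?thesis by blast
qed

section \<open>Integration along linear flows\<close>

lemma vector_derivative_lipschitz:
  fixes f :: "real \<Rightarrow> 'b::real_normed_vector"
  assumes "convex S" "\<And>s. s \<in> S \<Longrightarrow> (f has_vector_derivative f' s) (at s within S)"
    "\<And>s. s \<in> S \<Longrightarrow> norm (f' s) \<le> B" "s \<in> S" "t \<in> S"
  shows "norm (f s - f t) \<le> B * \<bar>s - t\<bar>"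
proof -
  have "norm (f s - f t) \<le> B * norm (s - t)"
  proof (rule differentiable_bound[OF assms(1) _ _ assms(4,5)])
    show "(f has_derivative (\<lambda>h. h *\<^sub>R f' x)) (at x within S)" if "x \<in> S" for x
      using assms(2)[OF that] by (simp add: has_vector_derivative_def)
    show "onorm (\<lambda>h. h *\<^sub>R f' x) \<le> B" if "x \<in> S" for x
    proof (rule onorm_le)
      fix h :: real
      have "norm (h *\<^sub>R f' x) = norm (f' x) * norm h" by simp
      also have "\<dots> \<le> B * norm h" by (intro mult_right_mono assms(3) that) simp
      finally show "norm (h *\<^sub>R f' x) \<le> B * norm h" .
    qed
  qed
  then show ?thesis by simp
qed

text \<open>The mean value inequality bounds the error of every difference quotient by 2 g, so
  dominated convergence applies along each sequence tending to \<open>s\<close> in \<open>S\<close>.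
  Derivatives are taken within \<open>S\<close> so that end points of intervals are
  included.\<close>

lemma leibniz_lebesgue:
  fixes f :: "real \<Rightarrow> 'a \<Rightarrow> 'b::{banach, second_countable_topology}"
  assumes S: "convex S" "s \<in> S" and int: "\<And>s. s \<in> S \<Longrightarrow> integrable M (f s)"
    and deriv: "\<And>x s. s \<in> S \<Longrightarrow> ((\<lambda>s. f s x) has_vector_derivative f' s x) (at s within S)"
    and bound: "\<And>x s. s \<in> S \<Longrightarrow> norm (f' s x) \<le> g x" and g: "integrable M g"
    and meas: "f' s \<in> borel_measurable M"
  shows "((\<lambda>s. integral\<^sup>L M (f s)) has_vector_derivative integral\<^sup>L M (f' s)) (at s within S)"
proof -
  have int': "integrable M (f' s)"
  proof (rule Bochner_Integration.integrable_bound[OF g meas], intro AE_I2)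
    fix x
    have "norm (f' s x) \<le> g x" by (rule bound[OF S(2)])
    also have "\<dots> \<le> norm (g x)" by simp
    finally show "norm (f' s x) \<le> norm (g x)" .
  qed
  have "((\<lambda>t. (1 / norm (t - s)) *\<^sub>R (integral\<^sup>L M (f t) - (integral\<^sup>L M (f s) + (t - s) *\<^sub>R integral\<^sup>L M (f' s)))) \<longlongrightarrow> 0) (at s within S)"
    unfolding tendsto_at_iff_sequentially
  proof (intro allI impI)
    fix X :: "nat \<Rightarrow> real" assume X: "\<forall>i. X i \<in> S - {s}" "X \<longlonglongrightarrow> s"
    define q where "q = (\<lambda>i x. (1 / norm (X i - s)) *\<^sub>R (f (X i) x - (f s x + (X i - s) *\<^sub>R f' s x)))"
    have "(\<lambda>i. integral\<^sup>L M (q i)) \<longlonglongrightarrow> integral\<^sup>L M (\<lambda>x. 0)"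
    proof (rule integral_dominated_convergence[where w = "\<lambda>x. 2 * g x"])
      show "integrable M (\<lambda>x. 2 * g x)" using g by simp
      show "AE x in M. (\<lambda>i. q i x) \<longlonglongrightarrow> 0"
      proof (intro AE_I2)
        fix x
        have "((\<lambda>t. (1 / norm (t - s)) *\<^sub>R (f t x - (f s x + (t - s) *\<^sub>R f' s x))) \<longlongrightarrow> 0) (at s within S)"
          using deriv[OF S(2), of x] unfolding has_vector_derivative_def has_derivative_within by blast
        then show "(\<lambda>i. q i x) \<longlonglongrightarrow> 0"
          unfolding tendsto_at_iff_sequentially q_def using X by (auto simp: o_def)
      qed
      show "AE x in M. norm (q i x) \<le> 2 * g x" for i
      proof (intro AE_I2)
        fix x
        have Xi: "X i \<in> S" "\<bar>X i - s\<bar> > 0" using X(1) by auto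
        have "norm (f (X i) x - f s x) \<le> g x * \<bar>X i - s\<bar>"
          by (rule vector_derivative_lipschitz[OF S(1) deriv bound Xi(1) S(2)])
        moreover have "norm ((X i - s) *\<^sub>R f' s x) \<le> g x * \<bar>X i - s\<bar>"
          using bound[OF S(2), of x] by (simp add: mult.commute mult_right_mono)
        ultimately have "norm (f (X i) x - (f s x + (X i - s) *\<^sub>R f' s x)) \<le> 2 * g x * \<bar>X i - s\<bar>"
          using norm_triangle_ineq4[of "f (X i) x - f s x" "(X i - s) *\<^sub>R f' s x"] by (simp add: algebra_simps)
        then show "norm (q i x) \<le> 2 * g x" using Xi(2) by (simp add: q_def divide_simps)
      qed
      show "q i \<in> borel_measurable M" for i
        using int[of "X i"] int[OF S(2)] X(1) meas unfolding q_def
        by (intro borel_measurable_scaleR borel_measurable_diff borel_measurable_add borel_measurable_const)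
          (auto dest: borel_measurable_integrable)
    qed simp
    moreover have "integral\<^sup>L M (q i) = (1 / norm (X i - s)) *\<^sub>R (integral\<^sup>L M (f (X i)) - (integral\<^sup>L M (f s) + (X i - s) *\<^sub>R integral\<^sup>L M (f' s)))" for i
    proof -
      have "integrable M (f (X i))" using int X(1) by auto
      then show ?thesis using int[OF S(2)] int' by (simp add: q_def)
    qed
    ultimately show "((\<lambda>t. (1 / norm (t - s)) *\<^sub>R (integral\<^sup>L M (f t) - (integral\<^sup>L M (f s) + (t - s) *\<^sub>R integral\<^sup>L M (f' s)))) \<circ> X) \<longlonglongrightarrow> 0"
      by (simp add: o_def)
  qed
  then show ?thesis
    unfolding has_vector_derivative_def has_derivative_within by (simp add: bounded_linear_scaleR_left)
qed

lemma lborel_translate: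
  fixes f :: "'a::euclidean_space \<Rightarrow> 'b::{banach, second_countable_topology}"
  assumes "f \<in> borel_measurable borel"
  shows "integrable lborel (\<lambda>x. f (x + a)) \<longleftrightarrow> integrable lborel f"
    "(LINT x|lborel. f (x + a)) = (LINT x|lborel. f x)"
proof -
  have d: "lborel = distr lborel borel (\<lambda>x::'a. x + a)"
  proof -
    have "(\<lambda>x. x + a) = (+) a" by (auto simp: add.commute)
    then show ?thesis using lborel_distr_plus[of a] by simp
  qed
  show "integrable lborel (\<lambda>x. f (x + a)) \<longleftrightarrow> integrable lborel f"
    using assms by (subst (2) d) (simp add: integrable_distr_eq)
  show "(LINT x|lborel. f (x + a)) = (LINT x|lborel. f x)"
    using assms by (subst (2) d) (simp add: integral_distr)
qed

text \<open>Integrate \<open>f (x + v) - f x = \<integral>\<^sub>0\<^sup>1 f' (x + \<theta> v) v d\<theta>\<close> over \<open>x\<close>, using translation invariance.\<close>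

lemma integral_directional_derivative_zero:
  fixes f :: "real^'n \<Rightarrow> complex"
  assumes deriv: "\<And>x. (f has_derivative f' x) (at x)" and cont: "continuous_on UNIV (\<lambda>x. f' x v)"
    and f: "integrable lborel f" and f': "integrable lborel (\<lambda>x. f' x v)"
  shows "(LINT x|lborel. f' x v) = 0"
proof -
  have fm: "f \<in> borel_measurable borel" using f by (auto dest: borel_measurable_integrable)
  have [measurable]: "(\<lambda>x. f' x v) \<in> borel_measurable borel" using cont by (rule borel_measurable_continuous_onI)
  let ?G = "\<lambda>\<theta> x. indicator {0..1::real} \<theta> *\<^sub>R f' (x + \<theta> *\<^sub>R v) v"
  have slice: "integrable lborel (?G \<theta>)" for \<theta>
    using lborel_translate(1)[of "\<lambda>x. f' x v" "\<theta> *\<^sub>R v"] f' by (intro integrable_scaleR_right) simp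
  have int: "integrable (lborel \<Otimes>\<^sub>M lborel) (\<lambda>(\<theta>, x). ?G \<theta> x)"
  proof (rule lborel_pair.Fubini_integrable)
    show "(\<lambda>(\<theta>, x). ?G \<theta> x) \<in> borel_measurable (lborel \<Otimes>\<^sub>M lborel)" by measurable
    have "(LINT x|lborel. norm (case (\<theta>, x) of (\<theta>, x) \<Rightarrow> ?G \<theta> x)) = indicator {0..1} \<theta> *\<^sub>R (LINT x|lborel. norm (f' x v))" for \<theta>
      using lborel_translate(2)[of "\<lambda>x. norm (f' x v)" "\<theta> *\<^sub>R v"] by (simp add: indicator_def)
    then show "integrable lborel (\<lambda>\<theta>. LINT x|lborel. norm (case (\<theta>, x) of (\<theta>, x) \<Rightarrow> ?G \<theta> x))"
      by (simp only: borel_integrable_compact[OF compact_Icc continuous_on_const])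
    show "AE \<theta> in lborel. integrable lborel (\<lambda>x. case (\<theta>, x) of (\<theta>, x) \<Rightarrow> ?G \<theta> x)" using slice by simp
  qed
  have FTC: "f (x + v) - f x = (LINT \<theta>|lborel. ?G \<theta> x)" for x
  proof -
    have "(LINT \<theta>|lborel. ?G \<theta> x) = f (x + 1 *\<^sub>R v) - f (x + 0 *\<^sub>R v)"
    proof (rule integral_FTC_atLeastAtMost)
      show "((\<lambda>\<theta>. f (x + \<theta> *\<^sub>R v)) has_vector_derivative f' (x + \<theta> *\<^sub>R v) v) (at \<theta> within {0..1})" for \<theta>
      proof -
        have "((\<lambda>\<theta>. x + \<theta> *\<^sub>R v) has_derivative (\<lambda>h. h *\<^sub>R v)) (at \<theta> within {0..1})"
          by (auto intro!: derivative_eq_intros)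
        from has_derivative_compose[OF this deriv[of "x + \<theta> *\<^sub>R v"]]
        show ?thesis
          by (simp add: has_vector_derivative_def linear_cmul[OF has_derivative_linear[OF deriv]])
      qed
      show "continuous_on {0..1} (\<lambda>\<theta>. f' (x + \<theta> *\<^sub>R v) v)"
        by (rule continuous_on_compose2[OF cont]) (auto intro!: continuous_intros)
    qed simp
    then show ?thesis by simp
  qed
  have "0 = (LINT x|lborel. f (x + v) - f x)"
    using f fm by (simp add: lborel_translate)
  also have "\<dots> = (LINT x|lborel. (LINT \<theta>|lborel. ?G \<theta> x))" by (simp only: FTC)
  also have "\<dots> = (LINT \<theta>|lborel. (LINT x|lborel. ?G \<theta> x))"
    by (rule lborel_pair.Fubini_integral[OF int])
  also have "\<dots> = (LINT \<theta>|lborel. indicator {0..1::real} \<theta> *\<^sub>R (LINT x|lborel. f' x v))"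
    using lborel_translate(2)[of "\<lambda>x. f' x v"] by simp
  also have "\<dots> = (LINT x|lborel. f' x v)" by simp
  finally show ?thesis by simp
qed

section \<open>Liouville's formula for linear flows\<close>

lemma C1cE:
  fixes f :: "real^'n \<Rightarrow> complex"
  assumes "f \<in> C1c"
  obtains f' R where "\<And>x. (f has_derivative f' x) (at x)"
    "\<And>g h. continuous_on UNIV g \<Longrightarrow> continuous_on UNIV h \<Longrightarrow> continuous_on UNIV (\<lambda>x::real^'n. f' (g x) (h x))"
    "R > 0" "\<And>x. norm x > R \<Longrightarrow> f x = 0" "\<And>x y. norm x > R \<Longrightarrow> f' x y = 0"
proof -
  obtain f' R where f': "\<And>x. (f has_derivative f' x) (at x)" "\<And>y. continuous_on UNIV (\<lambda>x. f' x y)"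
    and R: "\<And>x. norm x > R \<Longrightarrow> f x = 0" using assms by (auto simp: C1c_def)
  \<comment> \<open>Expanding the direction in the standard basis upgrades continuity in the base
    point, for each fixed direction, to continuity when both arguments vary.\<close>
  have rep: "f' x y = (\<Sum>i\<in>UNIV. (y $ i) *\<^sub>R f' x (axis i 1))" for x y
  proof -
    have "f' x y = f' x (\<Sum>i\<in>UNIV. (y $ i) *\<^sub>R axis i 1)" by (simp add: basis_expansion scalar_mult_eq_scaleR[symmetric])
    then show ?thesis
      using has_derivative_linear[OF f'(1)[of x]] by (simp add: linear_sum linear_cmul)
  qed
  have cont: "continuous_on UNIV (\<lambda>x::real^'n. f' (g x) (h x))" if "continuous_on UNIV g" "continuous_on UNIV h" for g h
  proof -
    have "(\<lambda>x. f' (g x) (h x)) = (\<lambda>x. \<Sum>i\<in>UNIV. (h x $ i) *\<^sub>R f' (g x) (axis i 1))"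
      by (rule ext) (rule rep)
    moreover have "continuous_on UNIV (\<lambda>x. \<Sum>i\<in>UNIV. (h x $ i) *\<^sub>R f' (g x) (axis i 1))"
      using that
      by (intro continuous_on_sum continuous_on_scaleR continuous_on_component continuous_on_compose2[OF f'(2) that(1)]) auto
    ultimately show ?thesis by (simp only:)
  qed
  have zero: "f' x y = 0" if "norm x > max R 1" for x y
  proof -
    have op: "open {x::real^'n. norm x > max R 1}" by (intro open_Collect_less continuous_intros)
    have "((\<lambda>_. 0) has_derivative f' x) (at x)"
      by (rule has_derivative_transform_within_open[OF f'(1) op]) (use that R in auto)
    from has_derivative_unique[OF this has_derivative_const] have "f' x = (\<lambda>_. 0)" .
    then show ?thesis by simp
  qed
  show ?thesis
  proof (rule that)
    show "(f has_derivative f' x) (at x)" for x by (rule f'(1))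
    show "continuous_on UNIV (\<lambda>x::real^'n. f' (g x) (h x))" if "continuous_on UNIV g" "continuous_on UNIV h" for g h
      using that by (rule cont)
    show "max R 1 > 0" by simp
    show "f x = 0" if "norm x > max R 1" for x using that R by simp
    show "f' x y = 0" if "norm x > max R 1" for x y using that by (rule zero)
  qed
qed

text \<open>Liouville's formula without determinants: the integral J(t) of f(e^(tM) x) solves J' = -
  tr(M) J, because the vector field M x has divergence tr M and integration by parts leaves no
  boundary term.\<close>

lemma C1c_flow_integral:
  fixes f :: "real^'n \<Rightarrow> complex"
  assumes "f \<in> C1c"
  shows "(LINT x|lborel. f (mexp M s *v x)) = complex_of_real (exp (- s * trace M)) * (LINT x|lborel. f x)"
proof -
  obtain f' R where f': "\<And>x. (f has_derivative f' x) (at x)"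
    "\<And>g h. continuous_on UNIV g \<Longrightarrow> continuous_on UNIV h \<Longrightarrow> continuous_on UNIV (\<lambda>x::real^'n. f' (g x) (h x))"
    and R: "R > 0" "\<And>x. norm x > R \<Longrightarrow> f x = 0" "\<And>x y. norm x > R \<Longrightarrow> f' x y = 0"
    by (rule C1cE[OF assms]) blast
  have fc: "continuous_on UNIV f" using C1c_imp_Cc[OF assms] by (rule Cc_continuous)
  define a where "a = \<bar>s\<bar> + 1"
  obtain C where C: "C \<ge> 1" "\<And>t x. \<bar>t\<bar> \<le> a \<Longrightarrow> norm (mexp M t *v x) \<le> C * norm (x :: real^'n)"
    by (rule mexp_flow_bound[of a M]) blast
  have far: "norm (mexp M t *v x) > R" if "\<bar>t\<bar> \<le> a" "norm x > C * R" for t and x :: "real^'n"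
  proof -
    have "norm x \<le> C * norm (mexp M t *v x)" using C(2)[of "- t" "mexp M t *v x"] that(1) by simp
    then have "C * R < C * norm (mexp M t *v x)" using that(2) by linarith
    then show ?thesis using C(1) by simp
  qed
  define J where "J = (\<lambda>t. LINT x|lborel. f (mexp M t *v x))"
  define k where "k = (\<lambda>y. f' y (M *v y))"
  have lin: "linear (f' x)" for x using f'(1) by (rule has_derivative_linear)
  have Mc: "continuous_on UNIV (\<lambda>x::real^'n. M *v x)"
    by (rule bounded_linear.continuous_on[OF matrix_vector_mul_bounded_linear continuous_on_id])
  have kc: "continuous_on UNIV k" unfolding k_def by (intro f'(2) continuous_on_id Mc)
  have "k \<in> Cc" unfolding Cc_def using kc R(3) by (auto simp: k_def)
  then obtain K where K: "K > 0" "\<And>x. cmod (k x) \<le> K" by (rule Cc_bounded) blast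
  have Ec: "continuous_on UNIV (\<lambda>x. mexp M t *v x)" for t by (intro continuous_on_mexp_flow continuous_intros)
  have J': "(J has_vector_derivative (LINT x|lborel. k (mexp M t *v x))) (at t within {-a..a})" if t: "t \<in> {-a..a}" for t
    unfolding J_def
  proof (rule leibniz_lebesgue[where f' = "\<lambda>t x. k (mexp M t *v x)" and g = "\<lambda>x. indicator (cball 0 (C * R)) x *\<^sub>R K"])
    show "integrable lborel (\<lambda>x. f (mexp M t *v x))" if "t \<in> {-a..a}" for t
      using that far[of t] R(2)
      by (intro continuous_compact_support_integrable[of _ "C * R"] continuous_on_compose2[OF fc Ec]) (auto simp: abs_le_iff)
    show "((\<lambda>t. f (mexp M t *v x)) has_vector_derivative k (mexp M t *v x)) (at t within {-a..a})" for x t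
    proof -
      have "((\<lambda>t. mexp M t *v x) has_derivative (\<lambda>h. h *\<^sub>R (M *v (mexp M t *v x)))) (at t within {-a..a})"
        using mexp_flow_deriv by (simp add: has_vector_derivative_def)
      from has_derivative_compose[OF this f'(1)]
      show ?thesis by (simp add: has_vector_derivative_def k_def linear_cmul[OF lin])
    qed
    show "norm (k (mexp M t *v x)) \<le> indicator (cball 0 (C * R)) x *\<^sub>R K" if "t \<in> {-a..a}" for x t
      using K(2)[of "mexp M t *v x"] far[of t x] R(3) that
      by (cases "norm x \<le> C * R") (auto simp: k_def abs_le_iff)
    show "integrable lborel (\<lambda>x::real^'n. indicator (cball 0 (C * R)) x *\<^sub>R K)"
      by (intro borel_integrable_compact continuous_intros) auto
    show "(\<lambda>x. k (mexp M t *v x)) \<in> borel_measurable lborel"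
      using continuous_on_compose2[OF kc Ec] by (simp add: borel_measurable_continuous_onI)
  qed (use t in auto)
  have ibp: "(LINT x|lborel. k (mexp M t *v x)) = - complex_of_real (trace M) * J t" if t: "t \<in> {-a..a}" for t
  proof -
    define g where "g = (\<lambda>x. f (mexp M t *v x))"
    define g' where "g' = (\<lambda>x y. f' (mexp M t *v x) (mexp M t *v y))"
    have ta: "\<bar>t\<bar> \<le> a" using t by auto
    have g'd: "(g has_derivative g' x) (at x)" for x
    proof -
      have "((\<lambda>x. mexp M t *v x) has_derivative (\<lambda>y. mexp M t *v y)) (at x)"
        by (rule bounded_linear_imp_has_derivative[OF matrix_vector_mul_bounded_linear])
      from has_derivative_compose[OF this f'(1)] show ?thesis by (simp add: g_def g'_def)
    qed
    have g'c: "continuous_on UNIV (\<lambda>x. g' x y)" for y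
      unfolding g'_def by (intro f'(2) Ec continuous_intros)
    have gc: "continuous_on UNIV g" unfolding g_def by (rule continuous_on_compose2[OF fc Ec]) auto
    have supp: "g x = 0" "g' x y = 0" if "norm x > C * R" for x y
      using far[OF ta that] R by (auto simp: g_def g'_def)
    have gi: "integrable lborel g" by (rule continuous_compact_support_integrable[OF gc supp(1)])
    \<comment> \<open>The derivative of x_j g(x) along the i-th axis integrates to 0; the product
      rule then leaves a contribution only for i = j, which is how the trace appears.\<close>
    have part: "(LINT x|lborel. complex_of_real (x $ j) * g' x (axis i 1)) = - (if i = j then J t else 0)" for i j
    proof -
      have "(LINT x|lborel. complex_of_real (x $ j) * g' x (axis i 1) + complex_of_real (axis i 1 $ j) * g x) = 0"
      proof (rule integral_directional_derivative_zero[where f = "\<lambda>x. complex_of_real (x $ j) * g x"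
          and f' = "\<lambda>x y. complex_of_real (x $ j) * g' x y + complex_of_real (y $ j) * g x"])
        show "((\<lambda>x. complex_of_real (x $ j) * g x) has_derivative (\<lambda>y. complex_of_real (x $ j) * g' x y + complex_of_real (y $ j) * g x)) (at x)" for x
          by (intro derivative_intros g'd bounded_linear_imp_has_derivative bounded_linear_vec_nth)
        show cc: "continuous_on UNIV (\<lambda>x. complex_of_real (x $ j) * g' x (axis i 1) + complex_of_real (axis i 1 $ j) * g x)"
          by (intro continuous_intros g'c gc)
        show "integrable lborel (\<lambda>x. complex_of_real (x $ j) * g x)"
          by (rule continuous_compact_support_integrable[of _ "C * R"]) (auto intro!: continuous_intros gc simp: supp)
        show "integrable lborel (\<lambda>x. complex_of_real (x $ j) * g' x (axis i 1) + complex_of_real (axis i 1 $ j) * g x)"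
          by (rule continuous_compact_support_integrable[OF cc, of "C * R"]) (auto simp: supp)
      qed
      moreover have "integrable lborel (\<lambda>x. complex_of_real (x $ j) * g' x (axis i 1))"
        by (rule continuous_compact_support_integrable[of _ "C * R"]) (auto intro!: continuous_intros g'c simp: supp)
      ultimately have "(LINT x|lborel. complex_of_real (x $ j) * g' x (axis i 1)) + complex_of_real (axis i 1 $ j) * (LINT x|lborel. g x) = 0"
        using gi by simp
      moreover have "axis i (1::real) $ j = (if i = j then 1 else 0)" by (simp add: axis_def)
      ultimately show ?thesis by (cases "i = j") (simp_all add: J_def g_def[symmetric] eq_neg_iff_add_eq_0)
    qed
    have "k (mexp M t *v x) = (\<Sum>i\<in>UNIV. \<Sum>j\<in>UNIV. complex_of_real (M $ i $ j) * (complex_of_real (x $ j) * g' x (axis i 1)))" for x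
    proof -
      have "k (mexp M t *v x) = g' x (M *v x)"
        by (simp add: k_def g'_def matrix_vector_mul_assoc mexp_commute)
      also have "\<dots> = g' x (\<Sum>i\<in>UNIV. ((M *v x) $ i) *\<^sub>R axis i 1)" by (simp add: basis_expansion scalar_mult_eq_scaleR[symmetric])
      also have "\<dots> = (\<Sum>i\<in>UNIV. ((M *v x) $ i) *\<^sub>R g' x (axis i 1))"
        using has_derivative_linear[OF g'd[of x]] by (simp add: linear_sum linear_cmul)
      also have "\<dots> = (\<Sum>i\<in>UNIV. \<Sum>j\<in>UNIV. complex_of_real (M $ i $ j) * (complex_of_real (x $ j) * g' x (axis i 1)))"
        by (simp add: matrix_vector_mult_def scaleR_conv_of_real sum_distrib_right mult.assoc)
      finally show ?thesis .
    qed
    then have "(LINT x|lborel. k (mexp M t *v x)) =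
      (LINT x|lborel. (\<Sum>i\<in>UNIV. \<Sum>j\<in>UNIV. complex_of_real (M $ i $ j) * (complex_of_real (x $ j) * g' x (axis i 1))))"
      by (simp only:)
    also have "\<dots> = (\<Sum>i\<in>UNIV. \<Sum>j\<in>UNIV. complex_of_real (M $ i $ j) * (LINT x|lborel. complex_of_real (x $ j) * g' x (axis i 1)))"
    proof -
      have "integrable lborel (\<lambda>x. complex_of_real (x $ j) * g' x (axis i 1))" for i j
        by (rule continuous_compact_support_integrable[of _ "C * R"]) (auto intro!: continuous_intros g'c simp: supp)
      then show ?thesis by (simp add: integrable_mult_right)
    qed
    also have "\<dots> = - complex_of_real (trace M) * J t"
      by (simp add: part if_distrib sum.delta trace_def sum_negf sum_distrib_right cong: if_cong)
    finally show ?thesis .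
  qed
  have "((\<lambda>t. exp (t * trace M) *\<^sub>R J t) has_vector_derivative 0) (at t within {-a..a})" if t: "t \<in> {-a..a}" for t
  proof -
    have "((\<lambda>t. exp (t * trace M) *\<^sub>R J t) has_vector_derivative
        exp (t * trace M) *\<^sub>R (- complex_of_real (trace M) * J t) + (exp (t * trace M) * trace M) *\<^sub>R J t) (at t within {-a..a})"
      by (rule has_vector_derivative_scaleR[OF _ J'[OF t, unfolded ibp[OF t]]]) (auto intro!: derivative_eq_intros)
    then show ?thesis by (simp add: scaleR_conv_of_real)
  qed
  then obtain c where c: "\<And>t. t \<in> {-a..a} \<Longrightarrow> exp (t * trace M) *\<^sub>R J t = c"
    using has_vector_derivative_zero_constant[of "{-a..a}" "\<lambda>t. exp (t * trace M) *\<^sub>R J t"] by auto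
  have "exp (s * trace M) *\<^sub>R J s = exp (0 * trace M) *\<^sub>R J 0"
  proof -
    have "s \<in> {-a..a}" "0 \<in> {-a..a}" by (auto simp: a_def)
    then show ?thesis by (simp only: c)
  qed
  then have "exp (s * trace M) *\<^sub>R J s = (LINT x|lborel. f x)" by (simp add: J_def)
  then have "exp (- s * trace M) *\<^sub>R (exp (s * trace M) *\<^sub>R J s) = exp (- s * trace M) *\<^sub>R (LINT x|lborel. f x)"
    by simp
  then have "J s = exp (- s * trace M) *\<^sub>R (LINT x|lborel. f x)"
    unfolding scaleR_scaleR by (simp flip: exp_add)
  then show ?thesis by (simp add: J_def scaleR_conv_of_real)
qed

lemma Cc_flow:
  assumes "f \<in> Cc"
  shows "(\<lambda>x. f (mexp M s *v x)) \<in> Cc"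
proof -
  obtain R where R: "R > 0" "\<And>x. norm x > R \<Longrightarrow> f x = 0" using Cc_support[OF assms] by blast
  obtain C where C: "C \<ge> 1" "\<And>t x. \<bar>t\<bar> \<le> \<bar>s\<bar> \<Longrightarrow> norm (mexp M t *v x) \<le> C * norm x"
    by (rule mexp_flow_bound[of "\<bar>s\<bar>" M]) blast
  have "f (mexp M s *v x) = 0" if "norm x > C * R" for x
  proof (rule R(2))
    have "norm x \<le> C * norm (mexp M s *v x)" using C(2)[of "- s" "mexp M s *v x"] by simp
    then have "C * R < C * norm (mexp M s *v x)" using that by linarith
    then show "R < norm (mexp M s *v x)" using C(1) by simp
  qed
  moreover have "continuous_on UNIV (\<lambda>x. f (mexp M s *v x))"
    by (rule continuous_on_compose2[OF Cc_continuous[OF assms]]) (auto intro!: continuous_on_mexp_flow continuous_intros)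
  ultimately show ?thesis by (auto simp: Cc_def)
qed

text \<open>The extension beyond C^1 is made because the formula is applied to products with the
  damping factor, which need not be smooth. Both sides are continuous under uniform convergence with
  supports in a fixed ball.\<close>

lemma Cc_flow_integral:
  fixes f :: "real^'n \<Rightarrow> complex"
  assumes "f \<in> Cc"
  shows "(LINT x|lborel. f (mexp M s *v x)) = complex_of_real (exp (- s * trace M)) * (LINT x|lborel. f x)"
proof -
  obtain R where R: "R > 0" "\<And>x. norm x > R \<Longrightarrow> f x = 0"
    "\<And>e. e > 0 \<Longrightarrow> \<exists>v\<in>C1c. (\<forall>x. cmod (f x - v x) \<le> e) \<and> (\<forall>x. norm x > R \<longrightarrow> v x = 0)"
    using Cc_uniform_approx[OF assms] by blast
  obtain C where C: "C \<ge> 1" "\<And>t x. \<bar>t\<bar> \<le> \<bar>s\<bar> \<Longrightarrow> norm (mexp M t *v x) \<le> C * norm (x :: real^'n)"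
    by (rule mexp_flow_bound[of "\<bar>s\<bar>" M]) blast
  have far: "R < norm (mexp M s *v x)" if "norm x > C * R" for x :: "real^'n"
  proof -
    have "norm x \<le> C * norm (mexp M s *v x)" using C(2)[of "- s" "mexp M s *v x"] by simp
    then have "C * R < C * norm (mexp M s *v x)" using that by linarith
    then show "R < norm (mexp M s *v x)" using C(1) by simp
  qed
  define V where "V = (\<lambda>r. measure lborel (cball (0::real^'n) r))"
  have small: "cmod (LINT x|lborel. h x) \<le> e * V r"
    if h: "h \<in> Cc" "\<And>x. cmod (h x) \<le> e" "\<And>x. norm x > r \<Longrightarrow> h x = 0" for h :: "real^'n \<Rightarrow> complex" and e r
  proof -
    have "cmod (LINT x|lborel. h x) \<le> (LINT x|lborel. cmod (h x))" by (rule integral_norm_bound)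
    also have "\<dots> \<le> (LINT x|lborel. indicator (cball (0::real^'n) r) x *\<^sub>R e)"
    proof (rule integral_mono)
      show "integrable lborel (\<lambda>x. cmod (h x))" using Cc_integrable[OF h(1)] by simp
      show "integrable lborel (\<lambda>x::real^'n. indicator (cball 0 r) x *\<^sub>R e)"
        by (intro borel_integrable_compact continuous_intros) auto
      show "cmod (h x) \<le> indicator (cball 0 r) x *\<^sub>R e" for x
        using h(2)[of x] h(3)[of x] by (auto simp: indicator_def)
    qed
    also have "\<dots> = e * V r" by (simp add: V_def)
    finally show ?thesis .
  qed
  let ?c = "complex_of_real (exp (- s * trace M))"
  let ?d = "(LINT x|lborel. f (mexp M s *v x)) - ?c * (LINT x|lborel. f x)"
  have le: "cmod ?d \<le> e * (V (C * R) + cmod ?c * V R)" if e: "e > 0" for e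
  proof -
    obtain v where v: "v \<in> C1c" "\<And>x. cmod (f x - v x) \<le> e" "\<And>x. norm x > R \<Longrightarrow> v x = 0" using R(3)[OF e] by blast
    have vc: "v \<in> Cc" using v(1) by (rule C1c_imp_Cc)
    define h where "h = (\<lambda>x. f x - v x)"
    have h: "h \<in> Cc" unfolding Cc_def h_def
      using Cc_continuous[OF assms] Cc_continuous[OF vc] R(2) v(3) by (auto intro!: continuous_intros exI[of _ R])
    have "cmod (LINT x|lborel. h x) \<le> e * V R"
      by (rule small[OF h]) (use v R(2) in \<open>auto simp: h_def\<close>)
    moreover have "cmod (LINT x|lborel. h (mexp M s *v x)) \<le> e * V (C * R)"
      by (rule small[OF Cc_flow[OF h]]) (use v R(2) far in \<open>auto simp: h_def\<close>)
    moreover have "cmod ?d = cmod ((LINT x|lborel. h (mexp M s *v x)) - ?c * (LINT x|lborel. h x))"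
      using Cc_integrable[OF assms] Cc_integrable[OF vc] Cc_integrable[OF Cc_flow[OF assms]] Cc_integrable[OF Cc_flow[OF vc]]
        C1c_flow_integral[OF v(1), of M s] by (simp add: h_def algebra_simps)
    moreover have "cmod (?c * (LINT x|lborel. h x)) \<le> cmod ?c * (e * V R)"
      unfolding norm_mult by (intro mult_left_mono) (use \<open>cmod (LINT x|lborel. h x) \<le> e * V R\<close> in auto)
    ultimately have "cmod ?d \<le> e * V (C * R) + cmod ?c * (e * V R)"
      using norm_triangle_ineq4[of "LINT x|lborel. h (mexp M s *v x)" "?c * (LINT x|lborel. h x)"] by linarith
    then show ?thesis by (simp add: algebra_simps)
  qed
  define K where "K = V (C * R) + cmod ?c * V R + 1"
  have K: "K > 0" unfolding K_def V_def by (intro add_nonneg_pos add_nonneg_nonneg mult_nonneg_nonneg) auto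
  have "cmod ?d \<le> 0"
  proof (rule field_le_epsilon)
    fix e :: real assume "e > 0"
    then have "cmod ?d \<le> e / K * (K - 1)" using le[of "e / K"] K by (simp add: K_def)
    also have "\<dots> \<le> 0 + e" using K \<open>e > 0\<close> by (simp add: field_simps)
    finally show "cmod ?d \<le> 0 + e" .
  qed
  then show ?thesis by simp
qed

lemma Cc_flow_L2norm:
  fixes f :: "real^'n \<Rightarrow> complex"
  assumes "f \<in> Cc"
  shows "L2norm (\<lambda>x. f (mexp M s *v x)) = exp (- s * trace M / 2) * L2norm f"
proof -
  have "(\<lambda>x. complex_of_real ((cmod (f x))\<^sup>2)) \<in> Cc"
    using assms unfolding Cc_def by (auto intro!: continuous_intros)
  from Cc_flow_integral[OF this, of M s]
  have "(LINT x|lborel. (cmod (f (mexp M s *v x)))\<^sup>2) = exp (- s * trace M) * (LINT x|lborel. (cmod (f x))\<^sup>2)"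
    by (simp only: integral_complex_of_real of_real_mult[symmetric] of_real_eq_iff)
  moreover have "exp (- s * trace M) = (exp (- s * trace M / 2))\<^sup>2"
    by (simp add: power2_eq_square flip: exp_add)
  ultimately show ?thesis by (simp only: L2norm_def real_sqrt_mult real_sqrt_abs abs_exp_cancel)
qed

section \<open>Schwartz functions\<close>

text \<open>The Schwartz class is the largest set of differentiable, rapidly decaying functions that
  is stable under directional derivatives. Exhibiting a stable set \<open>X\<close> replaces the
  computation of iterated derivatives.\<close>

lemma schwartz_coinduct:
  assumes "f \<in> X"
    and "\<And>f x. f \<in> X \<Longrightarrow> f differentiable (at x)"
    and "\<And>f k. f \<in> X \<Longrightarrow> bounded (range (\<lambda>x. norm x ^ k *\<^sub>R f x))"
    and "\<And>f v. f \<in> X \<Longrightarrow> dir_deriv v f \<in> X"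
  shows "f \<in> schwartz"
proof -
  have "foldr dir_deriv vs f \<in> X" for vs
    by (induction vs) (auto intro: assms)
  then show ?thesis using assms(2,3) by (simp add: schwartz_def)
qed

lemma schwartz_differentiable: "\<phi> \<in> schwartz \<Longrightarrow> \<phi> differentiable (at x)"
  and schwartz_bounded: "\<phi> \<in> schwartz \<Longrightarrow> bounded (range (\<lambda>x. norm x ^ k *\<^sub>R \<phi> x))"
proof -
  assume "\<phi> \<in> schwartz"
  then have "(\<forall>x. foldr dir_deriv [] \<phi> differentiable (at x)) \<and>
      (\<forall>k. bounded (range (\<lambda>x. norm x ^ k *\<^sub>R foldr dir_deriv [] \<phi> x)))"
    unfolding schwartz_def by blast
  then show "\<phi> differentiable (at x)" "bounded (range (\<lambda>x. norm x ^ k *\<^sub>R \<phi> x))" by simp_all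
qed

lemma schwartz_dir_deriv:
  assumes "\<phi> \<in> schwartz"
  shows "dir_deriv v \<phi> \<in> schwartz"
proof -
  have "foldr dir_deriv vs (dir_deriv v \<phi>) = foldr dir_deriv (vs @ [v]) \<phi>" for vs by simp
  then show ?thesis using assms unfolding schwartz_def by (simp only: mem_Collect_eq) blast
qed

lemma schwartz_has_derivative:
  assumes "\<phi> \<in> schwartz"
  shows "(\<phi> has_derivative (\<lambda>y. dir_deriv y \<phi> x)) (at x)"
  using schwartz_differentiable[OF assms, of x] unfolding frechet_derivative_works dir_deriv_def by simp

lemma dir_deriv_eqI:
  assumes "\<And>x. (f has_derivative f' x) (at x)"
  shows "dir_deriv v f = (\<lambda>x. f' x v)"
  unfolding dir_deriv_def using frechet_derivative_at[OF assms] by metis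

lemma schwartz_continuous:
  assumes "\<phi> \<in> schwartz"
  shows "continuous_on UNIV \<phi>"
  using schwartz_differentiable[OF assms] by (intro differentiable_imp_continuous_on) (simp add: differentiable_on_def)

lemma schwartz_lincomb:
  assumes "\<phi> \<in> schwartz" "\<psi> \<in> schwartz"
  shows "(\<lambda>x. a * \<phi> x + b * \<psi> x) \<in> schwartz"
proof (rule schwartz_coinduct[where X = "{\<lambda>x. a * \<phi> x + b * \<psi> x | \<phi> \<psi>. \<phi> \<in> schwartz \<and> \<psi> \<in> schwartz}"])
  fix f assume "f \<in> {\<lambda>x. a * \<phi> x + b * \<psi> x | \<phi> \<psi>. \<phi> \<in> schwartz \<and> \<psi> \<in> schwartz}"
  then obtain \<phi> \<psi> where f: "f = (\<lambda>x. a * \<phi> x + b * \<psi> x)" and \<phi>: "\<phi> \<in> schwartz" and \<psi>: "\<psi> \<in> schwartz" by blast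
  have D: "(f has_derivative (\<lambda>y. a * dir_deriv y \<phi> x + b * dir_deriv y \<psi> x)) (at x)" for x
    unfolding f by (intro derivative_intros schwartz_has_derivative \<phi> \<psi>)
  show "f differentiable (at x)" for x using D unfolding differentiable_def by blast
  show "dir_deriv v f \<in> {\<lambda>x. a * \<phi> x + b * \<psi> x | \<phi> \<psi>. \<phi> \<in> schwartz \<and> \<psi> \<in> schwartz}" for v
    unfolding dir_deriv_eqI[OF D] using schwartz_dir_deriv[OF \<phi>] schwartz_dir_deriv[OF \<psi>] by blast
  show "bounded (range (\<lambda>x. norm x ^ k *\<^sub>R f x))" for k
  proof -
    obtain A B where "\<And>x. norm (norm x ^ k *\<^sub>R \<phi> x) \<le> A" "\<And>x. norm (norm x ^ k *\<^sub>R \<psi> x) \<le> B"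
      using schwartz_bounded[OF \<phi>, of k] schwartz_bounded[OF \<psi>, of k] unfolding bounded_iff by blast
    then have "norm (a * (norm x ^ k *\<^sub>R \<phi> x) + b * (norm x ^ k *\<^sub>R \<psi> x)) \<le> cmod a * A + cmod b * B" for x
      by (intro order_trans[OF norm_triangle_ineq] add_mono) (simp_all only: norm_mult mult_left_mono norm_ge_zero)
    moreover have "norm x ^ k *\<^sub>R f x = a * (norm x ^ k *\<^sub>R \<phi> x) + b * (norm x ^ k *\<^sub>R \<psi> x)" for x
      by (simp add: f algebra_simps)
    ultimately show ?thesis unfolding bounded_iff by auto
  qed
qed (use assms in blast)

text \<open>Differentiating x_j \<phi> along v leaves the extra term v_j \<phi>, so the stable set
  consists of x_j times a Schwartz function plus another Schwartz function.\<close>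

lemma schwartz_coord_mult:
  fixes \<phi> :: "real^'n \<Rightarrow> complex"
  assumes "\<phi> \<in> schwartz"
  shows "(\<lambda>x. complex_of_real (x $ j) * \<phi> x) \<in> schwartz"
proof -
  let ?X = "{\<lambda>x. complex_of_real (x $ j) * \<phi> x + \<psi> x | (\<phi> :: real^'n \<Rightarrow> complex) \<psi>. \<phi> \<in> schwartz \<and> \<psi> \<in> schwartz}"
  have zero: "(\<lambda>x::real^'n. 0) \<in> schwartz" using schwartz_lincomb[OF assms assms, of 0 0] by simp
  show ?thesis
  proof (rule schwartz_coinduct[where X = ?X])
    show "(\<lambda>x. complex_of_real (x $ j) * \<phi> x) \<in> ?X"
      unfolding mem_Collect_eq by (intro exI[of _ \<phi>] exI[of _ "\<lambda>x. 0"]) (use assms zero in simp)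
  next
    fix f assume "f \<in> ?X"
    then obtain \<phi> \<psi> :: "real^'n \<Rightarrow> complex" where f: "f = (\<lambda>x. complex_of_real (x $ j) * \<phi> x + \<psi> x)"
      and \<phi>: "\<phi> \<in> schwartz" and \<psi>: "\<psi> \<in> schwartz" by blast
    have D: "(f has_derivative (\<lambda>y. complex_of_real (x $ j) * dir_deriv y \<phi> x + complex_of_real (y $ j) * \<phi> x + dir_deriv y \<psi> x)) (at x)" for x
      unfolding f by (intro derivative_intros schwartz_has_derivative \<phi> \<psi> bounded_linear_imp_has_derivative bounded_linear_vec_nth)
    show "f differentiable (at x)" for x using D unfolding differentiable_def by blast
    show "dir_deriv v f \<in> ?X" for v
    proof -
      have eq: "dir_deriv v f = (\<lambda>x. complex_of_real (x $ j) * dir_deriv v \<phi> x + (complex_of_real (v $ j) * \<phi> x + 1 * dir_deriv v \<psi> x))"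
        unfolding dir_deriv_eqI[OF D] by (simp add: add.assoc)
      have "(\<lambda>x. complex_of_real (v $ j) * \<phi> x + 1 * dir_deriv v \<psi> x) \<in> schwartz"
        by (intro schwartz_lincomb \<phi> schwartz_dir_deriv \<psi>)
      then show ?thesis
        unfolding mem_Collect_eq eq
        by (intro exI[of _ "dir_deriv v \<phi>"] exI[of _ "\<lambda>x. complex_of_real (v $ j) * \<phi> x + 1 * dir_deriv v \<psi> x"])
          (use schwartz_dir_deriv[OF \<phi>] in simp)
    qed
    show "bounded (range (\<lambda>x. norm x ^ k *\<^sub>R f x))" for k
    proof -
      obtain A B where A: "\<And>x. norm (norm x ^ Suc k *\<^sub>R \<phi> x) \<le> A" and B: "\<And>x. norm (norm x ^ k *\<^sub>R \<psi> x) \<le> B"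
        using schwartz_bounded[OF \<phi>, of "Suc k"] schwartz_bounded[OF \<psi>, of k] unfolding bounded_iff by blast
      have "norm (norm x ^ k *\<^sub>R f x) \<le> A + B" for x
      proof -
        have "norm (norm x ^ k *\<^sub>R (complex_of_real (x $ j) * \<phi> x)) = norm x ^ k * (\<bar>x $ j\<bar> * cmod (\<phi> x))"
          by (simp add: norm_mult)
        also have "\<dots> \<le> norm x ^ k * (norm x * cmod (\<phi> x))"
          by (intro mult_left_mono mult_right_mono component_le_norm_cart) auto
        also have "\<dots> \<le> A" using A[of x] by (simp add: mult_ac)
        finally show ?thesis
          using B[of x] norm_triangle_ineq[of "norm x ^ k *\<^sub>R (complex_of_real (x $ j) * \<phi> x)" "norm x ^ k *\<^sub>R \<psi> x"]
          by (simp add: f scaleR_add_right)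
      qed
      then show ?thesis unfolding bounded_iff by auto
    qed
  qed
qed

lemma integrable_inverse_1_plus_square_lborel: "integrable lborel (\<lambda>x::real. inverse (1 + x\<^sup>2))"
  using integrable_inverse_1_plus_square by (simp add: set_integrable_def)

text \<open>Decay of the orders 0 and 2n bounds \<phi> by a multiple of (1 + |x|^2)^(-n), and hence
  by a product of the one-variable functions 1 / (1 + (x \<bullet> b)^2), one for each basis
  vector.\<close>

lemma schwartz_integrable:
  fixes \<phi> :: "real^'n \<Rightarrow> complex"
  assumes "\<phi> \<in> schwartz"
  shows "integrable lborel \<phi>"
proof -
  let ?n = "CARD('n)"
  obtain A B where A: "\<And>x. norm (norm x ^ 0 *\<^sub>R \<phi> x) \<le> A" and B: "\<And>x. norm (norm x ^ (2 * ?n) *\<^sub>R \<phi> x) \<le> B"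
    using schwartz_bounded[OF assms, of 0] schwartz_bounded[OF assms, of "2 * ?n"] unfolding bounded_iff by blast
  let ?g = "\<lambda>x::real^'n. (2 ^ ?n * (A + B)) * (\<Prod>b\<in>Basis. inverse (1 + (x \<bullet> b)\<^sup>2))"
  have le: "cmod (\<phi> x) \<le> ?g x" for x
  proof -
    have "(1 + (norm x)\<^sup>2) ^ ?n \<le> 2 ^ ?n * (1 + norm x ^ (2 * ?n))"
    proof (cases "norm x \<le> 1")
      case True
      then have "(1 + (norm x)\<^sup>2) ^ ?n \<le> 2 ^ ?n" by (intro power_mono) (auto simp: power_le_one)
      also have "\<dots> \<le> 2 ^ ?n * (1 + norm x ^ (2 * ?n))" by simp
      finally show ?thesis .
    next
      case False
      then have "(1 + (norm x)\<^sup>2) ^ ?n \<le> (2 * (norm x)\<^sup>2) ^ ?n" by (intro power_mono) (auto simp: one_le_power)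
      also have "\<dots> \<le> 2 ^ ?n * (1 + norm x ^ (2 * ?n))" by (simp add: power_mult_distrib power_mult)
      finally show ?thesis .
    qed
    then have "(1 + (norm x)\<^sup>2) ^ ?n * cmod (\<phi> x) \<le> 2 ^ ?n * (1 + norm x ^ (2 * ?n)) * cmod (\<phi> x)"
      by (rule mult_right_mono) simp
    also have "\<dots> = 2 ^ ?n * (cmod (\<phi> x) + norm x ^ (2 * ?n) * cmod (\<phi> x))" by (simp add: algebra_simps)
    also have "\<dots> \<le> 2 ^ ?n * (A + B)" using A[of x] B[of x] by (intro mult_left_mono add_mono) auto
    finally have 1: "(1 + (norm x)\<^sup>2) ^ ?n * cmod (\<phi> x) \<le> 2 ^ ?n * (A + B)" .
    have 2: "(\<Prod>b\<in>Basis. 1 + (x \<bullet> b)\<^sup>2) \<le> (1 + (norm x)\<^sup>2) ^ ?n"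
    proof -
      have "(\<Prod>b\<in>(Basis :: (real^'n) set). 1 + (x \<bullet> b)\<^sup>2) \<le> (\<Prod>b\<in>(Basis :: (real^'n) set). 1 + (norm x)\<^sup>2)"
      proof (intro prod_mono conjI add_left_mono)
        fix b :: "real^'n" assume "b \<in> Basis"
        then have "\<bar>x \<bullet> b\<bar> \<le> norm x" by (rule Basis_le_norm)
        then show "(x \<bullet> b)\<^sup>2 \<le> (norm x)\<^sup>2" by (metis abs_ge_zero power2_abs power_mono)
      qed simp
      then show ?thesis by simp
    qed
    define P where "P = (\<Prod>b\<in>(Basis :: (real^'n) set). 1 + (x \<bullet> b)\<^sup>2)"
    have pos: "P > 0" unfolding P_def by (intro prod_pos) (simp add: add_pos_nonneg)
    have inv: "(\<Prod>b\<in>Basis. inverse (1 + (x \<bullet> b)\<^sup>2)) = inverse P"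
      unfolding P_def prod_inversef[symmetric] by (simp add: o_def)
    have "P * cmod (\<phi> x) \<le> 2 ^ ?n * (A + B)"
      using order_trans[OF mult_right_mono[OF 2 norm_ge_zero] 1] by (simp only: P_def)
    then have "cmod (\<phi> x) \<le> (2 ^ ?n * (A + B)) / P"
      using pos by (simp only: pos_le_divide_eq mult.commute)
    then show ?thesis by (simp only: inv divide_inverse)
  qed
  have "integrable lborel ?g"
    by (intro integrable_mult_right integral_basis_product(1) integrable_inverse_1_plus_square_lborel)
  then show ?thesis
  proof (rule Bochner_Integration.integrable_bound)
    show "\<phi> \<in> borel_measurable lborel"
      using schwartz_continuous[OF assms] by (simp add: borel_measurable_continuous_onI)
    show "AE x in lborel. norm (\<phi> x) \<le> norm (?g x)"
      using order_trans[OF le abs_ge_self] by (intro AE_I2) (simp only: real_norm_def)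
  qed
qed

lemma schwartz_bci:
  assumes "\<phi> \<in> schwartz"
  shows "\<phi> \<in> bci"
  using schwartz_bounded[OF assms, of 0] schwartz_continuous[OF assms] schwartz_integrable[OF assms] by (simp add: bci_def)

lemma has_derivative_cis_real: "(cis has_derivative (\<lambda>h. h *\<^sub>R (\<i> * cis t))) (at t)"
proof -
  have "((\<lambda>z. exp (\<i> * z)) has_field_derivative \<i> * exp (\<i> * complex_of_real t)) (at (complex_of_real t))"
    by (auto intro!: derivative_eq_intros)
  from has_vector_derivative_real_field[OF this, of UNIV]
  show ?thesis by (simp add: has_vector_derivative_def cis_conv_exp[abs_def])
qed

lemma ftr_dir_deriv:
  fixes \<phi> :: "real^'n \<Rightarrow> complex"
  assumes "\<phi> \<in> schwartz"
  shows "ftr 1 (dir_deriv v \<phi>) \<xi> = - (\<i> * complex_of_real (\<xi> \<bullet> v) * ftr 1 \<phi> \<xi>)"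
proof -
  have D: "((\<lambda>x. cis (\<xi> \<bullet> x) * \<phi> x) has_derivative (\<lambda>y. cis (\<xi> \<bullet> x) * dir_deriv y \<phi> x + ((\<xi> \<bullet> y) *\<^sub>R (\<i> * cis (\<xi> \<bullet> x))) * \<phi> x)) (at x)" for x
  proof -
    have "((\<lambda>x. \<xi> \<bullet> x) has_derivative (\<lambda>y. \<xi> \<bullet> y)) (at x)" by (auto intro!: derivative_eq_intros)
    from has_derivative_compose[OF this has_derivative_cis_real] have "((\<lambda>x. cis (\<xi> \<bullet> x)) has_derivative (\<lambda>y. (\<xi> \<bullet> y) *\<^sub>R (\<i> * cis (\<xi> \<bullet> x)))) (at x)" .
    from has_derivative_mult[OF this schwartz_has_derivative[OF assms]] show ?thesis by simp
  qed
  have i1: "integrable lborel (\<lambda>x. cis (\<xi> \<bullet> x) * \<phi> x)" if "\<phi> \<in> schwartz" for \<phi>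
    using cis_mult_integrable[OF schwartz_integrable[OF that], of 1 \<xi>] by simp
  have eq: "cis (\<xi> \<bullet> x) * dir_deriv v \<phi> x + ((\<xi> \<bullet> v) *\<^sub>R (\<i> * cis (\<xi> \<bullet> x))) * \<phi> x =
     cis (\<xi> \<bullet> x) * dir_deriv v \<phi> x + (\<i> * complex_of_real (\<xi> \<bullet> v)) * (cis (\<xi> \<bullet> x) * \<phi> x)" for x
    by (simp add: scaleR_conv_of_real mult_ac)
  have "(LINT x|lborel. cis (\<xi> \<bullet> x) * dir_deriv v \<phi> x + ((\<xi> \<bullet> v) *\<^sub>R (\<i> * cis (\<xi> \<bullet> x))) * \<phi> x) = 0"
  proof (rule integral_directional_derivative_zero[OF D])
    show "continuous_on UNIV (\<lambda>x. cis (\<xi> \<bullet> x) * dir_deriv v \<phi> x + ((\<xi> \<bullet> v) *\<^sub>R (\<i> * cis (\<xi> \<bullet> x))) * \<phi> x)"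
      by (intro continuous_intros schwartz_continuous schwartz_dir_deriv assms)
    show "integrable lborel (\<lambda>x. cis (\<xi> \<bullet> x) * dir_deriv v \<phi> x + ((\<xi> \<bullet> v) *\<^sub>R (\<i> * cis (\<xi> \<bullet> x))) * \<phi> x)"
      unfolding eq by (intro Bochner_Integration.integrable_add integrable_mult_right i1 schwartz_dir_deriv assms)
  qed (rule i1[OF assms])
  then have "(LINT x|lborel. cis (\<xi> \<bullet> x) * dir_deriv v \<phi> x) + (\<i> * complex_of_real (\<xi> \<bullet> v)) * (LINT x|lborel. cis (\<xi> \<bullet> x) * \<phi> x) = 0"
    unfolding eq using i1[OF assms] i1[OF schwartz_dir_deriv[OF assms]] by simp
  then show ?thesis by (simp add: ftr_def eq_neg_iff_add_eq_0)
qed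

text \<open>Phrased along a curve because it is applied to the backward flow line through a fixed
  point. Differentiation under the integral brings down the factors x_j, and the bound
  \<open>K\<close> on the speed yields a majorant.\<close>

lemma ftr_path_derivative:
  fixes \<phi> :: "real^'n \<Rightarrow> complex"
  assumes \<phi>: "\<phi> \<in> schwartz" and S: "convex S" "s \<in> S"
    and \<gamma>: "\<And>s. s \<in> S \<Longrightarrow> (\<gamma> has_vector_derivative \<gamma>' s) (at s within S)"
    and K: "\<And>s. s \<in> S \<Longrightarrow> norm (\<gamma>' s) \<le> K"
  shows "((\<lambda>s. ftr 1 \<phi> (\<gamma> s)) has_vector_derivative
     (\<Sum>j\<in>UNIV. \<i> * complex_of_real (\<gamma>' s $ j) * ftr 1 (\<lambda>x. complex_of_real (x $ j) * \<phi> x) (\<gamma> s))) (at s within S)"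
proof -
  let ?f' = "\<lambda>s x. \<i> * complex_of_real (\<gamma>' s \<bullet> x) * (cis (\<gamma> s \<bullet> x) * \<phi> x)"
  have \<phi>m: "\<phi> \<in> borel_measurable borel" by (rule bciD(3)[OF schwartz_bci[OF \<phi>]])
  have "((\<lambda>s. LINT x|lborel. cis (\<gamma> s \<bullet> x) * \<phi> x) has_vector_derivative (LINT x|lborel. ?f' s x)) (at s within S)"
  proof (rule leibniz_lebesgue[OF S, where g = "\<lambda>x. K * (\<Sum>j\<in>UNIV. cmod (complex_of_real (x $ j) * \<phi> x))"])
    show "integrable lborel (\<lambda>x. cis (\<gamma> s \<bullet> x) * \<phi> x)" for s
      using cis_mult_integrable[OF schwartz_integrable[OF \<phi>], of 1] by simp
    show "((\<lambda>s. cis (\<gamma> s \<bullet> x) * \<phi> x) has_vector_derivative ?f' s x) (at s within S)" if "s \<in> S" for s x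
    proof -
      have 1: "((\<lambda>s. \<gamma> s \<bullet> x) has_derivative (\<lambda>h. h * (\<gamma>' s \<bullet> x))) (at s within S)"
        using bounded_linear.has_derivative[OF bounded_linear_inner_left \<gamma>[OF that, unfolded has_vector_derivative_def]]
        by simp
      from has_derivative_mult_left[OF has_derivative_compose[OF 1 has_derivative_cis_real], of "\<phi> x"]
      show ?thesis by (simp add: has_vector_derivative_def scaleR_conv_of_real mult_ac)
    qed
    show "norm (?f' s x) \<le> K * (\<Sum>j\<in>UNIV. cmod (complex_of_real (x $ j) * \<phi> x))" if "s \<in> S" for s x
    proof -
      have "norm (?f' s x) = \<bar>\<gamma>' s \<bullet> x\<bar> * cmod (\<phi> x)" by (simp add: norm_mult)
      also have "\<dots> \<le> (K * norm x) * cmod (\<phi> x)"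
        by (intro mult_right_mono order_trans[OF Cauchy_Schwarz_ineq2 mult_right_mono[OF K[OF that]]]) auto
      also have "\<dots> \<le> (K * (\<Sum>j\<in>UNIV. \<bar>x $ j\<bar>)) * cmod (\<phi> x)"
        using order_trans[OF norm_ge_zero K[OF that]] by (intro mult_right_mono mult_left_mono norm_le_l1_cart) auto
      also have "\<dots> = K * (\<Sum>j\<in>UNIV. cmod (complex_of_real (x $ j) * \<phi> x))"
        by (simp add: norm_mult sum_distrib_right sum_distrib_left mult.assoc)
      finally show ?thesis .
    qed
    show "integrable lborel (\<lambda>x. K * (\<Sum>j\<in>UNIV. cmod (complex_of_real (x $ j) * \<phi> x)))"
      by (intro integrable_mult_right Bochner_Integration.integrable_sum integrable_norm schwartz_integrable schwartz_coord_mult \<phi>)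
    show "?f' s \<in> borel_measurable lborel" using \<phi>m by measurable
  qed
  also have "(LINT x|lborel. ?f' s x) = (LINT x|lborel. (\<Sum>j\<in>UNIV. \<i> * complex_of_real (\<gamma>' s $ j) * (cis (\<gamma> s \<bullet> x) * (complex_of_real (x $ j) * \<phi> x))))"
    by (intro Bochner_Integration.integral_cong) (auto simp: inner_vec_def sum_distrib_left sum_distrib_right mult_ac)
  also have "\<dots> = (\<Sum>j\<in>UNIV. \<i> * complex_of_real (\<gamma>' s $ j) * ftr 1 (\<lambda>x. complex_of_real (x $ j) * \<phi> x) (\<gamma> s))"
  proof -
    have "integrable lborel (\<lambda>x. cis (\<gamma> s \<bullet> x) * (complex_of_real (x $ j) * \<phi> x))" for j
      using cis_mult_integrable[OF schwartz_integrable[OF schwartz_coord_mult[OF \<phi>, of j]], of 1 "\<gamma> s"] by simp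
    then show ?thesis by (simp add: ftr_def)
  qed
  finally show ?thesis by (simp add: ftr_def)
qed

section \<open>Schwartz functions separate distributions\<close>

lemma real_polynomial_function_growth:
  fixes p :: "'a::real_normed_vector \<Rightarrow> real"
  assumes "real_polynomial_function p"
  shows "\<exists>C\<ge>0. \<exists>N. \<forall>x. \<bar>p x\<bar> \<le> C * (1 + norm x) ^ N"
  using assms
proof induction
  case (linear f)
  then obtain K where K: "K > 0" "\<And>x. norm (f x) \<le> norm x * K" using bounded_linear.pos_bounded by blast
  have "\<bar>f x\<bar> \<le> K * (1 + norm x) ^ 1" for x using K(2)[of x] K(1) by (simp add: algebra_simps)
  then show ?case using K(1) by (intro exI[of _ K] conjI exI[of _ 1]) auto
next
  case (const c)
  show ?case by (intro exI[of _ "\<bar>c\<bar>"] conjI exI[of _ 0]) auto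
next
  case (add f g)
  then obtain C N D M where C: "C \<ge> 0" "\<And>x. \<bar>f x\<bar> \<le> C * (1 + norm x) ^ N" and D: "D \<ge> 0" "\<And>x. \<bar>g x\<bar> \<le> D * (1 + norm x) ^ M"
    by blast
  have "\<bar>f x + g x\<bar> \<le> (C + D) * (1 + norm x) ^ (N + M)" for x
  proof -
    have "C * (1 + norm x) ^ N \<le> C * (1 + norm x) ^ (N + M)" "D * (1 + norm x) ^ M \<le> D * (1 + norm x) ^ (N + M)"
      using C(1) D(1) by (auto intro!: mult_left_mono power_increasing)
    then show ?thesis using C(2)[of x] D(2)[of x] by (simp add: algebra_simps)
  qed
  then show ?case using C(1) D(1) by (intro exI[of _ "C + D"] conjI exI[of _ "N + M"]) auto
next
  case (mult f g)
  then obtain C N D M where C: "C \<ge> 0" "\<And>x. \<bar>f x\<bar> \<le> C * (1 + norm x) ^ N" and D: "D \<ge> 0" "\<And>x. \<bar>g x\<bar> \<le> D * (1 + norm x) ^ M"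
    by blast
  have "\<bar>f x * g x\<bar> \<le> (C * D) * (1 + norm x) ^ (N + M)" for x
    using mult_mono[OF C(2)[of x] D(2)[of x]] C(1) by (simp add: abs_mult power_add mult_ac)
  then show ?case using C(1) D(1) by (intro exI[of _ "C * D"] conjI exI[of _ "N + M"]) auto
qed

lemma gauss_rapid_decay:
  fixes b :: "'a::euclidean_space"
  assumes h: "h \<noteq> 0"
  shows "\<exists>K. \<forall>x. (1 + norm x) ^ N * gauss (h *\<^sub>R (x - b)) \<le> K"
proof (cases "N = 0")
  case True
  then show ?thesis using gauss_le_1 by auto
next
  case False
  \<comment> \<open>With this \<open>c\<close> the Gaussian is the N-th power of exp (- c r^2),
    where r is the distance to b; this reduces the claim to a bound for (1 + r) exp (- c
    r^2).\<close>
  define c where "c = h\<^sup>2 / (2 * N)"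
  have c: "c > 0" using h False by (simp add: c_def)
  have 1: "(1 + r) * exp (- (c * r\<^sup>2)) \<le> 2 + 1 / c" if "r \<ge> 0" for r :: real
  proof -
    have "r \<le> 1 + r\<^sup>2" using zero_le_power2[of "r - 1/2"] by (simp add: power2_eq_square algebra_simps)
    then have "1 + r \<le> (2 + 1 / c) * (1 + c * r\<^sup>2)"
    proof -
      have "(2 + 1 / c) * (1 + c * r\<^sup>2) = 2 + 2 * (c * r\<^sup>2) + 1 / c + r\<^sup>2" using c by (simp add: field_simps)
      moreover have "c * r\<^sup>2 \<ge> 0" "1 / c \<ge> 0" using c by simp_all
      ultimately show ?thesis using \<open>r \<le> 1 + r\<^sup>2\<close> by linarith
    qed
    also have "\<dots> \<le> (2 + 1 / c) * exp (c * r\<^sup>2)"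
      using c by (intro mult_left_mono exp_ge_add_one_self) auto
    finally show ?thesis by (simp add: exp_minus field_simps)
  qed
  have "(1 + norm x) ^ N * gauss (h *\<^sub>R (x - b)) \<le> ((1 + norm b) * (2 + 1 / c)) ^ N" for x
  proof -
    define r where "r = norm (x - b)"
    have g: "gauss (h *\<^sub>R (x - b)) = exp (- (c * r\<^sup>2)) ^ N"
      using False by (simp add: gauss_def c_def r_def power_mult_distrib exp_of_nat_mult[symmetric])
    have "norm x \<le> norm b + r" unfolding r_def by (rule norm_triangle_sub)
    also have "\<dots> \<le> (1 + norm b) * (1 + r) - 1" by (simp add: r_def algebra_simps)
    finally have "1 + norm x \<le> (1 + norm b) * (1 + r)" by simp
    then have "(1 + norm x) * exp (- (c * r\<^sup>2)) \<le> (1 + norm b) * ((1 + r) * exp (- (c * r\<^sup>2)))"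
      by (simp add: mult.assoc[symmetric] mult_right_mono)
    also have "\<dots> \<le> (1 + norm b) * (2 + 1 / c)" using 1[of r] by (intro mult_left_mono) (auto simp: r_def)
    finally show ?thesis unfolding g power_mult_distrib[symmetric] by (intro power_mono) auto
  qed
  then show ?thesis by blast
qed

lemma gauss_schwartz:
  fixes b :: "real^'n"
  assumes h: "h \<noteq> 0"
  shows "(\<lambda>x. complex_of_real (gauss (h *\<^sub>R (x - b)))) \<in> schwartz"
proof -
  define G where "G = (\<lambda>x. gauss (h *\<^sub>R (x - b)))"
  let ?X = "{\<lambda>x. complex_of_real (p x * G x) | p :: real^'n \<Rightarrow> real. real_polynomial_function p}"
  have G: "(G has_derivative (\<lambda>y. - (h\<^sup>2 * ((x - b) \<bullet> y)) * G x)) (at x)" for x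
  proof -
    have 1: "((\<lambda>x. - (h\<^sup>2 * ((x - b) \<bullet> (x - b))) / 2) has_derivative (\<lambda>y. - (h\<^sup>2 * ((x - b) \<bullet> y)))) (at x)"
      by (auto intro!: derivative_eq_intros simp: inner_commute field_simps)
    have "G = (\<lambda>x. exp (- (h\<^sup>2 * ((x - b) \<bullet> (x - b))) / 2))"
      by (simp add: G_def gauss_def power_mult_distrib power2_norm_eq_inner)
    with has_derivative_exp[OF 1] show ?thesis by (simp add: mult.commute)
  qed
  show ?thesis
  proof (rule schwartz_coinduct[where X = ?X])
    show "(\<lambda>x. complex_of_real (gauss (h *\<^sub>R (x - b)))) \<in> ?X"
      unfolding mem_Collect_eq by (intro exI[of _ "\<lambda>x. 1"]) (auto simp: G_def intro: real_polynomial_function.intros)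
  next
    fix f assume "f \<in> ?X"
    then obtain p where f: "f = (\<lambda>x. complex_of_real (p x * G x))" and p: "real_polynomial_function p" by blast
    obtain p' where p': "\<And>x. (p has_derivative p' x) (at x)" "\<And>y. real_polynomial_function (\<lambda>x. p' x y)"
      using real_polynomial_function_derivative[OF p] by blast
    have D: "(f has_derivative (\<lambda>y. complex_of_real (p x * (- (h\<^sup>2 * ((x - b) \<bullet> y)) * G x) + p' x y * G x))) (at x)" for x
      unfolding f by (intro derivative_intros p' G)
    show "f differentiable (at x)" for x using D unfolding differentiable_def by blast
    show "dir_deriv v f \<in> ?X" for v
    proof -
      define q where "q = (\<lambda>x. p x * ((- h\<^sup>2) * (x \<bullet> v + (- (b \<bullet> v)))) + p' x v)"
      have "real_polynomial_function (\<lambda>x. x \<bullet> v)"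
        by (intro real_polynomial_function.intros(1) bounded_linear_inner_left)
      then have "real_polynomial_function q"
        unfolding q_def by (intro real_polynomial_function.intros(2-4) p p')
      moreover have "dir_deriv v f = (\<lambda>x. complex_of_real (q x * G x))"
        unfolding dir_deriv_eqI[OF D] q_def by (intro ext arg_cong[where f = complex_of_real]) (simp add: inner_diff_left algebra_simps)
      ultimately show ?thesis unfolding mem_Collect_eq by (intro exI[of _ q]) simp
    qed
    show "bounded (range (\<lambda>x. norm x ^ k *\<^sub>R f x))" for k
    proof -
      obtain C N where C: "C \<ge> 0" "\<And>x. \<bar>p x\<bar> \<le> C * (1 + norm x) ^ N"
        using real_polynomial_function_growth[OF p] by blast
      obtain K where K: "\<And>x. (1 + norm x) ^ (k + N) * gauss (h *\<^sub>R (x - b)) \<le> K"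
        using gauss_rapid_decay[OF h, of "k + N" b] by blast
      have "norm (norm x ^ k *\<^sub>R f x) \<le> C * K" for x
      proof -
        have "norm (norm x ^ k *\<^sub>R f x) = norm x ^ k * \<bar>p x\<bar> * G x"
          by (simp add: f G_def norm_mult)
        also have "\<dots> \<le> (1 + norm x) ^ k * (C * (1 + norm x) ^ N) * G x"
          using C by (intro mult_right_mono mult_mono power_mono) (auto simp: G_def)
        also have "\<dots> = C * ((1 + norm x) ^ (k + N) * G x)" by (simp add: power_add)
        also have "\<dots> \<le> C * K" unfolding G_def by (intro mult_left_mono K C)
        finally show ?thesis .
      qed
      then show ?thesis unfolding bounded_iff by auto
    qed
  qed
qed

text \<open>A Gaussian weight in \<open>y\<close> is traded for one of half the rate in the nearby
  point \<open>x\<close>, since |x|^2 \<le> 2 |y|^2 + 2 R^2. This is how majorants on a product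
  space become integrable in both variables.\<close>

lemma gauss_half_bound:
  fixes x y :: "'a::euclidean_space"
  assumes "norm (x - y) \<le> R" "c \<ge> 0"
  shows "exp (- c * (norm y)\<^sup>2) \<le> exp (c * R\<^sup>2) * exp (- c * (norm x)\<^sup>2 / 2)"
proof -
  have "(norm x)\<^sup>2 \<le> (norm y + R)\<^sup>2"
    using assms(1) norm_triangle_sub[of x y] by (intro power_mono) auto
  also have "\<dots> \<le> 2 * (norm y)\<^sup>2 + 2 * R\<^sup>2"
    using zero_le_power2[of "norm y - R"] by (simp add: power2_sum power2_diff)
  finally have "(norm x)\<^sup>2 / 2 - R\<^sup>2 \<le> (norm y)\<^sup>2" by simp
  then have "c * ((norm x)\<^sup>2 / 2 - R\<^sup>2) \<le> c * (norm y)\<^sup>2" using assms(2) by (rule mult_left_mono)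
  then show ?thesis by (simp add: algebra_simps flip: exp_add)
qed

lemma gauss_L2:
  assumes "h \<noteq> 0"
  shows "(\<lambda>x::real^'n. complex_of_real (gauss (h *\<^sub>R x))) \<in> L2"
  using bci_L2[OF schwartz_bci[OF gauss_schwartz[OF assms, of 0]]] by simp

lemma L2_gauss_integrable:
  fixes z :: "real^'n \<Rightarrow> complex"
  assumes "z \<in> L2" "h \<noteq> 0"
  shows "integrable lborel (\<lambda>x. z x * complex_of_real (gauss (h *\<^sub>R x)))"
  by (rule L2_mult_integrable[OF assms(1) gauss_L2[OF assms(2)]])

text \<open>Averages of translated Gaussians, which are Schwartz functions, approximate \<open>f\<close>.\<close>

lemma schwartz_separating_Cc:
  fixes z :: "real^'n \<Rightarrow> complex"
  assumes z: "z \<in> L2" and zero: "\<And>\<phi>. \<phi> \<in> schwartz \<Longrightarrow> (LINT x|lborel. z x * \<phi> x) = 0" and f: "f \<in> Cc"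
  shows "(LINT x|lborel. z x * f x) = 0"
proof -
  note [measurable] = L2_measurable[OF z] Cc_measurable[OF f]
  obtain K where K: "K > 0" "\<And>x. cmod (f x) \<le> K" using Cc_bounded[OF f] by blast
  obtain R where R: "R > 0" "\<And>x. norm x > R \<Longrightarrow> f x = 0" using Cc_support[OF f] by blast
  \<comment> \<open>One half of the Gaussian exponent in \<zeta> stays for integrability in \<zeta>;
    the other half becomes, by \<open>gauss_half_bound\<close> on the support of \<open>f\<close>, a
    Gaussian in \<xi> that makes \<open>z\<close> integrable. The constants are those of
    \<open>gauss_half_bound\<close> with rate 1/4.\<close>
  define D where "D = (\<lambda>(\<xi>, \<zeta>). norm ((z \<xi> * complex_of_real (gauss ((1/2) *\<^sub>R \<xi>))) * (complex_of_real (K * exp (R\<^sup>2 / 4)) * complex_of_real (gauss ((1 / sqrt 2) *\<^sub>R (\<zeta> :: real^'n))))))"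
  have limit: "(\<lambda>i. LINT \<xi>|lborel. z \<xi> * (LINT y|lborel. f y * complex_of_real ((sqrt (2 * pi) / (1 / Suc i)) ^ CARD('n) * gauss ((\<xi> - y) /\<^sub>R (1 / Suc i)))))
     \<longlonglongrightarrow> complex_of_real ((2 * pi) ^ CARD('n)) * (LINT \<xi>|lborel. z \<xi> * f \<xi>)"
  proof (rule gauss_approximate_identity)
    have "integrable lborel (\<lambda>\<zeta>::real^'n. complex_of_real (K * exp (R\<^sup>2 / 4)) * complex_of_real (gauss ((1 / sqrt 2) *\<^sub>R \<zeta>)))"
      by (intro integrable_mult_right integrable_of_real gauss_fourier_scaled(1)) simp
    from integrable_norm[OF pair_product_integrable[OF L2_gauss_integrable[OF z, of "1/2"] this]]
    show "integrable (lborel \<Otimes>\<^sub>M lborel) D" by (simp only: D_def case_prod_unfold)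
    show "cmod (z \<xi> * f (\<xi> - h *\<^sub>R \<zeta>)) * gauss \<zeta> \<le> D (\<xi>, \<zeta>)" if h: "0 < h" "h \<le> 1" for h \<xi> \<zeta>
    proof (cases "norm (\<xi> - h *\<^sub>R \<zeta>) \<le> R")
      case True
      have "exp (- (1/4) * (norm \<zeta>)\<^sup>2) \<le> exp (- (1/4) * (norm (h *\<^sub>R \<zeta>))\<^sup>2)"
        using h by (simp add: power_mult_distrib mult_left_le_one_le power_le_one)
      also have "\<dots> \<le> exp (1/4 * R\<^sup>2) * exp (- (1/4) * (norm \<xi>)\<^sup>2 / 2)" by (rule gauss_half_bound[OF True]) simp
      finally have g: "exp (- (1/4) * (norm \<zeta>)\<^sup>2) \<le> exp (R\<^sup>2 / 4) * gauss ((1/2) *\<^sub>R \<xi>)"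
        by (simp add: gauss_def power_mult_distrib power2_eq_square)
      have "gauss \<zeta> = exp (- (1/4) * (norm \<zeta>)\<^sup>2) * gauss ((1 / sqrt 2) *\<^sub>R \<zeta>)"
        by (simp add: gauss_def power_mult_distrib power_divide flip: exp_add)
      also have "\<dots> \<le> (exp (R\<^sup>2 / 4) * gauss ((1/2) *\<^sub>R \<xi>)) * gauss ((1 / sqrt 2) *\<^sub>R \<zeta>)"
        using g by (rule mult_right_mono) simp
      finally have "cmod (z \<xi> * f (\<xi> - h *\<^sub>R \<zeta>)) * gauss \<zeta> \<le> (cmod (z \<xi>) * K) * ((exp (R\<^sup>2 / 4) * gauss ((1/2) *\<^sub>R \<xi>)) * gauss ((1 / sqrt 2) *\<^sub>R \<zeta>))"
        unfolding norm_mult using K by (intro mult_mono mult_nonneg_nonneg) auto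
      also have "\<dots> = D (\<xi>, \<zeta>)" using K(1) by (simp add: D_def norm_mult mult_ac)
      finally show ?thesis .
    qed (use R in \<open>simp add: D_def\<close>)
  qed (use Cc_continuous[OF f] in auto)
  \<comment> \<open>Exchanging the integrals tests \<open>z\<close> against translated Gaussians,
    which are Schwartz functions at every scale \<open>h\<close>.\<close>
  have zero_i: "(LINT \<xi>|lborel. z \<xi> * (LINT y|lborel. f y * complex_of_real (c * gauss ((\<xi> - y) /\<^sub>R h)))) = 0"
    if h: "h > 0" for h c
  proof -
    have int: "integrable (lborel \<Otimes>\<^sub>M lborel) (\<lambda>(\<xi>, y). z \<xi> * (f y * complex_of_real (c * gauss ((\<xi> - y) /\<^sub>R h))))"
    proof -
      define c2 where "c2 = 1 / (2 * h\<^sup>2)"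
      have c2: "c2 \<ge> 0" by (simp add: c2_def)
      have ge: "gauss (x /\<^sub>R h) = exp (- c2 * (norm x)\<^sup>2)" for x :: "real^'n"
        using h by (simp add: gauss_def c2_def power_mult_distrib field_simps)
      have ge2: "gauss ((1 / (sqrt 2 * h)) *\<^sub>R x) = exp (- c2 * (norm x)\<^sup>2 / 2)" for x :: "real^'n"
        using h by (simp add: gauss_def c2_def power_mult_distrib field_simps)
      have I: "integrable (lborel \<Otimes>\<^sub>M lborel) (\<lambda>(\<xi>, y). (z \<xi> * complex_of_real (gauss ((1 / (sqrt 2 * h)) *\<^sub>R \<xi>))) * (complex_of_real (c * exp (c2 * R\<^sup>2)) * f y))"
        using h by (intro pair_product_integrable L2_gauss_integrable z integrable_mult_right Cc_integrable f) auto
      show ?thesis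
      proof (rule Bochner_Integration.integrable_bound[OF I], measurable, intro AE_I2)
        fix w :: "(real^'n) \<times> (real^'n)"
        obtain \<xi> y where w: "w = (\<xi>, y)" by (cases w)
        have "cmod (z \<xi> * (f y * complex_of_real (c * gauss ((\<xi> - y) /\<^sub>R h)))) \<le>
          cmod ((z \<xi> * complex_of_real (gauss ((1 / (sqrt 2 * h)) *\<^sub>R \<xi>))) * (complex_of_real (c * exp (c2 * R\<^sup>2)) * f y))"
        proof (cases "norm y \<le> R")
          case True
          then have "gauss ((\<xi> - y) /\<^sub>R h) \<le> exp (c2 * R\<^sup>2) * gauss ((1 / (sqrt 2 * h)) *\<^sub>R \<xi>)"
            unfolding ge ge2 using gauss_half_bound[of \<xi> "\<xi> - y" R c2] c2 by simp
          then have "(cmod (z \<xi>) * cmod (f y) * \<bar>c\<bar>) * gauss ((\<xi> - y) /\<^sub>R h) \<le> (cmod (z \<xi>) * cmod (f y) * \<bar>c\<bar>) * (exp (c2 * R\<^sup>2) * gauss ((1 / (sqrt 2 * h)) *\<^sub>R \<xi>))"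
            by (rule mult_left_mono) simp
          then show ?thesis by (simp add: norm_mult abs_mult mult_ac)
        qed (use R in simp)
        then show "norm (case w of (\<xi>, y) \<Rightarrow> z \<xi> * (f y * complex_of_real (c * gauss ((\<xi> - y) /\<^sub>R h)))) \<le>
          norm (case w of (\<xi>, y) \<Rightarrow> (z \<xi> * complex_of_real (gauss ((1 / (sqrt 2 * h)) *\<^sub>R \<xi>))) * (complex_of_real (c * exp (c2 * R\<^sup>2)) * f y))"
          by (simp only: w prod.case)
      qed
    qed
    have "(LINT \<xi>|lborel. z \<xi> * (LINT y|lborel. f y * complex_of_real (c * gauss ((\<xi> - y) /\<^sub>R h)))) =
      (LINT \<xi>|lborel. (LINT y|lborel. z \<xi> * (f y * complex_of_real (c * gauss ((\<xi> - y) /\<^sub>R h)))))" by simp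
    also have "\<dots> = (LINT y|lborel. (LINT \<xi>|lborel. z \<xi> * (f y * complex_of_real (c * gauss ((\<xi> - y) /\<^sub>R h)))))"
      by (rule lborel_pair.Fubini_integral[OF int, symmetric])
    also have "\<dots> = (LINT y|lborel. (f y * complex_of_real c) * (LINT \<xi>|lborel. z \<xi> * complex_of_real (gauss ((1 / h) *\<^sub>R (\<xi> - y)))))"
      using h by (simp add: mult_ac divide_inverse flip: integral_mult_right_zero)
    also have "\<dots> = 0" using h by (simp add: zero gauss_schwartz)
    finally show ?thesis .
  qed
  have "complex_of_real ((2 * pi) ^ CARD('n)) * (LINT \<xi>|lborel. z \<xi> * f \<xi>) = 0"
    using limit by (intro LIMSEQ_unique[OF limit]) (simp only: zero_i[of "1 / real (Suc _)"] of_nat_0_less_iff zero_less_divide_1_iff zero_less_Suc tendsto_const)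
  then show ?thesis by simp
qed

text \<open>The squared norm of \<open>z\<close> is its pairing with its own conjugate. Subtracting
  from the conjugate a close function of \<open>Cc\<close>, against which \<open>z\<close>
  integrates to 0, bounds the squared norm by the norm times an arbitrary \<open>e\<close>.\<close>

lemma schwartz_separating:
  fixes z :: "real^'n \<Rightarrow> complex"
  assumes z: "z \<in> L2" and zero: "\<And>\<phi>. \<phi> \<in> schwartz \<Longrightarrow> (LINT x|lborel. z x * \<phi> x) = 0"
  shows "AE x in lborel. z x = 0"
proof (rule L2norm_eq_0_AE[OF z])
  have "L2norm z \<le> 0"
  proof (rule field_le_epsilon)
    fix e :: real assume e: "e > 0"
    obtain f where f: "f \<in> Cc" "L2norm (\<lambda>x. cnj (z x) - f x) < e"
      using Cc_dense[OF L2_cnj[OF z] e] by blast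
    have d: "(\<lambda>x. cnj (z x) - f x) \<in> L2" by (intro L2_diff L2_cnj z Cc_L2 f)
    have "complex_of_real ((L2norm z)\<^sup>2) = (LINT x|lborel. z x * cnj (z x))"
      by (simp only: L2norm_square complex_norm_square[symmetric] integral_complex_of_real)
    also have "\<dots> = (LINT x|lborel. z x * (cnj (z x) - f x) + z x * f x)" by (simp add: algebra_simps)
    also have "\<dots> = (LINT x|lborel. z x * (cnj (z x) - f x))"
      using L2_mult_integrable[OF z d] L2_mult_integrable[OF z Cc_L2[OF f(1)]] schwartz_separating_Cc[OF z zero f(1)] by simp
    finally have "(L2norm z)\<^sup>2 \<le> L2norm z * L2norm (\<lambda>x. cnj (z x) - f x)"
      using L2_Cauchy_Schwarz[OF z d] by (metis norm_of_real abs_of_nonneg zero_le_power2)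
    also have "\<dots> \<le> L2norm z * e" using f(2) by (intro mult_left_mono) auto
    finally show "L2norm z \<le> 0 + e"
      using e by (cases "L2norm z = 0") (auto simp: power2_eq_square less_le)
  qed
  then show "L2norm z = 0" by (simp add: antisym)
qed

lemma represents_unique_AE:
  fixes f g :: "real^'n \<Rightarrow> complex"
  assumes "f \<in> L2" "g \<in> L2" "represents f T" "represents g T"
  shows "AE x in lborel. f x = g x"
proof -
  have "AE x in lborel. f x - g x = 0"
  proof (rule schwartz_separating[OF L2_diff[OF assms(1,2)]])
    fix \<phi> :: "real^'n \<Rightarrow> complex" assume \<phi>: "\<phi> \<in> schwartz"
    note L2_mult_integrable[OF assms(1) bci_L2[OF schwartz_bci[OF \<phi>]]] L2_mult_integrable[OF assms(2) bci_L2[OF schwartz_bci[OF \<phi>]]]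
    moreover have "distr_of f \<phi> = distr_of g \<phi>" using assms(3,4) \<phi> by (metis represents_def)
    ultimately show "(LINT x|lborel. (f x - g x) * \<phi> x) = 0"
      by (simp add: left_diff_distrib distr_of_def)
  qed
  then show ?thesis by simp
qed

section \<open>The Fourier transform of an inverse transform\<close>

lemma distr_of_inv_fourier:
  fixes v :: "real^'n \<Rightarrow> complex"
  assumes v: "v \<in> bci" and \<phi>: "\<phi> \<in> schwartz"
  shows "distr_of (inv_fourier v) \<phi> = (LINT \<xi>|lborel. v \<xi> * inv_fourier \<phi> \<xi>)"
  unfolding distr_of_def inv_fourier_ftr
  using ftr_swap[OF bciD(2)[OF v] schwartz_integrable[OF \<phi>], of 1] by (simp add: mult_ac)

text \<open>\<open>fourier_L2\<close> is a choice among representatives. By Parseval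
  \<open>v\<close> itself represents the distributional transform of \<open>inv_fourier v\<close>,
  and representatives in L^2 agree almost everywhere.\<close>

lemma fourier_L2_inv_fourier:
  fixes v :: "real^'n \<Rightarrow> complex"
  assumes v: "v \<in> bci"
  shows "fourier_L2 (inv_fourier v) \<in> L2" "AE \<xi> in lborel. fourier_L2 (inv_fourier v) \<xi> = v \<xi>"
proof -
  let ?T = "\<lambda>\<phi>. distr_of (inv_fourier v) (fourier \<phi>)"
  have rep: "represents v ?T"
    unfolding represents_def
  proof
    fix \<phi> :: "real^'n \<Rightarrow> complex" assume "\<phi> \<in> schwartz"
    from parseval[OF v schwartz_bci[OF this]] show "?T \<phi> = distr_of v \<phi>"
      by (simp add: distr_of_def fourier_ftr inv_fourier_ftr mult.assoc)
  qed
  have "fourier_L2 (inv_fourier v) \<in> L2 \<and> represents (fourier_L2 (inv_fourier v)) ?T"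
    unfolding fourier_L2_def by (rule someI[of _ v]) (use bci_L2[OF v] rep in simp)
  then show "fourier_L2 (inv_fourier v) \<in> L2" "AE \<xi> in lborel. fourier_L2 (inv_fourier v) \<xi> = v \<xi>"
    using represents_unique_AE[OF _ bci_L2[OF v] _ rep] by auto
qed

section \<open>Evolution on the Fourier side\<close>

lemma continuous_on_ftr:
  fixes f :: "real^'n \<Rightarrow> complex"
  assumes f: "integrable lborel f"
  shows "continuous_on UNIV (ftr \<sigma> f)"
proof -
  have "(\<lambda>i. ftr \<sigma> f (X i)) \<longlonglongrightarrow> ftr \<sigma> f x" if X: "X \<longlonglongrightarrow> x" for X x
    unfolding ftr_def
  proof (rule integral_dominated_convergence[where w = "\<lambda>y. norm (f y)"])
    show "AE y in lborel. (\<lambda>i. cis (\<sigma> * (X i \<bullet> y)) * f y) \<longlonglongrightarrow> cis (\<sigma> * (x \<bullet> y)) * f y"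
      by (intro AE_I2 tendsto_intros X)
  qed (use f in \<open>auto simp: norm_mult dest: borel_measurable_integrable\<close>)
  then show ?thesis
    by (intro continuous_at_imp_continuous_on ballI) (simp add: continuous_at_sequentially o_def)
qed

lemma ftr_lincomb:
  assumes "integrable lborel f" "integrable lborel g"
  shows "ftr \<sigma> (\<lambda>x. a * f x + b * g x) \<xi> = a * ftr \<sigma> f \<xi> + b * ftr \<sigma> g \<xi>"
proof -
  have "cis (\<sigma> * (\<xi> \<bullet> y)) * (a * f y + b * g y) = a * (cis (\<sigma> * (\<xi> \<bullet> y)) * f y) + b * (cis (\<sigma> * (\<xi> \<bullet> y)) * g y)" for y
    by (simp add: algebra_simps)
  then show ?thesis
    unfolding ftr_def using cis_mult_integrable[OF assms(1), of \<sigma> \<xi>] cis_mult_integrable[OF assms(2), of \<sigma> \<xi>] by simp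
qed

lemma inv_fourier_lincomb:
  assumes "f \<in> bci" "g \<in> bci"
  shows "inv_fourier (\<lambda>x. a * f x + b * g x) \<xi> = a * inv_fourier f \<xi> + b * inv_fourier g \<xi>"
  unfolding inv_fourier_ftr ftr_lincomb[OF bciD(2)[OF assms(1)] bciD(2)[OF assms(2)]] by (simp only: distrib_left mult.left_commute)

lemma Cc_lincomb:
  assumes "f \<in> Cc" "g \<in> Cc"
  shows "(\<lambda>x. a * f x + b * g x) \<in> Cc"
proof -
  obtain R where R: "\<And>x. norm x > R \<Longrightarrow> f x = 0" using Cc_support[OF assms(1)] by blast
  obtain R' where R': "\<And>x. norm x > R' \<Longrightarrow> g x = 0" using Cc_support[OF assms(2)] by blast
  have "continuous_on UNIV (\<lambda>x. a * f x + b * g x)"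
    by (intro continuous_intros Cc_continuous assms)
  moreover have "a * f x + b * g x = 0" if "norm x > max R R'" for x using R[of x] R'[of x] that by simp
  ultimately show ?thesis by (auto simp: Cc_def intro!: exI[of _ "max R R'"])
qed

lemma Cc_mult:
  assumes "f \<in> Cc" "continuous_on UNIV m"
  shows "(\<lambda>x. m x * f x) \<in> Cc"
proof -
  obtain R where "\<And>x. norm x > R \<Longrightarrow> f x = 0" using Cc_support[OF assms(1)] by blast
  then show ?thesis
    using assms(2) Cc_continuous[OF assms(1)] by (auto simp: Cc_def intro!: continuous_intros exI[of _ R])
qed

lemma dissip_nonneg: "pos_semidef Q \<Longrightarrow> s > 0 \<Longrightarrow> dissip s Q M t \<xi> \<ge> 0"
  unfolding dissip_def
  by (intro integral_nonneg integrable_continuous_interval continuous_on_symb continuous_on_mexp_flow continuous_intros symb_nonneg)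

lemma continuous_on_dissip:
  assumes "pos_semidef Q" "s > 0" "continuous_on S f"
  shows "continuous_on S (\<lambda>x. dissip s Q M t (f x))"
proof -
  have "continuous_on UNIV (\<lambda>\<xi>. integral (cbox 0 t) (\<lambda>\<tau>. symb s Q (mexp M \<tau> *v \<xi>)))"
    by (rule integral_continuous_on_param)
      (auto simp: split_beta intro!: continuous_on_symb continuous_on_mexp_flow continuous_intros assms)
  then have "continuous_on UNIV (dissip s Q M t)" by (simp add: dissip_def[abs_def])
  from continuous_on_compose2[OF this assms(3)] show ?thesis by simp
qed

lemma symb_path_integral_derivative:
  assumes "pos_semidef Q" "s > 0" "continuous_on {0..a} \<gamma>" "t \<in> {0..a}"
  shows "((\<lambda>t. integral {0..t} (\<lambda>\<tau>. symb s Q (\<gamma> \<tau>))) has_real_derivative symb s Q (\<gamma> t)) (at t within {0..a})"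
  by (rule integral_has_real_derivative) (use assms in \<open>auto intro: continuous_on_symb\<close>)

text \<open>Time reversal of the path, phrased through an antiderivative. With \<eta> held fixed,
  \<open>t\<close> enters the right-hand side only as the upper limit, so after the change of
  variables \<xi> = e^(-tM) \<eta> the damping is differentiable in \<open>t\<close> although the
  symbol need not be smooth.\<close>

lemma dissip_backward:
  assumes Q: "pos_semidef Q" and s: "s > 0" and t: "t \<ge> 0"
  shows "dissip s Q M t (mexp M (- t) *v \<eta>) = integral {0..t} (\<lambda>\<tau>. symb s Q (mexp M (- \<tau>) *v \<eta>))"
proof -
  define G where "G = (\<lambda>x. integral {0..x} (\<lambda>\<tau>. symb s Q (mexp M (- \<tau>) *v \<eta>)))"
  have "((\<lambda>\<tau>. symb s Q (mexp M \<tau> *v (mexp M (- t) *v \<eta>))) has_integral (- G (t - t) - - G (t - 0))) {0..t}"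
  proof (rule fundamental_theorem_of_calculus[OF t])
    fix x assume x: "x \<in> {0..t}"
    have "(G has_real_derivative symb s Q (mexp M (- (t - x)) *v \<eta>)) (at (t - x) within (\<lambda>x. t - x) ` {0..t})"
      unfolding G_def
      by (rule DERIV_subset[OF symb_path_integral_derivative[OF Q s, where a = t]])
        (use x in \<open>auto intro!: continuous_on_mexp_flow continuous_intros\<close>)
    moreover have "((\<lambda>x. t - x) has_real_derivative -1) (at x within {0..t})" by (auto intro!: derivative_eq_intros)
    ultimately have "((\<lambda>x. G (t - x)) has_real_derivative symb s Q (mexp M (- (t - x)) *v \<eta>) * -1) (at x within {0..t})"
      by (rule DERIV_image_chain[unfolded o_def])
    from DERIV_minus[OF this]
    show "((\<lambda>x. - G (t - x)) has_vector_derivative symb s Q (mexp M x *v (mexp M (- t) *v \<eta>))) (at x within {0..t})"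
      by (simp add: has_real_derivative_iff_has_vector_derivative mexp_add[symmetric])
  qed
  then show ?thesis by (simp add: dissip_def integral_unique G_def)
qed

section \<open>The explicit evolution and its derivative in time\<close>

definition evo :: "real \<Rightarrow> real^'n^'n \<Rightarrow> real^'n^'n \<Rightarrow> real \<Rightarrow> (real^'n \<Rightarrow> complex) \<Rightarrow> real^'n \<Rightarrow> complex" where
  "evo s Q M t v \<xi> = complex_of_real (exp (t * trace M) * exp (- dissip s Q M t \<xi> / 2)) * v (mexp M t *v \<xi>)"

text \<open>The derivative of T_t v at t = 0. At later times \<open>evo_deriv\<close> gives T_t
  applied to this function, so only \<open>v\<close>, never T_t v, is differentiated in
  \<xi>.\<close>

definition evo_gen :: "real \<Rightarrow> real^'n^'n \<Rightarrow> real^'n^'n \<Rightarrow> (real^'n \<Rightarrow> complex) \<Rightarrow> real^'n \<Rightarrow> complex" where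
  "evo_gen s Q M v y = complex_of_real (trace M - symb s Q y / 2) * v y + frechet_derivative v (at y) (M *v y)"

lemma evo_0: "evo s Q M 0 v = v"
  by (simp add: evo_def dissip_def fun_eq_iff)

locale fractional_symbol =
  fixes s :: real and Q M :: "real^'n^'n"
  assumes Q: "pos_semidef Q" and s: "s > 0"
begin

lemma evo_Cc:
  assumes "v \<in> Cc"
  shows "evo s Q M t v \<in> Cc"
  unfolding evo_def[abs_def]
  by (intro Cc_mult[OF Cc_flow[OF assms]] continuous_intros continuous_on_dissip Q s) auto

lemma evo_le: "cmod (evo s Q M t v \<xi>) \<le> exp (t * trace M) * cmod (v (mexp M t *v \<xi>))"
  using dissip_nonneg[OF Q s, of M t \<xi>]
  by (simp add: evo_def norm_mult mult_left_le_one_le mult_right_mono mult.commute[of _ "exp (- _)"] mult.assoc)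

lemma evo_uniform_bound:
  assumes "v \<in> Cc"
  obtains K R where "K > 0" "\<And>t \<xi>. t \<in> {0..a} \<Longrightarrow> cmod (evo s Q M t v \<xi>) \<le> indicator (cball 0 R) \<xi> *\<^sub>R K"
proof -
  obtain K where K: "K > 0" "\<And>x. cmod (v x) \<le> K" using Cc_bounded[OF assms] by blast
  obtain R where R: "R > 0" "\<And>x. norm x > R \<Longrightarrow> v x = 0" using Cc_support[OF assms] by blast
  obtain C where C: "C \<ge> 1" "\<And>t x. \<bar>t\<bar> \<le> a \<Longrightarrow> norm (mexp M t *v x) \<le> C * norm x"
    by (rule mexp_flow_bound[of a M]) blast
  show ?thesis
  proof (rule that)
    show "exp (a * \<bar>trace M\<bar>) * K > 0" using K by simp
    show "cmod (evo s Q M t v \<xi>) \<le> indicator (cball 0 (C * R)) \<xi> *\<^sub>R (exp (a * \<bar>trace M\<bar>) * K)" if t: "t \<in> {0..a}" for t \<xi>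
    proof (cases "norm \<xi> \<le> C * R")
      case True
      have "t * trace M \<le> t * \<bar>trace M\<bar>" using t by (intro mult_left_mono) auto
      also have "\<dots> \<le> a * \<bar>trace M\<bar>" using t by (intro mult_right_mono) auto
      finally have "exp (t * trace M) * cmod (v (mexp M t *v \<xi>)) \<le> exp (a * \<bar>trace M\<bar>) * K"
        using K by (intro mult_mono) auto
      then show ?thesis using evo_le[of t v \<xi>] True by simp
    next
      case False
      have "norm \<xi> \<le> C * norm (mexp M t *v \<xi>)" using C(2)[of "- t" "mexp M t *v \<xi>"] t by simp
      then have "C * R < C * norm (mexp M t *v \<xi>)" using False by linarith
      then have "norm (mexp M t *v \<xi>) > R" using C(1) by simp
      then show ?thesis using R(2) False by (simp add: evo_def)
    qed
  qed
qed

lemma evo_gen_Cc: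
  assumes "v \<in> C1c"
  shows "evo_gen s Q M v \<in> Cc"
proof -
  obtain v' R where v': "\<And>x. (v has_derivative v' x) (at x)"
    "\<And>g h. continuous_on UNIV g \<Longrightarrow> continuous_on UNIV h \<Longrightarrow> continuous_on UNIV (\<lambda>x::real^'n. v' (g x) (h x))"
    and R: "R > 0" "\<And>x. norm x > R \<Longrightarrow> v x = 0" "\<And>x y. norm x > R \<Longrightarrow> v' x y = 0"
    by (rule C1cE[OF assms]) blast
  have fd: "frechet_derivative v (at x) = v' x" for x using frechet_derivative_at[OF v'(1)] by simp
  have "continuous_on UNIV (\<lambda>x::real^'n. M *v x)"
    by (rule bounded_linear.continuous_on[OF matrix_vector_mul_bounded_linear continuous_on_id])
  then have "continuous_on UNIV (evo_gen s Q M v)"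
    unfolding evo_gen_def[abs_def] fd
    by (intro continuous_intros v'(2) Cc_continuous C1c_imp_Cc assms continuous_on_symb Q s) auto
  then show ?thesis unfolding Cc_def using R by (auto simp: evo_gen_def fd intro!: exI[of _ R])
qed

lemma evo_deriv:
  assumes "v \<in> C1c" and t: "t \<in> {0..a}"
  shows "((\<lambda>t. evo s Q M t v \<xi>) has_vector_derivative evo s Q M t (evo_gen s Q M v) \<xi>) (at t within {0..a})"
proof -
  obtain v' R where v': "\<And>x. (v has_derivative v' x) (at x)"
    by (rule C1cE[OF assms(1)]) blast
  have fd: "frechet_derivative v (at x) = v' x" for x using frechet_derivative_at[OF v'(1)] by simp
  let ?E = "mexp M t *v \<xi>"
  have 1: "((\<lambda>t. v (mexp M t *v \<xi>)) has_vector_derivative v' ?E (M *v ?E)) (at t within {0..a})"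
  proof -
    have "((\<lambda>t. mexp M t *v \<xi>) has_derivative (\<lambda>h. h *\<^sub>R (M *v ?E))) (at t within {0..a})"
      using mexp_flow_deriv by (simp add: has_vector_derivative_def)
    from has_derivative_compose[OF this v'(1)]
    show ?thesis by (simp add: has_vector_derivative_def linear_cmul[OF has_derivative_linear[OF v'(1)]])
  qed
  have D: "((\<lambda>t. dissip s Q M t \<xi>) has_real_derivative symb s Q ?E) (at t within {0..a})"
    unfolding dissip_def by (rule symb_path_integral_derivative[OF Q s _ t]) (intro continuous_on_mexp_flow continuous_intros)
  have 2: "((\<lambda>t. exp (t * trace M) * exp (- dissip s Q M t \<xi> / 2)) has_real_derivative
      exp (t * trace M) * exp (- dissip s Q M t \<xi> / 2) * (trace M - symb s Q ?E / 2)) (at t within {0..a})"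
    by (rule derivative_eq_intros D refl | simp add: algebra_simps)+
  from has_vector_derivative_scaleR[OF 2 1]
  show ?thesis
    by (simp add: evo_def evo_gen_def fd scaleR_conv_of_real algebra_simps)
qed

lemma evo_L2_deriv:
  assumes v: "v \<in> C1c" and t: "t \<ge> 0"
  shows "((\<lambda>h. L2norm (\<lambda>\<xi>. evo s Q M (t + h) v \<xi> - evo s Q M t v \<xi> - complex_of_real h * evo s Q M t (evo_gen s Q M v) \<xi>) / h) \<longlongrightarrow> 0) (at_right 0)"
proof -
  let ?k = "evo_gen s Q M v"
  define a where "a = t + 1"
  have vc: "v \<in> Cc" using v by (rule C1c_imp_Cc)
  note kc = evo_gen_Cc[OF v]
  obtain K R where K: "K > 0" "\<And>t \<xi>. t \<in> {0..a} \<Longrightarrow> cmod (evo s Q M t ?k \<xi>) \<le> indicator (cball 0 R) \<xi> *\<^sub>R K"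
    using evo_uniform_bound[OF kc] by metis
  \<comment> \<open>Restricting to h < 1 keeps t + h in [0, a] with a = t + 1, where a single
    majorant holds.\<close>
  have nhd: "at_right (0::real) = at 0 within {0<..<1}"
    by (rule at_within_nhd[where S = "{-1<..<1}"]) auto
  have ta: "t \<in> {0..a}" using t by (simp add: a_def)
  show ?thesis unfolding nhd tendsto_at_iff_sequentially
  proof (intro allI impI)
    fix X :: "nat \<Rightarrow> real" assume X: "\<forall>i. X i \<in> {0<..<1} - {0}" "X \<longlonglongrightarrow> 0"
    have Xi: "0 < X i" "t + X i \<in> {0..a}" for i using X(1) t by (auto simp: a_def less_imp_le)
    let ?q = "\<lambda>i \<xi>. evo s Q M (t + X i) v \<xi> - evo s Q M t v \<xi> - complex_of_real (X i) * evo s Q M t ?k \<xi>"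
    have qm: "(\<lambda>\<xi>. ?q i \<xi>) \<in> borel_measurable borel" for i
      using evo_Cc[OF vc] evo_Cc[OF kc] by (intro borel_measurable_diff borel_measurable_times) (auto intro: Cc_measurable)
    have q_le: "cmod (?q i \<xi>) \<le> X i * (indicator (cball 0 R) \<xi> *\<^sub>R (2 * K))" for i \<xi>
    proof -
      have "norm (evo s Q M (t + X i) v \<xi> - evo s Q M t v \<xi>) \<le> (indicator (cball 0 R) \<xi> *\<^sub>R K) * \<bar>(t + X i) - t\<bar>"
        by (rule vector_derivative_lipschitz[OF _ evo_deriv[OF v] K(2) Xi(2) ta]) auto
      moreover have "norm (complex_of_real (X i) * evo s Q M t ?k \<xi>) \<le> X i * (indicator (cball 0 R) \<xi> *\<^sub>R K)"
        using K(2)[OF ta, of \<xi>] Xi(1)[of i] by (simp add: norm_mult)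
      ultimately show ?thesis
        using norm_triangle_ineq4[of "evo s Q M (t + X i) v \<xi> - evo s Q M t v \<xi>" "complex_of_real (X i) * evo s Q M t ?k \<xi>"] Xi(1)[of i]
        by (simp add: algebra_simps)
    qed
    have "(\<lambda>i. LINT \<xi>|lborel. (cmod (?q i \<xi>) / X i)\<^sup>2) \<longlonglongrightarrow> (LINT \<xi>|(lborel :: (real^'n) measure). 0)"
    proof (rule integral_dominated_convergence[where w = "\<lambda>\<xi>. indicator (cball 0 R) \<xi> *\<^sub>R (2 * K)\<^sup>2"])
      show "integrable lborel (\<lambda>\<xi>::real^'n. indicator (cball 0 R) \<xi> *\<^sub>R (2 * K)\<^sup>2)"
        by (intro borel_integrable_compact continuous_intros) auto
      show "(\<lambda>\<xi>. (cmod (?q i \<xi>) / X i)\<^sup>2) \<in> borel_measurable lborel" for i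
        using qm[of i] by measurable
      show "AE \<xi> in lborel. norm ((cmod (?q i \<xi>) / X i)\<^sup>2) \<le> indicator (cball 0 R) \<xi> *\<^sub>R (2 * K)\<^sup>2" for i
      proof (intro AE_I2)
        fix \<xi> :: "real^'n"
        have "cmod (?q i \<xi>) / X i \<le> indicator (cball 0 R) \<xi> *\<^sub>R (2 * K)"
          using q_le[of i \<xi>] Xi(1)[of i] by (simp add: divide_le_eq mult.commute)
        then have "(cmod (?q i \<xi>) / X i)\<^sup>2 \<le> (indicator (cball 0 R) \<xi> *\<^sub>R (2 * K))\<^sup>2"
          using Xi(1)[of i] by (intro power_mono) auto
        then show "norm ((cmod (?q i \<xi>) / X i)\<^sup>2) \<le> indicator (cball 0 R) \<xi> *\<^sub>R (2 * K)\<^sup>2"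
          by (cases "norm \<xi> \<le> R") simp_all
      qed
      show "AE \<xi> in lborel. (\<lambda>i. (cmod (?q i \<xi>) / X i)\<^sup>2) \<longlonglongrightarrow> 0"
      proof (intro AE_I2)
        fix \<xi> :: "real^'n"
        have A: "((\<lambda>y. (1 / norm (y - t)) *\<^sub>R (evo s Q M y v \<xi> - (evo s Q M t v \<xi> + (y - t) *\<^sub>R evo s Q M t ?k \<xi>))) \<longlongrightarrow> 0) (at t within {0..a})"
          using evo_deriv[OF v ta, of \<xi>] unfolding has_vector_derivative_def has_derivative_within by blast
        have "(\<lambda>i. t + X i) \<longlonglongrightarrow> t" using tendsto_add[OF tendsto_const X(2), of t] by simp
        moreover have "\<forall>i. t + X i \<in> {0..a} - {t}"
        proof
          show "t + X i \<in> {0..a} - {t}" for i using Xi[of i] by auto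
        qed
        ultimately have "(\<lambda>i. (1 / norm (t + X i - t)) *\<^sub>R (evo s Q M (t + X i) v \<xi> - (evo s Q M t v \<xi> + (t + X i - t) *\<^sub>R evo s Q M t ?k \<xi>))) \<longlonglongrightarrow> 0"
          using A[unfolded tendsto_at_iff_sequentially o_def, THEN spec, of "\<lambda>i. t + X i"] by (simp only: simp_thms)
        from tendsto_power[OF tendsto_norm[OF this], of 2]
        show "(\<lambda>i. (cmod (?q i \<xi>) / X i)\<^sup>2) \<longlonglongrightarrow> 0"
          by (simp add: scaleR_conv_of_real diff_diff_add norm_mult norm_divide abs_of_pos[OF Xi(1)])
      qed
    qed simp
    then have "(\<lambda>i. sqrt (LINT \<xi>|lborel. (cmod (?q i \<xi>) / X i)\<^sup>2)) \<longlonglongrightarrow> sqrt 0"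
      by (intro tendsto_real_sqrt) simp
    moreover have "sqrt (LINT \<xi>|lborel. (cmod (?q i \<xi>) / X i)\<^sup>2) = L2norm (?q i) / X i" for i
      using Xi(1)[of i] by (simp add: L2norm_def power_divide real_sqrt_divide)
    ultimately show "((\<lambda>h. L2norm (\<lambda>\<xi>. evo s Q M (t + h) v \<xi> - evo s Q M t v \<xi> - complex_of_real h * evo s Q M t ?k \<xi>) / h) \<circ> X) \<longlonglongrightarrow> 0"
      by (simp add: o_def)
  qed
qed

lemma evo_L2_lipschitz:
  assumes v: "v \<in> C1c"
  obtains L where "L \<ge> 0" "\<And>r r'. r \<in> {0..a} \<Longrightarrow> r' \<in> {0..a} \<Longrightarrow>
    L2norm (\<lambda>\<xi>. evo s Q M r v \<xi> - evo s Q M r' v \<xi>) \<le> L * \<bar>r - r'\<bar>"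
proof -
  obtain K R where K: "K > 0" "\<And>t \<xi>. t \<in> {0..a} \<Longrightarrow> cmod (evo s Q M t (evo_gen s Q M v) \<xi>) \<le> indicator (cball 0 R) \<xi> *\<^sub>R K"
    using evo_uniform_bound[OF evo_gen_Cc[OF v]] by metis
  define V where "V = sqrt (measure lborel (cball (0::real^'n) R))"
  show ?thesis
  proof (rule that)
    show "K * V \<ge> 0" using K(1) by (simp add: V_def)
    show "L2norm (\<lambda>\<xi>. evo s Q M r v \<xi> - evo s Q M r' v \<xi>) \<le> (K * V) * \<bar>r - r'\<bar>"
      if r: "r \<in> {0..a}" "r' \<in> {0..a}" for r r'
    proof -
      have le: "cmod (evo s Q M r v \<xi> - evo s Q M r' v \<xi>) \<le> (indicator (cball 0 R) \<xi> *\<^sub>R K) * \<bar>r - r'\<bar>" for \<xi>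
        by (rule vector_derivative_lipschitz[OF _ evo_deriv[OF v] K(2) r]) auto
      have "L2norm (\<lambda>\<xi>. evo s Q M r v \<xi> - evo s Q M r' v \<xi>) \<le> (K * \<bar>r - r'\<bar>) * V"
        unfolding V_def
      proof (rule L2norm_bounded_support)
        show "(\<lambda>\<xi>. evo s Q M r v \<xi> - evo s Q M r' v \<xi>) \<in> borel_measurable borel"
          by (intro borel_measurable_diff Cc_measurable evo_Cc C1c_imp_Cc v)
        show "cmod (evo s Q M r v \<xi> - evo s Q M r' v \<xi>) \<le> K * \<bar>r - r'\<bar>" for \<xi>
        proof -
          have "(indicator (cball 0 R) \<xi> *\<^sub>R K) * \<bar>r - r'\<bar> \<le> K * \<bar>r - r'\<bar>"
            using K(1) by (intro mult_right_mono) (auto simp: indicator_def)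
          with le[of \<xi>] show ?thesis by linarith
        qed
        show "evo s Q M r v \<xi> - evo s Q M r' v \<xi> = 0" if "norm \<xi> > R" for \<xi>
          using le[of \<xi>] that by simp
      qed (use K(1) in simp)
      then show ?thesis by (simp add: mult_ac)
    qed
  qed
qed

text \<open>Differentiating \<open>\<integral> T\<^sub>t v \<cdot> ftr 1 \<phi>\<close> after moving the flow onto \<open>ftr 1 \<phi>\<close> by a change of variables avoids an
  integration by parts, for which \<open>T\<^sub>t v\<close> need not be smooth enough: for small \<open>s\<close> the symbol is not differentiable.\<close>

lemma evo_weak_equation:
  assumes v: "v \<in> C1c" and \<phi>: "\<phi> \<in> schwartz" and t: "t \<ge> 0"
  shows "(LINT \<xi>|lborel. evo s Q M t (evo_gen s Q M v) \<xi> * ftr 1 \<phi> \<xi>) =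
     - (LINT \<xi>|lborel. evo s Q M t v \<xi> * (complex_of_real (symb s Q \<xi> / 2) * ftr 1 \<phi> \<xi> +
         (\<Sum>j\<in>UNIV. \<i> * complex_of_real ((M *v \<xi>) $ j) * ftr 1 (\<lambda>x. complex_of_real (x $ j) * \<phi> x) \<xi>)))"
proof -
  let ?k = "evo_gen s Q M v" and ?\<psi> = "ftr 1 \<phi>"
  define \<omega> where "\<omega> = (\<lambda>\<xi>. \<Sum>j\<in>UNIV. \<i> * complex_of_real ((M *v \<xi>) $ j) * ftr 1 (\<lambda>x. complex_of_real (x $ j) * \<phi> x) \<xi>)"
  define m where "m = (\<lambda>\<xi>. complex_of_real (symb s Q \<xi> / 2) * ?\<psi> \<xi> + \<omega> \<xi>)"
  define a where "a = t + 1"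
  have ta: "t \<in> {0..a}" using t by (simp add: a_def)
  have vc: "v \<in> Cc" using v by (rule C1c_imp_Cc)
  note kc = evo_gen_Cc[OF v]
  have \<psi>c: "continuous_on UNIV ?\<psi>" by (intro continuous_on_ftr schwartz_integrable \<phi>)
  have Mc: "continuous_on UNIV (\<lambda>x::real^'n. M *v x)"
    by (rule bounded_linear.continuous_on[OF matrix_vector_mul_bounded_linear continuous_on_id])
  have \<omega>c: "continuous_on UNIV \<omega>" unfolding \<omega>_def
    by (intro continuous_intros continuous_on_ftr schwartz_integrable schwartz_coord_mult \<phi> Mc)
  have mc: "continuous_on UNIV m" unfolding m_def
    by (intro continuous_intros continuous_on_symb Q s \<psi>c \<omega>c) auto
  have flowc: "continuous_on UNIV (\<lambda>x. mexp M r *v x)" for r by (intro continuous_on_mexp_flow continuous_intros)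
  obtain P where P: "P > 0" "\<And>\<xi>. cmod (?\<psi> \<xi>) \<le> P"
    using ftr_bound[OF schwartz_integrable[OF \<phi>], of 1] by (meson le_less_trans less_add_one order_trans less_imp_le zero_less_one add_pos_nonneg integral_nonneg norm_ge_zero)
  \<comment> \<open>\<open>J\<close> is differentiated in two ways: with the flow acting on
    \<open>v\<close>, and with the flow moved onto the test function.\<close>
  define J where "J = (\<lambda>t. LINT \<xi>|lborel. evo s Q M t v \<xi> * ?\<psi> \<xi>)"
  have J1: "(J has_vector_derivative (LINT \<xi>|lborel. evo s Q M t ?k \<xi> * ?\<psi> \<xi>)) (at t within {0..a})"
  proof -
    obtain K R where K: "K > 0" "\<And>t \<xi>. t \<in> {0..a} \<Longrightarrow> cmod (evo s Q M t ?k \<xi>) \<le> indicator (cball 0 R) \<xi> *\<^sub>R K"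
      using evo_uniform_bound[OF kc] by metis
    show ?thesis unfolding J_def
    proof (rule leibniz_lebesgue[where f' = "\<lambda>t \<xi>. evo s Q M t ?k \<xi> * ?\<psi> \<xi>" and g = "\<lambda>\<xi>. indicator (cball 0 R) \<xi> *\<^sub>R (K * P)"])
      show "integrable lborel (\<lambda>\<xi>. evo s Q M r v \<xi> * ?\<psi> \<xi>)" for r
        using Cc_integrable[OF Cc_mult[OF evo_Cc[OF vc] \<psi>c]] by (simp add: mult.commute)
      show "((\<lambda>t. evo s Q M t v \<xi> * ?\<psi> \<xi>) has_vector_derivative evo s Q M r ?k \<xi> * ?\<psi> \<xi>) (at r within {0..a})" if "r \<in> {0..a}" for \<xi> r
        by (rule has_vector_derivative_mult_left[OF evo_deriv[OF v that]])
      show "norm (evo s Q M r ?k \<xi> * ?\<psi> \<xi>) \<le> indicator (cball 0 R) \<xi> *\<^sub>R (K * P)" if "r \<in> {0..a}" for \<xi> r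
        using mult_mono[OF K(2)[OF that, of \<xi>] P(2)[of \<xi>]] K(1) by (simp add: norm_mult mult.assoc)
      show "integrable lborel (\<lambda>\<xi>::real^'n. indicator (cball 0 R) \<xi> *\<^sub>R (K * P))"
        by (intro borel_integrable_compact continuous_intros) auto
      show "(\<lambda>\<xi>. evo s Q M t ?k \<xi> * ?\<psi> \<xi>) \<in> borel_measurable lborel"
        using Cc_measurable[OF evo_Cc[OF kc]] borel_measurable_continuous_onI[OF \<psi>c] by simp
    qed (use ta in auto)
  qed
  \<comment> \<open>The damping factor expressed in \<eta> = e^(rM) \<xi>, see
    \<open>dissip_backward\<close>.\<close>
  define e where "e = (\<lambda>r \<eta>. exp (- integral {0..r} (\<lambda>\<tau>. symb s Q (mexp M (- \<tau>) *v \<eta>)) / 2))"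
  have e_eq: "e r \<eta> = exp (- dissip s Q M r (mexp M (- r) *v \<eta>) / 2)" if "r \<ge> 0" for r \<eta>
    unfolding e_def dissip_backward[OF Q s that] by simp
  have ec: "continuous_on UNIV (e r)" if "r \<ge> 0" for r
    unfolding e_eq[OF that, abs_def] by (intro continuous_intros continuous_on_dissip Q s flowc) auto
  \<comment> \<open>The factor e^(r tr M) in \<open>evo\<close> cancels the volume factor of this
    change of variables.\<close>
  have change: "(LINT \<xi>|lborel. evo s Q M r v \<xi> * b \<xi>) = (LINT \<eta>|lborel. complex_of_real (e r \<eta>) * b (mexp M (- r) *v \<eta>) * v \<eta>)"
    if r: "r \<ge> 0" and b: "continuous_on UNIV b" for r b
  proof -
    let ?F = "\<lambda>\<eta>. complex_of_real (e r \<eta>) * b (mexp M (- r) *v \<eta>) * v \<eta>"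
    have "?F \<in> Cc"
      by (intro Cc_mult[OF vc] continuous_intros ec r continuous_on_compose2[OF b flowc]) auto
    from Cc_flow_integral[OF this, of M r]
    have "(LINT \<xi>|lborel. ?F (mexp M r *v \<xi>)) = complex_of_real (exp (- r * trace M)) * (LINT \<eta>|lborel. ?F \<eta>)" .
    moreover have "evo s Q M r v \<xi> * b \<xi> = complex_of_real (exp (r * trace M)) * ?F (mexp M r *v \<xi>)" for \<xi>
      by (simp add: evo_def e_eq[OF r] mult_ac)
    then have "(LINT \<xi>|lborel. evo s Q M r v \<xi> * b \<xi>) = complex_of_real (exp (r * trace M)) * (LINT \<xi>|lborel. ?F (mexp M r *v \<xi>))"
      by (simp only: integral_mult_right_zero)
    ultimately have "(LINT \<xi>|lborel. evo s Q M r v \<xi> * b \<xi>) =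
        complex_of_real (exp (r * trace M)) * (complex_of_real (exp (- r * trace M)) * (LINT \<eta>|lborel. ?F \<eta>))"
      by (simp only:)
    then show ?thesis by (simp add: mult.assoc[symmetric] exp_minus flip: of_real_mult)
  qed
  have J2: "(J has_vector_derivative (LINT \<eta>|lborel. - (complex_of_real (e t \<eta>) * m (mexp M (- t) *v \<eta>) * v \<eta>))) (at t within {0..a})"
  proof -
    obtain K where K: "K > 0" "\<And>x. cmod (v x) \<le> K" using Cc_bounded[OF vc] by blast
    obtain R where R: "R > 0" "\<And>x. norm x > R \<Longrightarrow> v x = 0" using Cc_support[OF vc] by blast
    obtain C where C: "C \<ge> 1" "\<And>t x. \<bar>t\<bar> \<le> a \<Longrightarrow> norm (mexp M t *v x) \<le> C * norm (x :: real^'n)"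
      by (rule mexp_flow_bound[of a M]) blast
    obtain \<kappa> where \<kappa>: "\<kappa> > 0" "\<And>x. norm (M *v x) \<le> \<kappa> * norm x"
      using linear_bounded_pos[OF matrix_vector_mul_linear[of M]] by blast
    have "bounded (m ` cball 0 (C * R))"
      by (intro compact_imp_bounded compact_continuous_image continuous_on_subset[OF mc]) auto
    then obtain L where L: "\<And>x. x \<in> cball 0 (C * R) \<Longrightarrow> cmod (m x) \<le> L" unfolding bounded_iff by blast
    have L0: "L \<ge> 0" using L[of 0] R C order_trans[OF norm_ge_zero] by simp
    have e1: "0 < e r \<eta>" "e r \<eta> \<le> 1" if "r \<ge> 0" for r \<eta>
      using dissip_nonneg[OF Q s, of M r "mexp M (- r) *v \<eta>"] by (simp_all add: e_eq[OF that])
    have "((\<lambda>r. LINT \<eta>|lborel. complex_of_real (e r \<eta>) * ?\<psi> (mexp M (- r) *v \<eta>) * v \<eta>) has_vector_derivative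
       (LINT \<eta>|lborel. - (complex_of_real (e t \<eta>) * m (mexp M (- t) *v \<eta>) * v \<eta>))) (at t within {0..a})"
    proof (rule leibniz_lebesgue[where f' = "\<lambda>r \<eta>. - (complex_of_real (e r \<eta>) * m (mexp M (- r) *v \<eta>) * v \<eta>)" and g = "\<lambda>\<xi>. indicator (cball 0 R) \<xi> *\<^sub>R (L * K)"])
      show "integrable lborel (\<lambda>\<eta>. complex_of_real (e r \<eta>) * ?\<psi> (mexp M (- r) *v \<eta>) * v \<eta>)" if "r \<in> {0..a}" for r
        using that by (intro Cc_integrable Cc_mult[OF vc] continuous_intros ec continuous_on_compose2[OF \<psi>c flowc]) auto
      show "((\<lambda>r. complex_of_real (e r \<eta>) * ?\<psi> (mexp M (- r) *v \<eta>) * v \<eta>) has_vector_derivative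
          - (complex_of_real (e r \<eta>) * m (mexp M (- r) *v \<eta>) * v \<eta>)) (at r within {0..a})" if r: "r \<in> {0..a}" for \<eta> r
      proof -
        let ?y = "mexp M (- r) *v \<eta>"
        have \<gamma>: "((\<lambda>r. mexp M (- r) *v \<eta>) has_vector_derivative - (M *v (mexp M (- r) *v \<eta>))) (at r within {0..a})" for r
        proof -
          have "((\<lambda>r. - r) has_vector_derivative -1) (at r within {0..a})" by (auto intro!: derivative_eq_intros)
          from vector_diff_chain_within[OF this mexp_flow_deriv[of M \<eta> "- r"]] show ?thesis by (simp add: o_def)
        qed
        have "((\<lambda>r. ?\<psi> (mexp M (- r) *v \<eta>)) has_vector_derivative
          (\<Sum>j\<in>UNIV. \<i> * complex_of_real ((- (M *v ?y)) $ j) * ftr 1 (\<lambda>x. complex_of_real (x $ j) * \<phi> x) ?y)) (at r within {0..a})"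
        proof (rule ftr_path_derivative[OF \<phi> _ r \<gamma>, where K = "\<kappa> * (C * norm \<eta>)"])
          show "norm (- (M *v (mexp M (- r) *v \<eta>))) \<le> \<kappa> * (C * norm \<eta>)" if "r \<in> {0..a}" for r
          proof -
            have "norm (M *v (mexp M (- r) *v \<eta>)) \<le> \<kappa> * norm (mexp M (- r) *v \<eta>)" by (rule \<kappa>(2))
            also have "\<dots> \<le> \<kappa> * (C * norm \<eta>)" using C(2)[of "- r" \<eta>] that \<kappa>(1) by simp
            finally show ?thesis by simp
          qed
        qed auto
        also have "(\<Sum>j\<in>UNIV. \<i> * complex_of_real ((- (M *v ?y)) $ j) * ftr 1 (\<lambda>x. complex_of_real (x $ j) * \<phi> x) ?y) = - \<omega> ?y"
          by (simp add: \<omega>_def sum_negf)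
        finally have d1: "((\<lambda>r. ?\<psi> (mexp M (- r) *v \<eta>)) has_vector_derivative - \<omega> ?y) (at r within {0..a})" .
        have "((\<lambda>r. integral {0..r} (\<lambda>\<tau>. symb s Q (mexp M (- \<tau>) *v \<eta>))) has_real_derivative symb s Q ?y) (at r within {0..a})"
          by (rule symb_path_integral_derivative[OF Q s _ r]) (intro continuous_on_mexp_flow continuous_intros)
        then have "((\<lambda>r. e r \<eta>) has_real_derivative e r \<eta> * (- symb s Q ?y / 2)) (at r within {0..a})"
          unfolding e_def by (auto intro!: derivative_eq_intros)
        from has_vector_derivative_mult_left[OF has_vector_derivative_scaleR[OF this d1], of "v \<eta>"]
        show ?thesis by (simp add: m_def scaleR_conv_of_real algebra_simps)
      qed
      show "norm (- (complex_of_real (e r \<eta>) * m (mexp M (- r) *v \<eta>) * v \<eta>)) \<le> indicator (cball 0 R) \<eta> *\<^sub>R (L * K)" if r: "r \<in> {0..a}" for \<eta> r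
      proof (cases "norm \<eta> \<le> R")
        case True
        have "norm (mexp M (- r) *v \<eta>) \<le> C * norm \<eta>" using C(2)[of "- r" \<eta>] r by simp
        also have "\<dots> \<le> C * R" using True C(1) by simp
        finally have "cmod (m (mexp M (- r) *v \<eta>)) \<le> L" by (intro L) simp
        then have "e r \<eta> * cmod (m (mexp M (- r) *v \<eta>)) * cmod (v \<eta>) \<le> (1 * L) * K"
          using e1[of r \<eta>] r K L0 by (intro mult_mono) auto
        then show ?thesis using True e1(1)[of r \<eta>] r by (simp add: norm_mult)
      qed (use R in simp)
      show "integrable lborel (\<lambda>\<xi>::real^'n. indicator (cball 0 R) \<xi> *\<^sub>R (L * K))"
        by (intro borel_integrable_compact continuous_intros) auto
      have "(\<lambda>\<eta>. complex_of_real (e t \<eta>) * m (mexp M (- t) *v \<eta>) * v \<eta>) \<in> Cc"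
        by (intro Cc_mult[OF vc] continuous_intros ec t continuous_on_compose2[OF mc flowc]) auto
      then show "(\<lambda>\<eta>. - (complex_of_real (e t \<eta>) * m (mexp M (- t) *v \<eta>) * v \<eta>)) \<in> borel_measurable lborel"
        using Cc_measurable by simp
    qed (use ta in auto)
    then show ?thesis
      by (rule has_vector_derivative_transform[OF ta, rotated]) (simp add: J_def change[OF _ \<psi>c])
  qed
  \<comment> \<open>Derivatives within [0, a] are unique also at end points, which includes the case
    t = 0.\<close>
  have "(LINT \<xi>|lborel. evo s Q M t ?k \<xi> * ?\<psi> \<xi>) = (LINT \<eta>|lborel. - (complex_of_real (e t \<eta>) * m (mexp M (- t) *v \<eta>) * v \<eta>))"
    by (rule vector_derivative_unique_within_closed_interval[where a = 0 and b = a, unfolded cbox_interval, OF _ ta J1 J2])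
      (use t in \<open>simp add: a_def\<close>)
  also have "\<dots> = - (LINT \<xi>|lborel. evo s Q M t v \<xi> * m \<xi>)"
    by (simp add: change[OF t mc])
  finally show ?thesis by (simp add: m_def \<omega>_def)
qed

end

section \<open>Strongly continuous semigroups\<close>

text \<open>For a small slope \<open>c\<close>, let b be the supremum of the times with \<Phi> r
  \<le> c r. The condition on the left shows that b is attained, and the condition on the right, a
  non-positive upper right derivative, pushes it further unless b = t.\<close>

lemma right_increment_bound:
  fixes \<Phi> :: "real \<Rightarrow> real"
  assumes t: "0 \<le> t" and zero: "\<Phi> 0 \<le> 0"
    and right: "\<And>r e. 0 \<le> r \<Longrightarrow> r < t \<Longrightarrow> e > 0 \<Longrightarrow>
      \<exists>d>0. \<forall>h. 0 < h \<longrightarrow> h < d \<longrightarrow> r + h \<le> t \<longrightarrow> \<Phi> (r + h) \<le> \<Phi> r + e * h"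
    and left: "\<And>r e. 0 < r \<Longrightarrow> r \<le> t \<Longrightarrow> e > 0 \<Longrightarrow>
      \<exists>d>0. \<forall>h. 0 < h \<longrightarrow> h < d \<longrightarrow> h \<le> r \<longrightarrow> \<Phi> r \<le> \<Phi> (r - h) + e"
  shows "\<Phi> t \<le> 0"
proof (rule field_le_epsilon)
  fix e :: real assume e: "e > 0"
  define c where "c = e / (t + 1)"
  have c: "c > 0" using e t by (simp add: c_def)
  define A where "A = {r \<in> {0..t}. \<Phi> r \<le> c * r}"
  define b where "b = Sup A"
  have 0: "0 \<in> A" using zero t by (simp add: A_def)
  have bdd: "bdd_above A" by (rule bdd_aboveI[of _ t]) (simp add: A_def)
  have b: "0 \<le> b" "b \<le> t"
    unfolding b_def using 0 cSup_upper[OF 0 bdd] by (auto intro!: cSup_least simp: A_def)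
  have "\<Phi> b \<le> c * b"
  proof (cases "b = 0")
    case False
    show ?thesis
    proof (rule field_le_epsilon)
      fix e' :: real assume "e' > 0"
      then obtain d where d: "d > 0" "\<And>h. 0 < h \<Longrightarrow> h < d \<Longrightarrow> h \<le> b \<Longrightarrow> \<Phi> b \<le> \<Phi> (b - h) + e'"
        using left[of b e'] b False by auto
      obtain r where r: "r \<in> A" "b - d < r" using less_cSupD[of A "b - d"] 0 d(1) by (auto simp: b_def)
      have rb: "r \<le> b" unfolding b_def by (rule cSup_upper[OF r(1) bdd])
      have cr: "\<Phi> r \<le> c * r" "c * r \<le> c * b" "0 \<le> r" using r(1) rb c by (auto simp: A_def)
      show "\<Phi> b \<le> c * b + e'"
      proof (cases "r = b")
        case True
        then show ?thesis using cr \<open>e' > 0\<close> by simp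
      next
        case False
        then show ?thesis using d(2)[of "b - r"] r(2) rb cr by simp
      qed
    qed
  qed (use zero in simp)
  have "b = t"
  proof (rule ccontr)
    assume "b \<noteq> t"
    then obtain d where d: "d > 0" "\<And>h. 0 < h \<Longrightarrow> h < d \<Longrightarrow> b + h \<le> t \<Longrightarrow> \<Phi> (b + h) \<le> \<Phi> b + c * h"
      using right[of b c] b c by auto
    define h where "h = min (d / 2) (t - b)"
    have h: "0 < h" "h < d" "b + h \<le> t" using d(1) b \<open>b \<noteq> t\<close> by (auto simp: h_def)
    then have "b + h \<in> A" using d(2)[OF h] \<open>\<Phi> b \<le> c * b\<close> b by (simp add: A_def algebra_simps)
    then have "b + h \<le> b" unfolding b_def by (rule cSup_upper[OF _ bdd])
    then show False using h by simp
  qed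
  have "c * t \<le> e" using e t by (simp add: c_def field_simps)
  then show "\<Phi> t \<le> 0 + e" using \<open>\<Phi> b \<le> c * b\<close> \<open>b = t\<close> by simp
qed

locale L2_semigroup =
  fixes U :: "real \<Rightarrow> (real^'n \<Rightarrow> complex) \<Rightarrow> real^'n \<Rightarrow> complex"
  assumes C0: "C0_semigroup U"
begin

lemma U_L2: "t \<ge> 0 \<Longrightarrow> u \<in> L2 \<Longrightarrow> U t u \<in> L2"
  using C0 by (auto simp: C0_semigroup_def)

lemma U_linear: "t \<ge> 0 \<Longrightarrow> u \<in> L2 \<Longrightarrow> v \<in> L2 \<Longrightarrow>
    AE x in lborel. U t (\<lambda>x. a * u x + b * v x) x = a * U t u x + b * U t v x"
  using C0 unfolding C0_semigroup_def by blast

lemma U_bounded: "t \<ge> 0 \<Longrightarrow> \<exists>C. \<forall>u\<in>L2. L2norm (U t u) \<le> C * L2norm u"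
  using C0 unfolding C0_semigroup_def by blast

lemma U_zero: "u \<in> L2 \<Longrightarrow> AE x in lborel. U 0 u x = u x"
  using C0 unfolding C0_semigroup_def by blast

lemma U_add: "t \<ge> 0 \<Longrightarrow> t' \<ge> 0 \<Longrightarrow> u \<in> L2 \<Longrightarrow> AE x in lborel. U (t + t') u x = U t (U t' u) x"
  using C0 unfolding C0_semigroup_def by blast

lemma U_continuous: "u \<in> L2 \<Longrightarrow> ((\<lambda>t. L2norm (\<lambda>x. U t u x - u x)) \<longlongrightarrow> 0) (at_right 0)"
  using C0 unfolding C0_semigroup_def by blast

lemma U_lincomb_norm:
  assumes "t \<ge> 0" "u \<in> L2" "v \<in> L2"
  shows "L2norm (U t (\<lambda>x. a * u x + b * v x)) = L2norm (\<lambda>x. a * U t u x + b * U t v x)"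
proof (rule L2norm_cong_AE[OF _ _ U_linear[OF assms]])
  have "(\<lambda>x. a * u x + b * v x) \<in> L2" by (intro L2_add L2_scale assms)
  then show "U t (\<lambda>x. a * u x + b * v x) \<in> borel_measurable borel" by (intro L2_measurable U_L2 assms)
  show "(\<lambda>x. a * U t u x + b * U t v x) \<in> borel_measurable borel" by (intro L2_measurable L2_add L2_scale U_L2 assms)
qed

lemma U_diff_norm:
  assumes "t \<ge> 0" "u \<in> L2" "v \<in> L2"
  shows "L2norm (\<lambda>x. U t u x - U t v x) = L2norm (U t (\<lambda>x. u x - v x))"
  using U_lincomb_norm[OF assms, of 1 "-1"] by simp

text \<open>Banach--Steinhaus by a gliding hump, completeness of \<open>L\<^sup>2\<close> replacing Baire's theorem.\<close>

lemma locally_bounded: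
  obtains \<delta> K where "\<delta> > 0" "K \<ge> 1" "\<And>t u. 0 \<le> t \<Longrightarrow> t \<le> \<delta> \<Longrightarrow> u \<in> L2 \<Longrightarrow> L2norm (U t u) \<le> K * L2norm u"
proof (rule ccontr)
  assume contra: "\<not> thesis"
  note main = that
  \<comment> \<open>Time 0 cannot cause the failure, since \<open>U 0\<close> is the identity almost
    everywhere and K \<ge> 1; hence the strict inequality 0 < t.\<close>
  have unbounded: "\<exists>t u. 0 < t \<and> t \<le> \<delta> \<and> u \<in> L2 \<and> L2norm (U t u) > K * L2norm u" if "\<delta> > 0" "K \<ge> 1" for \<delta> K
  proof (rule ccontr)
    assume neg: "\<nexists>t u. 0 < t \<and> t \<le> \<delta> \<and> u \<in> L2 \<and> L2norm (U t u) > K * L2norm u"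
    have "L2norm (U t u) \<le> K * L2norm u" if "0 \<le> t" "t \<le> \<delta>" "u \<in> L2" for t u
    proof (cases "t = 0")
      case True
      have "L2norm (U 0 u) = L2norm u"
        by (rule L2norm_cong_AE[OF L2_measurable[OF U_L2] L2_measurable U_zero]) (use that in auto)
      then show ?thesis using True mult_right_mono[OF \<open>K \<ge> 1\<close> L2norm_nonneg[of u]] by simp
    next
      case False
      then have "0 < t" using that(1) by simp
      then show ?thesis using neg that(2,3) by (auto simp: not_less)
    qed
    from main[OF \<open>\<delta> > 0\<close> \<open>K \<ge> 1\<close> this] contra show False by blast
  qed
  have "\<exists>Cb. \<forall>t\<ge>0. Cb t \<ge> 1 \<and> (\<forall>u\<in>L2. L2norm (U t u) \<le> Cb t * L2norm u)"
  proof -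
    have "\<exists>C. t \<ge> 0 \<longrightarrow> C \<ge> 1 \<and> (\<forall>u\<in>L2. L2norm (U t u) \<le> C * L2norm u)" for t
    proof (cases "t \<ge> 0")
      case True
      then obtain C where C: "\<And>u. u \<in> L2 \<Longrightarrow> L2norm (U t u) \<le> C * L2norm u" using U_bounded by blast
      have "L2norm (U t u) \<le> max C 1 * L2norm u" if "u \<in> L2" for u
        using C[OF that] mult_right_mono[OF max.cobounded1[of C 1] L2norm_nonneg[of u]] by linarith
      then show ?thesis by (intro exI[of _ "max C 1"]) auto
    qed auto
    then show ?thesis by (intro choice allI)
  qed
  then obtain Cb where Cb: "\<And>t. t \<ge> 0 \<Longrightarrow> Cb t \<ge> 1" "\<And>t u. t \<ge> 0 \<Longrightarrow> u \<in> L2 \<Longrightarrow> L2norm (U t u) \<le> Cb t * L2norm u"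
    by blast
  define P where "P = (\<lambda>p :: (real^'n \<Rightarrow> complex) \<times> real \<times> real. fst p \<in> L2 \<and> fst (snd p) > 0)"
  \<comment> \<open>A state consists of a centre, a radius and the time of the last hump. Stage n
    moves the centre within the old radius to a point whose image under \<open>U\<close>, at some
    time at most 1/(n+1), has norm at least n. The radius is halved or shrunk further, until all
    later motion, at most twice the new radius, changes that image by at most 1 in norm.\<close>
  define R where "R = (\<lambda>(n::nat) (p :: (real^'n \<Rightarrow> complex) \<times> real \<times> real) p'.
     L2norm (\<lambda>x. fst p' x - fst p x) \<le> fst (snd p) \<and> 0 < snd (snd p') \<and> snd (snd p') \<le> 1 / (n + 1) \<and>
     real n \<le> L2norm (U (snd (snd p')) (fst p')) \<and> fst (snd p') \<le> fst (snd p) / 2 \<and>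
     Cb (snd (snd p')) * (2 * fst (snd p')) \<le> 1)"
  have step: "\<exists>p'. P p' \<and> R n p p'" if p: "P p" for n p
  proof -
    obtain x \<epsilon> t0 where p_eq: "p = (x, \<epsilon>, t0)" by (cases p)
    have x: "x \<in> L2" "\<epsilon> > 0" using p by (simp_all add: P_def p_eq)
    obtain t u where t: "0 < t" "t \<le> 1 / (n + 1)" and u: "u \<in> L2" "L2norm (U t u) > max 1 (real n / \<epsilon>) * L2norm u"
      using unbounded[of "1 / (n + 1)" "max 1 (real n / \<epsilon>)"] by auto
    have "L2norm u \<noteq> 0" using u Cb(2)[of t u] t by auto
    then have u0: "L2norm u > 0" by (simp add: less_le)
    define y where "y = (\<lambda>z. complex_of_real (\<epsilon> / L2norm u) * u z)"
    have y: "y \<in> L2" unfolding y_def by (rule L2_scale[OF u(1)])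
    have y_norm: "L2norm y = \<epsilon>" unfolding y_def L2norm_scale norm_of_real using u0 x(2) by simp
    have "L2norm (U t y) = (\<epsilon> / L2norm u) * L2norm (U t u)"
    proof -
      have "L2norm (U t y) = L2norm (\<lambda>z. complex_of_real (\<epsilon> / L2norm u) * U t u z + 0 * U t u z)"
        using U_lincomb_norm[of t u u "complex_of_real (\<epsilon> / L2norm u)" 0] t u(1) by (simp add: y_def)
      also have "\<dots> = cmod (complex_of_real (\<epsilon> / L2norm u)) * L2norm (U t u)"
        using L2norm_scale[of "complex_of_real (\<epsilon> / L2norm u)" "U t u"] by simp
      finally show ?thesis unfolding norm_of_real using x(2) by simp
    qed
    moreover have "real n * L2norm u \<le> \<epsilon> * L2norm (U t u)"
    proof -
      have "(real n / \<epsilon>) * L2norm u \<le> max 1 (real n / \<epsilon>) * L2norm u" by (intro mult_right_mono) auto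
      then have "(real n / \<epsilon>) * L2norm u \<le> L2norm (U t u)" using u(2) by linarith
      then show ?thesis using x(2) by (simp add: field_simps)
    qed
    ultimately have "real n * L2norm u \<le> L2norm (U t y) * L2norm u" using u0 by simp
    then have big: "real n \<le> L2norm (U t y)" using u0 by simp
    \<comment> \<open>If x + y and x - y both had images of norm below n, then 2 y would have an
      image of norm below 2 n, contrary to the choice of \<open>y\<close>; so one sign
      works.\<close>
    have "\<exists>\<sigma>\<in>{1, -1}. real n \<le> L2norm (U t (\<lambda>z. 1 * x z + \<sigma> * y z))"
    proof (rule ccontr)
      assume "\<not> ?thesis"
      then have lt: "L2norm (U t (\<lambda>z. 1 * x z + 1 * y z)) < n" "L2norm (U t (\<lambda>z. 1 * x z + (-1) * y z)) < n" by auto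
      have "2 * L2norm (U t y) = L2norm (\<lambda>z. 2 * U t y z)" by (simp add: L2norm_scale)
      also have "\<dots> = L2norm (\<lambda>z. (1 * U t x z + 1 * U t y z) - (1 * U t x z + (-1) * U t y z))" by (simp add: algebra_simps)
      also have "\<dots> \<le> L2norm (\<lambda>z. 1 * U t x z + 1 * U t y z) + L2norm (\<lambda>z. 1 * U t x z + (-1) * U t y z)"
      proof -
        have L: "(\<lambda>z. 1 * U t x z + 1 * U t y z) \<in> L2" "(\<lambda>z. 1 * U t x z + (-1) * U t y z) \<in> L2"
          using t by (intro L2_add L2_scale U_L2 x y; simp)+
        have m: "L2norm (\<lambda>z. - f z) = L2norm f" for f :: "real^'n \<Rightarrow> complex" by (simp add: L2norm_def)
        show ?thesis using L2norm_triangle[OF L(1) L2_scale[OF L(2), of "-1"]] m[of "\<lambda>z. 1 * U t x z + (-1) * U t y z"]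
          by (simp add: algebra_simps)
      qed
      also have "\<dots> < 2 * real n"
        using lt U_lincomb_norm[OF _ x(1) y, of t 1 1] U_lincomb_norm[OF _ x(1) y, of t 1 "-1"] t by simp
      finally show False using big by simp
    qed
    then obtain \<sigma> where \<sigma>: "\<sigma> \<in> {1, -1}" "real n \<le> L2norm (U t (\<lambda>z. 1 * x z + \<sigma> * y z))" by blast
    define x' where "x' = (\<lambda>z. 1 * x z + \<sigma> * y z)"
    define \<epsilon>' where "\<epsilon>' = min (\<epsilon> / 2) (1 / (2 * Cb t))"
    have Ct: "Cb t \<ge> 1" using Cb(1) t by simp
    have \<epsilon>': "\<epsilon>' > 0" "\<epsilon>' \<le> \<epsilon> / 2" "\<epsilon>' \<le> 1 / (2 * Cb t)" using x(2) Ct by (auto simp: \<epsilon>'_def)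
    have "L2norm (\<lambda>z. x' z - x z) = L2norm (\<lambda>z. \<sigma> * y z)" by (simp add: x'_def)
    also have "\<dots> = \<epsilon>" using \<sigma>(1) by (auto simp: L2norm_scale y_norm)
    finally have "L2norm (\<lambda>z. x' z - x z) \<le> \<epsilon>" by simp
    moreover have "Cb t * (2 * \<epsilon>') \<le> 1" using \<epsilon>'(3) Ct by (simp add: field_simps)
    moreover have "x' \<in> L2" unfolding x'_def by (intro L2_add L2_scale x y)
    ultimately show ?thesis
      using t \<sigma>(2) \<epsilon>' by (intro exI[of _ "(x', \<epsilon>', t)"]) (simp add: P_def R_def p_eq x'_def)
  qed
  have "(\<lambda>z. 0) \<in> (L2 :: (real^'n \<Rightarrow> complex) set)" by (simp add: L2_def)
  then have "\<exists>p. P p" by (intro exI[of _ "(\<lambda>z. 0, 1, 0)"]) (simp add: P_def)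
  then have "\<exists>f. \<forall>n. P (f n) \<and> R n (f n) (f (Suc n))"
    by (rule dependent_nat_choice) (rule step)
  then obtain f where f: "\<And>n. P (f n)" "\<And>n. R n (f n) (f (Suc n))" by blast
  define x where "x = (\<lambda>n. fst (f n))"
  define \<epsilon> where "\<epsilon> = (\<lambda>n. fst (snd (f n)))"
  define \<tau> where "\<tau> = (\<lambda>n. snd (snd (f (Suc n))))"
  have x: "x n \<in> L2" and \<epsilon>: "\<epsilon> n > 0" for n using f(1)[of n] by (simp_all add: P_def x_def \<epsilon>_def)
  have stp: "L2norm (\<lambda>z. x (Suc n) z - x n z) \<le> \<epsilon> n" and \<tau>: "0 < \<tau> n" "\<tau> n \<le> 1 / (n + 1)"
    and big: "real n \<le> L2norm (U (\<tau> n) (x (Suc n)))" and half: "\<epsilon> (Suc n) \<le> \<epsilon> n / 2"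
    and Ce: "Cb (\<tau> n) * (2 * \<epsilon> (Suc n)) \<le> 1" for n
    using f(2)[of n] by (simp_all add: R_def x_def \<epsilon>_def \<tau>_def add.commute)
  have dist: "L2norm (\<lambda>z. x (n + m) z - x n z) \<le> 2 * \<epsilon> n - 2 * \<epsilon> (n + m)" for n m
  proof (induction m)
    case 0
    show ?case by (simp add: L2norm_def)
  next
    case (Suc m)
    have "L2norm (\<lambda>z. x (n + Suc m) z - x n z) \<le> L2norm (\<lambda>z. x (n + Suc m) z - x (n + m) z) + L2norm (\<lambda>z. x (n + m) z - x n z)"
      by (rule L2norm_triangle_diff[OF x x x])
    also have "\<dots> \<le> \<epsilon> (n + m) + L2norm (\<lambda>z. x (n + m) z - x n z)" using stp[of "n + m"] by simp
    finally show ?case using Suc half[of "n + m"] by simp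
  qed
  have close: "L2norm (\<lambda>z. x k z - x n z) \<le> 2 * \<epsilon> n" if "k \<ge> n" for n k
    using dist[of n "k - n"] \<epsilon>[of k] that by simp
  have \<epsilon>_le: "\<epsilon> n \<le> \<epsilon> 0 * (1/2) ^ n" for n
  proof (induction n)
    case (Suc n)
    then show ?case using half[of n] by simp
  qed simp
  obtain g where g: "g \<in> L2" "(\<lambda>n. L2norm (\<lambda>z. x n z - g z)) \<longlonglongrightarrow> 0"
  proof (rule L2_complete[of x])
    show "x n \<in> L2" for n by (rule x)
    fix e :: real assume "e > 0"
    then obtain N where N: "(1/2) ^ N < e / (4 * \<epsilon> 0)"
      using real_arch_pow_inv[of "e / (4 * \<epsilon> 0)" "1/2"] \<epsilon>[of 0] by auto
    have "4 * \<epsilon> N \<le> 4 * \<epsilon> 0 * (1/2) ^ N" using \<epsilon>_le[of N] by linarith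
    also have "\<dots> < 4 * \<epsilon> 0 * (e / (4 * \<epsilon> 0))" using \<epsilon>[of 0] by (intro mult_strict_left_mono N) auto
    also have "\<dots> = e" using \<epsilon>[of 0] by simp
    finally have "4 * \<epsilon> N < e" .
    have "L2norm (\<lambda>z. x m z - x n z) < e" if "m \<ge> N" "n \<ge> N" for m n
      using L2norm_triangle_diff[OF x[of m] x[of N] x[of n]] close[OF that(1)] close[OF that(2)]
        L2norm_minus_commute[of "x N" "x n"] \<open>4 * \<epsilon> N < e\<close> by linarith
    then show "\<exists>N. \<forall>m\<ge>N. \<forall>n\<ge>N. L2norm (\<lambda>z. x m z - x n z) < e" by blast
  qed blast
  have lim: "L2norm (\<lambda>z. x n z - g z) \<le> 2 * \<epsilon> n" for n
  proof (rule field_le_epsilon)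
    fix e :: real assume "e > 0"
    then obtain N where N: "\<And>k. k \<ge> N \<Longrightarrow> L2norm (\<lambda>z. x k z - g z) < e"
      using order_tendstoD(2)[OF g(2), of e] by (auto simp: eventually_sequentially)
    have "L2norm (\<lambda>z. x n z - g z) \<le> L2norm (\<lambda>z. x n z - x (max n N) z) + L2norm (\<lambda>z. x (max n N) z - g z)"
      by (rule L2norm_triangle_diff[OF x x g(1)])
    then show "L2norm (\<lambda>z. x n z - g z) \<le> 2 * \<epsilon> n + e"
      using close[of n "max n N"] N[of "max n N"] L2norm_minus_commute[of "x n" "x (max n N)"] by simp
  qed
  \<comment> \<open>The limit \<open>g\<close> stays within twice the radius of stage n + 1, so the
    hump survives up to 1. The norms of \<open>U (\<tau> n) g\<close> are then unbounded while
    \<open>\<tau> n\<close> tends to 0, against strong continuity.\<close>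
  have lower: "real n - 1 \<le> L2norm (U (\<tau> n) g)" for n
  proof -
    have \<tau>0: "\<tau> n \<ge> 0" using \<tau>(1)[of n] by simp
    have "L2norm (U (\<tau> n) (x (Suc n))) \<le> L2norm (U (\<tau> n) g) + L2norm (\<lambda>z. U (\<tau> n) (x (Suc n)) z - U (\<tau> n) g z)"
      by (rule L2norm_diff_le[OF U_L2[OF \<tau>0 x] U_L2[OF \<tau>0 g(1)]])
    also have "L2norm (\<lambda>z. U (\<tau> n) (x (Suc n)) z - U (\<tau> n) g z) \<le> Cb (\<tau> n) * L2norm (\<lambda>z. x (Suc n) z - g z)"
      unfolding U_diff_norm[OF \<tau>0 x g(1)] by (rule Cb(2)[OF \<tau>0 L2_diff[OF x g(1)]])
    also have "\<dots> \<le> Cb (\<tau> n) * (2 * \<epsilon> (Suc n))"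
      using lim Cb(1)[OF \<tau>0] by (intro mult_left_mono) auto
    finally show ?thesis using big[of n] Ce[of n] by linarith
  qed
  have "\<tau> \<longlonglongrightarrow> 0"
    by (rule tendsto_sandwich[OF _ _ tendsto_const LIMSEQ_inverse_real_of_nat])
      (use \<tau> in \<open>auto simp: inverse_eq_divide less_imp_le add.commute\<close>)
  then have "filterlim \<tau> (at_right 0) sequentially"
    using \<tau>(1) by (intro tendsto_imp_filterlim_at_right) auto
  from filterlim_compose[OF U_continuous[OF g(1)] this]
  have "eventually (\<lambda>n. L2norm (\<lambda>z. U (\<tau> n) g z - g z) < 1) sequentially"
    by (rule order_tendstoD(2)) simp
  then obtain N where N: "\<And>n. n \<ge> N \<Longrightarrow> L2norm (\<lambda>z. U (\<tau> n) g z - g z) < 1"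
    by (auto simp: eventually_sequentially)
  obtain n :: nat where n: "max (real N) (L2norm g + 2) \<le> n" using real_arch_simple by blast
  have "L2norm (U (\<tau> n) g) \<le> L2norm g + L2norm (\<lambda>z. U (\<tau> n) g z - g z)"
    using \<tau>(1)[of n] by (intro L2norm_diff_le U_L2 g) auto
  also have "\<dots> < L2norm g + 1" using N[of n] n by simp
  finally show False using lower[of n] n by simp
qed

end

section \<open>Derivatives of the evolution\<close>

lemma fold_dir_deriv_schwartz: "\<phi> \<in> schwartz \<Longrightarrow> fold dir_deriv vs \<phi> \<in> schwartz"
  by (induction vs arbitrary: \<phi>) (simp_all add: schwartz_dir_deriv)

text \<open>Duality reverses the order of the directions, hence \<open>fold\<close> on the
  right.\<close>

lemma foldr_distr_deriv: "foldr distr_deriv vs T \<phi> = (- 1) ^ length vs * T (fold dir_deriv vs \<phi>)"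
  by (induction vs arbitrary: \<phi>) (simp_all add: distr_deriv_def)

lemma distr_of_tendsto:
  fixes f :: "nat \<Rightarrow> real^'n \<Rightarrow> complex"
  assumes f: "\<And>k. f k \<in> L2" and g: "g \<in> L2" and lim: "(\<lambda>k. L2norm (\<lambda>x. f k x - g x)) \<longlonglongrightarrow> 0" and \<phi>: "\<phi> \<in> schwartz"
  shows "(\<lambda>k. distr_of (f k) \<phi>) \<longlonglongrightarrow> distr_of g \<phi>"
proof -
  have \<phi>2: "\<phi> \<in> L2" by (rule bci_L2[OF schwartz_bci[OF \<phi>]])
  have "(\<lambda>k. distr_of (f k) \<phi> - distr_of g \<phi>) \<longlonglongrightarrow> 0"
  proof (rule Lim_null_comparison)
    show "\<forall>\<^sub>F k in sequentially. norm (distr_of (f k) \<phi> - distr_of g \<phi>) \<le> L2norm (\<lambda>x. f k x - g x) * L2norm \<phi>"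
    proof (intro always_eventually allI)
      fix k
      have "distr_of (f k) \<phi> - distr_of g \<phi> = (LINT x|lborel. (f k x - g x) * \<phi> x)"
        using L2_mult_integrable[OF f \<phi>2] L2_mult_integrable[OF g \<phi>2] by (simp add: distr_of_def left_diff_distrib)
      then show "norm (distr_of (f k) \<phi> - distr_of g \<phi>) \<le> L2norm (\<lambda>x. f k x - g x) * L2norm \<phi>"
        using L2_Cauchy_Schwarz[OF L2_diff[OF f g] \<phi>2] by simp
    qed
    show "(\<lambda>k. L2norm (\<lambda>x. f k x - g x) * L2norm \<phi>) \<longlonglongrightarrow> 0"
      using tendsto_mult_left_zero[OF lim] by simp
  qed
  then show ?thesis by (rule LIM_zero_cancel)
qed

lemma foldr_distr_deriv_inv_fourier:
  fixes f :: "real^'n \<Rightarrow> complex"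
  assumes f: "f \<in> Cc" and \<phi>: "\<phi> \<in> schwartz"
  shows "foldr distr_deriv vs (distr_of (inv_fourier f)) \<phi> =
    distr_of (inv_fourier (\<lambda>\<xi>. (\<Prod>v\<leftarrow>vs. \<i> * complex_of_real (v \<bullet> \<xi>)) * f \<xi>)) \<phi>"
  using \<phi>
proof (induction vs arbitrary: \<phi>)
  case (Cons a vs)
  let ?P = "\<lambda>vs \<xi>. (\<Prod>v\<leftarrow>vs. \<i> * complex_of_real (v \<bullet> \<xi>)) * f \<xi>"
  have c: "continuous_on UNIV (\<lambda>\<xi>. \<Prod>v\<leftarrow>vs. \<i> * complex_of_real (v \<bullet> \<xi>))" for vs :: "(real^'n) list"
    by (induction vs) (auto intro!: continuous_intros)
  have b: "?P vs \<in> bci" for vs using Cc_mult[OF f c] by (intro Cc_bci)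
  have "foldr distr_deriv (a # vs) (distr_of (inv_fourier f)) \<phi> = - distr_of (inv_fourier (?P vs)) (dir_deriv a \<phi>)"
    using Cons.IH[OF schwartz_dir_deriv[OF Cons.prems]] by (simp only: foldr_Cons o_apply distr_deriv_def[of a])
  also have "\<dots> = - (LINT \<xi>|lborel. ?P vs \<xi> * inv_fourier (dir_deriv a \<phi>) \<xi>)"
    by (simp only: distr_of_inv_fourier[OF b schwartz_dir_deriv[OF Cons.prems]])
  also have "\<dots> = - (LINT \<xi>|lborel. - (?P (a # vs) \<xi> * inv_fourier \<phi> \<xi>))"
    by (simp add: inv_fourier_ftr ftr_dir_deriv[OF Cons.prems] inner_commute[of a] mult_ac)
  also have "\<dots> = distr_of (inv_fourier (?P (a # vs))) \<phi>"
    by (simp only: distr_of_inv_fourier[OF b Cons.prems] Bochner_Integration.integral_minus minus_minus)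
  finally show ?case .
qed simp

section \<open>Scalar bounds behind the factorial, and domination in L^2\<close>

lemma power_le_fact_exp:
  fixes x :: real
  assumes "x \<ge> 0"
  shows "x ^ m \<le> fact m * exp x"
proof -
  have "inverse (fact m) * x ^ m \<le> (\<Sum>k. inverse (fact k) * x ^ k)"
    using sum_le_suminf[OF summable_exp[of x], of "{m}"] assms by simp
  then show ?thesis by (simp add: exp_def field_simps)
qed

text \<open>Raise (s H)^m \<le> m! e^(sH) to the power 1/(2s): the exponential becomes e^(H/2),
  which the damping cancels exactly, and the factorial becomes (m!)^(1/(2s)).\<close>

lemma powr_exp_bound:
  fixes H s :: real
  assumes H: "H \<ge> 0" and s: "s > 0"
  shows "(H powr (1 / (2 * s))) ^ m * exp (- H / 2) \<le> ((1 / s) powr (1 / (2 * s))) ^ m * fact m powr (1 / (2 * s))"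
proof -
  let ?p = "1 / (2 * s)"
  have "(s * H) ^ m \<le> fact m * exp (s * H)" using H s by (intro power_le_fact_exp) simp
  then have "((s * H) ^ m) powr ?p \<le> (fact m * exp (s * H)) powr ?p"
    using H s by (intro powr_mono2) auto
  moreover have "((s * H) ^ m) powr ?p = (s powr ?p) ^ m * (H powr ?p) ^ m"
  proof -
    have "(x ^ m) powr ?p = (x powr ?p) ^ m" if "x \<ge> 0" for x :: real
      using that by (induction m) (simp_all add: powr_mult)
    from this[of "s * H"] show ?thesis using H s by (simp add: powr_mult power_mult_distrib)
  qed
  moreover have "(fact m * exp (s * H)) powr ?p = fact m powr ?p * exp (H / 2)"
    using s by (simp add: powr_mult powr_def[of "exp _"])
  ultimately have "(s powr ?p) ^ m * (H powr ?p) ^ m \<le> fact m powr ?p * exp (H / 2)" by simp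
  then have main: "((1 / s) powr ?p) ^ m * ((s powr ?p) ^ m * (H powr ?p) ^ m) * exp (- H / 2)
     \<le> ((1 / s) powr ?p) ^ m * (fact m powr ?p * exp (H / 2)) * exp (- H / 2)"
    by (intro mult_right_mono mult_left_mono) auto
  have E1: "((1 / s) powr ?p) ^ m * ((s powr ?p) ^ m * (H powr ?p) ^ m) * exp (- H / 2) = (H powr ?p) ^ m * exp (- H / 2)"
  proof -
    have "(1 / s) powr ?p * s powr ?p = 1" using s by (simp add: powr_divide)
    then show ?thesis by (simp add: mult.assoc[symmetric] flip: power_mult_distrib)
  qed
  have E2: "((1 / s) powr ?p) ^ m * (fact m powr ?p * exp (H / 2)) * exp (- H / 2) = ((1 / s) powr ?p) ^ m * fact m powr ?p"
    by (simp add: mult.assoc exp_minus)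
  show ?thesis using main unfolding E1 E2 .
qed

lemma L2norm_dominated:
  assumes g: "g \<in> L2" and f: "f \<in> borel_measurable borel" and le: "\<And>x. cmod (f x) \<le> c * cmod (g x)" and c: "c \<ge> 0"
  shows "f \<in> L2" "L2norm f \<le> c * L2norm g"
proof -
  have sq: "(cmod (f x))\<^sup>2 \<le> c\<^sup>2 * (cmod (g x))\<^sup>2" for x
    using power_mono[OF le[of x] norm_ge_zero, of 2] by (simp add: power_mult_distrib)
  have "(\<integral>\<^sup>+x. ennreal ((cmod (f x))\<^sup>2) \<partial>lborel) \<le> (\<integral>\<^sup>+x. ennreal (c\<^sup>2 * (cmod (g x))\<^sup>2) \<partial>lborel)"
    by (intro nn_integral_mono ennreal_leI sq)
  also have "\<dots> = ennreal (c\<^sup>2) * (\<integral>\<^sup>+x. ennreal ((cmod (g x))\<^sup>2) \<partial>lborel)"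
    using L2_measurable[OF g] by (simp add: ennreal_mult nn_integral_cmult)
  also have "\<dots> = ennreal ((c * L2norm g)\<^sup>2)"
    by (simp add: L2norm_nn_integral[OF g] power_mult_distrib ennreal_mult)
  finally have "(\<integral>\<^sup>+x. ennreal ((cmod (f x))\<^sup>2) \<partial>lborel) \<le> ennreal ((c * L2norm g)\<^sup>2)" .
  from L2I_nn_integral[OF f this] c show "f \<in> L2" "L2norm f \<le> c * L2norm g" by auto
qed

context fractional_symbol
begin

text \<open>Places the explicit solution in \<open>OU_domain\<close>, where membership is a
  distributional condition. The multiplier part is evaluated through
  \<open>fourier_L2_inv_fourier\<close>; in the drift part, summing B_ij \<xi>_i over i gives the
  j-th component of B^T \<xi>, which is why the flow on the Fourier side is that of the transpose.
  The weak equation then combines both parts.\<close>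

lemma OU_evo:
  fixes B :: "real^'n^'n"
  assumes M: "M = transpose B" and v: "v \<in> C1c" and t: "t \<ge> 0"
  shows "represents (\<lambda>x. - inv_fourier (evo s Q M t (evo_gen s Q M v)) x) (OU s B Q (inv_fourier (evo s Q M t v)))"
  unfolding represents_def
proof
  fix \<phi> :: "real^'n \<Rightarrow> complex" assume \<phi>: "\<phi> \<in> schwartz"
  define c where "c = complex_of_real (1 / (2 * pi) ^ CARD('n))"
  define f where "f = evo s Q M t v"
  define F where "F = (\<lambda>j. ftr 1 (\<lambda>x. complex_of_real (x $ j) * \<phi> x))"
  have inv: "inv_fourier \<psi> \<xi> = c * ftr 1 \<psi> \<xi>" for \<psi> :: "real^'n \<Rightarrow> complex" and \<xi> by (simp add: c_def inv_fourier_ftr)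
  have f: "f \<in> Cc" unfolding f_def by (intro evo_Cc C1c_imp_Cc v)
  note fb = Cc_bci[OF f]
  have Fc: "continuous_on UNIV (F j)" for j unfolding F_def
    by (intro continuous_on_ftr schwartz_integrable schwartz_coord_mult \<phi>)
  have \<phi>c: "continuous_on UNIV (ftr 1 \<phi>)" by (intro continuous_on_ftr schwartz_integrable \<phi>)
  have sc: "continuous_on UNIV (symb s Q)" by (intro continuous_on_symb Q s continuous_on_id)
  have "fourier_multiplier (\<lambda>\<xi>. ((Q *v \<xi>) \<bullet> \<xi>) powr s) (inv_fourier f) \<phi> =
      (LINT \<xi>|lborel. complex_of_real (symb s Q \<xi>) * fourier_L2 (inv_fourier f) \<xi> * inv_fourier \<phi> \<xi>)"
    by (simp add: fourier_multiplier_def distr_of_def symb_def)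
  also have "\<dots> = (LINT \<xi>|lborel. complex_of_real (symb s Q \<xi>) * f \<xi> * (c * ftr 1 \<phi> \<xi>))"
  proof (rule integral_cong_AE)
    show "AE \<xi> in lborel. complex_of_real (symb s Q \<xi>) * fourier_L2 (inv_fourier f) \<xi> * inv_fourier \<phi> \<xi> =
        complex_of_real (symb s Q \<xi>) * f \<xi> * (c * ftr 1 \<phi> \<xi>)"
      using fourier_L2_inv_fourier(2)[OF fb] by eventually_elim (simp add: inv)
  qed (use borel_measurable_continuous_onI[OF sc] L2_measurable[OF fourier_L2_inv_fourier(1)[OF fb]]
      borel_measurable_continuous_onI[OF \<phi>c] Cc_measurable[OF f] in \<open>simp_all add: inv\<close>)
  finally have mult: "fourier_multiplier (\<lambda>\<xi>. ((Q *v \<xi>) \<bullet> \<xi>) powr s) (inv_fourier f) \<phi> =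
      (LINT \<xi>|lborel. complex_of_real (symb s Q \<xi>) * f \<xi> * (c * ftr 1 \<phi> \<xi>))" .
  have intF: "integrable lborel (\<lambda>\<xi>. f \<xi> * (c * (\<i> * complex_of_real (\<xi> $ i) * F j \<xi>)))" for i j
    using Cc_integrable[OF Cc_mult[OF f, of "\<lambda>\<xi>. c * (\<i> * complex_of_real (\<xi> $ i) * F j \<xi>)"]] Fc
    by (simp add: mult.commute[of "f _"] continuous_intros)
  have part: "coord_mult j (distr_deriv (axis i 1) (distr_of (inv_fourier f))) \<phi> =
      (LINT \<xi>|lborel. f \<xi> * (c * (\<i> * complex_of_real (\<xi> $ i) * F j \<xi>)))" for i j
  proof -
    have "coord_mult j (distr_deriv (axis i 1) (distr_of (inv_fourier f))) \<phi> =
      - (LINT \<xi>|lborel. f \<xi> * inv_fourier (dir_deriv (axis i 1) (\<lambda>x. complex_of_real (x $ j) * \<phi> x)) \<xi>)"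
      unfolding coord_mult_def distr_deriv_def
      by (simp only: distr_of_inv_fourier[OF fb schwartz_dir_deriv[OF schwartz_coord_mult[OF \<phi>]]])
    also have "\<dots> = - (LINT \<xi>|lborel. - (f \<xi> * (c * (\<i> * complex_of_real (\<xi> $ i) * F j \<xi>))))"
      by (simp add: inv ftr_dir_deriv[OF schwartz_coord_mult[OF \<phi>]] F_def inner_axis)
    finally show ?thesis by (simp only: Bochner_Integration.integral_minus minus_minus)
  qed
  have "drift B (distr_of (inv_fourier f)) \<phi> =
      (LINT \<xi>|lborel. (\<Sum>i\<in>UNIV. \<Sum>j\<in>UNIV. complex_of_real (B $ i $ j) * (f \<xi> * (c * (\<i> * complex_of_real (\<xi> $ i) * F j \<xi>)))))"
    unfolding drift_def part using intF by simp
  also have "(\<lambda>\<xi>. \<Sum>i\<in>UNIV. \<Sum>j\<in>UNIV. complex_of_real (B $ i $ j) * (f \<xi> * (c * (\<i> * complex_of_real (\<xi> $ i) * F j \<xi>)))) =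
      (\<lambda>\<xi>. c * (f \<xi> * (\<Sum>j\<in>UNIV. \<i> * complex_of_real ((M *v \<xi>) $ j) * F j \<xi>)))"
  proof
    fix \<xi>
    have "(\<Sum>i\<in>UNIV. \<Sum>j\<in>UNIV. complex_of_real (B $ i $ j) * (f \<xi> * (c * (\<i> * complex_of_real (\<xi> $ i) * F j \<xi>)))) =
        (\<Sum>j\<in>UNIV. \<Sum>i\<in>UNIV. complex_of_real (B $ i $ j) * (f \<xi> * (c * (\<i> * complex_of_real (\<xi> $ i) * F j \<xi>))))"
      by (rule sum.swap)
    also have "\<dots> = c * (f \<xi> * (\<Sum>j\<in>UNIV. \<i> * complex_of_real ((M *v \<xi>) $ j) * F j \<xi>))"
      by (simp add: M matrix_vector_mult_def transpose_def sum_distrib_left sum_distrib_right mult_ac)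
    finally show "(\<Sum>i\<in>UNIV. \<Sum>j\<in>UNIV. complex_of_real (B $ i $ j) * (f \<xi> * (c * (\<i> * complex_of_real (\<xi> $ i) * F j \<xi>)))) =
      c * (f \<xi> * (\<Sum>j\<in>UNIV. \<i> * complex_of_real ((M *v \<xi>) $ j) * F j \<xi>))" .
  qed
  finally have drift: "drift B (distr_of (inv_fourier f)) \<phi> =
      c * (LINT \<xi>|lborel. f \<xi> * (\<Sum>j\<in>UNIV. \<i> * complex_of_real ((M *v \<xi>) $ j) * F j \<xi>))" by simp
  have Mc: "continuous_on UNIV (\<lambda>x::real^'n. M *v x)"
    by (rule bounded_linear.continuous_on[OF matrix_vector_mul_bounded_linear continuous_on_id])
  have int1: "integrable lborel (\<lambda>\<xi>. f \<xi> * (\<Sum>j\<in>UNIV. \<i> * complex_of_real ((M *v \<xi>) $ j) * F j \<xi>))"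
    using Cc_integrable[OF Cc_mult[OF f, of "\<lambda>\<xi>. \<Sum>j\<in>UNIV. \<i> * complex_of_real ((M *v \<xi>) $ j) * F j \<xi>"]] Fc Mc
    by (simp add: mult.commute[of "f _"] continuous_intros)
  have int2: "integrable lborel (\<lambda>\<xi>. f \<xi> * (complex_of_real (symb s Q \<xi> / 2) * ftr 1 \<phi> \<xi>))"
    using Cc_integrable[OF Cc_mult[OF f, of "\<lambda>\<xi>. complex_of_real (symb s Q \<xi> / 2) * ftr 1 \<phi> \<xi>"]] sc \<phi>c
    by (simp add: mult.commute[of "f _"] continuous_intros)
  have half: "1 / 2 * (LINT \<xi>|lborel. complex_of_real (symb s Q \<xi>) * f \<xi> * (c * ftr 1 \<phi> \<xi>)) =
      c * (LINT \<xi>|lborel. f \<xi> * (complex_of_real (symb s Q \<xi> / 2) * ftr 1 \<phi> \<xi>))"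
    by (simp add: mult_ac flip: integral_mult_right_zero)
  have "OU s B Q (inv_fourier f) \<phi> = c * ((LINT \<xi>|lborel. f \<xi> * (complex_of_real (symb s Q \<xi> / 2) * ftr 1 \<phi> \<xi>)) +
      (LINT \<xi>|lborel. f \<xi> * (\<Sum>j\<in>UNIV. \<i> * complex_of_real ((M *v \<xi>) $ j) * F j \<xi>)))"
    unfolding OU_def mult half drift by (simp only: distrib_left)
  also have "\<dots> = c * (LINT \<xi>|lborel. f \<xi> * (complex_of_real (symb s Q \<xi> / 2) * ftr 1 \<phi> \<xi> + (\<Sum>j\<in>UNIV. \<i> * complex_of_real ((M *v \<xi>) $ j) * F j \<xi>)))"
    using int1 int2 by (simp only: distrib_left Bochner_Integration.integral_add)
  also have "\<dots> = c * (- (LINT \<xi>|lborel. evo s Q M t (evo_gen s Q M v) \<xi> * ftr 1 \<phi> \<xi>))"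
    unfolding evo_weak_equation[OF v \<phi> t] by (simp only: f_def F_def minus_minus)
  also have "\<dots> = - distr_of (inv_fourier (evo s Q M t (evo_gen s Q M v))) \<phi>"
    using distr_of_inv_fourier[OF Cc_bci[OF evo_Cc[OF evo_gen_Cc[OF v]]] \<phi>, of t]
    by (simp add: inv mult.left_commute[of _ c])
  also have "\<dots> = distr_of (\<lambda>x. - inv_fourier (evo s Q M t (evo_gen s Q M v)) x) \<phi>"
    by (simp add: distr_of_def)
  finally show "OU s B Q (inv_fourier (evo s Q M t v)) \<phi> = distr_of (\<lambda>x. - inv_fourier (evo s Q M t (evo_gen s Q M v)) x) \<phi>"
    by (simp only: f_def)
qed

text \<open>Origin of the factor with half the trace: e^(t tr M) from \<open>evo\<close> meets e^(-t
  tr M / 2) from \<open>Cc_flow_L2norm\<close>. The Plancherel constants on the two sides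
  cancel.\<close>

lemma evo_multiplier_bound:
  assumes v: "v \<in> Cc" and P: "continuous_on UNIV P" and A: "A \<ge> 0"
    and le: "\<And>\<xi>. cmod (P \<xi>) * exp (- dissip s Q M t \<xi> / 2) \<le> A"
  shows "L2norm (inv_fourier (\<lambda>\<xi>. P \<xi> * evo s Q M t v \<xi>)) \<le> A * exp (trace M * t / 2) * L2norm (inv_fourier v)"
proof -
  let ?f = "\<lambda>\<xi>. P \<xi> * evo s Q M t v \<xi>"
  have f: "?f \<in> Cc" by (intro Cc_mult evo_Cc v P)
  have "L2norm ?f \<le> (A * exp (t * trace M)) * L2norm (\<lambda>\<xi>. v (mexp M t *v \<xi>))"
  proof (rule L2norm_dominated(2)[OF Cc_L2[OF Cc_flow[OF v]] Cc_measurable[OF f]])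
    show "cmod (?f \<xi>) \<le> A * exp (t * trace M) * cmod (v (mexp M t *v \<xi>))" for \<xi>
    proof -
      have "cmod (?f \<xi>) = (cmod (P \<xi>) * exp (- dissip s Q M t \<xi> / 2)) * (exp (t * trace M) * cmod (v (mexp M t *v \<xi>)))"
        by (simp add: evo_def norm_mult mult_ac)
      also have "\<dots> \<le> A * (exp (t * trace M) * cmod (v (mexp M t *v \<xi>)))" by (intro mult_right_mono le) simp
      finally show ?thesis by (simp add: mult.assoc)
    qed
  qed (use A in simp)
  also have "\<dots> = A * exp (trace M * t / 2) * L2norm v"
    unfolding Cc_flow_L2norm[OF v] by (simp add: mult_ac flip: exp_add)
  finally show ?thesis
    unfolding plancherel_inv_fourier[OF Cc_bci[OF f]] plancherel_inv_fourier[OF Cc_bci[OF v]]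
    by (simp add: divide_right_mono)
qed

end

section \<open>The Ornstein--Uhlenbeck semigroup\<close>

lemma trace_transpose_eq: "trace (transpose A) = trace A"
  by (simp add: trace_def transpose_def)

lemma generator_increment:
  assumes "generator U u g" "e > 0"
  shows "\<exists>d>0. \<forall>h. 0 < h \<longrightarrow> h < d \<longrightarrow> L2norm (\<lambda>x. U h u x - (u x + complex_of_real h * g x)) \<le> e * h"
proof -
  have "eventually (\<lambda>h. L2norm (\<lambda>x. (U h u x - u x) / complex_of_real h - g x) < e) (at_right 0)"
    using assms order_tendstoD(2) unfolding generator_def by blast
  then obtain d where d: "d > 0" "\<And>h. 0 < h \<Longrightarrow> h < d \<Longrightarrow> L2norm (\<lambda>x. (U h u x - u x) / complex_of_real h - g x) < e"
    unfolding eventually_at_right_field by auto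
  have "L2norm (\<lambda>x. U h u x - (u x + complex_of_real h * g x)) \<le> e * h" if h: "0 < h" "h < d" for h
  proof -
    have "(\<lambda>x. U h u x - (u x + complex_of_real h * g x)) = (\<lambda>x. complex_of_real h * ((U h u x - u x) / complex_of_real h - g x))"
      using h by (auto simp: fun_eq_iff field_simps)
    then have "L2norm (\<lambda>x. U h u x - (u x + complex_of_real h * g x)) = h * L2norm (\<lambda>x. (U h u x - u x) / complex_of_real h - g x)"
      using h by (simp only: L2norm_scale norm_of_real abs_of_pos)
    also have "\<dots> \<le> h * e" using d(2)[OF h] h by simp
    finally show ?thesis by (simp add: mult.commute)
  qed
  with d(1) show ?thesis by blast
qed

lemma inv_fourier_diff_norm_le:
  fixes f g :: "real^'n \<Rightarrow> complex"
  assumes "f \<in> Cc" "g \<in> Cc"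
  shows "L2norm (\<lambda>x. inv_fourier f x - inv_fourier g x) \<le> L2norm (\<lambda>x. f x - g x)"
proof -
  have fg: "(\<lambda>x. f x - g x) \<in> Cc" using Cc_lincomb[OF assms, of 1 "-1"] by simp
  have "L2norm (\<lambda>x. inv_fourier f x - inv_fourier g x) = L2norm (inv_fourier (\<lambda>x. f x - g x))"
    using inv_fourier_lincomb[OF Cc_bci[OF assms(1)] Cc_bci[OF assms(2)], of 1 "-1"] by (simp add: L2norm_def)
  also have "\<dots> = L2norm (\<lambda>x. f x - g x) / sqrt ((2 * pi) ^ CARD('n))"
    by (rule plancherel_inv_fourier[OF Cc_bci[OF fg]])
  also have "\<dots> \<le> L2norm (\<lambda>x. f x - g x) / 1"
  proof (intro divide_left_mono)
    have "1 \<le> (2 * pi) ^ CARD('n)" using pi_gt3 by (intro one_le_power) simp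
    then show "1 \<le> sqrt ((2 * pi) ^ CARD('n))" by simp
  qed auto
  finally show ?thesis by simp
qed

lemma continuous_on_prod_list_directions:
  "continuous_on UNIV (\<lambda>\<xi>::real^'n. \<Prod>v\<leftarrow>vs. \<i> * complex_of_real (v \<bullet> \<xi>))"
  by (induction vs) (auto intro!: continuous_intros)

locale ornstein_uhlenbeck =
  fixes s :: real and B Q :: "real^'n^'n"
    and U :: "real \<Rightarrow> (real^'n \<Rightarrow> complex) \<Rightarrow> real^'n \<Rightarrow> complex"
  assumes s_pos: "s > 0" and psd: "pos_semidef Q" and OU: "OU_semigroup s B Q U"
begin

sublocale fractional_symbol s Q "transpose B"
  by standard (use s_pos psd in auto)

sublocale L2_semigroup U
  by standard (use OU in \<open>simp add: OU_semigroup_def\<close>)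

abbreviation "E \<equiv> evo s Q (transpose B)"

abbreviation "gen \<equiv> evo_gen s Q (transpose B)"

lemma inv_ev_L2: "v \<in> C1c \<Longrightarrow> inv_fourier (E t v) \<in> L2"
  by (intro bci_inv_fourier_L2 Cc_bci evo_Cc C1c_imp_Cc)

lemma generator_evo:
  assumes v: "v \<in> C1c" and t: "t \<ge> 0"
  shows "generator U (inv_fourier (E t v)) (inv_fourier (E t (gen v)))"
proof -
  let ?g = "\<lambda>x. - inv_fourier (E t (gen v)) x"
  have g: "?g \<in> L2"
    using L2_scale[OF bci_inv_fourier_L2[OF Cc_bci[OF evo_Cc[OF evo_gen_Cc[OF v]]]], of "-1" t] by simp
  have rep: "represents ?g (OU s B Q (inv_fourier (E t v)))"
    by (rule OU_evo[OF refl v t])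
  have "inv_fourier (E t v) \<in> OU_domain s B Q"
    using inv_ev_L2[OF v] g rep by (auto simp: OU_domain_def)
  then have "generator U (inv_fourier (E t v)) (\<lambda>x. - ?g x)"
    using OU g rep unfolding OU_semigroup_def by blast
  then show ?thesis by simp
qed

lemma evo_increment:
  assumes v: "v \<in> C1c" and r: "r \<ge> 0" and e: "e > 0"
  shows "\<exists>d>0. \<forall>h. 0 < h \<longrightarrow> h < d \<longrightarrow>
    L2norm (\<lambda>x. inv_fourier (E (r + h) v) x - (inv_fourier (E r v) x + complex_of_real h * inv_fourier (E r (gen v)) x)) \<le> e * h"
proof -
  have "eventually (\<lambda>h. L2norm (\<lambda>\<xi>. E (r + h) v \<xi> - E r v \<xi> - complex_of_real h * E r (gen v) \<xi>) / h < e) (at_right 0)"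
    using evo_L2_deriv[OF v r] order_tendstoD(2) e by blast
  then obtain d where d: "d > 0" "\<And>h. 0 < h \<Longrightarrow> h < d \<Longrightarrow> L2norm (\<lambda>\<xi>. E (r + h) v \<xi> - E r v \<xi> - complex_of_real h * E r (gen v) \<xi>) / h < e"
    unfolding eventually_at_right_field by auto
  have C: "E r v \<in> Cc" "E r (gen v) \<in> Cc" for r
    using evo_Cc[OF C1c_imp_Cc[OF v]] evo_Cc[OF evo_gen_Cc[OF v]] by auto
  have "L2norm (\<lambda>x. inv_fourier (E (r + h) v) x - (inv_fourier (E r v) x + complex_of_real h * inv_fourier (E r (gen v)) x)) \<le> e * h"
    if h: "0 < h" "h < d" for h
  proof -
    let ?g = "\<lambda>\<xi>. 1 * E r v \<xi> + complex_of_real h * E r (gen v) \<xi>"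
    have "inv_fourier ?g x = inv_fourier (E r v) x + complex_of_real h * inv_fourier (E r (gen v)) x" for x
      using inv_fourier_lincomb[OF Cc_bci[OF C(1)] Cc_bci[OF C(2)], of 1 r "complex_of_real h" r x] by simp
    then have "L2norm (\<lambda>x. inv_fourier (E (r + h) v) x - (inv_fourier (E r v) x + complex_of_real h * inv_fourier (E r (gen v)) x)) \<le> L2norm (\<lambda>\<xi>. E (r + h) v \<xi> - ?g \<xi>)"
      using inv_fourier_diff_norm_le[OF C(1)[of "r + h"] Cc_lincomb[OF C(1)[of r] C(2)[of r], of 1 "complex_of_real h"]] by simp
    also have "\<dots> \<le> e * h" using d(2)[OF h] h by (simp add: diff_diff_add divide_less_eq)
    finally show ?thesis .
  qed
  with d(1) show ?thesis by blast
qed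

text \<open>Uniqueness for the abstract Cauchy problem: \<open>r \<mapsto> U (t - r) w(r)\<close> is continuous with vanishing
  right derivative, where \<open>w\<close> is the explicit evolution.\<close>

lemma semigroup_evo:
  assumes K: "K \<ge> 1" "\<And>r u. 0 \<le> r \<Longrightarrow> r \<le> t \<Longrightarrow> u \<in> L2 \<Longrightarrow> L2norm (U r u) \<le> K * L2norm u"
    and v: "v \<in> C1c" and t: "t \<ge> 0"
  shows "AE x in lborel. U t (inv_fourier v) x = inv_fourier (E t v) x"
proof -
  define w where "w = (\<lambda>r. inv_fourier (E r v))"
  have w: "w r \<in> L2" for r unfolding w_def by (rule inv_ev_L2[OF v])
  \<comment> \<open>At r = 0 the two terms coincide; at r = t the difference is w(t) - U_t w(0)
    almost everywhere, the quantity to be shown null.\<close>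
  define \<Phi> where "\<Phi> = (\<lambda>r. L2norm (\<lambda>x. U (t - r) (w r) x - U t (w 0) x))"
  \<comment> \<open>Both U_(t-r') w(r') and U_(t-r) w(r) factor through U_(t-r'), so the increment
    is controlled by how far \<open>w\<close> is from following \<open>U\<close> between r and
    r'.\<close>
  have incr: "\<bar>\<Phi> r' - \<Phi> r\<bar> \<le> K * L2norm (\<lambda>x. w r' x - U (r' - r) (w r) x)" if r: "0 \<le> r" "r \<le> r'" "r' \<le> t" for r r'
  proof -
    have L: "U (t - r) (w r) \<in> L2" "U (t - r') (w r') \<in> L2" "U t (w 0) \<in> L2" "U (r' - r) (w r) \<in> L2"
      using r t by (auto intro!: U_L2 w)
    have "AE x in lborel. U (t - r) (w r) x = U (t - r') (U (r' - r) (w r)) x"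
      using U_add[of "t - r'" "r' - r" "w r"] r w by simp
    then have "L2norm (\<lambda>x. U (t - r') (w r') x - U (t - r) (w r) x) = L2norm (\<lambda>x. U (t - r') (w r') x - U (t - r') (U (r' - r) (w r)) x)"
      using r by (intro L2norm_cong_AE L2_measurable L2_diff L U_L2) auto
    also have "\<dots> = L2norm (U (t - r') (\<lambda>x. w r' x - U (r' - r) (w r) x))"
      using r by (intro U_diff_norm w L) auto
    also have "\<dots> \<le> K * L2norm (\<lambda>x. w r' x - U (r' - r) (w r) x)"
      using r by (intro K L2_diff w L) auto
    finally have le: "L2norm (\<lambda>x. U (t - r') (w r') x - U (t - r) (w r) x) \<le> K * L2norm (\<lambda>x. w r' x - U (r' - r) (w r) x)" .
    have "\<Phi> r' \<le> L2norm (\<lambda>x. U (t - r') (w r') x - U (t - r) (w r) x) + \<Phi> r"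
      unfolding \<Phi>_def by (rule L2norm_triangle_diff[OF L(2,1,3)])
    moreover have "\<Phi> r \<le> L2norm (\<lambda>x. U (t - r') (w r') x - U (t - r) (w r) x) + \<Phi> r'"
      unfolding \<Phi>_def L2norm_minus_commute[of "U (t - r') (w r')" "U (t - r) (w r)"] by (rule L2norm_triangle_diff[OF L(1,2,3)])
    ultimately show ?thesis using le by linarith
  qed
  have "\<Phi> t \<le> 0"
  proof (rule right_increment_bound[OF t])
    show "\<Phi> 0 \<le> 0" by (simp add: \<Phi>_def L2norm_def)
  next
    fix r e :: real assume r: "0 \<le> r" "r < t" and "e > 0"
    define e' where "e' = e / (2 * K)"
    have e': "e' > 0" using \<open>e > 0\<close> K(1) by (simp add: e'_def)
    obtain d1 where d1: "d1 > 0" "\<And>h. 0 < h \<Longrightarrow> h < d1 \<Longrightarrow>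
        L2norm (\<lambda>x. U h (w r) x - (w r x + complex_of_real h * inv_fourier (E r (gen v)) x)) \<le> e' * h"
      using generator_increment[OF generator_evo[OF v r(1)] e'] unfolding w_def by blast
    obtain d2 where d2: "d2 > 0" "\<And>h. 0 < h \<Longrightarrow> h < d2 \<Longrightarrow>
        L2norm (\<lambda>x. w (r + h) x - (w r x + complex_of_real h * inv_fourier (E r (gen v)) x)) \<le> e' * h"
      using evo_increment[OF v r(1) e'] unfolding w_def by blast
    \<comment> \<open>The first order expansion shared by w(r + h) and U_h w(r): the time derivative
      of \<open>w\<close> is the generator applied to w(r). The two therefore differ by
      o(h).\<close>
    have mid: "(\<lambda>x. w r x + complex_of_real h * inv_fourier (E r (gen v)) x) \<in> L2" for h
      by (intro L2_add L2_scale w bci_inv_fourier_L2 Cc_bci evo_Cc evo_gen_Cc v)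
    show "\<exists>d>0. \<forall>h. 0 < h \<longrightarrow> h < d \<longrightarrow> r + h \<le> t \<longrightarrow> \<Phi> (r + h) \<le> \<Phi> r + e * h"
    proof (intro exI[of _ "min d1 d2"] conjI allI impI)
      fix h assume h: "0 < h" "h < min d1 d2" "r + h \<le> t"
      have "L2norm (\<lambda>x. w (r + h) x - U h (w r) x) \<le> e' * h + e' * h"
        using L2norm_triangle_diff[OF w mid[of h] U_L2[OF _ w], of h "r + h" r] h d2(2)[of h] d1(2)[of h]
          L2norm_minus_commute[of "U h (w r)" "\<lambda>x. w r x + complex_of_real h * inv_fourier (E r (gen v)) x"]
        by linarith
      then have "K * L2norm (\<lambda>x. w (r + h) x - U h (w r) x) \<le> K * (e' * h + e' * h)"
        using K(1) by (intro mult_left_mono) auto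
      also have "\<dots> = e * h" using K(1) by (simp add: e'_def)
      finally show "\<Phi> (r + h) \<le> \<Phi> r + e * h" using incr[of r "r + h"] r h by simp
    qed (use d1 d2 in simp)
  next
    fix r e :: real assume r: "0 < r" "r \<le> t" and "e > 0"
    define e' where "e' = e / (2 * K)"
    have e': "e' > 0" using \<open>e > 0\<close> K(1) by (simp add: e'_def)
    obtain L where L: "L \<ge> 0" "\<And>r r'. r \<in> {0..t} \<Longrightarrow> r' \<in> {0..t} \<Longrightarrow> L2norm (\<lambda>\<xi>. E r v \<xi> - E r' v \<xi>) \<le> L * \<bar>r - r'\<bar>"
      by (rule evo_L2_lipschitz[OF v, of t]) blast
    have "eventually (\<lambda>h. L2norm (\<lambda>x. U h (w r) x - w r x) < e') (at_right 0)"
      using U_continuous[OF w] order_tendstoD(2) e' by blast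
    then obtain d1 where d1: "d1 > 0" "\<And>h. 0 < h \<Longrightarrow> h < d1 \<Longrightarrow> L2norm (\<lambda>x. U h (w r) x - w r x) < e'"
      unfolding eventually_at_right_field by auto
    define d2 where "d2 = e' / (K * (L + 1))"
    have d2: "d2 > 0" using e' K(1) L(1) by (simp add: d2_def)
    show "\<exists>d>0. \<forall>h. 0 < h \<longrightarrow> h < d \<longrightarrow> h \<le> r \<longrightarrow> \<Phi> r \<le> \<Phi> (r - h) + e"
    proof (intro exI[of _ "min d1 d2"] conjI allI impI)
      fix h assume h: "0 < h" "h < min d1 d2" "h \<le> r"
      \<comment> \<open>Inserting U_h w(r) uses strong continuity only at the fixed vector w(r); the
        moving vector w(r - h) is handled by the Lipschitz bound on \<open>w\<close>.\<close>
      have "L2norm (\<lambda>x. U h (w r) x - U h (w (r - h)) x) \<le> K * L2norm (\<lambda>x. w r x - w (r - h) x)"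
        using h r by (subst U_diff_norm) (auto intro!: K L2_diff w)
      also have "\<dots> \<le> K * (L * h)"
      proof -
        have "L2norm (\<lambda>x. w r x - w (r - h) x) \<le> L2norm (\<lambda>\<xi>. E r v \<xi> - E (r - h) v \<xi>)"
          unfolding w_def by (intro inv_fourier_diff_norm_le evo_Cc C1c_imp_Cc v)
        also have "\<dots> \<le> L * h" using L(2)[of r "r - h"] h r by simp
        finally show ?thesis using K(1) by (intro mult_left_mono) auto
      qed
      also have "\<dots> \<le> K * ((L + 1) * d2)" using K(1) L(1) h by (intro mult_left_mono mult_mono) auto
      also have "\<dots> = e'" using K(1) L(1) by (simp add: d2_def)
      finally have "L2norm (\<lambda>x. w r x - U h (w (r - h)) x) \<le> e' + e'"
        using L2norm_triangle_diff[OF w[of r] U_L2[OF _ w[of r]] U_L2[OF _ w[of "r - h"]], of h h] h d1(2)[of h]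
          L2norm_minus_commute[of "w r" "U h (w r)"] by linarith
      then have "K * L2norm (\<lambda>x. w r x - U h (w (r - h)) x) \<le> K * (e' + e')"
        using K(1) by (intro mult_left_mono) auto
      also have "\<dots> = e" using K(1) by (simp add: e'_def)
      finally show "\<Phi> r \<le> \<Phi> (r - h) + e" using incr[of "r - h" r] r h by simp
    qed (use d1 d2 in simp)
  qed
  then have "L2norm (\<lambda>x. U (t - t) (w t) x - U t (w 0) x) = 0"
    unfolding \<Phi>_def by (rule antisym) simp
  then have "AE x in lborel. U 0 (w t) x - U t (w 0) x = 0"
    using t by (intro L2norm_eq_0_AE L2_diff U_L2 w) auto
  moreover have "AE x in lborel. U 0 (w t) x = w t x" by (rule U_zero[OF w])
  ultimately show ?thesis by eventually_elim (simp add: w_def evo_0)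
qed

text \<open>For data \<open>inv_fourier v\<close> with \<open>v\<close> in \<open>C1c\<close> this
  is the multiplier bound for the explicit evolution. Applied to differences, the same bound makes
  the derivatives of approximants a Cauchy sequence, and distributional derivatives pass to L^2
  limits. \<open>K\<close> enters through uniqueness and convergence and does not appear in the
  final estimate.\<close>

lemma semigroup_derivatives:
  assumes K: "K \<ge> 1" "\<And>r u. 0 \<le> r \<Longrightarrow> r \<le> t \<Longrightarrow> u \<in> L2 \<Longrightarrow> L2norm (U r u) \<le> K * L2norm u"
    and t: "t \<ge> 0" and u: "u \<in> L2" and A: "A \<ge> 0"
    and le: "\<And>\<xi>. cmod (\<Prod>v\<leftarrow>vs. \<i> * complex_of_real (v \<bullet> \<xi>)) * exp (- dissip s Q (transpose B) t \<xi> / 2) \<le> A"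
  shows "\<exists>g\<in>L2. represents g (foldr distr_deriv vs (distr_of (U t u))) \<and>
     L2norm g \<le> A * exp (trace B * t / 2) * L2norm u"
proof -
  let ?P = "\<lambda>\<xi>::real^'n. \<Prod>v\<leftarrow>vs. \<i> * complex_of_real (v \<bullet> \<xi>)"
  let ?E = "A * exp (trace B * t / 2)"
  have E: "?E \<ge> 0" using A by simp
  have Pc: "continuous_on UNIV ?P"
    by (rule continuous_on_prod_list_directions)
  have "\<exists>v. v \<in> C1c \<and> L2norm (\<lambda>x. u x - inv_fourier v x) < inverse (real (Suc k))" for k
    using inv_fourier_C1c_dense[OF u, of "inverse (real (Suc k))"] by auto
  then obtain v where v: "\<And>k. v k \<in> C1c" "\<And>k. L2norm (\<lambda>x. u x - inv_fourier (v k) x) < inverse (real (Suc k))"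
    by metis
  have vc: "v k \<in> Cc" for k by (rule C1c_imp_Cc[OF v(1)])
  define w where "w = (\<lambda>k. inv_fourier (v k))"
  have w: "w k \<in> L2" for k unfolding w_def by (intro bci_inv_fourier_L2 Cc_bci vc)
  have wlim: "(\<lambda>k. L2norm (\<lambda>x. u x - w k x)) \<longlonglongrightarrow> 0"
    by (rule tendsto_sandwich[OF _ _ tendsto_const LIMSEQ_inverse_real_of_nat])
      (use v(2) in \<open>auto simp: w_def less_imp_le\<close>)
  have UE: "AE x in lborel. U t (inv_fourier (v k)) x = inv_fourier (E t (v k)) x" for k
    by (rule semigroup_evo[OF K(1) _ v(1) t]) (rule K(2))
  define g where "g = (\<lambda>k. inv_fourier (\<lambda>\<xi>. ?P \<xi> * E t (v k) \<xi>))"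
  have gL2: "g k \<in> L2" for k unfolding g_def by (intro bci_inv_fourier_L2 Cc_bci Cc_mult evo_Cc vc Pc)
  have tr: "trace (transpose B) = trace B" by (rule trace_transpose_eq)
  have g_le: "L2norm (g k) \<le> ?E * L2norm (w k)" for k
    using evo_multiplier_bound[OF vc Pc A le] by (simp add: g_def w_def tr)
  have g_diff: "L2norm (\<lambda>x. g k x - g l x) \<le> ?E * L2norm (\<lambda>x. w k x - w l x)" for k l
  proof -
    let ?d = "\<lambda>\<xi>. 1 * v k \<xi> + (- 1) * v l \<xi>"
    have d: "?d \<in> Cc" by (rule Cc_lincomb[OF vc vc])
    have b: "(\<lambda>\<xi>. ?P \<xi> * E t (v k) \<xi>) \<in> bci" for k by (intro Cc_bci Cc_mult evo_Cc vc Pc)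
    have "?P \<xi> * E t ?d \<xi> = 1 * (?P \<xi> * E t (v k) \<xi>) + (- 1) * (?P \<xi> * E t (v l) \<xi>)" for \<xi>
      by (simp add: evo_def algebra_simps)
    then have "(\<lambda>x. g k x - g l x) = inv_fourier (\<lambda>\<xi>. ?P \<xi> * E t ?d \<xi>)"
      using inv_fourier_lincomb[OF b b, of 1 k "-1" l] by (simp add: g_def fun_eq_iff)
    moreover have "(\<lambda>x. w k x - w l x) = inv_fourier ?d"
      using inv_fourier_lincomb[OF Cc_bci[OF vc] Cc_bci[OF vc], of 1 k "-1" l] by (simp add: w_def fun_eq_iff)
    ultimately show ?thesis using evo_multiplier_bound[OF d Pc A le] by (simp only: tr)
  qed
  obtain G where G: "G \<in> L2" "(\<lambda>k. L2norm (\<lambda>x. g k x - G x)) \<longlonglongrightarrow> 0"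
  proof (rule L2_complete[of g])
    show "g k \<in> L2" for k by (rule gL2)
    fix e :: real assume e: "e > 0"
    \<comment> \<open>The summand 1 keeps the denominator positive when \<open>?E = 0\<close> and
      makes the final inequality strict.\<close>
    define e' where "e' = e / (2 * (?E + 1))"
    have e': "e' > 0" using e E by (simp add: e'_def)
    obtain N where N: "\<And>k. k \<ge> N \<Longrightarrow> L2norm (\<lambda>x. u x - w k x) < e'"
      using order_tendstoD(2)[OF wlim e'] by (auto simp: eventually_sequentially)
    have "L2norm (\<lambda>x. g m x - g n x) < e" if "m \<ge> N" "n \<ge> N" for m n
    proof -
      have "L2norm (\<lambda>x. w m x - w n x) \<le> 2 * e'"
        using L2norm_triangle_diff[OF w u w, of m n] N[OF that(1)] N[OF that(2)] L2norm_minus_commute[of u "w m"] by linarith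
      then have "?E * L2norm (\<lambda>x. w m x - w n x) \<le> ?E * (2 * e')" by (rule mult_left_mono[OF _ E])
      also have "\<dots> < (?E + 1) * (2 * e')" using e' by simp
      also have "\<dots> = e"
      proof -
        have "D * (2 * (e / (2 * D))) = e" if "D > 0" for D :: real using that by simp
        from this[OF add_nonneg_pos[OF E zero_less_one]] show ?thesis unfolding e'_def .
      qed
      finally show ?thesis using g_diff[of m n] by linarith
    qed
    then show "\<exists>N. \<forall>m\<ge>N. \<forall>n\<ge>N. L2norm (\<lambda>x. g m x - g n x) < e" by blast
  qed blast
  have "represents G (foldr distr_deriv vs (distr_of (U t u)))"
    unfolding represents_def
  proof
    fix \<phi> :: "real^'n \<Rightarrow> complex" assume \<phi>: "\<phi> \<in> schwartz"
    define \<psi> where "\<psi> = fold dir_deriv vs \<phi>"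
    have \<psi>: "\<psi> \<in> schwartz" unfolding \<psi>_def by (rule fold_dir_deriv_schwartz[OF \<phi>])
    have Ulim: "(\<lambda>k. L2norm (\<lambda>x. U t (w k) x - U t u x)) \<longlonglongrightarrow> 0"
    proof (rule tendsto_sandwich[OF _ _ tendsto_const])
      show "(\<lambda>k. K * L2norm (\<lambda>x. u x - w k x)) \<longlonglongrightarrow> 0" using tendsto_mult_right_zero[OF wlim] by simp
      show "\<forall>\<^sub>F k in sequentially. L2norm (\<lambda>x. U t (w k) x - U t u x) \<le> K * L2norm (\<lambda>x. u x - w k x)"
      proof (intro always_eventually allI)
        fix k
        have "L2norm (\<lambda>x. U t (w k) x - U t u x) = L2norm (U t (\<lambda>x. w k x - u x))" by (rule U_diff_norm[OF t w u])
        also have "\<dots> \<le> K * L2norm (\<lambda>x. w k x - u x)" using t by (intro K L2_diff w u) auto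
        finally show "L2norm (\<lambda>x. U t (w k) x - U t u x) \<le> K * L2norm (\<lambda>x. u x - w k x)"
          by (simp only: L2norm_minus_commute[of "w k"])
      qed
    qed simp
    have "(\<lambda>k. distr_of (U t (w k)) \<psi>) \<longlonglongrightarrow> distr_of (U t u) \<psi>"
      by (rule distr_of_tendsto[OF U_L2[OF t w] U_L2[OF t u] Ulim \<psi>])
    then have "(\<lambda>k. (- 1) ^ length vs * distr_of (U t (w k)) \<psi>) \<longlonglongrightarrow> (- 1) ^ length vs * distr_of (U t u) \<psi>"
      by (intro tendsto_intros)
    moreover have "(- 1) ^ length vs * distr_of (U t (w k)) \<psi> = distr_of (g k) \<phi>" for k
    proof -
      have "distr_of (U t (w k)) \<psi> = distr_of (inv_fourier (E t (v k))) \<psi>"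
        unfolding distr_of_def
      proof (rule integral_cong_AE)
        show "AE x in lborel. U t (w k) x * \<psi> x = inv_fourier (E t (v k)) x * \<psi> x"
          using UE[of k] unfolding w_def by eventually_elim simp
      qed (use L2_measurable[OF U_L2[OF t w[of k]]] L2_measurable[OF inv_ev_L2[OF v(1)[of k], of t]]
          bciD(3)[OF schwartz_bci[OF \<psi>]] in simp_all)
      then have "(- 1) ^ length vs * distr_of (U t (w k)) \<psi> = foldr distr_deriv vs (distr_of (inv_fourier (E t (v k)))) \<phi>"
        by (simp only: foldr_distr_deriv \<psi>_def)
      also have "\<dots> = distr_of (g k) \<phi>"
        unfolding g_def by (rule foldr_distr_deriv_inv_fourier[OF evo_Cc[OF vc] \<phi>])
      finally show ?thesis .
    qed
    ultimately have "(\<lambda>k. distr_of (g k) \<phi>) \<longlonglongrightarrow> foldr distr_deriv vs (distr_of (U t u)) \<phi>"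
      by (simp only: foldr_distr_deriv \<psi>_def)
    moreover have "(\<lambda>k. distr_of (g k) \<phi>) \<longlonglongrightarrow> distr_of G \<phi>"
      by (rule distr_of_tendsto[OF gL2 G \<phi>])
    ultimately show "foldr distr_deriv vs (distr_of (U t u)) \<phi> = distr_of G \<phi>"
      by (rule LIMSEQ_unique)
  qed
  moreover have "L2norm G \<le> ?E * L2norm u"
  proof (rule LIMSEQ_le_const)
    show "(\<lambda>k. ?E * (L2norm u + L2norm (\<lambda>x. u x - w k x)) + L2norm (\<lambda>x. g k x - G x)) \<longlonglongrightarrow> ?E * L2norm u"
      using tendsto_add[OF tendsto_mult_left[OF tendsto_add[OF tendsto_const wlim]] G(2), of ?E "L2norm u"] by simp
    have "L2norm G \<le> ?E * (L2norm u + L2norm (\<lambda>x. u x - w k x)) + L2norm (\<lambda>x. g k x - G x)" for k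
    proof -
      have "L2norm (w k) \<le> L2norm u + L2norm (\<lambda>x. u x - w k x)"
        using L2norm_diff_le[OF w u, of k] L2norm_minus_commute[of u "w k"] by simp
      then have "?E * L2norm (w k) \<le> ?E * (L2norm u + L2norm (\<lambda>x. u x - w k x))" by (rule mult_left_mono[OF _ E])
      then show ?thesis
        using L2norm_diff_le[OF G(1) gL2, of k] L2norm_minus_commute[of G "g k"] g_le[of k] by linarith
    qed
    then show "\<exists>N. \<forall>n\<ge>N. L2norm G \<le> ?E * (L2norm u + L2norm (\<lambda>x. u x - w n x)) + L2norm (\<lambda>x. g n x - G x)" by blast
  qed
  ultimately show ?thesis using G(1) by blast
qed

text \<open>The pointwise bounds for the m directions multiply to the m-th power of H^(1/(2s)), and
  the single damping factor e^(-H/2) is spent on the whole product. Thus \<open>c\<close> does not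
  depend on m.\<close>

lemma derivative_symbol_bound:
  obtains c T where "c > 1" "T > 0"
    "\<And>t \<xi> vs. 0 < t \<Longrightarrow> t < T \<Longrightarrow> set vs \<subseteq> (singular_space B Q)\<^sup>\<bottom> \<Longrightarrow>
       cmod (\<Prod>v\<leftarrow>vs. \<i> * complex_of_real (v \<bullet> \<xi>)) * exp (- dissip s Q (transpose B) t \<xi> / 2) \<le>
       c ^ length vs / t powr (real (\<Sum>v\<leftarrow>vs. vec_index B Q v) + real (length vs) / (2 * s))
         * (\<Prod>v\<leftarrow>vs. norm v) * fact (length vs) powr (1 / (2 * s))"
proof -
  obtain C T where C: "C \<ge> 1" "T > 0" "\<And>t \<xi> \<xi>0. 0 < t \<Longrightarrow> t < T \<Longrightarrow> \<xi>0 \<in> (singular_space B Q)\<^sup>\<bottom> \<Longrightarrow>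
       \<bar>\<xi>0 \<bullet> \<xi>\<bar> \<le> C * norm \<xi>0 * dissip s Q (transpose B) t \<xi> powr (1 / (2 * s))
          / t powr (real (vec_index B Q \<xi>0) + 1 / (2 * s))"
    by (rule inner_dissip_bound[OF psd s_pos, of B]) blast
  let ?p = "1 / (2 * s)"
  \<comment> \<open>The maximum with 2 ensures c > 1; the other entry joins the constant of
    \<open>inner_dissip_bound\<close> to the base of the power in
    \<open>powr_exp_bound\<close>.\<close>
  define c where "c = max 2 (C * (1 / s) powr ?p)"
  have "cmod (\<Prod>v\<leftarrow>vs. \<i> * complex_of_real (v \<bullet> \<xi>)) * exp (- dissip s Q (transpose B) t \<xi> / 2) \<le>
       c ^ length vs / t powr (real (\<Sum>v\<leftarrow>vs. vec_index B Q v) + real (length vs) / (2 * s))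
         * (\<Prod>v\<leftarrow>vs. norm v) * fact (length vs) powr ?p"
    if t: "0 < t" "t < T" and vs: "set vs \<subseteq> (singular_space B Q)\<^sup>\<bottom>" for t \<xi> vs
  proof -
    define H where "H = dissip s Q (transpose B) t \<xi>"
    have H: "H \<ge> 0" unfolding H_def by (rule dissip_nonneg[OF psd s_pos])
    let ?D = "\<lambda>vs. t powr (real (\<Sum>v\<leftarrow>vs. vec_index B Q v) + real (length vs) / (2 * s))"
    let ?N = "\<lambda>vs. (\<Prod>v\<leftarrow>vs. norm (v :: real^'n))"
    have N: "?N vs \<ge> 0" for vs by (induction vs) auto
    have "cmod (\<Prod>v\<leftarrow>vs. \<i> * complex_of_real (v \<bullet> \<xi>)) \<le> C ^ length vs * (H powr ?p) ^ length vs * ?N vs / ?D vs"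
      using vs
    proof (induction vs)
      case Nil
      then show ?case using t by simp
    next
      case (Cons a vs)
      have "cmod (\<Prod>v\<leftarrow>a # vs. \<i> * complex_of_real (v \<bullet> \<xi>)) = \<bar>a \<bullet> \<xi>\<bar> * cmod (\<Prod>v\<leftarrow>vs. \<i> * complex_of_real (v \<bullet> \<xi>))"
        by (simp add: norm_mult)
      also have "\<dots> \<le> (C * norm a * H powr ?p / t powr (real (vec_index B Q a) + ?p)) *
          (C ^ length vs * (H powr ?p) ^ length vs * ?N vs / ?D vs)"
        using Cons C(1) C(3)[OF t, of a \<xi>] unfolding H_def[symmetric] by (intro mult_mono) auto
      also have "\<dots> = C ^ length (a # vs) * (H powr ?p) ^ length (a # vs) * ?N (a # vs) / ?D (a # vs)"
      proof -
        have "real (\<Sum>v\<leftarrow>a # vs. vec_index B Q v) + real (length (a # vs)) / (2 * s) =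
            (real (vec_index B Q a) + ?p) + (real (\<Sum>v\<leftarrow>vs. vec_index B Q v) + real (length vs) / (2 * s))"
          by (simp add: add_divide_distrib)
        then have "?D (a # vs) = t powr (real (vec_index B Q a) + ?p) * ?D vs" by (simp only: powr_add)
        then show ?thesis by simp
      qed
      finally show ?case .
    qed
    then have "cmod (\<Prod>v\<leftarrow>vs. \<i> * complex_of_real (v \<bullet> \<xi>)) * exp (- H / 2) \<le>
        (C ^ length vs * (H powr ?p) ^ length vs * ?N vs / ?D vs) * exp (- H / 2)"
      by (rule mult_right_mono) simp
    also have "\<dots> = (C ^ length vs * ?N vs / ?D vs) * ((H powr ?p) ^ length vs * exp (- H / 2))" by simp
    also have "\<dots> \<le> (C ^ length vs * ?N vs / ?D vs) * (((1 / s) powr ?p) ^ length vs * fact (length vs) powr ?p)"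
      using C(1) N by (intro mult_left_mono powr_exp_bound H s_pos) auto
    also have "\<dots> = (C * (1 / s) powr ?p) ^ length vs * (?N vs / ?D vs * fact (length vs) powr ?p)"
      by (simp add: power_mult_distrib)
    also have "\<dots> \<le> c ^ length vs * (?N vs / ?D vs * fact (length vs) powr ?p)"
      using C(1) N by (intro mult_right_mono power_mono) (auto simp: c_def)
    finally show ?thesis by (simp add: H_def)
  qed
  moreover have "c > 1" by (simp add: c_def)
  ultimately show ?thesis using that C(2) by blast
qed

end

theorem theorem2p2:
  fixes s :: real
    and B Q :: "real^'n^'n"
    and U :: "real \<Rightarrow> (real^'n \<Rightarrow> complex) \<Rightarrow> real^'n \<Rightarrow> complex"
  assumes "s > 0"
    and "pos_semidef Q"
    and "OU_semigroup s B Q U"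
  shows "\<exists>c>1. \<exists>T>0. \<forall>m\<ge>1. \<forall>\<xi>s::(real^'n) list. \<forall>t u.
           length \<xi>s = m \<and> set \<xi>s \<subseteq> (singular_space B Q)\<^sup>\<bottom> \<and> 0 < t \<and> t < T \<and> u \<in> L2 \<longrightarrow>
           (\<exists>g\<in>L2. represents g (foldr distr_deriv \<xi>s (distr_of (U t u))) \<and>
              L2norm g \<le>
                c ^ m * exp (trace B * t / 2)
                  / t powr (real (\<Sum>\<xi>\<leftarrow>\<xi>s. vec_index B Q \<xi>) + real m / (2 * s))
                * (\<Prod>\<xi>\<leftarrow>\<xi>s. norm \<xi>) * fact m powr (1 / (2 * s)) * L2norm u)"
proof -
  interpret ornstein_uhlenbeck s B Q U
    by standard (use assms in auto)
  obtain c T where c: "c > 1" "T > 0"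
    and bound: "\<And>t \<xi> vs. 0 < t \<Longrightarrow> t < T \<Longrightarrow> set vs \<subseteq> (singular_space B Q)\<^sup>\<bottom> \<Longrightarrow>
       cmod (\<Prod>v\<leftarrow>vs. \<i> * complex_of_real (v \<bullet> \<xi>)) * exp (- dissip s Q (transpose B) t \<xi> / 2) \<le>
       c ^ length vs / t powr (real (\<Sum>v\<leftarrow>vs. vec_index B Q v) + real (length vs) / (2 * s))
         * (\<Prod>v\<leftarrow>vs. norm v) * fact (length vs) powr (1 / (2 * s))"
    by (rule derivative_symbol_bound) blast
  obtain \<delta> K where \<delta>: "\<delta> > 0" "K \<ge> 1" "\<And>t u. 0 \<le> t \<Longrightarrow> t \<le> \<delta> \<Longrightarrow> u \<in> L2 \<Longrightarrow> L2norm (U t u) \<le> K * L2norm u"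
    by (rule locally_bounded) blast
  \<comment> \<open>The threshold includes \<open>\<delta>\<close> because uniqueness for the Cauchy
    problem on [0, t] uses a bound on \<open>U\<close> throughout that interval.\<close>
  show ?thesis
  proof (rule exI[of _ c], rule conjI[OF c(1)], rule exI[of _ "min T \<delta>"], intro conjI allI impI)
    fix m :: nat and \<xi>s :: "(real^'n) list" and t and u :: "real^'n \<Rightarrow> complex"
    assume "length \<xi>s = m \<and> set \<xi>s \<subseteq> (singular_space B Q)\<^sup>\<bottom> \<and> 0 < t \<and> t < min T \<delta> \<and> u \<in> L2"
    then have m: "length \<xi>s = m" and sub: "set \<xi>s \<subseteq> (singular_space B Q)\<^sup>\<bottom>" and t: "0 < t" "t < T" "t < \<delta>" and u: "u \<in> L2"
      by auto
    define A where "A = c ^ m / t powr (real (\<Sum>\<xi>\<leftarrow>\<xi>s. vec_index B Q \<xi>) + real m / (2 * s))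
         * (\<Prod>\<xi>\<leftarrow>\<xi>s. norm \<xi>) * fact m powr (1 / (2 * s))"
    have le: "cmod (\<Prod>v\<leftarrow>\<xi>s. \<i> * complex_of_real (v \<bullet> \<xi>)) * exp (- dissip s Q (transpose B) t \<xi> / 2) \<le> A" for \<xi>
      using bound[OF t(1,2) sub, of \<xi>] by (simp only: m A_def)
    \<comment> \<open>Any instance of the bound, here at \<xi> = 0, has a non-negative left-hand
      side.\<close>
    have A: "A \<ge> 0" using order_trans[OF _ le[of 0]] by simp
    have "\<exists>g\<in>L2. represents g (foldr distr_deriv \<xi>s (distr_of (U t u))) \<and> L2norm g \<le> A * exp (trace B * t / 2) * L2norm u"
    proof (rule semigroup_derivatives[OF \<delta>(2)])
      show "L2norm (U r w) \<le> K * L2norm w" if "0 \<le> r" "r \<le> t" "w \<in> L2" for r w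
        using \<delta>(3) that t by simp
    qed (use t u A le in auto)
    then show "\<exists>g\<in>L2. represents g (foldr distr_deriv \<xi>s (distr_of (U t u))) \<and>
              L2norm g \<le> c ^ m * exp (trace B * t / 2)
                  / t powr (real (\<Sum>\<xi>\<leftarrow>\<xi>s. vec_index B Q \<xi>) + real m / (2 * s))
                * (\<Prod>\<xi>\<leftarrow>\<xi>s. norm \<xi>) * fact m powr (1 / (2 * s)) * L2norm u"
      by (simp add: A_def mult_ac)
  qed (use c \<delta> in auto)
qed

end
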